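(* Let $\Omega\subset\mathbb{R}^d$ be a bounded open set. Then for every $0\leq t<s\leq 1$ and $1<p\leq q<\infty$ satisfying $$\frac1p-\frac sd<\frac1q-\frac td,$$ the embedding $\Lambda^{s,p}_0(\Omega)\subset\Lambda^{t,q}_0(\Omega)$ holds and is compact.
   Context: Fractional gradient. For $r\in(0,1)$ and $\varphi\in C_c^\infty(\mathbb{R}^d)$ let $I_r\varphi(x)=\frac{\mu_{d,1-r}}{d-r}\int_{\mathbb{R}^d}\frac{\varphi(y)}{|x-y|^{d-r}}\,dy$ be the Riesz potential, where $\mu_{d,s}=\frac{2^s\Gamma((d+s+1)/2)}{\pi^{d/2}\Gamma((1-s)/2)}$. For $s\in(0,1)$, $D^s\varphi=D(I_{1-s}\varphi)$, where $D$ is the classical gradient; $D^1=D$; and $D^0=-R$, where $R$ is the vector-valued Riesz transform, $R_j\varphi(x)=\frac{\Gamma((d+1)/2)}{\pi^{(d+1)/2}}\,\mathrm{p.v.}\!\int_{\mathbb{R}^d}\frac{x_j-y_j}{|x-y|^{d+1}}\varphi(y)\,dy$. For $\Phi\in C^\infty_c(\mathbb{R}^d;\mathbb{R}^d)$, $D^s\cdot\Phi=\sum_{j=1}^d (D^s\Phi_j)_j$. For $0\le s<1$ and $u\in L^p(\mathbb{R}^d)$, the weak $s$-fractional gradient $D^su$ is the function $\Gamma\in L^1_{\mathrm{loc}}(\mathbb{R}^d;\mathbb{R}^d)$ (if it exists) such that $\int u\,D^s\cdot\Phi\,dx=-\int\Gamma\cdot\Phi\,dx$ for all $\Phi\in C_c^\infty(\mathbb{R}^d;\mathbb{R}^d)$.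 Spaces. For $1<p<\infty$, $\Lambda^{s,p}(\mathbb{R}^d)=\{u\in L^p(\mathbb{R}^d): D^su\in L^p(\mathbb{R}^d;\mathbb{R}^d)\}$ with norm $(\|u\|^p_{L^p(\mathbb{R}^d)}+\|D^su\|^p_{L^p(\mathbb{R}^d;\mathbb{R}^d)})^{1/p}$; $\Lambda^{1,p}(\mathbb{R}^d)=W^{1,p}(\mathbb{R}^d)$ and $\Lambda^{0,p}(\mathbb{R}^d)=L^p(\mathbb{R}^d)$ with equivalent norms. For $\Omega\subset\mathbb{R}^d$ open, $\Lambda^{s,p}_0(\Omega)$ is the closure of $C^\infty_c(\Omega)$ in $\Lambda^{s,p}(\mathbb{R}^d)$, with the same norm; in particular $\Lambda^{0,p}_0(\Omega)=\{u\in L^p(\mathbb{R}^d):u=0\text{ a.e. in }\mathbb{R}^d\setminus\Omega\}$. *)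

theory Defs
  imports "HOL-Analysis.Analysis"
begin

text \<open>Throughout, the Euclidean space of dimension $d$ is a type
  \<open>'a :: euclidean_space\<close> with \<open>d = DIM('a)\<close>; the coordinate indexed by $j$ is the inner
  product with the basis vector \<open>j \<in> Basis\<close>.\<close>

section \<open>Test functions\<close>

primrec Ck :: "nat \<Rightarrow> ('a::euclidean_space \<Rightarrow> 'b::real_normed_vector) \<Rightarrow> bool" where
  "Ck 0 f \<longleftrightarrow> continuous_on UNIV f"
| "Ck (Suc k) f \<longleftrightarrow> (\<forall>x. f differentiable (at x)) \<and>
     (\<forall>j\<in>Basis. Ck k (\<lambda>x. frechet_derivative f (at x) j))"

definition smooth :: "('a::euclidean_space \<Rightarrow> 'b::real_normed_vector) \<Rightarrow> bool" where
  "smooth f \<longleftrightarrow> (\<forall>k. Ck k f)"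

text \<open>Elements of $C_c^\infty(\Omega)$ are represented by their extension by zero to the whole
  space.\<close>

definition Cc_inf :: "'a::euclidean_space set \<Rightarrow> ('a \<Rightarrow> 'b::real_normed_vector) set" where
  "Cc_inf \<Omega> = {f. smooth f \<and> compact (closure {x. f x \<noteq> 0}) \<and> closure {x. f x \<noteq> 0} \<subseteq> \<Omega>}"

section \<open>The fractional gradient of test functions\<close>

definition gradient :: "('a::euclidean_space \<Rightarrow> real) \<Rightarrow> 'a \<Rightarrow> 'a" where
  "gradient f x = (THE D. GDERIV f x :> D)"

definition riesz_mu :: "nat \<Rightarrow> real \<Rightarrow> real" where
  "riesz_mu d s = 2 powr s * Gamma ((real d + s + 1) / 2) / (pi powr (real d / 2) * Gamma ((1 - s) / 2))"

definition riesz_potential :: "real \<Rightarrow> ('a::euclidean_space \<Rightarrow> real) \<Rightarrow> 'a \<Rightarrow> real" where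
  "riesz_potential r \<phi> x = riesz_mu DIM('a) (1 - r) / (real DIM('a) - r) *
     (LINT y|lebesgue. \<phi> y / norm (x - y) powr (real DIM('a) - r))"

text \<open>The principal value is the limit, as \<open>\<epsilon>\<close> decreases to zero, of the integrals over the
  complements of the balls of radius \<open>\<epsilon>\<close> around \<open>x\<close>.\<close>

definition riesz_transform_component :: "'a \<Rightarrow> ('a::euclidean_space \<Rightarrow> real) \<Rightarrow> 'a \<Rightarrow> real" where
  "riesz_transform_component j \<phi> x =
     Gamma ((real DIM('a) + 1) / 2) / pi powr ((real DIM('a) + 1) / 2) *
     Lim (at_right 0) (\<lambda>\<epsilon>. LINT y:{y. \<epsilon> < norm (x - y)}|lebesgue.
       ((x - y) \<bullet> j) / norm (x - y) ^ (DIM('a) + 1) * \<phi> y)"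

definition riesz_transform :: "('a::euclidean_space \<Rightarrow> real) \<Rightarrow> 'a \<Rightarrow> 'a" where
  "riesz_transform \<phi> x = (\<Sum>j\<in>Basis. riesz_transform_component j \<phi> x *\<^sub>R j)"

definition frac_gradient :: "real \<Rightarrow> ('a::euclidean_space \<Rightarrow> real) \<Rightarrow> 'a \<Rightarrow> 'a" where
  "frac_gradient s \<phi> =
     (if s = 0 then (\<lambda>x. - riesz_transform \<phi> x)
      else if s = 1 then gradient \<phi>
      else gradient (riesz_potential (1 - s) \<phi>))"

definition frac_divergence :: "real \<Rightarrow> ('a::euclidean_space \<Rightarrow> 'a) \<Rightarrow> 'a \<Rightarrow> real" where
  "frac_divergence s \<Phi> x = (\<Sum>j\<in>Basis. frac_gradient s (\<lambda>y. \<Phi> y \<bullet> j) x \<bullet> j)"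

section \<open>Lebesgue spaces\<close>

text \<open>Function spaces are sets of functions rather than of classes modulo equality almost
  everywhere, so the norms below are seminorms on these sets, vanishing exactly at the functions
  that are zero almost everywhere. Weak gradients are likewise determined only almost
  everywhere.\<close>

definition Lp_space :: "real \<Rightarrow> ('a::euclidean_space \<Rightarrow> 'b::euclidean_space) set" where
  "Lp_space p = {u. u \<in> borel_measurable lebesgue \<and> integrable lebesgue (\<lambda>x. norm (u x) powr p)}"

definition Lp_norm :: "real \<Rightarrow> ('a::euclidean_space \<Rightarrow> 'b::euclidean_space) \<Rightarrow> real" where
  "Lp_norm p u = (LINT x|lebesgue. norm (u x) powr p) powr (1 / p)"

definition L1_loc :: "('a::euclidean_space \<Rightarrow> 'b::euclidean_space) set" where
  "L1_loc = {u. u \<in> borel_measurable lebesgue \<and> (\<forall>K. compact K \<longrightarrow> set_integrable lebesgue K u)}"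

section \<open>Weak fractional gradients and the associated spaces\<close>

text \<open>For \<open>s = 1\<close> this is the usual weak gradient, and \<open>Lambda_space 1 p\<close> below is the
  Sobolev space $W^{1,p}$.\<close>

definition has_weak_frac_gradient ::
    "real \<Rightarrow> ('a::euclidean_space \<Rightarrow> real) \<Rightarrow> ('a \<Rightarrow> 'a) \<Rightarrow> bool" where
  "has_weak_frac_gradient s u G \<longleftrightarrow> G \<in> L1_loc \<and>
     (\<forall>\<Phi>\<in>Cc_inf UNIV. (LINT x|lebesgue. u x * frac_divergence s \<Phi> x) = - (LINT x|lebesgue. G x \<bullet> \<Phi> x))"

definition weak_frac_gradient :: "real \<Rightarrow> ('a::euclidean_space \<Rightarrow> real) \<Rightarrow> 'a \<Rightarrow> 'a" where
  "weak_frac_gradient s u = (SOME G. has_weak_frac_gradient s u G)"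

definition Lambda_space :: "real \<Rightarrow> real \<Rightarrow> ('a::euclidean_space \<Rightarrow> real) set" where
  "Lambda_space s p = {u \<in> Lp_space p.
     (\<exists>G. has_weak_frac_gradient s u G) \<and> weak_frac_gradient s u \<in> Lp_space p}"

definition Lambda_norm :: "real \<Rightarrow> real \<Rightarrow> ('a::euclidean_space \<Rightarrow> real) \<Rightarrow> real" where
  "Lambda_norm s p u = (Lp_norm p u powr p + Lp_norm p (weak_frac_gradient s u) powr p) powr (1 / p)"

definition Lambda0_space :: "real \<Rightarrow> real \<Rightarrow> 'a::euclidean_space set \<Rightarrow> ('a \<Rightarrow> real) set" where
  "Lambda0_space s p \<Omega> = {u \<in> Lambda_space s p.
     \<forall>\<epsilon>>0. \<exists>\<phi>\<in>Cc_inf \<Omega>. Lambda_norm s p (\<lambda>x. u x - \<phi> x) < \<epsilon>}"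

section \<open>Compact embeddings\<close>

definition continuous_embedding ::
    "('a \<Rightarrow> real) set \<Rightarrow> (('a \<Rightarrow> real) \<Rightarrow> real) \<Rightarrow> ('a \<Rightarrow> real) set \<Rightarrow> (('a \<Rightarrow> real) \<Rightarrow> real) \<Rightarrow> bool" where
  "continuous_embedding X nX Y nY \<longleftrightarrow> X \<subseteq> Y \<and> (\<exists>C. \<forall>u\<in>X. nY u \<le> C * nX u)"

definition compact_embedding ::
    "('a \<Rightarrow> real) set \<Rightarrow> (('a \<Rightarrow> real) \<Rightarrow> real) \<Rightarrow> ('a \<Rightarrow> real) set \<Rightarrow> (('a \<Rightarrow> real) \<Rightarrow> real) \<Rightarrow> bool" where
  "compact_embedding X nX Y nY \<longleftrightarrow> continuous_embedding X nX Y nY \<and>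
     (\<forall>u :: nat \<Rightarrow> 'a \<Rightarrow> real. (\<forall>n. u n \<in> X) \<and> (\<exists>B. \<forall>n. nX (u n) \<le> B) \<longrightarrow>
        (\<exists>v\<in>Y. \<exists>r :: nat \<Rightarrow> nat. strict_mono r \<and> (\<lambda>n. nY (\<lambda>x. u (r n) x - v x)) \<longlonglongrightarrow> 0))"

end

theory Submission
  imports Defs "HOL-Library.Diagonal_Subsequence"
begin

text \<open>The proof is based on the heat semigroup \<open>P\<^sub>r\<close>, convolution with \<open>gauss r\<close>, which is the heat
  kernel at time \<open>r/4\<close>.

  Riesz kernels are superpositions of Gaussians: \<open>|z|^(2\<gamma>-d)\<close> is a multiple of the integral of
  \<open>r^(\<gamma>-1) gauss r z\<close> over all times \<open>r > 0\<close>. Consequently, for \<open>0 \<le> t < 1\<close> and a test function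
  \<open>f\<close>, the fractional gradient \<open>D^t f\<close> is a multiple of the integral of \<open>r^((1-t)/2-1) P\<^sub>r D f\<close>
  over time (\<open>frac_gradient_heat_integral\<close>), and \<open>f\<close> itself is half the time integral of the
  convolutions of the partial derivatives \<open>\<partial>\<^sub>j f\<close> with \<open>egauss j r\<close> (\<open>test_heat_integral\<close>).
  These are fractional integrals in the time variable, and fractional integrals compose by
  Euler's Beta integral. So \<open>D^t f\<close> is a multiple of the integral of \<open>r^((s-t)/2-1) P\<^sub>r D^s f\<close>,
  for
  \<open>t < s \<le> 1\<close>.

  Split this integral at a time \<open>T\<close>. For \<open>r > T\<close> it is better to return to \<open>D f\<close> and to let the
  semigroup absorb the derivative, so that only the mollified function \<open>P\<^sub>T\<^sub>/\<^sub>2 f\<close> enters. Since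
  \<open>P\<^sub>r\<close> maps \<open>L^p\<close> to \<open>L^q\<close> with norm of order \<open>r^(-d/2 (1/p-1/q))\<close>, the integral over \<open>r < T\<close>
  has \<open>L^q\<close> norm at most a multiple of \<open>T^\<theta>\<close> times the \<open>L^p\<close> norm of \<open>D^s f\<close>, where
  \<open>\<theta> = (s-t)/2 - d/2 (1/p-1/q)\<close> is positive exactly because \<open>1/p - s/d < 1/q - t/d\<close>. Thus the
  \<open>\<Lambda>^(t,q)\<close> norm of \<open>f\<close> is at most \<open>D T^\<theta>\<close> times its \<open>\<Lambda>^(s,p)\<close> norm plus a constant depending on
  \<open>T\<close> times the \<open>L^1\<close> norm of \<open>P\<^sub>T\<^sub>/\<^sub>2 f\<close> (\<open>test_mollified_estimate\<close>).

  With \<open>T = 1\<close> this gives the embedding, because on functions supported in the bounded set \<open>\<Omega>\<close>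
  the \<open>L^1\<close> norm is controlled by the \<open>L^p\<close> norm and \<open>P\<^sub>r\<close> contracts \<open>L^1\<close>. For compactness,
  \<open>P\<^sub>r\<close> maps \<open>L^1\<close>-bounded sequences of test functions supported in \<open>\<Omega>\<close> to sequences that are
  locally equi-Lipschitz and dominated by a fixed Gaussian, so a subsequence converges in \<open>L^1\<close>
  for every time in a sequence tending to zero (\<open>heat_L1_compact\<close>). First taking \<open>T\<close> small and
  then the indices large shows that the subsequence is Cauchy in \<open>\<Lambda>^(t,q)\<close>.

  It remains to pass from test functions to their closure. Integration by parts, again obtained
  from the heat semigroup, shows that the fractional gradient of a test function is a weak one;
  weak gradients are unique by the fundamental lemma of the calculus of variations, and they
  survive \<open>L^q\<close> limits. Hence a sequence of test functions that is Cauchy in \<open>\<Lambda>^(t,q)\<close> converges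
  to an element of \<open>\<Lambda>\<^sub>0^(t,q)(\<Omega>)\<close> (\<open>Lambda0_limit\<close>).\<close>

section \<open>Integral inequalities\<close>

lemma ennreal_approx_lt:
  assumes "0 < (a::ennreal)" shows "\<exists>e>0. ennreal e < a"
proof -
  obtain b where b: "0 < b" "b < a" using dense[OF assms] by blast
  then obtain e where "b = ennreal e" "e \<ge> 0" by (cases b) auto
  thus ?thesis using b by (intro exI[of _ e]) auto
qed

text \<open>It holds for every \<open>f\<close> because the Bochner integral of a function that is not integrable is \<open>0\<close>.\<close>

lemma abs_integral_le_nn:
  fixes f :: "'x \<Rightarrow> real"
  shows "ennreal \<bar>\<integral>x. f x \<partial>M\<bar> \<le> (\<integral>\<^sup>+x. ennreal \<bar>f x\<bar> \<partial>M)"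
proof (cases "integrable M f")
  case True
  then show ?thesis using integral_norm_bound_ennreal[OF True] by simp
qed (simp add: not_integrable_integral_eq)

lemma abs_integral_le:
  fixes f :: "'x \<Rightarrow> real"
  assumes g: "integrable M g" "\<And>x. \<bar>f x\<bar> \<le> g x"
  shows "\<bar>\<integral>x. f x \<partial>M\<bar> \<le> (\<integral>x. g x \<partial>M)"
proof -
  have g0: "0 \<le> g x" for x using g(2)[of x] by simp
  have "ennreal \<bar>\<integral>x. f x \<partial>M\<bar> \<le> (\<integral>\<^sup>+x. ennreal (g x) \<partial>M)"
    by (rule order_trans[OF abs_integral_le_nn]) (intro nn_integral_mono ennreal_leI g)
  also have "\<dots> = ennreal (\<integral>x. g x \<partial>M)" using g g0 by (intro nn_integral_eq_integral) auto
  finally show ?thesis using g0 by (simp add: ennreal_le_iff integral_nonneg)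
qed

lemma nn_integral_lborel_affine:
  fixes f :: "'a::euclidean_space \<Rightarrow> ennreal"
  assumes [measurable]: "f \<in> borel_measurable borel" and c: "c \<noteq> 0"
  shows "(\<integral>\<^sup>+x. f x \<partial>lborel) = ennreal (\<bar>c\<bar> ^ DIM('a)) * (\<integral>\<^sup>+x. f (t + c *\<^sub>R x) \<partial>lborel)"
  by (subst lborel_affine[OF c, of t]) (simp add: nn_integral_density nn_integral_distr nn_integral_cmult)

lemma integral_lborel_affine:
  fixes f :: "'a::euclidean_space \<Rightarrow> real"
  assumes [measurable]: "f \<in> borel_measurable borel" and c: "c \<noteq> 0"
  shows "(\<integral>x. f x \<partial>lborel) = \<bar>c\<bar> ^ DIM('a) * (\<integral>x. f (t + c *\<^sub>R x) \<partial>lborel)"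
proof -
  have "(\<integral>x. f x \<partial>lborel) = (\<integral>x. f x \<partial>density (distr lborel borel (\<lambda>x. t + c *\<^sub>R x)) (\<lambda>_. ennreal (\<bar>c\<bar> ^ DIM('a))))"
    using lborel_affine[OF c, of t] by simp
  also have "\<dots> = (\<integral>x. (\<bar>c\<bar> ^ DIM('a)) *\<^sub>R f x \<partial>distr lborel borel (\<lambda>x. t + c *\<^sub>R x))"
    by (subst integral_density) auto
  also have "\<dots> = (\<integral>x. \<bar>c\<bar> ^ DIM('a) * f (t + c *\<^sub>R x) \<partial>lborel)"
    by (subst integral_distr) auto
  finally show ?thesis by simp
qed

lemma integrable_lborel_affine:
  fixes f :: "'a::euclidean_space \<Rightarrow> real"
  assumes [measurable]: "f \<in> borel_measurable borel" and c: "c \<noteq> 0"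
  shows "integrable lborel (\<lambda>x. f (t + c *\<^sub>R x)) \<longleftrightarrow> integrable lborel f"
proof -
  have "(\<integral>\<^sup>+x. ennreal (norm (f x)) \<partial>lborel) = ennreal (\<bar>c\<bar> ^ DIM('a)) * (\<integral>\<^sup>+x. ennreal (norm (f (t + c *\<^sub>R x))) \<partial>lborel)"
    by (rule nn_integral_lborel_affine) (use c in auto)
  moreover have "ennreal (\<bar>c\<bar> ^ DIM('a)) \<noteq> 0" "ennreal (\<bar>c\<bar> ^ DIM('a)) \<noteq> top" using c by auto
  ultimately show ?thesis
    by (auto simp: integrable_iff_bounded ennreal_mult_less_top ennreal_mult_eq_top_iff less_top)
qed

lemma integrable_bounded_support:
  fixes f :: "'a::euclidean_space \<Rightarrow> real"
  assumes [measurable]: "f \<in> borel_measurable borel"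
    and K: "\<And>x. \<bar>f x\<bar> \<le> K" and R: "\<And>x. norm x > R \<Longrightarrow> f x = 0"
  shows "integrable lborel f"
proof (rule Bochner_Integration.integrable_bound)
  have "emeasure lborel (cball (0::'a) R) < \<infinity>" by (rule emeasure_lborel_cball_finite)
  thus "integrable lborel (\<lambda>x::'a. K * indicator (cball 0 R) x)" by (intro integrable_mult_right) simp
  show "AE x in lborel. norm (f x) \<le> norm (K * indicator (cball 0 R) x :: real)"
  proof (rule AE_I2)
    fix x show "norm (f x) \<le> norm (K * indicator (cball 0 R) x :: real)"
      using K[of x] R[of x] by (cases "norm x \<le> R") auto
  qed
qed measurable

text \<open>The form in which Fubini's theorem is used throughout: absolute integrability on the product is
  reduced to an integrable majorant of the inner integrals.\<close>

lemma fubini_dominated: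
  fixes F :: "'a::euclidean_space \<Rightarrow> 'b::euclidean_space \<Rightarrow> real"
  assumes meas: "(\<lambda>(x, y). F x y) \<in> borel_measurable (lborel \<Otimes>\<^sub>M lborel)"
    and int: "AE x in lborel. integrable lborel (F x)"
    and g: "integrable lborel g" and le: "AE x in lborel. (\<integral>y. \<bar>F x y\<bar> \<partial>lborel) \<le> g x"
  shows "(\<integral>x. \<integral>y. F x y \<partial>lborel \<partial>lborel) = (\<integral>y. \<integral>x. F x y \<partial>lborel \<partial>lborel)"
    and "integrable lborel (\<lambda>y. \<integral>x. F x y \<partial>lborel)"
proof -
  have int1: "integrable (lborel \<Otimes>\<^sub>M lborel) (\<lambda>(x, y). F x y)"
  proof (rule lborel_pair.Fubini_integrable[OF meas])
    show "AE x in lborel. integrable lborel (\<lambda>y. case (x, y) of (x, y) \<Rightarrow> F x y)" using int by simp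
    show "integrable lborel (\<lambda>x. \<integral>y. norm (case (x, y) of (x, y) \<Rightarrow> F x y) \<partial>lborel)"
    proof (rule Bochner_Integration.integrable_bound[OF g])
      have "(\<lambda>(x, y). norm (F x y)) \<in> borel_measurable (lborel \<Otimes>\<^sub>M lborel)"
        using meas by (simp add: case_prod_unfold)
      from lborel.borel_measurable_lebesgue_integral[OF this]
      show "(\<lambda>x. \<integral>y. norm (case (x, y) of (x, y) \<Rightarrow> F x y) \<partial>lborel) \<in> borel_measurable lborel" by simp
      show "AE x in lborel. norm (\<integral>y. norm (case (x, y) of (x, y) \<Rightarrow> F x y) \<partial>lborel) \<le> norm (g x)"
        using le by eventually_elim (auto intro: order_trans[OF _ abs_ge_self])
    qed
  qed
  have int2: "integrable (lborel \<Otimes>\<^sub>M lborel) (\<lambda>(y, x). F x y)"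
    using int1 by (subst lborel_pair.integrable_product_swap_iff[symmetric]) simp
  show "(\<integral>x. \<integral>y. F x y \<partial>lborel \<partial>lborel) = (\<integral>y. \<integral>x. F x y \<partial>lborel \<partial>lborel)"
    by (rule lborel_pair.Fubini_integral[OF int2])
  show "integrable lborel (\<lambda>y. \<integral>x. F x y \<partial>lborel)"
    using lborel_pair.integrable_fst'[OF int2] by simp
qed

text \<open>Convexity of \<open>x powr q\<close>: the graph lies above its tangent at \<open>m\<close>. It is Young's inequality in
  disguise.\<close>

lemma powr_tangent:
  fixes f m q :: real
  assumes "f \<ge> 0" "m > 0" "q \<ge> 1"
  shows "q * m powr (q - 1) * f \<le> f powr q + (q - 1) * m powr q"
proof (cases "q = 1")
  case True then show ?thesis using assms by simp
next
  case False
  hence q: "q > 1" using assms by simp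
  have "f * m powr (q-1) \<le> f powr q / q + (m powr (q-1)) powr (q/(q-1)) / (q/(q-1))"
    by (rule Youngs_inequality) (use q assms in \<open>auto simp: field_simps\<close>)
  also have "(m powr (q-1)) powr (q/(q-1)) = m powr q" using q by (simp add: powr_powr)
  finally have "q * (f * m powr (q-1)) \<le> q * (f powr q / q + m powr q / (q/(q-1)))"
    using q by (intro mult_left_mono) auto
  also have "\<dots> = f powr q + (q-1) * m powr q" using q by (simp add: field_simps)
  finally show ?thesis by (simp add: mult_ac)
qed

text \<open>Integrating the tangent inequality at the mean \<open>m = y / A\<close> against the weight \<open>a\<close>, whose total
  mass is \<open>A\<close>. The weight is not normalised, which produces the power \<open>A powr (q - 1)\<close>. Bounding
  \<open>y\<close> by an integral in the extended reals includes the case that \<open>a f\<close> is not integrable.\<close>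

lemma jensen_powr:
  fixes a f :: "'x \<Rightarrow> real"
  assumes a: "integrable M a" "\<And>x. 0 \<le> a x"
    and f[measurable]: "f \<in> borel_measurable M" and f0: "\<And>x. 0 \<le> f x"
    and q: "1 \<le> q" and y: "0 \<le> y" "ennreal y \<le> (\<integral>\<^sup>+x. ennreal (a x * f x) \<partial>M)"
  shows "ennreal (y powr q) \<le> ennreal ((\<integral>x. a x \<partial>M) powr (q - 1)) * (\<integral>\<^sup>+x. ennreal (a x * f x powr q) \<partial>M)"
proof (cases "y = 0")
  case True then show ?thesis by simp
next
  case False
  note [measurable] = borel_measurable_integrable[OF a(1)]
  define A where "A = (\<integral>x. a x \<partial>M)"
  have A: "(\<integral>\<^sup>+x. ennreal (a x) \<partial>M) = ennreal A" "A \<ge> 0"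
    unfolding A_def using a by (auto intro: nn_integral_eq_integral)
  have "A \<noteq> 0"
  proof
    assume "A = 0"
    hence "AE x in M. a x = 0" using A a by (auto simp: nn_integral_0_iff_AE)
    hence "(\<integral>\<^sup>+x. ennreal (a x * f x) \<partial>M) = (\<integral>\<^sup>+x. 0 \<partial>M)" by (intro nn_integral_cong_AE) auto
    thus False using y False by simp
  qed
  hence Ap: "A > 0" using A by simp
  define m where "m = y / A"
  have m: "m > 0" using Ap y False by (simp add: m_def)
  define Z where "Z = (\<integral>\<^sup>+x. ennreal (a x * f x powr q) \<partial>M)"
  have "ennreal (q * m powr (q-1)) * ennreal y \<le> ennreal (q * m powr (q-1)) * (\<integral>\<^sup>+x. ennreal (a x * f x) \<partial>M)"
    using y by (intro mult_left_mono) auto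
  also have "\<dots> = (\<integral>\<^sup>+x. ennreal (a x * (q * m powr (q-1) * f x)) \<partial>M)"
    by (subst nn_integral_cmult[symmetric]) (use q a f0 in \<open>auto intro!: nn_integral_cong simp: ennreal_mult[symmetric] mult_ac\<close>)
  also have "\<dots> \<le> (\<integral>\<^sup>+x. ennreal (a x * (f x powr q)) + ennreal ((q - 1) * m powr q) * ennreal (a x) \<partial>M)"
  proof (intro nn_integral_mono)
    fix x
    have "a x * (q * m powr (q-1) * f x) \<le> a x * (f x powr q + (q - 1) * m powr q)"
      by (intro mult_left_mono powr_tangent) (use q m a f0 in auto)
    moreover have "0 \<le> (q - 1) * m powr q * a x" using q a(2)[of x] by simp
    ultimately show "ennreal (a x * (q * m powr (q-1) * f x)) \<le> ennreal (a x * (f x powr q)) + ennreal ((q - 1) * m powr q) * ennreal (a x)"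
      using q a(2)[of x]
      by (subst ennreal_mult[symmetric], simp, simp, subst ennreal_plus[symmetric]) (auto simp: algebra_simps intro!: ennreal_leI)
  qed
  also have "\<dots> = Z + ennreal ((q - 1) * m powr q) * ennreal A"
    by (subst nn_integral_add) (auto simp: Z_def nn_integral_cmult A)
  finally have *: "ennreal (q * m powr (q-1) * y) \<le> Z + ennreal ((q - 1) * m powr q * A)"
    using q Ap y by (simp add: ennreal_mult)
  show ?thesis unfolding A_def[symmetric] Z_def[symmetric]
  proof (cases Z)
    case top
    then show "ennreal (y powr q) \<le> ennreal (A powr (q - 1)) * Z" using Ap by (simp add: ennreal_mult_top)
  next
    case (real z)
    have "q * m powr (q-1) * y \<le> z + (q - 1) * m powr q * A"
      using * real q Ap m by (subst (asm) real(2)) (simp add: ennreal_plus[symmetric] del: ennreal_plus)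
    moreover have "q * m powr (q-1) * y = q * m powr q * A"
    proof -
      have "y = m * A" using Ap by (simp add: m_def)
      moreover have "m powr (q-1) * m = m powr q" using m by (simp add: powr_diff)
      ultimately show ?thesis by (metis (no_types, lifting) mult.assoc mult.commute)
    qed
    ultimately have "q * m powr q * A \<le> z + (q - 1) * m powr q * A" by simp
    hence "m powr q * A \<le> z" by (simp add: algebra_simps)
    hence "A powr (q-1) * (m powr q * A) \<le> A powr (q-1) * z" by (intro mult_left_mono) auto
    moreover have "A powr (q-1) * (m powr q * A) = y powr q"
    proof -
      have "A powr (q-1) * A = A powr q" using Ap by (simp add: powr_diff)
      moreover have "m powr q * A powr q = y powr q" using Ap m by (simp add: powr_mult[symmetric] m_def)
      ultimately show ?thesis by (metis mult.assoc mult.commute)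
    qed
    ultimately show "ennreal (y powr q) \<le> ennreal (A powr (q - 1)) * Z"
      using real by (simp add: ennreal_mult[symmetric] ennreal_leI)
  qed
qed

section \<open>Mass functionals and completeness\<close>

text \<open>The \<open>p\<close>-th power of the \<open>L^p\<close> norm, with values in the extended nonnegative reals. Without the
  root and with the value \<open>\<infinity>\<close> allowed, the rules below carry no integrability side conditions,
  and the triangle inequality takes the simple form with the constant \<open>2 powr p\<close>.\<close>

definition pmass :: "'x measure \<Rightarrow> real \<Rightarrow> ('x \<Rightarrow> 'b::real_normed_vector) \<Rightarrow> ennreal" where
  "pmass M p u = (\<integral>\<^sup>+x. ennreal (norm (u x) powr p) \<partial>M)"

lemma powr_sum_le:
  fixes a b p :: real assumes "a \<ge> 0" "b \<ge> 0" "p \<ge> 0"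
  shows "(a + b) powr p \<le> 2 powr p * (a powr p + b powr p)"
proof -
  have "(a + b) powr p \<le> (2 * max a b) powr p" using assms by (intro powr_mono2) auto
  also have "\<dots> = 2 powr p * max a b powr p" using assms by (simp add: powr_mult)
  also have "\<dots> \<le> 2 powr p * (a powr p + b powr p)" by (intro mult_left_mono) (auto simp: max_def)
  finally show ?thesis .
qed

lemma pmass_add:
  fixes u v :: "'x \<Rightarrow> 'b::euclidean_space"
  assumes [measurable]: "u \<in> borel_measurable M" "v \<in> borel_measurable M" and p: "p \<ge> 0"
  shows "pmass M p (\<lambda>x. u x + v x) \<le> ennreal (2 powr p) * (pmass M p u + pmass M p v)"
proof -
  have "pmass M p (\<lambda>x. u x + v x) \<le> (\<integral>\<^sup>+x. ennreal (2 powr p) * (ennreal (norm (u x) powr p) + ennreal (norm (v x) powr p)) \<partial>M)"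
    unfolding pmass_def
  proof (intro nn_integral_mono)
    fix x
    have "norm (u x + v x) powr p \<le> (norm (u x) + norm (v x)) powr p"
      using p by (intro powr_mono2 norm_triangle_ineq) auto
    also have "\<dots> \<le> 2 powr p * (norm (u x) powr p + norm (v x) powr p)" by (rule powr_sum_le) (use p in auto)
    finally show "ennreal (norm (u x + v x) powr p) \<le> ennreal (2 powr p) * (ennreal (norm (u x) powr p) + ennreal (norm (v x) powr p))"
      by (simp add: ennreal_mult[symmetric] ennreal_plus[symmetric] ennreal_leI del: ennreal_plus)
  qed
  also have "\<dots> = ennreal (2 powr p) * (pmass M p u + pmass M p v)"
    unfolding pmass_def by (simp add: nn_integral_cmult nn_integral_add)
  finally show ?thesis .
qed

lemma pmass_minus_commute: "pmass M p (\<lambda>x. u x - v x) = pmass M p (\<lambda>x. v x - u x)"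
  by (simp add: pmass_def norm_minus_commute)

lemma pmass_diff:
  fixes u v :: "'x \<Rightarrow> 'b::euclidean_space"
  assumes [measurable]: "u \<in> borel_measurable M" "v \<in> borel_measurable M" and p: "p \<ge> 0"
  shows "pmass M p (\<lambda>x. u x - v x) \<le> ennreal (2 powr p) * (pmass M p u + pmass M p v)"
  using pmass_add[of u M "\<lambda>x. - v x" p] assms by (simp add: pmass_def)

lemma pmass_eq_integral:
  assumes "integrable M (\<lambda>x. norm (u x) powr p)"
  shows "pmass M p u = ennreal (\<integral>x. norm (u x) powr p \<partial>M)"
  unfolding pmass_def using assms by (intro nn_integral_eq_integral) auto

lemma pmass_finite_iff:
  fixes u :: "'x \<Rightarrow> 'b::euclidean_space"
  assumes [measurable]: "u \<in> borel_measurable M"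
  shows "pmass M p u < \<infinity> \<longleftrightarrow> integrable M (\<lambda>x. norm (u x) powr p)"
  by (auto simp: pmass_def integrable_iff_bounded)

lemma tendsto_0_if_powr_tendsto_0:
  fixes a :: "nat \<Rightarrow> real" assumes "\<And>n. 0 \<le> a n" "p > 0" "(\<lambda>n. a n powr p) \<longlonglongrightarrow> 0"
  shows "a \<longlonglongrightarrow> 0"
proof -
  have "(\<lambda>n. (a n powr p) powr (1/p)) \<longlonglongrightarrow> 0 powr (1/p)"
    using assms by (intro tendsto_powr2) (auto intro: tendsto_const)
  moreover have "(a n powr p) powr (1/p) = a n" for n using assms by (simp add: powr_powr)
  ultimately show ?thesis by simp
qed

lemma pmass_tendsto_AE_subseq:
  fixes h :: "nat \<Rightarrow> 'x \<Rightarrow> 'b::euclidean_space"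
  assumes [measurable]: "\<And>n. h n \<in> borel_measurable M" and p: "p > 0"
    and lim: "(\<lambda>n. pmass M p (h n)) \<longlonglongrightarrow> 0" and fin: "\<And>n. pmass M p (h n) < \<infinity>"
  shows "\<exists>r::nat\<Rightarrow>nat. strict_mono r \<and> (AE x in M. (\<lambda>k. h (r k) x) \<longlonglongrightarrow> 0)"
proof -
  have int: "integrable M (\<lambda>x. norm (h n x) powr p)" for n
    using fin pmass_finite_iff assms(1) by blast
  have "(\<lambda>n. ennreal (\<integral>x. norm (norm (h n x) powr p) \<partial>M)) \<longlonglongrightarrow> ennreal 0"
    using lim pmass_eq_integral[OF int] by simp
  hence "(\<lambda>n. (\<integral>x. norm (norm (h n x) powr p) \<partial>M)) \<longlonglongrightarrow> 0"
    by (subst (asm) tendsto_ennreal_iff) auto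
  from tendsto_L1_AE_subseq[OF int this]
  obtain r where r: "strict_mono r" "AE x in M. (\<lambda>k. norm (h (r k) x) powr p) \<longlonglongrightarrow> 0" by blast
  have "AE x in M. (\<lambda>k. h (r k) x) \<longlonglongrightarrow> 0"
    using r(2) by eventually_elim (use p in \<open>auto dest!: tendsto_0_if_powr_tendsto_0[rotated 2] intro: tendsto_norm_zero_cancel\<close>)
  with r(1) show ?thesis by blast
qed

definition pCauchy :: "'x measure \<Rightarrow> real \<Rightarrow> (nat \<Rightarrow> 'x \<Rightarrow> 'b::real_normed_vector) \<Rightarrow> bool" where
  "pCauchy M p f \<longleftrightarrow> (\<forall>e>0. \<exists>N. \<forall>m\<ge>N. \<forall>n\<ge>N. pmass M p (\<lambda>x. f m x - f n x) \<le> ennreal e)"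

text \<open>By Fatou's lemma: the distance from \<open>f n\<close> to the limit is at most the lower limit of its
  distances to the members of the subsequence, and these are small by the Cauchy property.\<close>

lemma pCauchy_AE_limit:
  fixes f :: "nat \<Rightarrow> 'x \<Rightarrow> 'b::euclidean_space"
  assumes [measurable]: "\<And>n. f n \<in> borel_measurable M" "g \<in> borel_measurable M"
    and C: "pCauchy M p f" and r: "strict_mono (r::nat\<Rightarrow>nat)" "AE x in M. (\<lambda>k. f (r k) x) \<longlonglongrightarrow> g x" and p: "p > 0"
  shows "(\<lambda>n. pmass M p (\<lambda>x. f n x - g x)) \<longlonglongrightarrow> 0"
proof (rule tendsto_sandwich[OF _ _ tendsto_const])
  show "\<forall>\<^sub>F n in sequentially. 0 \<le> pmass M p (\<lambda>x. f n x - g x)" by simp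
  show "\<forall>\<^sub>F n in sequentially. pmass M p (\<lambda>x. f n x - g x) \<le> pmass M p (\<lambda>x. f n x - g x)" by simp
  show "(\<lambda>n. pmass M p (\<lambda>x. f n x - g x)) \<longlonglongrightarrow> 0"
  proof (rule order_tendstoI)
    fix a :: ennreal assume "0 < a"
    then obtain e where e: "0 < e" "ennreal e < a"
      using ennreal_approx_lt by blast
    obtain N where N: "\<And>m n. m \<ge> N \<Longrightarrow> n \<ge> N \<Longrightarrow> pmass M p (\<lambda>x. f m x - f n x) \<le> ennreal e"
      using C e unfolding pCauchy_def by blast
    have "pmass M p (\<lambda>x. f n x - g x) \<le> ennreal e" if n: "n \<ge> N" for n
    proof -
      have "pmass M p (\<lambda>x. f n x - g x) = (\<integral>\<^sup>+x. liminf (\<lambda>k. ennreal (norm (f n x - f (r k) x) powr p)) \<partial>M)"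
        unfolding pmass_def
      proof (intro nn_integral_cong_AE, use r(2) in eventually_elim)
        fix x assume "(\<lambda>k. f (r k) x) \<longlonglongrightarrow> g x"
        hence "(\<lambda>k. norm (f n x - f (r k) x) powr p) \<longlonglongrightarrow> norm (f n x - g x) powr p"
          using p by (intro tendsto_powr2 tendsto_intros) auto
        hence "(\<lambda>k. ennreal (norm (f n x - f (r k) x) powr p)) \<longlonglongrightarrow> ennreal (norm (f n x - g x) powr p)"
          by (rule tendsto_ennrealI)
        thus "ennreal (norm (f n x - g x) powr p) = liminf (\<lambda>k. ennreal (norm (f n x - f (r k) x) powr p))"
          by (intro lim_imp_Liminf[symmetric]) auto
      qed
      also have "\<dots> \<le> liminf (\<lambda>k. pmass M p (\<lambda>x. f n x - f (r k) x))"
        unfolding pmass_def by (intro nn_integral_liminf) auto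
      also have "\<dots> \<le> ennreal e"
      proof (rule Liminf_le)
        show "\<forall>\<^sub>F k in sequentially. pmass M p (\<lambda>x. f n x - f (r k) x) \<le> ennreal e"
          using N[OF n] seq_suble[OF r(1)] by (intro eventually_sequentiallyI[of N]) (meson order_trans)
      qed simp
      finally show ?thesis .
    qed
    thus "\<forall>\<^sub>F n in sequentially. pmass M p (\<lambda>x. f n x - g x) < a"
      using e by (intro eventually_sequentiallyI[of N]) (meson order_le_less_trans)
  qed auto
qed

text \<open>Riesz--Fischer completeness: along a subsequence whose successive differences have mass at most
  \<open>2^(-k(p+1))\<close>, these differences are eventually below \<open>2^(-k)\<close> almost everywhere, by Chebyshev
  and Borel--Cantelli in the form of a convergent series of integrals.\<close>

lemma pCauchy_imp_limit:
  fixes f :: "nat \<Rightarrow> 'x \<Rightarrow> 'b::euclidean_space"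
  assumes m[measurable]: "\<And>n. f n \<in> borel_measurable M" and C: "pCauchy M p f" and p: "p > 0"
  shows "\<exists>g\<in>borel_measurable M. (\<lambda>n. pmass M p (\<lambda>x. f n x - g x)) \<longlonglongrightarrow> 0"
proof -
  define e where "e k = 2 powr (- (real k * (p + 1)))" for k
  have "\<exists>N. \<forall>m\<ge>N. \<forall>n\<ge>N. pmass M p (\<lambda>x. f m x - f n x) \<le> ennreal (e k)" for k
    using C unfolding pCauchy_def by (auto simp: e_def)
  then obtain N where N: "\<And>k m n. m \<ge> N k \<Longrightarrow> n \<ge> N k \<Longrightarrow> pmass M p (\<lambda>x. f m x - f n x) \<le> ennreal (e k)" by metis
  define r where "r = rec_nat (N 0) (\<lambda>k rk. max (Suc rk) (N (Suc k)))"
  have r0: "r 0 = N 0" and rS: "r (Suc k) = max (Suc (r k)) (N (Suc k))" for k by (auto simp: r_def)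
  have rm: "strict_mono r" by (rule strict_monoI_Suc) (simp add: rS)
  have rN: "r k \<ge> N k" for k by (cases k) (auto simp: r0 rS)
  have step: "pmass M p (\<lambda>x. f (r (Suc k)) x - f (r k) x) \<le> ennreal (e k)" for k
    using N[of k "r (Suc k)" "r k"] rN[of k] strict_monoD[OF rm, of k "Suc k"] by simp
  \<comment> \<open>Weighting by \<open>2^(kp)\<close> turns \<open>?D k x < 1\<close> into \<open>norm (...) < 2^(-k)\<close> and leaves integrals summing
    like \<open>2^(-k)\<close>.\<close>
  let ?D = "\<lambda>k x. 2 powr (real k * p) * norm (f (r (Suc k)) x - f (r k) x) powr p"
  have "(\<integral>\<^sup>+x. (\<Sum>k. ennreal (?D k x)) \<partial>M) = (\<Sum>k. \<integral>\<^sup>+x. ennreal (?D k x) \<partial>M)"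
    by (rule nn_integral_suminf) auto
  also have "\<dots> \<le> (\<Sum>k. ennreal ((1/2)^k))"
  proof (rule suminf_le)
    fix k
    have "(\<integral>\<^sup>+x. ennreal (?D k x) \<partial>M) = ennreal (2 powr (real k * p)) * pmass M p (\<lambda>x. f (r (Suc k)) x - f (r k) x)"
      unfolding pmass_def by (subst nn_integral_cmult[symmetric]) (auto simp: ennreal_mult)
    also have "\<dots> \<le> ennreal (2 powr (real k * p)) * ennreal (e k)" by (intro mult_left_mono step) auto
    also have "\<dots> = ennreal ((1/2)^k)"
      by (simp add: ennreal_mult[symmetric] e_def powr_add[symmetric] algebra_simps powr_minus powr_realpow power_one_over inverse_eq_divide)
    finally show "(\<integral>\<^sup>+x. ennreal (?D k x) \<partial>M) \<le> ennreal ((1/2)^k)" .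
  qed auto
  also have "\<dots> = ennreal (\<Sum>k. (1/2)^k)" by (rule suminf_ennreal2) (auto simp: summable_geometric)
  also have "\<dots> < \<infinity>" by simp
  finally have "AE x in M. (\<Sum>k. ennreal (?D k x)) \<noteq> \<infinity>"
    by (intro nn_integral_PInf_AE) auto
  hence "AE x in M. convergent (\<lambda>k. f (r k) x)"
  proof eventually_elim
    fix x assume "(\<Sum>k. ennreal (?D k x)) \<noteq> \<infinity>"
    hence "summable (\<lambda>k. ?D k x)" by (intro summable_suminf_not_top) auto
    hence "(\<lambda>k. ?D k x) \<longlonglongrightarrow> 0" by (rule summable_LIMSEQ_zero)
    hence "\<forall>\<^sub>F k in sequentially. ?D k x < 1" by (rule order_tendstoD) simp
    hence ev: "\<forall>\<^sub>F k in sequentially. norm (f (r (Suc k)) x - f (r k) x) \<le> (1/2)^k"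
    proof eventually_elim
      case (elim k)
      have "(2 powr real k * norm (f (r (Suc k)) x - f (r k) x)) powr p < 1"
        using elim by (simp add: powr_mult powr_powr)
      hence "2 powr real k * norm (f (r (Suc k)) x - f (r k) x) < 1"
        using p by (metis ge_one_powr_ge_zero less_le_not_le linorder_not_less)
      thus ?case by (simp add: powr_realpow power_one_over field_simps)
    qed
    have "summable (\<lambda>k. f (r (Suc k)) x - f (r k) x)"
      by (rule summable_comparison_test_ev[OF ev]) (simp add: summable_geometric)
    hence "convergent (\<lambda>n. \<Sum>k<n. f (r (Suc k)) x - f (r k) x)" by (simp add: summable_iff_convergent)
    hence "convergent (\<lambda>n. f (r n) x - f (r 0) x)" using sum_lessThan_telescope[of "\<lambda>k. f (r k) x"] by simp
    hence "convergent (\<lambda>n. (f (r n) x - f (r 0) x) + f (r 0) x)" by (rule convergent_add) (rule convergent_const)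
    thus "convergent (\<lambda>k. f (r k) x)" by simp
  qed
  hence AE: "AE x in M. (\<lambda>k. f (r k) x) \<longlonglongrightarrow> lim (\<lambda>k. f (r k) x)"
    by (simp add: convergent_LIMSEQ_iff)
  have mg: "(\<lambda>x. lim (\<lambda>k. f (r k) x)) \<in> borel_measurable M" by (rule borel_measurable_lim_metric) auto
  show ?thesis
  proof (rule bexI)
    show "(\<lambda>n. pmass M p (\<lambda>x. f n x - lim (\<lambda>k. f (r k) x))) \<longlonglongrightarrow> 0"
      by (rule pCauchy_AE_limit[OF m mg C rm AE p])
    show "(\<lambda>x. lim (\<lambda>k. f (r k) x)) \<in> borel_measurable M" by (rule mg)
  qed
qed

text \<open>The free parameter \<open>l\<close> weights the two summands against each other; the constants \<open>1/p\<close> and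
  \<open>1/p'\<close> are dropped.\<close>

lemma young_scaled:
  fixes a b :: real
  assumes "1 < p" "0 \<le> a" "0 \<le> b" "l > 0"
  shows "a * b \<le> l powr p * a powr p + (1/l) powr (p/(p-1)) * b powr (p/(p-1))"
proof -
  have "(l*a) * (b/l) \<le> (l*a) powr p / p + (b/l) powr (p/(p-1)) / (p/(p-1))"
    by (rule Youngs_inequality) (use assms in \<open>auto simp: field_simps\<close>)
  also have "\<dots> \<le> (l*a) powr p + (b/l) powr (p/(p-1))"
    using assms by (intro add_mono) (simp_all add: divide_le_eq mult_le_cancel_left1 mult_ge1_I mult_left_mono)
  finally show ?thesis using assms by (simp add: powr_mult powr_divide divide_simps)
qed

lemma integrable_mult_conjugate:
  fixes u f :: "'x \<Rightarrow> real"
  assumes [measurable]: "u \<in> borel_measurable M" "f \<in> borel_measurable M" and p: "1 < p"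
    and u: "integrable M (\<lambda>x. \<bar>u x\<bar> powr p)" and f: "integrable M (\<lambda>x. \<bar>f x\<bar> powr (p/(p-1)))"
  shows "integrable M (\<lambda>x. u x * f x)"
proof (rule Bochner_Integration.integrable_bound)
  show "integrable M (\<lambda>x. \<bar>u x\<bar> powr p + \<bar>f x\<bar> powr (p/(p-1)))" using u f by simp
  show "AE x in M. norm (u x * f x) \<le> norm (\<bar>u x\<bar> powr p + \<bar>f x\<bar> powr (p/(p-1)))"
    using young_scaled[OF p, of "\<bar>u x\<bar>" "\<bar>f x\<bar>" 1 for x] by (auto simp: abs_mult)
qed measurable

text \<open>In the scaled Young inequality, \<open>l\<close> is first chosen so that the summand with \<open>f\<close> is at most half
  of \<open>e\<close>, and then \<open>n\<close> so large that the summand with \<open>u n\<close> is small as well.\<close>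

lemma pairing_tendsto_0:
  fixes u :: "nat \<Rightarrow> 'x \<Rightarrow> real"
  assumes [measurable]: "\<And>n. u n \<in> borel_measurable M" "f \<in> borel_measurable M" and p: "1 < p"
    and u: "(\<lambda>n. pmass M p (u n)) \<longlonglongrightarrow> 0" and f: "integrable M (\<lambda>x. \<bar>f x\<bar> powr (p/(p-1)))"
  shows "(\<lambda>n. \<integral>x. u n x * f x \<partial>M) \<longlonglongrightarrow> 0"
proof (rule LIMSEQ_I)
  fix e :: real assume e: "e > 0"
  define F where "F = (\<integral>x. \<bar>f x\<bar> powr (p/(p-1)) \<partial>M)"
  have F: "F \<ge> 0" by (simp add: F_def)
  define c where "c = (e / (2 * (F + 1))) powr ((p-1)/p)"
  define l where "l = 1 / c"
  have c: "c > 0" using e F by (simp add: c_def)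
  have cp: "c powr (p/(p-1)) = e / (2 * (F+1))" using e F p by (simp add: c_def powr_powr)
  have l: "l > 0" using c by (simp add: l_def)
  define d where "d = e / (4 * l powr p)"
  have d: "d > 0" using e l by (simp add: d_def)
  have "\<forall>\<^sub>F n in sequentially. pmass M p (u n) < ennreal d"
    using u d by (intro order_tendstoD) auto
  then obtain N where N: "\<And>n. n \<ge> N \<Longrightarrow> pmass M p (u n) < ennreal d" unfolding eventually_sequentially by blast
  show "\<exists>N. \<forall>n\<ge>N. norm ((\<integral>x. u n x * f x \<partial>M) - 0) < e"
  proof (intro exI allI impI)
    fix n assume "n \<ge> N"
    hence m: "pmass M p (u n) < ennreal d" by (rule N)
    hence fin: "pmass M p (u n) < \<infinity>" by (simp add: order_less_trans)
    have int: "integrable M (\<lambda>x. \<bar>u n x\<bar> powr p)" using fin by (simp add: pmass_finite_iff[of "u n" M p, simplified])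
    have "ennreal (\<integral>x. \<bar>u n x\<bar> powr p \<partial>M) < ennreal d" using m pmass_eq_integral[of M "u n" p] int by simp
    hence U: "(\<integral>x. \<bar>u n x\<bar> powr p \<partial>M) < d" by (simp add: ennreal_less_iff)
    have "norm (\<integral>x. u n x * f x \<partial>M) \<le> (\<integral>x. l powr p * \<bar>u n x\<bar> powr p + (1/l) powr (p/(p-1)) * \<bar>f x\<bar> powr (p/(p-1)) \<partial>M)"
    proof -
      have "\<bar>u n x * f x\<bar> \<le> l powr p * \<bar>u n x\<bar> powr p + (1/l) powr (p/(p-1)) * \<bar>f x\<bar> powr (p/(p-1))" for x
        using young_scaled[OF p, of "\<bar>u n x\<bar>" "\<bar>f x\<bar>" l] l by (auto simp: abs_mult)
      thus ?thesis unfolding real_norm_def using int f by (intro abs_integral_le) auto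
    qed
    also have "\<dots> = l powr p * (\<integral>x. \<bar>u n x\<bar> powr p \<partial>M) + c powr (p/(p-1)) * F"
      using int f by (simp add: F_def l_def)
    also have "\<dots> \<le> l powr p * d + c powr (p/(p-1)) * F" using U by (intro add_mono mult_left_mono) auto
    also have "\<dots> < e"
    proof -
      have "l powr p * d = e / 4" using l by (simp add: d_def)
      moreover have "e / (2 * (F+1)) * F \<le> e / 2" using F e by (simp add: field_simps)
      ultimately show ?thesis using e cp by simp
    qed
    finally show "norm ((\<integral>x. u n x * f x \<partial>M) - 0) < e" by simp
  qed
qed

section \<open>Test functions\<close>

text \<open>The partial derivative in direction \<open>j\<close>; it is the function that occurs in the recursive
  definition of \<open>Ck\<close>.\<close>

definition pd :: "'a \<Rightarrow> ('a::euclidean_space \<Rightarrow> 'b::real_normed_vector) \<Rightarrow> 'a \<Rightarrow> 'b" where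
  "pd j f x = frechet_derivative f (at x) j"

lemma pd_eq: "(f has_derivative f') (at x) \<Longrightarrow> pd j f x = f' j"
  using frechet_derivative_at[of f f' x] by (simp add: pd_def)

lemma Ck_Suc_iff: "Ck (Suc k) f \<longleftrightarrow> (\<forall>x. f differentiable (at x)) \<and> (\<forall>j\<in>Basis. Ck k (pd j f))"
  by (simp add: pd_def[abs_def])

text \<open>From now on \<open>Ck\<close> is unfolded in terms of \<open>pd\<close>, by \<open>Ck_Suc_iff\<close>.\<close>

declare Ck.simps(2)[simp del]

lemma Ck_mono: "Ck (Suc k) f \<Longrightarrow> Ck k f"
proof (induction k arbitrary: f)
  case 0
  thus ?case by (auto simp: Ck_Suc_iff continuous_on_eq_continuous_at intro: differentiable_imp_continuous_within)
next
  case (Suc k)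
  thus ?case by (subst Ck_Suc_iff) (auto simp: Ck_Suc_iff[of "Suc k"])
qed

lemma Ck_const: "Ck k (\<lambda>x::'a::euclidean_space. c)"
proof (induction k arbitrary: c)
  case (Suc k)
  have "pd j (\<lambda>x::'a. c) = (\<lambda>x. 0)" for j by (auto simp: pd_def)
  with Suc show ?case by (auto simp: Ck_Suc_iff)
qed auto

lemma Ck_linear:
  assumes L: "bounded_linear L" shows "Ck k f \<Longrightarrow> Ck k (\<lambda>x. L (f x))"
proof (induction k arbitrary: f)
  case 0
  thus ?case using L by (simp add: bounded_linear.continuous_on)
next
  case (Suc k)
  have d: "((\<lambda>x. L (f x)) has_derivative (\<lambda>h. L (frechet_derivative f (at x) h))) (at x)" for x
    using Suc.prems by (intro bounded_linear.has_derivative[OF L]) (auto simp: Ck_Suc_iff frechet_derivative_works)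
  have "pd j (\<lambda>x. L (f x)) = (\<lambda>x. L (pd j f x))" for j
    using pd_eq[OF d] by (auto simp: pd_def)
  moreover have "(\<lambda>x. L (f x)) differentiable (at x)" for x using d[of x] by (auto simp: differentiable_def)
  ultimately show ?case using Suc by (auto simp: Ck_Suc_iff)
qed

lemma Ck_add: "Ck k f \<Longrightarrow> Ck k g \<Longrightarrow> Ck k (\<lambda>x. f x + g x)"
proof (induction k arbitrary: f g)
  case 0 thus ?case by (simp add: continuous_on_add)
next
  case (Suc k)
  have d: "((\<lambda>x. f x + g x) has_derivative (\<lambda>h. frechet_derivative f (at x) h + frechet_derivative g (at x) h)) (at x)" for x
    using Suc.prems by (intro has_derivative_add) (auto simp: Ck_Suc_iff frechet_derivative_works)
  have "pd j (\<lambda>x. f x + g x) = (\<lambda>x. pd j f x + pd j g x)" for j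
    using pd_eq[OF d] by (auto simp: pd_def)
  moreover have "(\<lambda>x. f x + g x) differentiable (at x)" for x using d[of x] by (auto simp: differentiable_def)
  ultimately show ?case using Suc by (auto simp: Ck_Suc_iff)
qed

lemma Ck_diff: "Ck k f \<Longrightarrow> Ck k g \<Longrightarrow> Ck k (\<lambda>x. f x - g x)"
  using Ck_add[OF _ Ck_linear[OF bounded_linear_minus[OF bounded_linear_ident]], of k f g] by simp

lemma Ck_mult:
  fixes f g :: "'a::euclidean_space \<Rightarrow> real"
  shows "Ck k f \<Longrightarrow> Ck k g \<Longrightarrow> Ck k (\<lambda>x. f x * g x)"
proof (induction k arbitrary: f g)
  case 0 thus ?case by (simp add: continuous_on_mult)
next
  case (Suc k)
  have d: "((\<lambda>x. f x * g x) has_derivative (\<lambda>h. f x * frechet_derivative g (at x) h + frechet_derivative f (at x) h * g x)) (at x)" for x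
    using Suc.prems by (intro has_derivative_mult) (auto simp: Ck_Suc_iff frechet_derivative_works)
  have "pd j (\<lambda>x. f x * g x) = (\<lambda>x. f x * pd j g x + pd j f x * g x)" for j
    using pd_eq[OF d] by (auto simp: pd_def)
  moreover have "(\<lambda>x. f x * g x) differentiable (at x)" for x using d[of x] by (auto simp: differentiable_def)
  moreover have "Ck k f" "Ck k g" using Suc.prems by (auto intro: Ck_mono)
  moreover have "Ck k (pd j f)" "Ck k (pd j g)" if "j \<in> Basis" for j using Suc.prems that by (auto simp: Ck_Suc_iff)
  ultimately show ?case unfolding Ck_Suc_iff by (auto intro!: Ck_add Suc.IH)
qed

lemma Ck_prod:
  fixes f :: "'i \<Rightarrow> 'a::euclidean_space \<Rightarrow> real"
  shows "finite A \<Longrightarrow> (\<And>i. i \<in> A \<Longrightarrow> Ck k (f i)) \<Longrightarrow> Ck k (\<lambda>x. \<Prod>i\<in>A. f i x)"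
  by (induction A rule: finite_induct) (auto intro: Ck_const Ck_mult)

text \<open>A class of smooth functions of one variable, here any set closed under differentiation, becomes
  smooth on the whole space after composition with an affine function of one coordinate.\<close>

lemma Ck_affine:
  fixes F :: "(real \<Rightarrow> real) set" and j :: "'a::euclidean_space"
  assumes F: "\<And>f. f \<in> F \<Longrightarrow> \<exists>f'\<in>F. \<forall>x. (f has_field_derivative f' x) (at x)"
  shows "f \<in> F \<Longrightarrow> Ck k (\<lambda>x. f (c * (x \<bullet> j) + a))"
proof (induction k arbitrary: f)
  case 0
  then obtain f' where f': "\<And>x. (f has_field_derivative f' x) (at x)" using F by blast
  have "continuous_on UNIV f" using f' by (meson DERIV_isCont continuous_at_imp_continuous_on)
  thus ?case by (auto intro!: continuous_on_compose2[of UNIV f] continuous_intros)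
next
  case (Suc k)
  then obtain f' where f': "f' \<in> F" "\<And>x. (f has_field_derivative f' x) (at x)" using F by blast
  have d: "((\<lambda>x. f (c * (x \<bullet> j) + a)) has_derivative (\<lambda>h. (c * (h \<bullet> j)) * f' (c * (x \<bullet> j) + a))) (at x)" for x
    by (rule DERIV_compose_FDERIV[OF f'(2)]) (auto intro!: derivative_eq_intros)
  have "pd i (\<lambda>x. f (c * (x \<bullet> j) + a)) = (\<lambda>x. (c * (i \<bullet> j)) * f' (c * (x \<bullet> j) + a))" for i
    using pd_eq[OF d] by auto
  moreover have "(\<lambda>x. f (c * (x \<bullet> j) + a)) differentiable (at x)" for x using d[of x] by (auto simp: differentiable_def)
  moreover have "Ck k (\<lambda>x. (c * (i \<bullet> j)) * f' (c * (x \<bullet> j) + a))" for i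
    by (rule Ck_linear[OF bounded_linear_mult_right Suc.IH[OF f'(1)]])
  ultimately show ?case by (auto simp: Ck_Suc_iff)
qed

section \<open>The fundamental lemma of the calculus of variations\<close>

lemma poly_exp_tendsto_0: "((\<lambda>y. poly P y * exp (- y)) \<longlongrightarrow> (0::real)) at_top"
proof -
  have "((\<lambda>y. \<Sum>i\<le>degree P. coeff P i * (y ^ i / exp y)) \<longlongrightarrow> (\<Sum>i\<le>degree P. coeff P i * 0)) at_top"
    by (intro tendsto_intros tendsto_power_div_exp_0)
  thus ?thesis by (simp add: poly_altdef sum_distrib_right exp_minus divide_inverse mult.assoc)
qed

text \<open>The functions \<open>P(1/x) exp(-1/x)\<close>, extended by zero to the left, for all polynomials \<open>P\<close>.
  Together they form a set closed under differentiation, whence their smoothness; \<open>flat_fun 1\<close>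
  is the usual building block of bump functions.\<close>

definition flat_fun :: "real poly \<Rightarrow> real \<Rightarrow> real" where
  "flat_fun P x = (if x > 0 then poly P (1/x) * exp (- (1/x)) else 0)"

lemma flat_fun_deriv: "(flat_fun P has_field_derivative flat_fun ([:0,0,1:] * (P - pderiv P)) x) (at x)"
proof -
  consider "x > 0" | "x < 0" | "x = 0" by linarith
  thus ?thesis
  proof cases
    case 1
    have "((\<lambda>x. poly P (1/x) * exp (- (1/x))) has_field_derivative flat_fun ([:0,0,1:] * (P - pderiv P)) x) (at x)"
      using 1 by (auto intro!: derivative_eq_intros simp: flat_fun_def field_simps power2_eq_square)
    thus ?thesis
      by (rule has_field_derivative_transform_within_open[where S="{0<..}"]) (use 1 in \<open>auto simp: flat_fun_def\<close>)
  next
    case 2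
    have "((\<lambda>x. 0) has_field_derivative flat_fun ([:0,0,1:] * (P - pderiv P)) x) (at x)"
      using 2 by (auto simp: flat_fun_def)
    thus ?thesis
      by (rule has_field_derivative_transform_within_open[where S="{..<0}"]) (use 2 in \<open>auto simp: flat_fun_def\<close>)
  next
    case 3
    have "((\<lambda>h. flat_fun P h / h) \<longlongrightarrow> 0) (at 0)"
    proof (rule filterlim_split_at)
      show "((\<lambda>h. flat_fun P h / h) \<longlongrightarrow> 0) (at_left 0)"
        by (rule tendsto_eventually) (auto simp: eventually_at_filter flat_fun_def)
      have "((\<lambda>h. poly (pCons 0 P) (inverse h) * exp (- inverse h)) \<longlongrightarrow> 0) (at_right 0)"
        by (rule filterlim_compose[OF poly_exp_tendsto_0 filterlim_inverse_at_top_right])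
      thus "((\<lambda>h. flat_fun P h / h) \<longlongrightarrow> 0) (at_right 0)"
        by (rule Lim_transform_eventually) (auto simp: eventually_at_filter flat_fun_def field_simps)
    qed
    thus ?thesis using 3 by (simp add: DERIV_def flat_fun_def)
  qed
qed

text \<open>Both factors of each coordinate have the form \<open>c * (x \<bullet> j) + a\<close> required by \<open>Ck_affine\<close>. As \<open>n\<close>
  grows, the bumps increase to the indicator function of the open box.\<close>

definition box_bump :: "nat \<Rightarrow> 'a::euclidean_space \<Rightarrow> 'a \<Rightarrow> 'a \<Rightarrow> real" where
  "box_bump n a b x = (\<Prod>j\<in>Basis. flat_fun 1 (real n * (x \<bullet> j) + - (real n * (a \<bullet> j))) * flat_fun 1 (- real n * (x \<bullet> j) + real n * (b \<bullet> j)))"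

lemma Ck_flat_fun: "Ck k (\<lambda>x. flat_fun P (c * (x \<bullet> j) + a))"
proof (rule Ck_affine[where F="range flat_fun"])
  fix f assume "f \<in> range flat_fun"
  then obtain P where P: "f = flat_fun P" by auto
  show "\<exists>f'\<in>range flat_fun. \<forall>x. (f has_real_derivative f' x) (at x)"
    unfolding P by (rule bexI[where x="flat_fun ([:0,0,1:] * (P - pderiv P))"]) (use flat_fun_deriv[of P] in auto)
qed auto

lemma Ck_box_bump: "Ck k (box_bump n a b)"
  unfolding box_bump_def[abs_def] by (intro Ck_prod Ck_mult Ck_flat_fun) auto

lemma flat_fun_1_bounds: "0 \<le> flat_fun 1 x" "flat_fun 1 x \<le> 1" "x \<le> 0 \<Longrightarrow> flat_fun 1 x = 0"
  by (auto simp: flat_fun_def)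

lemma box_bump_outside:
  assumes "x \<notin> box a b" shows "box_bump n a b x = 0"
proof -
  obtain j where j: "j \<in> Basis" "\<not> (a \<bullet> j < x \<bullet> j \<and> x \<bullet> j < b \<bullet> j)" using assms by (auto simp: mem_box)
  have "flat_fun 1 (real n * (x \<bullet> j) + - (real n * (a \<bullet> j))) * flat_fun 1 (- real n * (x \<bullet> j) + real n * (b \<bullet> j)) = 0"
  proof (cases "a \<bullet> j < x \<bullet> j")
    case True
    hence "- real n * (x \<bullet> j) + real n * (b \<bullet> j) \<le> 0" using j by (simp add: mult_left_mono)
    thus ?thesis by (simp add: flat_fun_1_bounds)
  next
    case False
    hence "real n * (x \<bullet> j) + - (real n * (a \<bullet> j)) \<le> 0" using j by (simp add: mult_left_mono)
    thus ?thesis by (simp add: flat_fun_1_bounds)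
  qed
  thus ?thesis unfolding box_bump_def using j by (auto simp: prod_zero_iff)
qed

lemma box_bump_bounds: "0 \<le> box_bump n a b x" "box_bump n a b x \<le> 1"
  unfolding box_bump_def by (auto intro!: prod_nonneg prod_le_1 mult_le_one simp: flat_fun_1_bounds)

lemma flat_fun_tendsto: "c > 0 \<Longrightarrow> (\<lambda>n. flat_fun 1 (real n * c)) \<longlonglongrightarrow> 1"
proof -
  assume c: "c > 0"
  have "(\<lambda>n. exp (- ((1/c) * inverse (real n)))) \<longlonglongrightarrow> exp (- ((1/c) * 0))"
    by (intro tendsto_intros lim_inverse_n)
  hence "(\<lambda>n. exp (- ((1/c) * inverse (real n)))) \<longlonglongrightarrow> 1" by simp
  thus ?thesis
    by (rule Lim_transform_eventually) (use c in \<open>auto intro!: eventually_sequentiallyI[of 1] simp: flat_fun_def field_simps\<close>)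
qed

lemma box_bump_tendsto: "(\<lambda>n. box_bump n a b x) \<longlonglongrightarrow> indicator (box a b) x"
proof (cases "x \<in> box a b")
  case True
  have "(\<lambda>n. box_bump n a b x) \<longlonglongrightarrow> (\<Prod>j\<in>(Basis::'a set). 1 * 1)"
    unfolding box_bump_def
  proof (intro tendsto_prod tendsto_mult)
    fix j :: 'a assume j: "j \<in> Basis"
    show "(\<lambda>n. flat_fun 1 (real n * (x \<bullet> j) + - (real n * (a \<bullet> j)))) \<longlonglongrightarrow> 1"
      using flat_fun_tendsto[of "x \<bullet> j - a \<bullet> j"] True j by (simp add: algebra_simps mem_box)
    show "(\<lambda>n. flat_fun 1 (- real n * (x \<bullet> j) + real n * (b \<bullet> j))) \<longlonglongrightarrow> 1"
      using flat_fun_tendsto[of "b \<bullet> j - x \<bullet> j"] True j by (simp add: algebra_simps mem_box)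
  qed
  thus ?thesis using True by simp
next
  case False
  thus ?thesis by (simp add: box_bump_outside)
qed

lemma box_bump_vec_test: "(\<lambda>x. box_bump n a b x *\<^sub>R (v::'b::real_normed_vector)) \<in> Cc_inf UNIV"
proof -
  have "{x. box_bump n a b x *\<^sub>R v \<noteq> 0} \<subseteq> cbox a b"
    using box_bump_outside box_subset_cbox by fastforce
  hence "closure {x. box_bump n a b x *\<^sub>R v \<noteq> 0} \<subseteq> cbox a b"
    by (intro closure_minimal) auto
  hence "compact (closure {x. box_bump n a b x *\<^sub>R v \<noteq> 0})"
    by (metis bounded_cbox bounded_subset closed_closure compact_eq_bounded_closed)
  thus ?thesis unfolding Cc_inf_def smooth_def
    by (auto intro: Ck_linear[OF bounded_linear_scaleR_left Ck_box_bump])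
qed

lemma box_bump_borel[measurable]: "box_bump n a b \<in> borel_measurable borel"
  using Ck_box_bump[of 0 n a b] by (auto intro: borel_measurable_continuous_onI)

text \<open>Boxes form an intersection-stable generator of the Borel sets, so the measures with densities
  \<open>g\<^sup>+\<close> and \<open>g\<^sup>-\<close>, which agree on boxes, are equal; hence their densities agree almost
  everywhere.\<close>

lemma AE_zero_if_box_integrals_zero:
  fixes g :: "'a::euclidean_space \<Rightarrow> real"
  assumes m: "g \<in> borel_measurable lebesgue"
    and int: "\<And>a b. set_integrable lebesgue (box a b) g"
    and zero: "\<And>a b. (LINT x:box a b|lebesgue. g x) = 0"
  shows "AE x in lebesgue. g x = 0"
proof -
  note [measurable] = m
  obtain g' where g'[measurable]: "g' \<in> borel_measurable lborel" and AE: "AE x in lborel. g x = g' x"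
    using completion_ex_borel_measurable_real[OF m] by blast
  hence AE': "AE x in lebesgue. g x = g' x" by (intro AE_completion)
  have [measurable]: "g' \<in> borel_measurable lebesgue" using g' by (rule measurable_completion)
  have eqn: "(\<integral>\<^sup>+x. ennreal (g' x) * indicator (box a b) x \<partial>lborel) = (\<integral>\<^sup>+x. ennreal (- g' x) * indicator (box a b) x \<partial>lborel)
    \<and> (\<integral>\<^sup>+x. ennreal (g' x) * indicator (box a b) x \<partial>lborel) \<noteq> \<infinity>" for a b
  proof -
    let ?h = "\<lambda>x. indicator (box a b) x * g' x"
    have "integrable lebesgue (\<lambda>x. indicator (box a b) x * g x)" using int[of a b] by (simp add: set_integrable_def)
    moreover have "integrable lebesgue (\<lambda>x. indicator (box a b) x * g x) \<longleftrightarrow> integrable lebesgue ?h"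
      by (intro integrable_cong_AE) (use AE' in \<open>auto intro!: borel_measurable_times borel_measurable_indicator\<close>)
    ultimately have i: "integrable lborel ?h" by (simp add: integrable_completion)
    have "(\<integral>x. indicator (box a b) x * g x \<partial>lebesgue) = (\<integral>x. ?h x \<partial>lebesgue)"
      by (intro integral_cong_AE) (use AE' in \<open>auto intro!: borel_measurable_times borel_measurable_indicator\<close>)
    hence "(\<integral>x. ?h x \<partial>lborel) = 0"
      using zero[of a b] by (simp add: set_lebesgue_integral_def integral_completion)
    hence z: "enn2real (\<integral>\<^sup>+x. ennreal (?h x) \<partial>lborel) = enn2real (\<integral>\<^sup>+x. ennreal (- ?h x) \<partial>lborel)"
      using real_lebesgue_integral_def[OF i] by simp
    have f: "(\<integral>\<^sup>+x. ennreal (?h x) \<partial>lborel) \<noteq> \<infinity>" "(\<integral>\<^sup>+x. ennreal (- ?h x) \<partial>lborel) \<noteq> \<infinity>"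
      using i by (auto simp: real_integrable_def)
    have e: "ennreal (?h x) = ennreal (g' x) * indicator (box a b) x" "ennreal (- ?h x) = ennreal (- g' x) * indicator (box a b) x" for x
      by (auto simp: indicator_def)
    have "(\<integral>\<^sup>+x. ennreal (?h x) \<partial>lborel) = (\<integral>\<^sup>+x. ennreal (- ?h x) \<partial>lborel)"
      using arg_cong[OF z, of ennreal] f by (simp only: ennreal_enn2real less_top infinity_ennreal_def)
    thus ?thesis using f(1) unfolding e by simp
  qed
  have "density lborel (\<lambda>x. ennreal (g' x)) = density lborel (\<lambda>x. ennreal (- g' x))"
  proof (rule measure_eqI_generator_eq)
    let ?E = "range (\<lambda>(a, b). box a b::'a set)"
    show "Int_stable ?E"
      by (auto simp: Int_stable_def box_Int_box)
    show "?E \<subseteq> Pow UNIV" "sets (density lborel (\<lambda>x. ennreal (g' x))) = sigma_sets UNIV ?E"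
      "sets (density lborel (\<lambda>x. ennreal (- g' x))) = sigma_sets UNIV ?E"
      by (simp_all add: borel_eq_box)
    let ?A = "\<lambda>n::nat. box (- (real n *\<^sub>R One)) (real n *\<^sub>R One) :: 'a set"
    show "range ?A \<subseteq> ?E" "(\<Union>i. ?A i) = UNIV"
      unfolding UN_box_eq_UNIV by auto
    show "emeasure (density lborel (\<lambda>x. ennreal (g' x))) (?A i) \<noteq> \<infinity>" for i
      using eqn[of "- (real i *\<^sub>R One)" "real i *\<^sub>R One"] by (auto simp add: emeasure_density)
    show "emeasure (density lborel (\<lambda>x. ennreal (g' x))) X = emeasure (density lborel (\<lambda>x. ennreal (- g' x))) X" if X: "X \<in> ?E" for X
    proof -
      obtain a b where "X = box a b" using X by auto
      thus ?thesis using eqn[of a b] by (simp add: emeasure_density)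
    qed
  qed
  hence "AE x in lborel. ennreal (g' x) = ennreal (- g' x)"
    by (subst (asm) sigma_finite_measure.density_unique_iff[OF sigma_finite_lborel]) auto
  hence "AE x in lborel. g x = 0" using AE
  proof eventually_elim
    fix x assume "ennreal (g' x) = ennreal (- g' x)" "g x = g' x"
    thus "g x = 0" by (cases "g' x \<ge> 0") (auto simp: ennreal_neg dest: sym)
  qed
  thus ?thesis by (rule AE_completion)
qed

text \<open>The fundamental lemma of the calculus of variations. Testing with \<open>box_bump n a b\<close> times a basis
  vector and letting \<open>n\<close> tend to infinity shows that every component of \<open>G\<close> has vanishing
  integral over every box.\<close>

lemma AE_zero_if_orthogonal_to_tests:
  fixes G :: "'a::euclidean_space \<Rightarrow> 'a"
  assumes G: "G \<in> L1_loc" and zero: "\<And>\<Phi>. \<Phi> \<in> Cc_inf UNIV \<Longrightarrow> (LINT x|lebesgue. G x \<bullet> \<Phi> x) = 0"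
  shows "AE x in lebesgue. G x = 0"
proof -
  have Gm[measurable]: "G \<in> borel_measurable lebesgue" using G by (simp add: L1_loc_def)
  have "AE x in lebesgue. G x \<bullet> j = 0" if j: "j \<in> Basis" for j
  proof (rule AE_zero_if_box_integrals_zero)
    show gm: "(\<lambda>x. G x \<bullet> j) \<in> borel_measurable lebesgue" using Gm by measurable
    fix a b :: 'a
    have "set_integrable lebesgue (cbox a b) G" using G by (simp add: L1_loc_def)
    hence "set_integrable lebesgue (box a b) G"
      by (rule set_integrable_subset) (auto simp: box_subset_cbox)
    hence "integrable lebesgue (\<lambda>x. (indicator (box a b) x *\<^sub>R G x) \<bullet> j)" unfolding set_integrable_def by (intro integrable_inner_left)
    thus int: "set_integrable lebesgue (box a b) (\<lambda>x. G x \<bullet> j)" by (simp add: set_integrable_def)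
    have "(\<lambda>n. LINT x|lebesgue. box_bump n a b x * (G x \<bullet> j)) \<longlonglongrightarrow> (LINT x|lebesgue. indicator (box a b) x * (G x \<bullet> j))"
    proof (rule integral_dominated_convergence[where w="\<lambda>x. \<bar>indicator (box a b) x * (G x \<bullet> j)\<bar>"])
      show "integrable lebesgue (\<lambda>x. \<bar>indicator (box a b) x * (G x \<bullet> j)\<bar>)" using int by (simp add: set_integrable_def)
      show "AE x in lebesgue. (\<lambda>n. box_bump n a b x * (G x \<bullet> j)) \<longlonglongrightarrow> indicator (box a b) x * (G x \<bullet> j)"
        by (intro AE_I2 tendsto_mult box_bump_tendsto tendsto_const)
      show "AE x in lebesgue. norm (box_bump n a b x * (G x \<bullet> j)) \<le> \<bar>indicator (box a b) x * (G x \<bullet> j)\<bar>" for n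
      proof (rule AE_I2)
        fix x show "norm (box_bump n a b x * (G x \<bullet> j)) \<le> \<bar>indicator (box a b) x * (G x \<bullet> j)\<bar>"
          using box_bump_bounds[of n a b x] box_bump_outside[of x a b n]
          by (auto simp: abs_mult indicator_def intro: mult_left_le_one_le)
      qed
    next
      have [measurable]: "box_bump n a b \<in> borel_measurable lebesgue" for n by (rule measurable_completion) simp
      show "(\<lambda>x. box_bump n a b x * (G x \<bullet> j)) \<in> borel_measurable lebesgue" for n using gm by measurable
      show "(\<lambda>x. indicator (box a b) x * (G x \<bullet> j)) \<in> borel_measurable lebesgue"
        using gm by (intro borel_measurable_times borel_measurable_indicator) auto
    qed
    moreover have "(LINT x|lebesgue. box_bump n a b x * (G x \<bullet> j)) = 0" for n
      using zero[OF box_bump_vec_test[of n a b j]] by simp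
    ultimately have "(LINT x|lebesgue. indicator (box a b) x * (G x \<bullet> j)) = 0"
      by (simp add: LIMSEQ_const_iff)
    thus "(LINT x:box a b|lebesgue. G x \<bullet> j) = 0" by (simp add: set_lebesgue_integral_def)
  qed
  hence "AE x in lebesgue. \<forall>j\<in>Basis. G x \<bullet> j = 0" by (intro AE_finite_allI) auto
  thus ?thesis by eventually_elim (auto intro: euclidean_eqI)
qed

section \<open>Calculus of test functions\<close>

lemma compact_subset: "compact T \<Longrightarrow> closure A \<subseteq> T \<Longrightarrow> compact (closure A)"
  for T :: "'a::euclidean_space set"
  by (metis closed_closure compact_Int_closed inf.absorb_iff2)

lemma test_diff:
  assumes "f \<in> Cc_inf S" "g \<in> Cc_inf S" shows "(\<lambda>x. f x - g x) \<in> Cc_inf S"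
proof -
  have "closure {x. f x - g x \<noteq> 0} \<subseteq> closure ({x. f x \<noteq> 0} \<union> {x. g x \<noteq> 0})"
    by (rule closure_mono) auto
  hence *: "closure {x. f x - g x \<noteq> 0} \<subseteq> closure {x. f x \<noteq> 0} \<union> closure {x. g x \<noteq> 0}" by (simp add: closure_Un)
  have "compact (closure {x. f x \<noteq> 0} \<union> closure {x. g x \<noteq> 0})" using assms by (auto simp: Cc_inf_def compact_Un)
  hence "compact (closure {x. f x - g x \<noteq> 0})"
    by (rule compact_subset) (rule *)
  thus ?thesis using assms * unfolding Cc_inf_def smooth_def by (auto intro: Ck_diff)
qed

lemma test_linear:
  assumes "f \<in> Cc_inf S" and L: "bounded_linear L" shows "(\<lambda>x. L (f x)) \<in> Cc_inf S"
proof -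
  have "L 0 = 0" using L by (simp add: linear_0 bounded_linear.linear)
  hence "closure {x. L (f x) \<noteq> 0} \<subseteq> closure {x. f x \<noteq> 0}" by (intro closure_mono) auto
  thus ?thesis using assms unfolding Cc_inf_def smooth_def
    by (auto intro: Ck_linear compact_subset simp del: compact_closure)
qed

lemma test_UNIV: "f \<in> Cc_inf S \<Longrightarrow> f \<in> Cc_inf UNIV"
  by (auto simp: Cc_inf_def)

lemma test_differentiable: "f \<in> Cc_inf S \<Longrightarrow> f differentiable (at x)"
  by (auto simp: Cc_inf_def smooth_def Ck_Suc_iff dest: spec[of _ "Suc 0"])

lemma test_pd:
  assumes f: "f \<in> Cc_inf S" and j: "j \<in> Basis" shows "pd j f \<in> Cc_inf S"
proof -
  have "pd j f x = 0" if "x \<notin> closure {x. f x \<noteq> 0}" for x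
  proof -
    have "((\<lambda>x. 0) has_derivative (\<lambda>h. 0)) (at x)" by simp
    hence "(f has_derivative (\<lambda>h. 0)) (at x)"
      by (rule has_derivative_transform_within_open[where s="- closure {x. f x \<noteq> 0}"])
         (use that closure_subset[of "{x. f x \<noteq> 0}"] in auto)
    thus ?thesis by (simp add: pd_eq)
  qed
  hence "{x. pd j f x \<noteq> 0} \<subseteq> closure {x. f x \<noteq> 0}" by auto
  hence *: "closure {x. pd j f x \<noteq> 0} \<subseteq> closure {x. f x \<noteq> 0}" by (simp add: closure_minimal)
  have "Ck k (pd j f)" for k
    using f j by (auto simp: Cc_inf_def smooth_def Ck_Suc_iff dest: spec[of _ "Suc k"])
  thus ?thesis using f * unfolding Cc_inf_def smooth_def by (auto intro: compact_subset simp del: compact_closure)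
qed

lemma test_continuous: "f \<in> Cc_inf S \<Longrightarrow> continuous_on UNIV f"
  unfolding Cc_inf_def smooth_def by (auto dest: spec[of _ 0])

lemma test_borel: "f \<in> Cc_inf S \<Longrightarrow> f \<in> borel_measurable borel"
  by (intro borel_measurable_continuous_onI test_continuous)

lemma test_support:
  assumes "f \<in> Cc_inf S" shows "\<exists>R>0. \<forall>x. norm x > R \<longrightarrow> f x = 0"
proof -
  have "bounded (closure {x. f x \<noteq> 0})" using assms by (auto simp: Cc_inf_def compact_imp_bounded)
  then obtain R where R: "R > 0" "\<And>x. x \<in> closure {x. f x \<noteq> 0} \<Longrightarrow> norm x \<le> R" by (auto simp: bounded_pos)
  thus ?thesis using closure_subset[of "{x. f x \<noteq> 0}"] by (intro exI[of _ R]) force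
qed

lemma test_pd_support:
  assumes R: "\<And>x. norm x > R \<Longrightarrow> f x = 0" and x: "norm x > R" shows "pd j f x = 0"
proof -
  have "((\<lambda>x. 0) has_derivative (\<lambda>h. 0)) (at x)" by simp
  hence "(f has_derivative (\<lambda>h. 0)) (at x)"
    by (rule has_derivative_transform_within_open[where s="{x. norm x > R}"])
       (use R x in \<open>auto intro!: open_Collect_less continuous_intros\<close>)
  thus ?thesis by (simp add: pd_eq)
qed

lemma test_outside: "f \<in> Cc_inf S \<Longrightarrow> x \<notin> S \<Longrightarrow> f x = 0"
  using closure_subset[of "{x. f x \<noteq> 0}"] by (auto simp: Cc_inf_def)

lemma test_bounded:
  assumes f: "f \<in> Cc_inf S" shows "\<exists>K>0. \<forall>x. norm (f x) \<le> K"
proof -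
  have "compact (f ` closure {x. f x \<noteq> 0})"
    using f by (intro compact_continuous_image continuous_on_subset[OF test_continuous[OF f]]) (auto simp: Cc_inf_def)
  then obtain K where K: "K > 0" "\<And>x. x \<in> closure {x. f x \<noteq> 0} \<Longrightarrow> norm (f x) \<le> K"
    by (auto simp: bounded_pos dest!: compact_imp_bounded)
  have "norm (f x) \<le> K" for x
  proof (cases "f x = 0")
    case False
    hence "x \<in> closure {x. f x \<noteq> 0}" using closure_subset[of "{x. f x \<noteq> 0}"] by auto
    thus ?thesis by (rule K)
  qed (use K in simp)
  thus ?thesis using K by blast
qed

lemma test_integrable:
  fixes f :: "'a::euclidean_space \<Rightarrow> real"
  assumes f: "f \<in> Cc_inf S" shows "integrable lborel f"
proof -
  obtain K where K: "K > 0" "\<And>x. norm (f x) \<le> K" using test_bounded[OF f] by blast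
  obtain R where R: "R > 0" "\<And>x. norm x > R \<Longrightarrow> f x = 0" using test_support[OF f] by blast
  show ?thesis by (rule integrable_bounded_support[OF test_borel[OF f], of K R]) (use K R in auto)
qed

lemma test_has_derivative:
  fixes f :: "'a::euclidean_space \<Rightarrow> real"
  assumes f: "f \<in> Cc_inf S" shows "(f has_derivative (\<lambda>h. \<Sum>j\<in>Basis. (h \<bullet> j) * pd j f x)) (at x)"
proof -
  have d: "(f has_derivative frechet_derivative f (at x)) (at x)"
    using test_differentiable[OF f] by (simp add: frechet_derivative_works)
  hence l: "linear (frechet_derivative f (at x))" by (rule has_derivative_linear)
  have "frechet_derivative f (at x) h = (\<Sum>j\<in>Basis. (h \<bullet> j) * pd j f x)" for h
    using linear_sum[OF l, of "\<lambda>j. (h \<bullet> j) *\<^sub>R j" Basis]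
    by (simp add: euclidean_representation linear_scale[OF l] pd_def)
  hence "frechet_derivative f (at x) = (\<lambda>h. \<Sum>j\<in>Basis. (h \<bullet> j) * pd j f x)" by (rule ext)
  with d show ?thesis by simp
qed

lemma test_dir_deriv:
  fixes f :: "'a::euclidean_space \<Rightarrow> real"
  assumes f: "f \<in> Cc_inf S" and j: "j \<in> Basis"
  shows "((\<lambda>t. f (y + t *\<^sub>R j)) has_real_derivative pd j f y) (at 0)"
proof -
  have "((\<lambda>t. f (y + t *\<^sub>R j)) has_derivative (\<lambda>h. \<Sum>i\<in>Basis. ((h *\<^sub>R j) \<bullet> i) * pd i f (y + 0 *\<^sub>R j))) (at 0)"
    by (rule has_derivative_compose[OF _ test_has_derivative[OF f]]) (auto intro!: derivative_eq_intros)
  moreover have "(\<Sum>i\<in>Basis. ((h *\<^sub>R j) \<bullet> i) * pd i f (y + 0 *\<^sub>R j)) = pd j f y * h" for h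
  proof -
    have "(\<Sum>i\<in>Basis. ((h *\<^sub>R j) \<bullet> i) * pd i f (y + 0 *\<^sub>R j)) = (\<Sum>i\<in>Basis. if i = j then h * pd i f y else 0)"
      using j by (intro sum.cong) (auto simp: inner_Basis)
    thus ?thesis using j by simp
  qed
  ultimately show ?thesis by (simp add: has_field_derivative_def)
qed

lemma test_Lipschitz:
  fixes f :: "'a::euclidean_space \<Rightarrow> real"
  assumes f: "f \<in> Cc_inf S" shows "\<exists>L>0. \<forall>x y. \<bar>f x - f y\<bar> \<le> L * norm (x - y)"
proof -
  have "\<forall>j\<in>Basis. \<exists>K>0. \<forall>x. norm (pd j f x) \<le> K" by (intro ballI test_bounded[OF test_pd[OF f]])
  then obtain K where K: "\<And>j. j \<in> Basis \<Longrightarrow> K j > 0" "\<And>j x. j \<in> Basis \<Longrightarrow> norm (pd j f x) \<le> K j" by metis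
  define L where "L = (\<Sum>j\<in>(Basis::'a set). K j)"
  have L: "L > 0" unfolding L_def using K by (intro sum_pos) auto
  have "norm (f x - f y) \<le> L * norm (x - y)" for x y
  proof (rule differentiable_bound[OF convex_UNIV])
    show "(f has_derivative (\<lambda>h. \<Sum>j\<in>Basis. (h \<bullet> j) * pd j f x)) (at x within UNIV)" for x
      by (rule test_has_derivative[OF f])
    show "onorm (\<lambda>h. \<Sum>j\<in>Basis. (h \<bullet> j) * pd j f x) \<le> L" for x
    proof (rule onorm_le)
      fix h
      have "norm (\<Sum>j\<in>Basis. (h \<bullet> j) * pd j f x) \<le> (\<Sum>j\<in>Basis. norm h * K j)"
        using K by (intro sum_norm_le) (auto simp: abs_mult intro!: mult_mono Basis_le_norm)
      thus "norm (\<Sum>j\<in>Basis. (h \<bullet> j) * pd j f x) \<le> L * norm h" by (simp add: L_def sum_distrib_left mult.commute)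
    qed
  qed auto
  with L show ?thesis by auto
qed

text \<open>Componentwise Lipschitz derivatives give a second-order remainder, uniformly in \<open>x\<close>. The
  uniformity is what allows differentiation under the convolution with a singular kernel.\<close>

lemma test_taylor:
  fixes f :: "'a::euclidean_space \<Rightarrow> real"
  assumes f: "f \<in> Cc_inf S"
  shows "\<exists>L>0. \<forall>x h. \<bar>f (x + h) - f x - (\<Sum>j\<in>Basis. (h \<bullet> j) * pd j f x)\<bar> \<le> L * norm h ^ 2"
proof -
  have "\<forall>j\<in>Basis. \<exists>K>0. \<forall>x y. \<bar>pd j f x - pd j f y\<bar> \<le> K * norm (x - y)" by (intro ballI test_Lipschitz[OF test_pd[OF f]])
  then obtain K where K: "\<And>j. j \<in> Basis \<Longrightarrow> K j > 0" "\<And>j x y. j \<in> Basis \<Longrightarrow> \<bar>pd j f x - pd j f y\<bar> \<le> K j * norm (x - y)" by metis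
  define L where "L = (\<Sum>j\<in>(Basis::'a set). K j)"
  have L: "L > 0" unfolding L_def using K by (intro sum_pos) auto
  have "\<bar>f (x + h) - f x - (\<Sum>j\<in>Basis. (h \<bullet> j) * pd j f x)\<bar> \<le> L * norm h ^ 2" for x h
  proof -
    define F where "F y = f y - (\<Sum>j\<in>Basis. (y \<bullet> j) * pd j f x)" for y
    have "norm (F (x + h) - F x) \<le> (L * norm h) * norm (x + h - x)"
    proof (rule differentiable_bound[of "cball x (norm h)"])
      show "(F has_derivative (\<lambda>k. \<Sum>j\<in>Basis. (k \<bullet> j) * (pd j f y - pd j f x))) (at y within cball x (norm h))" for y
        unfolding F_def
        by (rule has_derivative_eq_rhs, rule derivative_intros,
            rule has_derivative_at_withinI[OF test_has_derivative[OF f]], (rule derivative_intros)+)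
           (auto simp: fun_eq_iff sum_subtractf algebra_simps)
      show "onorm (\<lambda>k. \<Sum>j\<in>Basis. (k \<bullet> j) * (pd j f y - pd j f x)) \<le> L * norm h" if y: "y \<in> cball x (norm h)" for y
      proof (rule onorm_le)
        fix k
        have "\<bar>pd j f y - pd j f x\<bar> \<le> K j * norm h" if j: "j \<in> Basis" for j
        proof -
          have "norm (y - x) \<le> norm h" using y by (simp add: dist_norm norm_minus_commute[of x y])
          hence "K j * norm (y - x) \<le> K j * norm h" using K(1)[OF j] by (intro mult_left_mono) auto
          thus ?thesis using K(2)[OF j, of y x] by linarith
        qed
        hence "norm (\<Sum>j\<in>Basis. (k \<bullet> j) * (pd j f y - pd j f x)) \<le> (\<Sum>j\<in>Basis. norm k * (K j * norm h))"
          by (intro sum_norm_le) (auto simp: abs_mult intro!: mult_mono Basis_le_norm)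
        thus "norm (\<Sum>j\<in>Basis. (k \<bullet> j) * (pd j f y - pd j f x)) \<le> L * norm h * norm k"
          by (simp add: L_def sum_distrib_left sum_distrib_right mult_ac)
      qed
    qed (auto simp: dist_norm)
    moreover have "F (x + h) - F x = f (x + h) - f x - (\<Sum>j\<in>Basis. (h \<bullet> j) * pd j f x)"
      by (simp add: F_def inner_add_left algebra_simps sum.distrib)
    ultimately show ?thesis by (simp add: power2_eq_square mult.assoc)
  qed
  with L show ?thesis by blast
qed

lemma gradient_eq: assumes "GDERIV f x :> D" shows "gradient f x = D"
  unfolding gradient_def
proof (rule the_equality[of "\<lambda>D. GDERIV f x :> D", OF assms])
  fix D' assume "GDERIV f x :> D'"
  hence "(\<lambda>h. h \<bullet> D') = (\<lambda>h. h \<bullet> D)" using assms unfolding gderiv_def by (rule has_derivative_unique)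
  thus "D' = D" by (metis inner_commute vector_eq_rdot)
qed

lemma gradient_test:
  assumes f: "f \<in> Cc_inf S" shows "gradient f x = (\<Sum>j\<in>Basis. pd j f x *\<^sub>R j)"
  by (rule gradient_eq) (use test_has_derivative[OF f, of x] in \<open>simp add: gderiv_def inner_sum_right mult.commute\<close>)

text \<open>Difference quotients of \<open>f\<close> integrate to zero by translation invariance, and they are dominated
  because \<open>g\<close> is bounded and \<open>f\<close> vanishes outside a ball.\<close>

lemma integral_dir_deriv_zero:
  fixes f g :: "'a::euclidean_space \<Rightarrow> real"
  assumes d: "\<And>x. ((\<lambda>r. f (x + r *\<^sub>R j)) has_real_derivative g x) (at 0)"
    and fi: "integrable lborel f" and [measurable]: "f \<in> borel_measurable borel" "g \<in> borel_measurable borel"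
    and supp: "\<And>x. norm x > R \<Longrightarrow> f x = 0"
    and bound: "\<And>x. \<bar>g x\<bar> \<le> L"
  shows "(\<integral>x. g x \<partial>lborel) = 0"
proof -
  have lip: "\<bar>f (x + r *\<^sub>R j) - f x\<bar> \<le> L * \<bar>r\<bar>" for x r
  proof -
    have "((\<lambda>r. f (x + r *\<^sub>R j)) has_real_derivative g (x + r *\<^sub>R j)) (at r)" for r
      using d[of "x + r *\<^sub>R j"] DERIV_shift[of "\<lambda>r. f (x + r *\<^sub>R j)" "g (x + r *\<^sub>R j)" 0 r] by (simp add: algebra_simps)
    hence "norm (f (x + r *\<^sub>R j) - f (x + 0 *\<^sub>R j)) \<le> L * norm (r - 0)"
      by (intro field_differentiable_bound[of UNIV "\<lambda>r. f (x + r *\<^sub>R j)" "\<lambda>r. g (x + r *\<^sub>R j)"]) (use bound in auto)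
    thus ?thesis by simp
  qed
  define h where "h n = 1 / real (Suc n)" for n
  have h: "h n > 0" "h n \<le> 1" for n by (auto simp: h_def)
  have h0: "h \<longlonglongrightarrow> 0" unfolding h_def using LIMSEQ_Suc[OF lim_1_over_n] by simp
  have "(\<lambda>n. \<integral>x. (f (x + h n *\<^sub>R j) - f x) / h n \<partial>lborel) \<longlonglongrightarrow> (\<integral>x. g x \<partial>lborel)"
  proof (rule integral_dominated_convergence[where w="\<lambda>x. L * indicator (cball 0 (R + norm j)) x"])
    show "AE x in lborel. (\<lambda>n. (f (x + h n *\<^sub>R j) - f x) / h n) \<longlonglongrightarrow> g x"
    proof (rule AE_I2)
      fix x
      have "((\<lambda>r. (f (x + r *\<^sub>R j) - f x) / r) \<longlongrightarrow> g x) (at 0)" using d[of x] by (simp add: DERIV_def)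
      moreover have "filterlim h (at 0) sequentially" using h0 h by (auto simp: filterlim_at intro!: always_eventually less_imp_neq[symmetric])
      ultimately show "(\<lambda>n. (f (x + h n *\<^sub>R j) - f x) / h n) \<longlonglongrightarrow> g x" by (rule filterlim_compose)
    qed
    show "AE x in lborel. norm ((f (x + h n *\<^sub>R j) - f x) / h n) \<le> L * indicator (cball 0 (R + norm j)) x" for n
    proof (rule AE_I2)
      fix x
      show "norm ((f (x + h n *\<^sub>R j) - f x) / h n) \<le> L * indicator (cball 0 (R + norm j)) x"
      proof (cases "norm x \<le> R + norm j")
        case True
        thus ?thesis using lip[of x "h n"] h[of n] by (simp add: abs_divide field_simps)
      next
        case False
        have "norm x \<le> norm (x + h n *\<^sub>R j) + norm (h n *\<^sub>R j)" using norm_triangle_ineq4[of "x + h n *\<^sub>R j" "h n *\<^sub>R j"] by simp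
        also have "norm (h n *\<^sub>R j) \<le> norm j" using h[of n] by (simp add: mult_left_le_one_le)
        finally have "norm (x + h n *\<^sub>R j) > R" using False by simp
        moreover have "norm x > R" using False norm_ge_zero[of j] by linarith
        ultimately show ?thesis using supp False by simp
      qed
    qed
    have "emeasure lborel (cball (0::'a) (R + norm j)) < \<infinity>" by (rule emeasure_lborel_cball_finite)
    thus "integrable lborel (\<lambda>x::'a. L * indicator (cball 0 (R + norm j)) x)" by (intro integrable_mult_right) simp
  qed auto
  moreover have "(\<integral>x. (f (x + h n *\<^sub>R j) - f x) / h n \<partial>lborel) = 0" for n
  proof -
    have "integrable lborel (\<lambda>x. f (x + h n *\<^sub>R j))" "(\<integral>x. f (x + h n *\<^sub>R j) \<partial>lborel) = (\<integral>x. f x \<partial>lborel)"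
      using integrable_lborel_affine[of f 1 "h n *\<^sub>R j"] integral_lborel_affine[of f 1 "h n *\<^sub>R j"] fi by (auto simp: add.commute)
    thus ?thesis using fi by simp
  qed
  ultimately have "(\<lambda>n::nat. 0::real) \<longlonglongrightarrow> (\<integral>x. g x \<partial>lborel)" by (simp only:)
  thus ?thesis by (simp add: LIMSEQ_const_iff)
qed

section \<open>Gaussian kernels\<close>

lemma nn_integral_exp_neg_abs: "(\<integral>\<^sup>+(x::real). ennreal (exp (- \<bar>x\<bar>)) \<partial>lborel) < \<infinity>"
proof -
  have 1: "(\<integral>\<^sup>+(x::real). ennreal (exp (- x)) * indicator {0..} x \<partial>lborel) = ennreal (0 - (- exp (- 0)))"
  proof (rule nn_integral_FTC_atLeast)
    show "((\<lambda>x::real. - exp (- x)) \<longlongrightarrow> 0) at_top"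
      using tendsto_minus[OF filterlim_compose[OF exp_at_bot filterlim_uminus_at_bot_at_top]] by simp
  qed (auto intro!: derivative_eq_intros)
  have 2: "(\<integral>\<^sup>+(x::real). ennreal (exp x) * indicator {..0} x \<partial>lborel) = (\<integral>\<^sup>+(x::real). ennreal (exp (- x)) * indicator {0..} x \<partial>lborel)"
    by (subst nn_integral_real_affine[where c="-1" and t=0]) (auto intro!: nn_integral_cong simp: indicator_def)
  have "(\<integral>\<^sup>+(x::real). ennreal (exp (- \<bar>x\<bar>)) \<partial>lborel) \<le> (\<integral>\<^sup>+(x::real). ennreal (exp (- x)) * indicator {0..} x + ennreal (exp x) * indicator {..0} x \<partial>lborel)"
    by (intro nn_integral_mono) (auto simp: indicator_def abs_if)
  also have "\<dots> = 1 + 1" using 1 2 by (subst nn_integral_add) auto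
  also have "\<dots> < \<infinity>" by simp
  finally show ?thesis .
qed

text \<open>The integrand is a product over the coordinates, and in one variable \<open>exp (-x\<^sup>2)\<close> is dominated
  by a multiple of \<open>exp (-|x|)\<close>.\<close>

lemma integrable_exp_norm_sq: "integrable lborel (\<lambda>x::'a::euclidean_space. exp (- (norm x)\<^sup>2))"
proof (rule integrableI_bounded)
  have "(\<integral>\<^sup>+(x::'a). ennreal (norm (exp (- (norm x)\<^sup>2))) \<partial>lborel) = (\<integral>\<^sup>+(x::'a). (\<Prod>b\<in>Basis. ennreal (exp (- (x \<bullet> b)\<^sup>2))) \<partial>lborel)"
  proof (intro nn_integral_cong)
    fix x :: 'a
    have "(norm x)\<^sup>2 = (\<Sum>b\<in>Basis. (x \<bullet> b)\<^sup>2)"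
      unfolding power2_norm_eq_inner by (subst euclidean_inner) (simp add: power2_eq_square)
    thus "ennreal (norm (exp (- (norm x)\<^sup>2))) = (\<Prod>b\<in>Basis. ennreal (exp (- (x \<bullet> b)\<^sup>2)))"
      by (simp add: prod_ennreal exp_sum[symmetric] sum_negf)
  qed
  also have "\<dots> = (\<Prod>b\<in>(Basis::'a set). (\<integral>\<^sup>+x. ennreal (exp (- x\<^sup>2)) \<partial>lborel))"
    by (rule nn_integral_lborel_prod) auto
  also have "\<dots> < \<infinity>"
  proof -
    have "(\<integral>\<^sup>+(x::real). ennreal (exp (- x\<^sup>2)) \<partial>lborel) \<le> (\<integral>\<^sup>+(x::real). ennreal (exp 1) * ennreal (exp (- \<bar>x\<bar>)) \<partial>lborel)"
    proof (intro nn_integral_mono)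
      fix x :: real
      have "0 \<le> (\<bar>x\<bar> - 1/2)\<^sup>2" by simp
      hence "- x\<^sup>2 \<le> 1 + - \<bar>x\<bar>" by (simp add: power2_diff power_divide)
      hence "exp (- x\<^sup>2) \<le> exp 1 * exp (- \<bar>x\<bar>)" by (simp add: exp_add[symmetric])
      thus "ennreal (exp (- x\<^sup>2)) \<le> ennreal (exp 1) * ennreal (exp (- \<bar>x\<bar>))" by (simp add: ennreal_mult[symmetric])
    qed
    also have "\<dots> < \<infinity>" using nn_integral_exp_neg_abs by (simp add: nn_integral_cmult ennreal_mult_less_top)
    finally show ?thesis by (auto simp: less_top ennreal_prod_eq_top intro!: power_less_top_ennreal[THEN iffD2])
  qed
  finally show "(\<integral>\<^sup>+(x::'a). ennreal (norm (exp (- (norm x)\<^sup>2))) \<partial>lborel) < \<infinity>" .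
qed simp

text \<open>It equals \<open>pi powr (d/2)\<close>; the dimension \<open>d\<close> is carried by the type argument.\<close>

definition gauss_mass :: "'a::euclidean_space itself \<Rightarrow> real" where
  "gauss_mass _ = (\<integral>(y::'a). exp (- (norm y)\<^sup>2) \<partial>lborel)"

lemma gauss_mass_measurable[measurable]: "(\<lambda>x. gauss_mass TYPE('a::euclidean_space)) \<in> borel_measurable M"
  by (rule borel_measurable_const)

lemma gauss_mass_pos: "gauss_mass TYPE('a::euclidean_space) > 0"
proof -
  have "gauss_mass TYPE('a) \<noteq> 0"
  proof
    assume "gauss_mass TYPE('a) = 0"
    hence "AE x::'a in lborel. exp (- (norm x)\<^sup>2) = 0"
      unfolding gauss_mass_def using integral_nonneg_eq_0_iff_AE[OF integrable_exp_norm_sq[where 'a='a]] by simp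
    hence "AE x::'a in lborel. False" by (auto elim: eventually_mono)
    hence "emeasure lborel (UNIV::'a set) = 0" by (subst (asm) AE_iff_measurable[of UNIV]) auto
    thus False by simp
  qed
  moreover have "gauss_mass TYPE('a) \<ge> 0" unfolding gauss_mass_def by (intro integral_nonneg_AE) auto
  ultimately show ?thesis by simp
qed

text \<open>The heat kernel at time \<open>r/4\<close>. With this parametrisation \<open>gauss a\<close> convolved with \<open>gauss b\<close> is
  \<open>gauss (a + b)\<close>, and no factor \<open>4\<close> occurs in the exponents.\<close>

definition gauss :: "real \<Rightarrow> 'a::euclidean_space \<Rightarrow> real" where
  "gauss r x = exp (- (norm x)\<^sup>2 / r) / (r powr (real DIM('a) / 2) * gauss_mass TYPE('a))"

lemma gauss_measurable[measurable (raw)]: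
  "f \<in> borel_measurable M \<Longrightarrow> g \<in> borel_measurable M \<Longrightarrow> (\<lambda>x. gauss (f x) (g x)) \<in> borel_measurable M"
  unfolding gauss_def
  by (intro borel_measurable_divide borel_measurable_times gauss_mass_measurable powr_real_measurable; measurable)

lemma gauss_nonneg: "gauss r (x::'a::euclidean_space) \<ge> 0"
  unfolding gauss_def using gauss_mass_pos[where 'a='a] by auto

lemma gauss_minus[simp]: "gauss r (- x) = gauss r x"
  by (simp add: gauss_def)

lemma gauss_le: "r > 0 \<Longrightarrow> gauss r (x::'a::euclidean_space) \<le> 1 / (r powr (real DIM('a) / 2) * gauss_mass TYPE('a))"
  unfolding gauss_def using gauss_mass_pos[where 'a='a] by (intro divide_right_mono) auto

lemma gauss_integrable: "r > 0 \<Longrightarrow> integrable lborel (gauss r :: 'a::euclidean_space \<Rightarrow> real)"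
  and gauss_integral: "r > 0 \<Longrightarrow> (\<integral>x. gauss r (x::'a::euclidean_space) \<partial>lborel) = 1"
proof -
  assume r: "r > 0"
  have eq: "exp (- (norm (0 + sqrt r *\<^sub>R x))\<^sup>2 / r) = exp (- (norm x)\<^sup>2)" for x :: 'a
    using r by (simp add: power_mult_distrib)
  have "integrable lborel (\<lambda>x::'a. exp (- (norm (0 + sqrt r *\<^sub>R x))\<^sup>2 / r))"
    unfolding eq by (rule integrable_exp_norm_sq)
  hence *: "integrable lborel (\<lambda>x::'a. exp (- (norm x)\<^sup>2 / r))"
    using integrable_lborel_affine[of "\<lambda>x::'a. exp (- (norm x)\<^sup>2 / r)" "sqrt r" 0] r by simp
  show "integrable lborel (gauss r :: 'a \<Rightarrow> real)" unfolding gauss_def by (intro integrable_divide *)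
  have "(\<integral>(x::'a). exp (- (norm x)\<^sup>2 / r) \<partial>lborel) = \<bar>sqrt r\<bar> ^ DIM('a) * gauss_mass TYPE('a)"
    by (subst integral_lborel_affine[where c="sqrt r" and t=0]) (use r eq in \<open>auto simp: gauss_mass_def\<close>)
  also have "\<bar>sqrt r\<bar> ^ DIM('a) = r powr (real DIM('a) / 2)"
    using r by (simp add: powr_half_sqrt[symmetric] powr_powr powr_realpow[symmetric])
  finally show "(\<integral>x. gauss r (x::'a) \<partial>lborel) = 1"
    unfolding gauss_def using gauss_mass_pos[where 'a='a] r by simp
qed

lemma gauss_double: "r > 0 \<Longrightarrow> gauss r (x::'a::euclidean_space) \<le> 2 powr (real DIM('a) / 2) * gauss (2 * r) x"
  unfolding gauss_def using gauss_mass_pos[where 'a='a] by (auto simp: powr_mult field_simps)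

text \<open>This is \<open>-1/2\<close> times the partial derivative of \<open>gauss r\<close> in direction \<open>j\<close>.\<close>

definition egauss :: "'a \<Rightarrow> real \<Rightarrow> 'a::euclidean_space \<Rightarrow> real" where
  "egauss j r x = (x \<bullet> j) / r * gauss r x"

lemma egauss_measurable[measurable (raw)]:
  "f \<in> borel_measurable M \<Longrightarrow> g \<in> borel_measurable M \<Longrightarrow> (\<lambda>x. egauss j (f x) (g x)) \<in> borel_measurable M"
  unfolding egauss_def by (intro borel_measurable_times borel_measurable_divide borel_measurable_inner gauss_measurable) auto

lemma egauss_minus[simp]: "egauss j r (- x) = - egauss j r x"
  by (simp add: egauss_def)

text \<open>The factor \<open>|x|/sqrt r\<close> is absorbed by half of the Gaussian decay, at the price of doubling the
  time.\<close>

lemma egauss_le: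
  assumes r: "r > 0" and j: "j \<in> Basis"
  shows "\<bar>egauss j r (x::'a::euclidean_space)\<bar> \<le> 2 powr (real DIM('a) / 2) * r powr (-1/2) * gauss (2 * r) x"
proof -
  define u where "u = norm x / sqrt r"
  have u: "u \<ge> 0" "u\<^sup>2 = (norm x)\<^sup>2 / r" using r by (auto simp: u_def power_divide)
  have "u \<le> exp (u\<^sup>2 / 2)"
  proof -
    have "0 \<le> (u - 1)\<^sup>2" by simp
    hence "u \<le> 1 + u\<^sup>2 / 2" by (simp add: power2_diff)
    also have "\<dots> \<le> exp (u\<^sup>2/2)" using exp_ge_add_one_self_aux[of "u\<^sup>2/2"] by simp
    finally show ?thesis .
  qed
  hence "u * exp (- u\<^sup>2) \<le> exp (u\<^sup>2/2) * exp (- u\<^sup>2)" by (intro mult_right_mono) auto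
  hence *: "u * exp (- u\<^sup>2) \<le> exp (- (u\<^sup>2 / 2))" by (simp add: exp_add[symmetric])
  have "\<bar>egauss j r x\<bar> = \<bar>x \<bullet> j\<bar> / r * gauss r x" using r gauss_nonneg[of r x] by (simp add: egauss_def abs_mult)
  also have "\<dots> \<le> norm x / r * gauss r x"
    using r j by (intro mult_right_mono divide_right_mono Basis_le_norm gauss_nonneg) auto
  also have "norm x / r = u * r powr (-1/2)" using r by (simp add: u_def powr_minus_divide powr_half_sqrt)
  also have "u * r powr (-1/2) * gauss r x = r powr (-1/2) * (u * exp (- u\<^sup>2)) / (r powr (real DIM('a) / 2) * gauss_mass TYPE('a))"
    unfolding gauss_def u(2) by simp
  also have "\<dots> \<le> r powr (-1/2) * exp (- (u\<^sup>2 / 2)) / (r powr (real DIM('a) / 2) * gauss_mass TYPE('a))"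
    using * gauss_mass_pos[where 'a='a] by (intro divide_right_mono mult_left_mono) auto
  also have "\<dots> = 2 powr (real DIM('a) / 2) * r powr (-1/2) * gauss (2 * r) x"
    unfolding gauss_def u(2) using r by (simp add: powr_mult field_simps)
  finally show ?thesis .
qed

lemma egauss_integrable:
  assumes r: "r > 0" and j: "j \<in> Basis"
  shows "integrable lborel (egauss j r :: 'a::euclidean_space \<Rightarrow> real)"
proof (rule Bochner_Integration.integrable_bound)
  show "integrable lborel (\<lambda>x::'a. 2 powr (real DIM('a) / 2) * r powr (-1/2) * gauss (2 * r) x)"
    using r by (intro integrable_mult_right gauss_integrable) simp
  show "AE x::'a in lborel. norm (egauss j r x) \<le> norm (2 powr (real DIM('a) / 2) * r powr (-1/2) * gauss (2 * r) x)"
    using egauss_le[OF r j] by (intro AE_I2) (simp add: abs_mult gauss_nonneg)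
qed simp

lemma egauss_integral: "(\<integral>x. egauss j r x \<partial>lborel) = 0"
proof -
  have "(\<integral>x. egauss j r x \<partial>lborel) = - (\<integral>x. egauss j r x \<partial>lborel)"
    using integral_lborel_affine[of "egauss j r" "-1" 0] by simp
  thus ?thesis by simp
qed

section \<open>Convolution and the heat semigroup\<close>

definition conv :: "('a::euclidean_space \<Rightarrow> real) \<Rightarrow> ('a \<Rightarrow> real) \<Rightarrow> 'a \<Rightarrow> real" where
  "conv k f x = (\<integral>y. k (x - y) * f y \<partial>lborel)"

lemma conv_measurable:
  assumes k: "(\<lambda>(z, y). k z y) \<in> borel_measurable (M \<Otimes>\<^sub>M borel)" and f[measurable]: "f \<in> borel_measurable borel"
    and g[measurable]: "g \<in> borel_measurable M"
  shows "(\<lambda>z. conv (k z) f (g z)) \<in> borel_measurable M"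
proof -
  have "(\<lambda>p. (fst p, g (fst p) - snd p)) \<in> measurable (M \<Otimes>\<^sub>M lborel) (M \<Otimes>\<^sub>M borel)" by measurable
  from measurable_compose[OF this k]
  have [measurable]: "(\<lambda>p. k (fst p) (g (fst p) - snd p)) \<in> borel_measurable (M \<Otimes>\<^sub>M lborel)" by simp
  have "(\<lambda>p. k (fst p) (g (fst p) - snd p) * f (snd p)) \<in> borel_measurable (M \<Otimes>\<^sub>M lborel)"
    by (intro borel_measurable_times) measurable
  hence "(\<lambda>(z, y). k z (g z - y) * f y) \<in> borel_measurable (M \<Otimes>\<^sub>M lborel)" by (simp add: case_prod_unfold)
  thus ?thesis unfolding conv_def by (rule lborel.borel_measurable_lebesgue_integral)
qed

lemma conv_borel[measurable]:
  assumes [measurable]: "k \<in> borel_measurable borel" "f \<in> borel_measurable borel"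
  shows "conv k f \<in> borel_measurable borel"
  by (rule conv_measurable) simp_all

lemma conv_swap:
  assumes [measurable]: "k \<in> borel_measurable borel" "f \<in> borel_measurable borel"
  shows "conv k f x = (\<integral>z. k z * f (x - z) \<partial>lborel)"
  unfolding conv_def using integral_lborel_affine[of "\<lambda>y. k (x - y) * f y" "-1" x] by simp

lemma integrable_reflect:
  fixes k :: "'a::euclidean_space \<Rightarrow> real"
  assumes "integrable lborel k" shows "integrable lborel (\<lambda>y. k (x - y))"
  using integrable_lborel_affine[of k "-1" x] assms by simp

lemma integral_reflect:
  fixes k :: "'a::euclidean_space \<Rightarrow> real"
  assumes [measurable]: "k \<in> borel_measurable borel" shows "(\<integral>y. k (x - y) \<partial>lborel) = (\<integral>y. k y \<partial>lborel)"
  using integral_lborel_affine[of k "-1" x] by simp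

lemma conv_integrable:
  fixes k f :: "'a::euclidean_space \<Rightarrow> real"
  assumes k: "integrable lborel k" and [measurable]: "f \<in> borel_measurable borel" and f: "\<And>x. \<bar>f x\<bar> \<le> K"
  shows "integrable lborel (\<lambda>y. k (x - y) * f y)"
proof (rule Bochner_Integration.integrable_bound[where f="\<lambda>y. K * k (x - y)"])
  show "integrable lborel (\<lambda>y. K * k (x - y))" by (intro integrable_mult_right integrable_reflect k)
next
  show "AE y in lborel. norm (k (x - y) * f y) \<le> norm (K * k (x - y))"
    using f order_trans[OF abs_ge_zero f[of x]] by (auto simp: abs_mult mult.commute intro!: mult_right_mono)
qed (use borel_measurable_integrable[OF k] in measurable)

lemma conv_abs_le:
  assumes k: "integrable lborel k" and f: "\<And>x. \<bar>f x\<bar> \<le> K"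
  shows "\<bar>conv k f x\<bar> \<le> K * (\<integral>y. \<bar>k y\<bar> \<partial>lborel)"
proof -
  note [measurable] = borel_measurable_integrable[OF k]
  have "\<bar>conv k f x\<bar> \<le> (\<integral>y. K * \<bar>k (x - y)\<bar> \<partial>lborel)"
    unfolding conv_def
    by (intro abs_integral_le integrable_mult_right integrable_abs integrable_reflect k)
       (use f in \<open>auto simp: abs_mult mult.commute[of "K"] intro!: mult_left_mono\<close>)
  also have "\<dots> = K * (\<integral>y. \<bar>k y\<bar> \<partial>lborel)" by (simp add: integral_reflect[of "\<lambda>y. \<bar>k y\<bar>"])
  finally show ?thesis .
qed

lemma conv_abs_le_L1:
  assumes k: "\<And>x. \<bar>k x\<bar> \<le> K" and f: "integrable lborel f"
  shows "\<bar>conv k f x\<bar> \<le> K * (\<integral>y. \<bar>f y\<bar> \<partial>lborel)"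
proof -
  have "\<bar>conv k f x\<bar> \<le> (\<integral>y. K * \<bar>f y\<bar> \<partial>lborel)"
    unfolding conv_def
    by (intro abs_integral_le integrable_mult_right integrable_abs f)
       (use k in \<open>auto simp: abs_mult intro!: mult_right_mono\<close>)
  thus ?thesis by simp
qed

lemma conv_abs_le_conv:
  assumes g: "integrable lborel g" and f[measurable]: "f \<in> borel_measurable borel" "\<And>x. \<bar>f x\<bar> \<le> K"
    and k: "\<And>x. \<bar>k x\<bar> \<le> g x"
  shows "\<bar>conv k f x\<bar> \<le> conv g (\<lambda>y. \<bar>f y\<bar>) x"
  unfolding conv_def
  by (intro abs_integral_le conv_integrable g) (use f k in \<open>auto simp: abs_mult intro!: mult_right_mono\<close>)

lemma conv_assoc:
  assumes k1: "integrable lborel k1" and k2: "integrable lborel k2"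
    and f[measurable]: "f \<in> borel_measurable borel" and K: "\<And>x. \<bar>f x\<bar> \<le> K"
  shows "conv k1 (conv k2 f) x = conv (conv k1 k2) f x"
proof -
  note [measurable] = borel_measurable_integrable[OF k1, simplified] borel_measurable_integrable[OF k2, simplified]
  have swap: "(\<integral>y. \<integral>z. k1 (x - y) * (k2 (y - z) * f z) \<partial>lborel \<partial>lborel) = (\<integral>z. \<integral>y. k1 (x - y) * (k2 (y - z) * f z) \<partial>lborel \<partial>lborel)"
  proof (rule fubini_dominated(1))
    show "AE y in lborel. integrable lborel (\<lambda>z. k1 (x - y) * (k2 (y - z) * f z))"
      by (auto intro!: integrable_mult_right conv_integrable[OF k2 f K])
    show "integrable lborel (\<lambda>y. \<bar>k1 (x - y)\<bar> * (K * (\<integral>y. \<bar>k2 y\<bar> \<partial>lborel)))"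
      by (intro integrable_mult_left integrable_abs integrable_reflect k1)
    show "AE y in lborel. (\<integral>z. \<bar>k1 (x - y) * (k2 (y - z) * f z)\<bar> \<partial>lborel) \<le> \<bar>k1 (x - y)\<bar> * (K * (\<integral>y. \<bar>k2 y\<bar> \<partial>lborel))"
    proof (rule AE_I2)
      fix y
      have "\<bar>conv (\<lambda>z. \<bar>k2 z\<bar>) (\<lambda>z. \<bar>f z\<bar>) y\<bar> \<le> K * (\<integral>y. \<bar>\<bar>k2 y\<bar>\<bar> \<partial>lborel)"
        by (intro conv_abs_le integrable_abs k2) (use K in auto)
      hence "\<bar>k1 (x - y)\<bar> * conv (\<lambda>z. \<bar>k2 z\<bar>) (\<lambda>z. \<bar>f z\<bar>) y \<le> \<bar>k1 (x - y)\<bar> * (K * (\<integral>y. \<bar>k2 y\<bar> \<partial>lborel))"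
        by (intro mult_left_mono) auto
      thus "(\<integral>z. \<bar>k1 (x - y) * (k2 (y - z) * f z)\<bar> \<partial>lborel) \<le> \<bar>k1 (x - y)\<bar> * (K * (\<integral>y. \<bar>k2 y\<bar> \<partial>lborel))"
        by (simp add: abs_mult conv_def)
    qed
  qed measurable
  have "conv k1 (conv k2 f) x = (\<integral>y. \<integral>z. k1 (x - y) * (k2 (y - z) * f z) \<partial>lborel \<partial>lborel)"
    unfolding conv_def by simp
  also have "\<dots> = (\<integral>z. \<integral>y. k1 (x - y) * (k2 (y - z) * f z) \<partial>lborel \<partial>lborel)"
    by (rule swap)
  also have "\<dots> = (\<integral>z. conv k1 k2 (x - z) * f z \<partial>lborel)"
  proof (intro Bochner_Integration.integral_cong refl)
    fix z
    have "(\<integral>y. k1 (x - y) * k2 (y - z) \<partial>lborel) = (\<integral>v. k1 (x - (z + v)) * k2 v \<partial>lborel)"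
      using integral_lborel_affine[of "\<lambda>y. k1 (x - y) * k2 (y - z)" 1 z] by simp
    also have "\<dots> = conv k1 k2 (x - z)" by (simp add: conv_def diff_diff_eq)
    finally have *: "(\<integral>y. k1 (x - y) * k2 (y - z) \<partial>lborel) = conv k1 k2 (x - z)" .
    have "(\<integral>y. k1 (x - y) * (k2 (y - z) * f z) \<partial>lborel) = (\<integral>y. (k1 (x - y) * k2 (y - z)) * f z \<partial>lborel)" by (simp add: mult.assoc)
    thus "(\<integral>y. k1 (x - y) * (k2 (y - z) * f z) \<partial>lborel) = conv k1 k2 (x - z) * f z" using * by simp
  qed
  also have "\<dots> = conv (conv k1 k2) f x" by (simp add: conv_def)
  finally show ?thesis .
qed

text \<open>Completing the square: for \<open>y = m + w\<close>, centred at \<open>m = b/(a+b) x\<close>, the product of the two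
  Gaussians separates into a factor depending on \<open>x\<close> and a Gaussian in \<open>w\<close>.\<close>

lemma gauss_factor:
  fixes x w :: "'a::euclidean_space"
  assumes a: "a > 0" and b: "b > 0"
  defines "m \<equiv> (b / (a + b)) *\<^sub>R x"
  shows "gauss a (x - (m + w)) * gauss b (m + w) = gauss (a + b) x * gauss (a * b / (a + b)) w"
proof -
  have xm: "x - (m + w) = (a / (a + b)) *\<^sub>R x - w"
  proof -
    have "x - m = (1 - b / (a + b)) *\<^sub>R x" by (simp add: m_def scaleR_diff_left)
    also have "1 - b / (a + b) = a / (a + b)" using a b by (simp add: field_simps)
    finally show ?thesis by (simp add: algebra_simps)
  qed
  have n1: "(norm (x - (m + w)))\<^sup>2 = (a / (a + b))\<^sup>2 * (norm x)\<^sup>2 - 2 * (a / (a + b)) * (x \<bullet> w) + (norm w)\<^sup>2"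
    unfolding xm power2_norm_eq_inner by (simp add:  inner_diff_left inner_diff_right inner_commute power2_eq_square algebra_simps)
  have n2: "(norm (m + w))\<^sup>2 = (b / (a + b))\<^sup>2 * (norm x)\<^sup>2 + 2 * (b / (a + b)) * (x \<bullet> w) + (norm w)\<^sup>2"
    unfolding m_def power2_norm_eq_inner by (simp add:  inner_add_left inner_add_right inner_commute power2_eq_square algebra_simps)
  have "(norm (x - (m + w)))\<^sup>2 / a + (norm (m + w))\<^sup>2 / b = (norm x)\<^sup>2 / (a + b) + (norm w)\<^sup>2 / (a * b / (a + b))"
  proof -
    define X where "X = (norm x)\<^sup>2"
    define W where "W = (norm w)\<^sup>2"
    define P where "P = x \<bullet> w"
    define s where "s = a + b"
    have s: "s > 0" "a + b = s" using a b by (auto simp: s_def)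
    have "((a/s)\<^sup>2 * X - 2 * (a/s) * P + W) / a + ((b/s)\<^sup>2 * X + 2 * (b/s) * P + W) / b = (a + b) * X / s\<^sup>2 + (a + b) * W / (a * b)"
      using a b s(1) by (simp add: field_simps power2_eq_square)
    also have "\<dots> = X / s + W / (a * b / s)" unfolding s(2) using s(1) a b by (simp add: field_simps power2_eq_square)
    finally show ?thesis unfolding n1 n2 X_def W_def P_def s_def .
  qed
  hence e: "exp (- (norm (x - (m + w)))\<^sup>2 / a) * exp (- (norm (m + w))\<^sup>2 / b) = exp (- (norm x)\<^sup>2 / (a + b)) * exp (- (norm w)\<^sup>2 / (a * b / (a + b)))"
    by (simp only: exp_add[symmetric] minus_divide_left[symmetric] minus_add_distrib[symmetric])
  define h where "h = real DIM('a) / 2"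
  have p: "a powr h * b powr h = (a + b) powr h * (a * b / (a + b)) powr h"
    using a b by (simp add: powr_mult[symmetric])
  have "gauss a (x - (m + w)) * gauss b (m + w) = (exp (- (norm (x - (m + w)))\<^sup>2 / a) * exp (- (norm (m + w))\<^sup>2 / b)) / ((a powr h * b powr h) * (gauss_mass TYPE('a))\<^sup>2)"
    unfolding gauss_def h_def by (simp add: power2_eq_square mult_ac)
  also have "\<dots> = gauss (a + b) x * gauss (a * b / (a + b)) w"
    unfolding e p unfolding gauss_def h_def by (simp add: power2_eq_square mult_ac)
  finally show ?thesis .
qed

lemma gauss_conv_gauss:
  assumes a: "a > 0" and b: "b > 0" shows "conv (gauss a) (gauss b) = gauss (a + b)"
proof
  fix x :: 'a
  define m where "m = (b / (a + b)) *\<^sub>R x"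
  have "conv (gauss a) (gauss b) x = (\<integral>w. gauss a (x - (m + w)) * gauss b (m + w) \<partial>lborel)"
    unfolding conv_def using integral_lborel_affine[of "\<lambda>y. gauss a (x - y) * gauss b y" 1 m] by simp
  also have "\<dots> = (\<integral>w. gauss (a + b) x * gauss (a * b / (a + b)) (w::'a) \<partial>lborel)"
    unfolding m_def gauss_factor[OF a b] ..
  also have "\<dots> = gauss (a + b) x" using a b by (simp add: gauss_integral)
  finally show "conv (gauss a) (gauss b) x = gauss (a + b) x" .
qed

text \<open>In the coordinates of \<open>gauss_factor\<close>, the linear factor of \<open>egauss\<close> splits into a part depending
  on \<open>x\<close> and a part odd in \<open>w\<close>, whose integral vanishes.\<close>

lemma egauss_conv_gauss:
  assumes a: "a > 0" and b: "b > 0" and j: "j \<in> Basis"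
  shows "conv (egauss j a) (gauss b) = egauss j (a + b)"
proof
  fix x :: 'a
  define c where "c = a * b / (a + b)"
  have c: "c > 0" using a b by (simp add: c_def)
  define m where "m = (b / (a + b)) *\<^sub>R x"
  have "conv (egauss j a) (gauss b) x = (\<integral>w. egauss j a (x - (m + w)) * gauss b (m + w) \<partial>lborel)"
    unfolding conv_def using integral_lborel_affine[of "\<lambda>y. egauss j a (x - y) * gauss b y" 1 m] by simp
  also have "\<dots> = (\<integral>w. egauss j (a + b) x * gauss c w - (c / a * gauss (a + b) x) * egauss j c w \<partial>lborel)"
  proof (intro Bochner_Integration.integral_cong refl)
    fix w
    have "x - m = (1 - b / (a + b)) *\<^sub>R x" by (simp add: m_def scaleR_diff_left)
    also have "1 - b / (a + b) = a / (a + b)" using a b by (simp add: field_simps)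
    finally have "x - (m + w) = (a / (a + b)) *\<^sub>R x - w" by (simp add: algebra_simps)
    hence i: "(x - (m + w)) \<bullet> j / a = (x \<bullet> j) / (a + b) - (w \<bullet> j) / a" using a by (simp only: inner_diff_left diff_divide_distrib inner_scaleR_left) simp
    have "egauss j a (x - (m + w)) * gauss b (m + w) = ((x - (m + w)) \<bullet> j / a) * (gauss a (x - (m + w)) * gauss b (m + w))"
      by (simp add: egauss_def)
    also have "\<dots> = ((x \<bullet> j) / (a + b) - (w \<bullet> j) / a) * (gauss (a + b) x * gauss c w)"
      unfolding i using gauss_factor[OF a b, of x w] by (simp only: m_def c_def)
    also have "\<dots> = egauss j (a + b) x * gauss c w - (c / a * gauss (a + b) x) * egauss j c w"
      using c a by (simp add: egauss_def algebra_simps)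
    finally show "egauss j a (x - (m + w)) * gauss b (m + w) = egauss j (a + b) x * gauss c w - (c / a * gauss (a + b) x) * egauss j c w" .
  qed
  also have "\<dots> = egauss j (a + b) x"
    using c j by (simp add: gauss_integral gauss_integrable egauss_integrable egauss_integral)
  finally show "conv (egauss j a) (gauss b) x = egauss j (a + b) x" .
qed

text \<open>The class on which convolution with an integrable kernel is defined everywhere and which such
  convolutions preserve. Working with honest functions at every point avoids almost-everywhere
  arguments until weak gradients enter.\<close>

definition bdd_borel :: "('a::euclidean_space \<Rightarrow> real) \<Rightarrow> bool" where
  "bdd_borel f \<longleftrightarrow> f \<in> borel_measurable borel \<and> (\<exists>K. \<forall>x. \<bar>f x\<bar> \<le> K)"

lemma bdd_borelD: "bdd_borel f \<Longrightarrow> f \<in> borel_measurable borel" by (simp add: bdd_borel_def)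

lemma bdd_borel_test: fixes f :: "'a::euclidean_space \<Rightarrow> real" shows "f \<in> Cc_inf S \<Longrightarrow> bdd_borel f"
  using test_borel[of f S] test_bounded[of f S] by (auto simp: bdd_borel_def)

lemma bdd_borel_conv:
  assumes k: "integrable lborel k" and f: "bdd_borel f" shows "bdd_borel (conv k f)"
proof -
  obtain K where K: "f \<in> borel_measurable borel" "\<And>x. \<bar>f x\<bar> \<le> K" using f by (auto simp: bdd_borel_def)
  show ?thesis unfolding bdd_borel_def
    using conv_borel[of k f] borel_measurable_integrable[OF k] K conv_abs_le[OF k, of f K] by auto
qed

lemma bdd_borel_abs: "bdd_borel f \<Longrightarrow> bdd_borel (\<lambda>x. \<bar>f x\<bar>)"
  unfolding bdd_borel_def by auto

lemma heat_heat:
  fixes f :: "'a::euclidean_space \<Rightarrow> real"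
  assumes "a > 0" "b > 0" and f: "bdd_borel f"
  shows "conv (gauss a) (conv (gauss b) f) = conv (gauss (a + b)) f"
proof -
  obtain K where K: "f \<in> borel_measurable borel" "\<And>x. \<bar>f x\<bar> \<le> K" using f by (auto simp: bdd_borel_def)
  show ?thesis
    using conv_assoc[OF gauss_integrable[OF assms(1)] gauss_integrable[OF assms(2)] K] gauss_conv_gauss[OF assms(1,2), where 'a='a] by (intro ext) (simp only:)
qed

lemma egauss_heat:
  assumes "a > 0" "b > 0" and f: "bdd_borel f" and j: "j \<in> Basis"
  shows "conv (egauss j a) (conv (gauss b) f) = conv (egauss j (a + b)) f"
proof -
  obtain K where K: "f \<in> borel_measurable borel" "\<And>x. \<bar>f x\<bar> \<le> K" using f by (auto simp: bdd_borel_def)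
  show ?thesis
    using conv_assoc[OF egauss_integrable[OF assms(1) j] gauss_integrable[OF assms(2)] K] egauss_conv_gauss[OF assms(1,2) j]
    by (intro ext) (simp only:)
qed

lemma conv_cmult_left: "conv (\<lambda>x. c * k x) f = (\<lambda>x. c * conv k f x)"
  by (auto simp: conv_def mult.assoc)

lemma conv_cmult_right: "conv k (\<lambda>x. c * f x) = (\<lambda>x. c * conv k f x)"
  by (auto simp: conv_def mult.left_commute[of _ c])

lemma conv_nonneg: "(\<And>x. 0 \<le> k x) \<Longrightarrow> (\<And>x. 0 \<le> f x) \<Longrightarrow> 0 \<le> conv k f x"
  unfolding conv_def by (intro integral_nonneg_AE) auto

lemma conv_mono:
  assumes "integrable lborel k" "\<And>x. 0 \<le> k x" "bdd_borel f" "bdd_borel g" "\<And>x. f x \<le> g x"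
  shows "conv k f x \<le> conv k g x"
proof -
  obtain K K' where "f \<in> borel_measurable borel" "\<And>x. \<bar>f x\<bar> \<le> K" "g \<in> borel_measurable borel" "\<And>x. \<bar>g x\<bar> \<le> K'"
    using assms(3,4) unfolding bdd_borel_def by auto
  thus ?thesis unfolding conv_def
    using assms by (intro integral_mono conv_integrable[of k f K] conv_integrable[of k g K']) (auto intro: mult_left_mono)
qed

lemma conv_le_conv_gauss:
  fixes f :: "'a::euclidean_space \<Rightarrow> real"
  assumes r: "r > 0" and f: "bdd_borel f" and k: "\<And>x. \<bar>k x\<bar> \<le> c * gauss r x"
  shows "\<bar>conv k f x\<bar> \<le> c * conv (gauss r) (\<lambda>y. \<bar>f y\<bar>) x"
proof -
  obtain K where K: "f \<in> borel_measurable borel" "\<And>x. \<bar>f x\<bar> \<le> K" using f by (auto simp: bdd_borel_def)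
  have "\<bar>conv k f x\<bar> \<le> conv (\<lambda>x. c * gauss r x) (\<lambda>y. \<bar>f y\<bar>) x"
    by (rule conv_abs_le_conv[OF _ K k]) (intro integrable_mult_right gauss_integrable r)
  thus ?thesis by (simp only: conv_cmult_left)
qed

lemma heat_abs_le:
  assumes r: "r > 0" and f: "bdd_borel f"
  shows "\<bar>conv (gauss r) f x\<bar> \<le> conv (gauss r) (\<lambda>y. \<bar>f y\<bar>) x"
  using conv_le_conv_gauss[OF r f, of "gauss r" 1 x] by (simp add: gauss_nonneg)

lemma heat_double_le:
  fixes f :: "'a::euclidean_space \<Rightarrow> real"
  assumes r: "r > 0" and f: "bdd_borel f"
  shows "\<bar>conv (gauss r) f x\<bar> \<le> 2 powr (real DIM('a) / 2) * conv (gauss (2 * r)) (\<lambda>y. \<bar>f y\<bar>) x"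
  by (rule conv_le_conv_gauss[OF _ f]) (use r gauss_double[OF r] in \<open>auto simp: gauss_nonneg\<close>)

lemma egauss_abs_le:
  fixes f :: "'a::euclidean_space \<Rightarrow> real"
  assumes r: "r > 0" and f: "bdd_borel f" and j: "j \<in> Basis"
  shows "\<bar>conv (egauss j r) f x\<bar> \<le> 2 powr (real DIM('a) / 2) * r powr (-1/2) * conv (gauss (2 * r)) (\<lambda>y. \<bar>f y\<bar>) x"
  by (rule conv_le_conv_gauss[OF _ f egauss_le[OF r j]]) (use r in simp)

lemma heat_const_bound:
  fixes f :: "'a::euclidean_space \<Rightarrow> real"
  assumes r: "r > 0" and K: "\<And>x. \<bar>f x\<bar> \<le> K" shows "\<bar>conv (gauss r) f x\<bar> \<le> K"
proof -
  have "\<bar>conv (gauss r) f x\<bar> \<le> K * (\<integral>y. \<bar>gauss r (y::'a)\<bar> \<partial>lborel)"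
    by (rule conv_abs_le[OF gauss_integrable[OF r] K])
  thus ?thesis by (simp add: gauss_nonneg gauss_integral[OF r])
qed

text \<open>Integration by parts moves the derivative from \<open>f\<close> to the Gaussian.\<close>

lemma heat_pd:
  fixes f :: "'a::euclidean_space \<Rightarrow> real"
  assumes f: "f \<in> Cc_inf S" and r: "r > 0" and j: "j \<in> Basis"
  shows "conv (gauss r) (pd j f) x = -2 * conv (egauss j r) f x"
proof -
  have [measurable]: "f \<in> borel_measurable borel" "pd j f \<in> borel_measurable borel"
    using test_borel[OF f] test_borel[OF test_pd[OF f j]] by auto
  obtain K where K: "\<And>x. \<bar>f x\<bar> \<le> K" using test_bounded[OF f] by auto
  obtain K' where K': "\<And>x. \<bar>pd j f x\<bar> \<le> K'" using test_bounded[OF test_pd[OF f j]] by auto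
  obtain R where R: "\<And>x. norm x > R \<Longrightarrow> f x = 0" using test_support[OF f] by blast
  have i1: "integrable lborel (\<lambda>y. egauss j r (x - y) * f y)" by (rule conv_integrable[OF egauss_integrable[OF r j]]) (use K in auto)
  have i2: "integrable lborel (\<lambda>y. gauss r (x - y) * pd j f y)" by (rule conv_integrable[OF gauss_integrable[OF r]]) (use K' in auto)
  have i0: "integrable lborel (\<lambda>y. gauss r (x - y) * f y)" by (rule conv_integrable[OF gauss_integrable[OF r]]) (use K in auto)
  let ?g = "\<lambda>y. 2 * (egauss j r (x - y) * f y) + gauss r (x - y) * pd j f y"
  define M where "M = 1 / (r powr (real DIM('a) / 2) * gauss_mass TYPE('a))"
  define M' where "M' = 2 powr (real DIM('a) / 2) * r powr (-1/2) * (1 / ((2*r) powr (real DIM('a) / 2) * gauss_mass TYPE('a)))"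
  have M: "\<bar>gauss r y\<bar> \<le> M" for y :: 'a unfolding M_def using gauss_le[OF r, of y] gauss_nonneg[of r y] by simp
  have M': "\<bar>egauss j r y\<bar> \<le> M'" for y unfolding M'_def
    by (rule order_trans[OF egauss_le[OF r j]]) (intro mult_left_mono gauss_le, use r in auto)
  have "(\<integral>y. ?g y \<partial>lborel) = 0"
  proof (rule integral_dir_deriv_zero[where f="\<lambda>y. gauss r (x - y) * f y" and j=j])
    fix y
    have gd: "((\<lambda>t. gauss r (x - (y + t *\<^sub>R j))) has_real_derivative 2 * egauss j r (x - y)) (at 0)"
    proof -
      have n: "(norm (x - (y + t *\<^sub>R j)))\<^sup>2 = (norm (x - y))\<^sup>2 - 2 * t * ((x - y) \<bullet> j) + t\<^sup>2" for t
        using j unfolding power2_norm_eq_inner by (simp add: algebra_simps inner_commute power2_eq_square)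
      show ?thesis unfolding gauss_def egauss_def n
        using r gauss_mass_pos[where 'a='a] by (auto intro!: derivative_eq_intros simp: field_simps)
    qed
    show "((\<lambda>t. gauss r (x - (y + t *\<^sub>R j)) * f (y + t *\<^sub>R j)) has_real_derivative ?g y) (at 0)"
      using DERIV_mult[OF gd test_dir_deriv[OF f j]] by (simp add: algebra_simps)
    show "\<bar>?g y\<bar> \<le> 2 * (M' * K) + M * K'"
    proof -
      have "\<bar>egauss j r (x - y) * f y\<bar> \<le> M' * K" "\<bar>gauss r (x - y) * pd j f y\<bar> \<le> M * K'"
        using M M' K K' unfolding abs_mult by (meson abs_ge_zero mult_mono order_trans)+
      thus ?thesis by linarith
    qed
  next
    show "\<And>y. R < norm y \<Longrightarrow> gauss r (x - y) * f y = 0" using R by auto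
  qed (use i0 in auto)
  hence "2 * conv (egauss j r) f x + conv (gauss r) (pd j f) x = 0"
    using i1 i2 by (simp add: conv_def)
  thus ?thesis by simp
qed

section \<open>Power weights on the half line\<close>

text \<open>The kernel of the fractional integral of order \<open>a\<close> in time, up to the factor \<open>1/Gamma a\<close>.
  Negative \<open>a\<close> is allowed, for weights on intervals that stay away from zero.\<close>

definition pw :: "real \<Rightarrow> real \<Rightarrow> real" where
  "pw a r = (if r > 0 then r powr (a - 1) else 0)"

lemma pw_measurable[measurable]: "pw a \<in> borel_measurable borel"
  unfolding pw_def by measurable

lemma pw_nonneg: "0 \<le> pw a r" by (simp add: pw_def)

lemma pw_pos: "r > 0 \<Longrightarrow> pw a r = r powr (a - 1)" by (simp add: pw_def)

lemma nn_pw_0: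
  assumes a: "a > 0" and T: "T > 0"
  shows "(\<integral>\<^sup>+r. ennreal (indicator {0<..<T} r * pw a r) \<partial>lborel) = ennreal (T powr a / a)"
proof (rule nn_integral_has_integral_lborel)
  have "((\<lambda>x. x powr (a - 1)) has_integral (T powr a / a)) {0..T}"
    using has_integral_powr_from_0[of "a - 1" T] a T by simp
  hence "((\<lambda>x. x powr (a - 1)) has_integral (T powr a / a)) {0<..<T}"
    by (simp add: has_integral_Icc_iff_Ioo)
  hence "((\<lambda>x. if x \<in> {0<..<T} then x powr (a - 1) else 0) has_integral (T powr a / a)) UNIV"
    by (simp only: has_integral_restrict_UNIV)
  thus "((\<lambda>r. indicator {0<..<T} r * pw a r) has_integral (T powr a / a)) UNIV"
    by (rule has_integral_eq[rotated]) (auto simp: pw_def)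
qed (auto simp: pw_nonneg)

lemma nn_pw_inf:
  assumes a: "a > 0" and T: "T > 0"
  shows "(\<integral>\<^sup>+r. ennreal (indicator {T<..} r * pw (- a) r) \<partial>lborel) = ennreal (T powr (- a) / a)"
proof -
  have lim: "((\<lambda>x. - (x powr (- a) / a)) \<longlongrightarrow> - (0 / a)) at_top"
    by (intro tendsto_intros tendsto_neg_powr filterlim_ident) (use a in auto)
  have "(\<integral>\<^sup>+r. ennreal (pw (- a) r) * indicator {T..} r \<partial>lborel) = ennreal (- (0 / a) - (- (T powr (- a) / a)))"
  proof (rule nn_integral_FTC_atLeast[OF _ _ _ lim])
    show "((\<lambda>x. - (x powr (- a) / a)) has_real_derivative pw (- a) x) (at x)" if "T \<le> x" for x
      using that T a by (auto intro!: derivative_eq_intros simp: pw_def)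
  qed (auto simp: pw_nonneg)
  moreover have "(\<integral>\<^sup>+r. ennreal (indicator {T<..} r * pw (- a) r) \<partial>lborel) = (\<integral>\<^sup>+r. ennreal (pw (- a) r) * indicator {T..} r \<partial>lborel)"
    by (rule nn_integral_cong_AE, use AE_lborel_singleton[of T] in eventually_elim) (auto simp: indicator_def)
  ultimately show ?thesis by simp
qed

lemma integrable_of_nn:
  fixes f :: "'x \<Rightarrow> real"
  assumes "f \<in> borel_measurable M" "\<And>x. 0 \<le> f x" "(\<integral>\<^sup>+x. ennreal (f x) \<partial>M) = ennreal c" "c \<ge> 0"
  shows "integrable M f" "(\<integral>x. f x \<partial>M) = c"
  using assms by (auto intro!: integrableI_nonneg simp: integral_eq_nn_integral)

lemma integrable_pw_0: "a > 0 \<Longrightarrow> T > 0 \<Longrightarrow> integrable lborel (\<lambda>r. indicator {0<..<T} r * pw a r)"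
  and integral_pw_0: "a > 0 \<Longrightarrow> T > 0 \<Longrightarrow> (\<integral>r. indicator {0<..<T} r * pw a r \<partial>lborel) = T powr a / a"
  using integrable_of_nn[OF _ _ nn_pw_0[of a T]] by (auto simp: pw_nonneg)

lemma integrable_pw_inf: "a > 0 \<Longrightarrow> T > 0 \<Longrightarrow> integrable lborel (\<lambda>r. indicator {T<..} r * pw (-a) r)"
  and integral_pw_inf: "a > 0 \<Longrightarrow> T > 0 \<Longrightarrow> (\<integral>r. indicator {T<..} r * pw (-a) r \<partial>lborel) = T powr (-a) / a"
  using integrable_of_nn[OF _ _ nn_pw_inf[of a T]] by (auto simp: pw_nonneg)

text \<open>For \<open>0 < b < 1\<close>, boundedness of \<open>B\<close> suffices near zero and decay like \<open>1/r\<close> at infinity.\<close>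

lemma integrable_pw_decay:
  assumes b: "0 < b" "b < 1" and [measurable]: "B \<in> borel_measurable borel"
    and K: "\<And>r. r > 0 \<Longrightarrow> \<bar>B r\<bar> \<le> K" "\<And>r. r > 0 \<Longrightarrow> \<bar>B r\<bar> \<le> K / r"
  shows "integrable lborel (\<lambda>r. pw b r * B r)"
proof (rule Bochner_Integration.integrable_bound)
  show "integrable lborel (\<lambda>r. K * (indicator {0<..<2} r * pw b r + indicator {1<..} r * pw (- (1 - b)) r))"
    using b by (intro integrable_mult_right Bochner_Integration.integrable_add integrable_pw_0 integrable_pw_inf) auto
  have K0: "K \<ge> 0" using K(1)[of 1] by simp
  show "AE r in lborel. norm (pw b r * B r) \<le> norm (K * (indicator {0<..<2} r * pw b r + indicator {1<..} r * pw (- (1 - b)) r))"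
  proof (rule AE_I2)
    fix r :: real
    show "norm (pw b r * B r) \<le> norm (K * (indicator {0<..<2} r * pw b r + indicator {1<..} r * pw (- (1 - b)) r))"
    proof (cases "r > 0")
      case True
      have "pw b r * \<bar>B r\<bar> \<le> K * (indicator {0<..<2} r * pw b r + indicator {1<..} r * pw (- (1 - b)) r)"
      proof (cases "r \<le> 1")
        case True
        have "pw b r * \<bar>B r\<bar> \<le> pw b r * K" using K(1)[OF \<open>r > 0\<close>] by (intro mult_left_mono pw_nonneg)
        thus ?thesis using True \<open>r > 0\<close> by (simp add: mult.commute)
      next
        case False
        have "pw b r * \<bar>B r\<bar> \<le> pw b r * (K / r)" using K(2)[OF \<open>r > 0\<close>] by (intro mult_left_mono pw_nonneg)
        also have "pw b r * (K / r) = K * pw (- (1 - b)) r" using \<open>r > 0\<close> by (simp add: pw_def powr_diff powr_minus field_simps power2_eq_square)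
        also have "\<dots> \<le> K * (indicator {0<..<2} r * pw b r + indicator {1<..} r * pw (- (1 - b)) r)"
          using False K0 by (intro mult_left_mono) (auto simp: pw_nonneg)
        finally show ?thesis .
      qed
      thus ?thesis using K0 by (simp add: abs_mult pw_nonneg)
    qed (simp add: pw_def)
  qed
qed measurable

section \<open>Composition of fractional integrals on the half line\<close>

lemma Beta_pos: "a > 0 \<Longrightarrow> b > 0 \<Longrightarrow> Beta a b > (0::real)"
  by (simp add: Beta_def)

text \<open>After scaling to \<open>z = 1\<close> this is Euler's Beta integral.\<close>

lemma nn_beta:
  assumes a: "a > 0" and b: "b > 0"
  shows "(\<integral>\<^sup>+r. ennreal (pw a r * pw b (z - r)) \<partial>lborel) = ennreal (Beta a b * pw (a + b) z)"
proof (cases "z > 0")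
  case False
  hence "pw a r * pw b (z - r) = 0" for r by (auto simp: pw_def)
  hence "(\<integral>\<^sup>+r. ennreal (pw a r * pw b (z - r)) \<partial>lborel) = 0" by (simp only: ennreal_0 nn_integral_const) simp
  thus ?thesis using False by (simp add: pw_def)
next
  case z: True
  have 1: "(\<integral>\<^sup>+t. ennreal (indicator {0<..<1} t * (t powr (a - 1) * (1 - t) powr (b - 1))) \<partial>lborel) = ennreal (Beta a b)"
  proof (rule nn_integral_has_integral_lborel)
    have "((\<lambda>t. t powr (a - 1) * (1 - t) powr (b - 1)) has_integral Beta a b) {0<..<1}"
      using has_integral_Beta_real[OF a b] by (simp add: has_integral_Icc_iff_Ioo)
    hence "((\<lambda>t. if t \<in> {0<..<1} then t powr (a - 1) * (1 - t) powr (b - 1) else 0) has_integral Beta a b) UNIV"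
      by (simp only: has_integral_restrict_UNIV)
    thus "((\<lambda>t. indicator {0<..<1} t * (t powr (a - 1) * (1 - t) powr (b - 1))) has_integral Beta a b) UNIV"
      by (rule has_integral_eq[rotated]) auto
  qed auto
  have "(\<integral>\<^sup>+r. ennreal (pw a r * pw b (z - r)) \<partial>lborel) = ennreal \<bar>z\<bar> * (\<integral>\<^sup>+t. ennreal (pw a (0 + z * t) * pw b (z - (0 + z * t))) \<partial>lborel)"
    by (rule nn_integral_real_affine) (use z in auto)
  also have "\<dots> = ennreal \<bar>z\<bar> * (\<integral>\<^sup>+t. ennreal (z powr (a + b - 2)) * ennreal (indicator {0<..<1} t * (t powr (a - 1) * (1 - t) powr (b - 1))) \<partial>lborel)"
  proof (intro arg_cong2[where f="(*)"] nn_integral_cong refl)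
    fix t :: real
    have "pw a (0 + z * t) * pw b (z - (0 + z * t)) = z powr (a + b - 2) * (indicator {0<..<1} t * (t powr (a - 1) * (1 - t) powr (b - 1)))"
    proof (cases "0 < t \<and> t < 1")
      case True
      hence "z - z * t = z * (1 - t)" "z * t > 0" "z * (1 - t) > 0" using z by (auto simp: algebra_simps)
      moreover have "z powr (a - 1) * z powr (b - 1) = z powr (a + b - 2)" using z by (simp add: powr_add[symmetric])
      ultimately show ?thesis using True z by (simp add: pw_def powr_mult mult_ac)
    next
      case False
      hence "\<not> (z * t > 0 \<and> z - z * t > 0)" using z by (auto simp: zero_less_mult_iff mult_less_cancel_left2)
      thus ?thesis using False by (auto simp: pw_def)
    qed
    thus "ennreal (pw a (0 + z * t) * pw b (z - (0 + z * t))) = ennreal (z powr (a + b - 2)) * ennreal (indicator {0<..<1} t * (t powr (a - 1) * (1 - t) powr (b - 1)))"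
      by (simp add: ennreal_mult)
  qed
  also have "\<dots> = ennreal \<bar>z\<bar> * (ennreal (z powr (a + b - 2)) * ennreal (Beta a b))"
    by (subst nn_integral_cmult) (use 1 in auto)
  also have "\<dots> = ennreal (z * z powr (a + b - 2) * Beta a b)"
    using z Beta_pos[OF a b] by (simp add: ennreal_mult[symmetric] mult.assoc)
  also have "z * z powr (a + b - 2) = pw (a + b) z" using z by (simp add: pw_def powr_mult_base)
  finally show ?thesis by (simp add: mult.commute)
qed

lemma nn_frac_compose:
  fixes f :: "real \<Rightarrow> ennreal"
  assumes a: "a > 0" and b: "b > 0" and [measurable]: "f \<in> borel_measurable borel"
  shows "(\<integral>\<^sup>+r. ennreal (pw a r) * (\<integral>\<^sup>+s. ennreal (pw b s) * f (r + s) \<partial>lborel) \<partial>lborel)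
    = ennreal (Beta a b) * (\<integral>\<^sup>+z. ennreal (pw (a + b) z) * f z \<partial>lborel)"
proof -
  have "(\<integral>\<^sup>+s. ennreal (pw b s) * f (r + s) \<partial>lborel) = (\<integral>\<^sup>+z. ennreal (pw b (z - r)) * f z \<partial>lborel)" for r
    by (subst nn_integral_real_affine[where c=1 and t="-r"]) auto
  hence "(\<integral>\<^sup>+r. ennreal (pw a r) * (\<integral>\<^sup>+s. ennreal (pw b s) * f (r + s) \<partial>lborel) \<partial>lborel)
    = (\<integral>\<^sup>+r. \<integral>\<^sup>+z. ennreal (pw a r * pw b (z - r)) * f z \<partial>lborel \<partial>lborel)"
    by (simp add: nn_integral_cmult[symmetric] ennreal_mult pw_nonneg mult.assoc)
  also have "\<dots> = (\<integral>\<^sup>+z. \<integral>\<^sup>+r. ennreal (pw a r * pw b (z - r)) * f z \<partial>lborel \<partial>lborel)"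
    by (rule lborel_pair.Fubini') measurable
  also have "\<dots> = (\<integral>\<^sup>+z. ennreal (Beta a b) * (ennreal (pw (a + b) z) * f z) \<partial>lborel)"
  proof (intro nn_integral_cong)
    fix z
    have "(\<integral>\<^sup>+r. ennreal (pw a r * pw b (z - r)) * f z \<partial>lborel) = ennreal (Beta a b * pw (a + b) z) * f z"
      by (subst nn_integral_multc) (auto simp: nn_beta[OF a b])
    thus "(\<integral>\<^sup>+r. ennreal (pw a r * pw b (z - r)) * f z \<partial>lborel) = ennreal (Beta a b) * (ennreal (pw (a + b) z) * f z)"
      using Beta_pos[OF a b] by (simp add: ennreal_mult pw_nonneg mult.assoc)
  qed
  also have "\<dots> = ennreal (Beta a b) * (\<integral>\<^sup>+z. ennreal (pw (a + b) z) * f z \<partial>lborel)"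
    by (subst nn_integral_cmult) auto
  finally show ?thesis .
qed

text \<open>Fubini's theorem and \<open>nn_beta\<close>: the fractional integral of order \<open>a\<close> of the one of order \<open>b\<close> is,
  up to the factor \<open>Beta a b\<close>, the one of order \<open>a + b\<close>.\<close>

lemma frac_compose:
  fixes f :: "real \<Rightarrow> real"
  assumes a: "a > 0" and b: "b > 0" and [measurable]: "f \<in> borel_measurable borel"
    and int: "integrable lborel (\<lambda>z. pw (a + b) z * f z)"
  shows "(\<integral>r. pw a r * (\<integral>s. pw b s * f (r + s) \<partial>lborel) \<partial>lborel) = Beta a b * (\<integral>z. pw (a + b) z * f z \<partial>lborel)"
proof -
  have ib: "integrable lborel (\<lambda>r. pw a r * pw b (z - r))" "(\<integral>r. pw a r * pw b (z - r) \<partial>lborel) = Beta a b * pw (a + b) z" for z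
    using integrable_of_nn[OF _ _ nn_beta[OF a b, of z]] Beta_pos[OF a b] by (auto simp: pw_nonneg)
  have swap: "(\<integral>z. \<integral>r. pw a r * pw b (z - r) * f z \<partial>lborel \<partial>lborel) = (\<integral>r. \<integral>z. pw a r * pw b (z - r) * f z \<partial>lborel \<partial>lborel)"
  proof (rule fubini_dominated(1))
    show "AE z in lborel. integrable lborel (\<lambda>r. pw a r * pw b (z - r) * f z)" using ib(1) by auto
    show "integrable lborel (\<lambda>z. Beta a b * \<bar>pw (a + b) z * f z\<bar>)" using int by simp
    show "AE z in lborel. (\<integral>r. \<bar>pw a r * pw b (z - r) * f z\<bar> \<partial>lborel) \<le> Beta a b * \<bar>pw (a + b) z * f z\<bar>"
      using ib(2) by (auto simp: abs_mult pw_nonneg)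
  qed measurable
  have "(\<integral>s. pw b s * f (r + s) \<partial>lborel) = (\<integral>z. pw b (z - r) * f z \<partial>lborel)" for r
    by (subst lborel_integral_real_affine[where c=1 and t="-r"]) auto
  hence "(\<integral>r. pw a r * (\<integral>s. pw b s * f (r + s) \<partial>lborel) \<partial>lborel) = (\<integral>r. \<integral>z. pw a r * pw b (z - r) * f z \<partial>lborel \<partial>lborel)"
    by (simp add: mult.assoc)
  also have "\<dots> = (\<integral>z. \<integral>r. pw a r * pw b (z - r) * f z \<partial>lborel \<partial>lborel)"
    by (rule swap[symmetric])
  also have "\<dots> = Beta a b * (\<integral>z. pw (a + b) z * f z \<partial>lborel)"
    using ib(2) by (simp add: mult.assoc[of "Beta a b"])
  finally show ?thesis .
qed

text \<open>The integral of order \<open>b\<close> is rewritten as the integral of order \<open>b - \<alpha>\<close> of \<open>A\<close>, the integral of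
  order \<open>\<alpha>\<close> of \<open>B\<close>. The times \<open>r < T\<close> are kept in this form; for \<open>r \<ge> T\<close> the definition of \<open>A\<close>
  is inserted again, which involves \<open>B\<close> at times greater than \<open>T\<close> only, and the composition rule
  is undone. In \<open>frac_gradient_pointwise\<close>, \<open>A r\<close> is the heat flow of the gradient of order \<open>s\<close>
  and \<open>B r\<close> that of the classical gradient.\<close>

lemma near_far_split:
  fixes A B :: "real \<Rightarrow> real"
  assumes al: "\<alpha> > 0" "\<alpha> < b" and [measurable]: "B \<in> borel_measurable borel"
    and int: "integrable lborel (\<lambda>z. pw b z * B z)"
    and A: "\<And>r. r > 0 \<Longrightarrow> A r = (\<integral>s. pw \<alpha> s * B (r + s) \<partial>lborel)" and T: "T > 0"
  shows "ennreal \<bar>\<integral>z. pw b z * B z \<partial>lborel\<bar> \<le>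
     ennreal (1 / Beta (b - \<alpha>) \<alpha>) * (\<integral>\<^sup>+r. ennreal (indicator {0<..<T} r * pw (b - \<alpha>) r * \<bar>A r\<bar>) \<partial>lborel)
     + (\<integral>\<^sup>+z. ennreal (indicator {T<..} z * pw b z * \<bar>B z\<bar>) \<partial>lborel)"
proof -
  define a where "a = b - \<alpha>"
  have a: "a > 0" "a + \<alpha> = b" using al by (auto simp: a_def)
  define c where "c = Beta a \<alpha>"
  have c: "c > 0" using Beta_pos[OF a(1) al(1)] by (simp add: c_def)
  define F where "F = (\<integral>z. pw b z * B z \<partial>lborel)"
  let ?A = "\<lambda>r. \<integral>s. pw \<alpha> s * B (r + s) \<partial>lborel"
  have Am[measurable]: "?A \<in> borel_measurable borel"
  proof -
    have "(\<lambda>(r, s). pw \<alpha> s * B (r + s)) \<in> borel_measurable (borel \<Otimes>\<^sub>M lborel)" by measurable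
    from lborel.borel_measurable_lebesgue_integral[OF this] show ?thesis by simp
  qed
  have "c * F = (\<integral>r. pw a r * ?A r \<partial>lborel)"
    unfolding c_def F_def using frac_compose[OF a(1) al(1), of B] int a(2) by simp
  hence "ennreal \<bar>c * F\<bar> \<le> (\<integral>\<^sup>+r. ennreal \<bar>pw a r * ?A r\<bar> \<partial>lborel)" by (simp only: abs_integral_le_nn)
  also have "\<dots> = (\<integral>\<^sup>+r. ennreal (indicator {0<..<T} r * pw a r * \<bar>?A r\<bar>) + ennreal (indicator {T..} r * pw a r * \<bar>?A r\<bar>) \<partial>lborel)"
    by (intro nn_integral_cong) (auto simp: indicator_def pw_def abs_mult)
  also have "\<dots> = (\<integral>\<^sup>+r. ennreal (indicator {0<..<T} r * pw a r * \<bar>?A r\<bar>) \<partial>lborel) + (\<integral>\<^sup>+r. ennreal (indicator {T..} r * pw a r * \<bar>?A r\<bar>) \<partial>lborel)"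
    by (intro nn_integral_add) auto
  also have "(\<integral>\<^sup>+r. ennreal (indicator {T..} r * pw a r * \<bar>?A r\<bar>) \<partial>lborel)
      \<le> (\<integral>\<^sup>+r. ennreal (pw a r) * (\<integral>\<^sup>+s. ennreal (pw \<alpha> s) * ennreal (indicator {T<..} (r + s) * \<bar>B (r + s)\<bar>) \<partial>lborel) \<partial>lborel)"
  proof (intro nn_integral_mono)
    fix r
    show "ennreal (indicator {T..} r * pw a r * \<bar>?A r\<bar>) \<le> ennreal (pw a r) * (\<integral>\<^sup>+s. ennreal (pw \<alpha> s) * ennreal (indicator {T<..} (r + s) * \<bar>B (r + s)\<bar>) \<partial>lborel)"
    proof (cases "r \<ge> T")
      case True
      have "ennreal \<bar>?A r\<bar> \<le> (\<integral>\<^sup>+s. ennreal \<bar>pw \<alpha> s * B (r + s)\<bar> \<partial>lborel)" by (rule abs_integral_le_nn)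
      also have "\<dots> \<le> (\<integral>\<^sup>+s. ennreal (pw \<alpha> s) * ennreal (indicator {T<..} (r + s) * \<bar>B (r + s)\<bar>) \<partial>lborel)"
        using True by (intro nn_integral_mono) (auto simp: indicator_def pw_def abs_mult ennreal_mult)
      finally have *: "ennreal \<bar>?A r\<bar> \<le> (\<integral>\<^sup>+s. ennreal (pw \<alpha> s) * ennreal (indicator {T<..} (r + s) * \<bar>B (r + s)\<bar>) \<partial>lborel)" .
      have "ennreal (indicator {T..} r * pw a r * \<bar>?A r\<bar>) = ennreal (pw a r) * ennreal \<bar>?A r\<bar>"
        using True by (simp add: ennreal_mult pw_nonneg)
      also have "\<dots> \<le> ennreal (pw a r) * (\<integral>\<^sup>+s. ennreal (pw \<alpha> s) * ennreal (indicator {T<..} (r + s) * \<bar>B (r + s)\<bar>) \<partial>lborel)"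
        by (rule mult_left_mono[OF *]) simp
      finally show ?thesis .
    qed simp
  qed
  also have "\<dots> = ennreal c * (\<integral>\<^sup>+z. ennreal (pw b z) * ennreal (indicator {T<..} z * \<bar>B z\<bar>) \<partial>lborel)"
    unfolding c_def using nn_frac_compose[OF a(1) al(1), of "\<lambda>z. ennreal (indicator {T<..} z * \<bar>B z\<bar>)"] a(2) by simp
  also have "(\<integral>\<^sup>+z. ennreal (pw b z) * ennreal (indicator {T<..} z * \<bar>B z\<bar>) \<partial>lborel) = (\<integral>\<^sup>+z. ennreal (indicator {T<..} z * pw b z * \<bar>B z\<bar>) \<partial>lborel)"
    by (intro nn_integral_cong) (auto simp: ennreal_mult[symmetric] pw_nonneg mult_ac)
  also have "(\<integral>\<^sup>+r. ennreal (indicator {0<..<T} r * pw a r * \<bar>?A r\<bar>) \<partial>lborel) = (\<integral>\<^sup>+r. ennreal (indicator {0<..<T} r * pw a r * \<bar>A r\<bar>) \<partial>lborel)"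
    by (intro nn_integral_cong) (auto simp: indicator_def A)
  finally have main: "ennreal \<bar>c * F\<bar> \<le> (\<integral>\<^sup>+r. ennreal (indicator {0<..<T} r * pw a r * \<bar>A r\<bar>) \<partial>lborel)
      + ennreal c * (\<integral>\<^sup>+z. ennreal (indicator {T<..} z * pw b z * \<bar>B z\<bar>) \<partial>lborel)" by (simp add: add_left_mono)
  have "ennreal \<bar>F\<bar> = ennreal (1 / c) * ennreal \<bar>c * F\<bar>" using c by (simp add: ennreal_mult[symmetric] abs_mult)
  also have "\<dots> \<le> ennreal (1 / c) * ((\<integral>\<^sup>+r. ennreal (indicator {0<..<T} r * pw a r * \<bar>A r\<bar>) \<partial>lborel)
      + ennreal c * (\<integral>\<^sup>+z. ennreal (indicator {T<..} z * pw b z * \<bar>B z\<bar>) \<partial>lborel))"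
    by (rule mult_left_mono[OF main]) simp
  also have "\<dots> = ennreal (1 / c) * (\<integral>\<^sup>+r. ennreal (indicator {0<..<T} r * pw a r * \<bar>A r\<bar>) \<partial>lborel)
      + (\<integral>\<^sup>+z. ennreal (indicator {T<..} z * pw b z * \<bar>B z\<bar>) \<partial>lborel)"
    using c by (simp add: distrib_left mult.assoc[symmetric] ennreal_mult[symmetric])
  finally show ?thesis unfolding F_def c_def a_def .
qed

section \<open>Riesz kernels as superpositions of Gaussians\<close>

text \<open>The exponential series dominates each of its terms.\<close>

lemma powr_exp_bounded: "\<exists>C\<ge>0. \<forall>u::real. 0 < u \<longrightarrow> u \<le> 1 \<longrightarrow> u powr (- m) * exp (- (1 / u)) \<le> C"
proof -
  obtain n :: nat where n: "m \<le> real n" using real_arch_simple by blast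
  have "u powr (- m) * exp (- (1 / u)) \<le> fact n" if u: "0 < u" "u \<le> 1" for u :: real
  proof -
    have "u powr (- m) \<le> u powr (- real n)" using n u by (intro powr_mono') auto
    also have "\<dots> = (1/u) ^ n" using u by (simp add: powr_minus powr_realpow power_one_over inverse_eq_divide)
    finally have 1: "u powr (- m) \<le> (1/u) ^ n" .
    have "(1/u) ^ n / fact n \<le> exp (1 / u)"
    proof -
      have s: "(\<lambda>k. (1/u) ^ k /\<^sub>R fact k) sums exp (1/u)" by (rule exp_converges)
      have "(1/u) ^ n /\<^sub>R fact n \<le> exp (1/u)"
        using sum_le_suminf[OF sums_summable[OF s], of "{n}"] u sums_unique[OF s] by simp
      thus ?thesis by (simp add: divide_inverse mult.commute)
    qed
    hence "fact n * ((1/u) ^ n / fact n) \<le> fact n * exp (1 / u)" by (intro mult_left_mono) auto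
    hence "(1/u) ^ n \<le> fact n * exp (1 / u)" by simp
    with 1 have "u powr (- m) \<le> fact n * exp (1 / u)" by linarith
    hence "u powr (- m) * exp (- (1 / u)) \<le> fact n * exp (1 / u) * exp (- (1 / u))" by (intro mult_right_mono) auto
    also have "\<dots> = fact n" by (simp add: exp_minus)
    finally show ?thesis .
  qed
  thus ?thesis by (intro exI[of _ "fact n"]) auto
qed

text \<open>Substituting \<open>r = |z|\<^sup>2 u\<close> extracts the power of \<open>|z|\<close> and leaves an integral over \<open>u\<close> that
  depends on \<open>\<gamma>\<close> only. It converges at zero for every \<open>\<gamma>\<close>, because of the exponential, and at
  infinity because \<open>\<gamma> < d/2\<close>. The Riesz transform uses a negative \<open>\<gamma>\<close>.\<close>

lemma riesz_kernel_gauss: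
  fixes \<gamma> :: real
  assumes g: "\<gamma> < real DIM('a) / 2"
  shows "\<exists>\<kappa>>0. \<forall>z::'a::euclidean_space. z \<noteq> 0 \<longrightarrow>
    (\<integral>\<^sup>+r. ennreal (pw \<gamma> r * gauss r z) \<partial>lborel) = ennreal (\<kappa> * norm z powr (2 * \<gamma> - real DIM('a)))"
proof -
  define h where "h = real DIM('a) / 2"
  define f where "f u = (if u > 0 then u powr (\<gamma> - 1 - h) * exp (- (1 / u)) / gauss_mass TYPE('a) else 0)" for u :: real
  have [measurable]: "f \<in> borel_measurable borel" unfolding f_def by measurable
  have f0: "f u \<ge> 0" for u using gauss_mass_pos[where 'a='a] by (auto simp: f_def)
  define k where "k = (\<integral>\<^sup>+u. ennreal (f u) \<partial>lborel)"
  have "k < \<infinity>"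
  proof -
    obtain C where C: "C \<ge> 0" "\<And>u::real. 0 < u \<Longrightarrow> u \<le> 1 \<Longrightarrow> u powr (- (1 + h - \<gamma>)) * exp (- (1 / u)) \<le> C"
      using powr_exp_bounded by blast
    have "k \<le> (\<integral>\<^sup>+u. ennreal (C / gauss_mass TYPE('a)) * indicator {0..1} u + ennreal (1 / gauss_mass TYPE('a)) * ennreal (indicator {1<..} u * pw (- (h - \<gamma>)) u) \<partial>lborel)"
      unfolding k_def
    proof (intro nn_integral_mono)
      fix u :: real
      consider "u \<le> 0" | "0 < u" "u \<le> 1" | "u > 1" by linarith
      thus "ennreal (f u) \<le> ennreal (C / gauss_mass TYPE('a)) * indicator {0..1} u + ennreal (1 / gauss_mass TYPE('a)) * ennreal (indicator {1<..} u * pw (- (h - \<gamma>)) u)"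
      proof cases
        case 2
        have "u powr (\<gamma> - 1 - h) * exp (- (1 / u)) \<le> C" using C(2)[OF 2] by (simp add: algebra_simps)
        hence "f u \<le> C / gauss_mass TYPE('a)" using 2 gauss_mass_pos[where 'a='a] by (simp add: f_def divide_right_mono)
        thus ?thesis using 2 by (simp add: ennreal_leI)
      next
        case 3
        have "u powr (\<gamma> - 1 - h) * exp (- (1 / u)) \<le> u powr (\<gamma> - 1 - h) * 1" using 3 by (intro mult_left_mono) auto
        hence "f u \<le> 1 / gauss_mass TYPE('a) * pw (- (h - \<gamma>)) u"
          using 3 gauss_mass_pos[where 'a='a] by (simp add: f_def pw_def divide_right_mono algebra_simps)
        thus ?thesis using 3 gauss_mass_pos[where 'a='a] by (simp add: ennreal_mult[symmetric] pw_nonneg ennreal_leI)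
      qed (simp add: f_def)
    qed
    also have "\<dots> < \<infinity>"
      using nn_pw_inf[of "h - \<gamma>" 1] g by (subst nn_integral_add) (auto simp: nn_integral_cmult h_def ennreal_mult_less_top)
    finally show ?thesis .
  qed
  moreover have "k \<noteq> 0"
  proof
    assume "k = 0"
    hence "AE u in lborel. f u = 0" unfolding k_def by (subst (asm) nn_integral_0_iff_AE) (auto simp: ennreal_eq_0_iff f0 antisym elim!: eventually_mono)
    hence "AE u in lborel. u \<notin> {0<..<1::real}" using gauss_mass_pos[where 'a='a] by (auto simp: f_def elim!: eventually_mono)
    hence "emeasure lborel {0<..<1::real} = 0" by (subst (asm) AE_iff_measurable[of "{0<..<1}"]) auto
    thus False by simp
  qed
  ultimately obtain \<kappa> where k: "k = ennreal \<kappa>" "\<kappa> > 0" by (cases k) (auto simp: less_le)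
  have "(\<integral>\<^sup>+r. ennreal (pw \<gamma> r * gauss r z) \<partial>lborel) = ennreal (\<kappa> * norm z powr (2 * \<gamma> - real DIM('a)))" if z: "z \<noteq> 0" for z :: 'a
  proof -
    define n where "n = norm z"
    have n: "n > 0" using z by (simp add: n_def)
    have "(\<integral>\<^sup>+r. ennreal (pw \<gamma> r * gauss r z) \<partial>lborel) = ennreal \<bar>n\<^sup>2\<bar> * (\<integral>\<^sup>+u. ennreal (pw \<gamma> (0 + n\<^sup>2 * u) * gauss (0 + n\<^sup>2 * u) z) \<partial>lborel)"
      by (rule nn_integral_real_affine) (use n in auto)
    also have "\<dots> = ennreal (n\<^sup>2) * (\<integral>\<^sup>+u. ennreal (n powr (2 * \<gamma> - 2 - 2 * h)) * ennreal (f u) \<partial>lborel)"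
    proof -
      have "pw \<gamma> (0 + n\<^sup>2 * u) * gauss (0 + n\<^sup>2 * u) z = n powr (2 * \<gamma> - 2 - 2 * h) * f u" for u
      proof (cases "u > 0")
        case True
        have n2: "n\<^sup>2 powr c = n powr (2 * c)" for c using n powr_powr[of n 2 c] by simp
        have e: "- (norm z)\<^sup>2 / (n\<^sup>2 * u) = - (1 / u)" using n by (simp add: n_def)
        have "pw \<gamma> (n\<^sup>2 * u) * gauss (n\<^sup>2 * u) z = (n powr (2 * (\<gamma> - 1)) * u powr (\<gamma> - 1)) * exp (- (1 / u)) / (n powr (2 * h) * u powr h * gauss_mass TYPE('a))"
          using True n unfolding gauss_def e by (simp add: pw_def powr_mult n2 h_def)
        also have "\<dots> = (n powr (2 * (\<gamma> - 1)) / n powr (2 * h)) * (u powr (\<gamma> - 1) / u powr h) * exp (- (1 / u)) / gauss_mass TYPE('a)"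
          by simp
        also have "\<dots> = n powr (2 * \<gamma> - 2 - 2 * h) * f u"
          using True by (simp add: f_def powr_diff[symmetric] algebra_simps)
        finally show ?thesis by simp
      next
        case False
        thus ?thesis using n by (simp add: pw_def f_def zero_less_mult_iff)
      qed
      thus ?thesis by (simp add: ennreal_mult f0)
    qed
    also have "\<dots> = ennreal (n\<^sup>2) * (ennreal (n powr (2 * \<gamma> - 2 - 2 * h)) * ennreal \<kappa>)"
      by (subst nn_integral_cmult) (auto simp: k(1)[symmetric] k_def)
    also have "\<dots> = ennreal (\<kappa> * (n\<^sup>2 * n powr (2 * \<gamma> - 2 - 2 * h)))"
      using k by (simp add: ennreal_mult[symmetric] mult_ac)
    also have "n\<^sup>2 * n powr (2 * \<gamma> - 2 - 2 * h) = n powr (2 * \<gamma> - real DIM('a))"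
    proof -
      have "n\<^sup>2 = n powr 2" using n by simp
      thus ?thesis by (simp only: powr_add[symmetric]) (simp add: h_def)
    qed
    finally show ?thesis by (simp add: n_def)
  qed
  with k show ?thesis by blast
qed

section \<open>Fractional gradients of test functions as time integrals of heat flows\<close>

lemma riesz_kernel_fubini:
  fixes q :: "'a::euclidean_space \<Rightarrow> real"
  assumes k: "\<kappa> > 0" "\<And>z::'a. z \<noteq> 0 \<Longrightarrow> (\<integral>\<^sup>+r. ennreal (pw \<gamma> r * gauss r z) \<partial>lborel) = ennreal (\<kappa> * norm z powr (2 * \<gamma> - real DIM('a)))"
    and [measurable]: "q \<in> borel_measurable borel"
    and int: "integrable lborel (\<lambda>z. norm z powr (2 * \<gamma> - real DIM('a)) * q z)"
  shows "(\<integral>z. norm z powr (2 * \<gamma> - real DIM('a)) * q z \<partial>lborel) = (1 / \<kappa>) * (\<integral>r. pw \<gamma> r * (\<integral>z. gauss r z * q z \<partial>lborel) \<partial>lborel)"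
proof -
  have ib: "integrable lborel (\<lambda>r. pw \<gamma> r * gauss r z)" "(\<integral>r. pw \<gamma> r * gauss r z \<partial>lborel) = \<kappa> * norm z powr (2 * \<gamma> - real DIM('a))"
    if "z \<noteq> 0" for z :: 'a
    using integrable_of_nn[OF _ _ k(2)[OF that]] k(1) by (auto simp: pw_nonneg gauss_nonneg)
  have nz: "AE z::'a in lborel. z \<noteq> 0" by (rule AE_lborel_singleton)
  have swap: "(\<integral>z. \<integral>r. pw \<gamma> r * gauss r z * q z \<partial>lborel \<partial>lborel) = (\<integral>r. \<integral>z. pw \<gamma> r * gauss r z * q z \<partial>lborel \<partial>lborel)"
  proof (rule fubini_dominated(1))
    show "AE z::'a in lborel. integrable lborel (\<lambda>r. pw \<gamma> r * gauss r z * q z)"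
      using nz by eventually_elim (auto intro!: integrable_mult_left ib)
    show "integrable lborel (\<lambda>z. \<kappa> * norm (norm z powr (2 * \<gamma> - real DIM('a)) * q z))" using int by simp
    show "AE z::'a in lborel. (\<integral>r. \<bar>pw \<gamma> r * gauss r z * q z\<bar> \<partial>lborel) \<le> \<kappa> * norm (norm z powr (2 * \<gamma> - real DIM('a)) * q z)"
      using nz by eventually_elim (auto simp: abs_mult pw_nonneg gauss_nonneg ib)
  qed measurable
  have "(\<integral>r. pw \<gamma> r * (\<integral>z. gauss r z * q z \<partial>lborel) \<partial>lborel) = (\<integral>r. \<integral>z. pw \<gamma> r * gauss r z * q z \<partial>lborel \<partial>lborel)"
    by (simp add: mult.assoc)
  also have "\<dots> = (\<integral>z. \<integral>r. pw \<gamma> r * gauss r z * q z \<partial>lborel \<partial>lborel)"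
    by (rule swap[symmetric])
  also have "\<dots> = (\<integral>z. \<kappa> * (norm z powr (2 * \<gamma> - real DIM('a)) * q z) \<partial>lborel)"
    by (rule integral_cong_AE) (use nz in \<open>measurable, eventually_elim, auto simp: ib\<close>)
  finally show ?thesis using k(1) by simp
qed

text \<open>The Gaussian representation again: over a ball, \<open>gauss r\<close> has integral at most \<open>1\<close> and at most a
  multiple of \<open>r powr (-d/2)\<close>, so the time integral converges at zero for \<open>\<gamma> > 0\<close> and at
  infinity for \<open>\<gamma> < d/2\<close>.\<close>

lemma riesz_kernel_locally_integrable:
  fixes \<gamma> :: real
  assumes g: "0 < \<gamma>" "\<gamma> < real DIM('a) / 2"
  shows "integrable lborel (\<lambda>z::'a::euclidean_space. indicator (cball 0 R) z * norm z powr (2 * \<gamma> - real DIM('a)))"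
proof -
  obtain \<kappa> where k: "\<kappa> > 0" "\<And>z::'a. z \<noteq> 0 \<Longrightarrow> (\<integral>\<^sup>+r. ennreal (pw \<gamma> r * gauss r z) \<partial>lborel) = ennreal (\<kappa> * norm z powr (2 * \<gamma> - real DIM('a)))"
    using riesz_kernel_gauss[OF g(2)] by blast
  define V where "V = measure lborel (cball (0::'a) R)"
  have V: "emeasure lborel (cball (0::'a) R) = ennreal V"
    unfolding V_def using emeasure_lborel_cball_finite[of "0::'a" R] by (simp add: emeasure_eq_ennreal_measure)
  define h where "h = real DIM('a) / 2"
  define c where "c = V / gauss_mass TYPE('a)"
  have c: "c \<ge> 0" unfolding c_def V_def using gauss_mass_pos[where 'a='a] by simp
  have inner: "(\<integral>\<^sup>+z. ennreal (gauss r z) * indicator (cball (0::'a) R) z \<partial>lborel) \<le> ennreal (c * r powr (- h))" if r: "r > 0" for r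
  proof -
    have "(\<integral>\<^sup>+z. ennreal (gauss r z) * indicator (cball (0::'a) R) z \<partial>lborel) \<le> (\<integral>\<^sup>+z. ennreal (1 / (r powr h * gauss_mass TYPE('a))) * indicator (cball (0::'a) R) z \<partial>lborel)"
      using gauss_le[OF r, where 'a='a] by (intro nn_integral_mono mult_right_mono ennreal_leI) (auto simp: h_def)
    also have "\<dots> = ennreal (1 / (r powr h * gauss_mass TYPE('a))) * ennreal V" by (subst nn_integral_cmult_indicator) (auto simp: V)
    also have "\<dots> = ennreal (c * r powr (- h))" using gauss_mass_pos[where 'a='a]
      by (simp add: ennreal_mult[symmetric] c_def V_def powr_minus field_simps)
    finally show ?thesis .
  qed
  have inner1: "(\<integral>\<^sup>+z. ennreal (gauss r z) * indicator (cball (0::'a) R) z \<partial>lborel) \<le> 1" if r: "r > 0" for r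
  proof -
    have "(\<integral>\<^sup>+z. ennreal (gauss r z) * indicator (cball (0::'a) R) z \<partial>lborel) \<le> (\<integral>\<^sup>+z. ennreal (gauss r (z::'a)) \<partial>lborel)"
      by (intro nn_integral_mono) (auto simp: indicator_def)
    also have "\<dots> = ennreal 1" using nn_integral_eq_integral[OF gauss_integrable[OF r, where 'a='a]] gauss_integral[OF r, where 'a='a] by (simp add: gauss_nonneg)
    finally show ?thesis by simp
  qed
  show ?thesis
  proof (rule integrableI_bounded)
    have "ennreal \<kappa> * (\<integral>\<^sup>+(z::'a). ennreal (norm (indicator (cball 0 R) z * norm z powr (2 * \<gamma> - real DIM('a)))) \<partial>lborel)
       = (\<integral>\<^sup>+(z::'a). ennreal (\<kappa> * norm z powr (2 * \<gamma> - real DIM('a))) * indicator (cball 0 R) z \<partial>lborel)"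
      by (subst nn_integral_cmult[symmetric]) (use k(1) in \<open>auto intro!: nn_integral_cong simp: ennreal_mult indicator_def\<close>)
    also have "\<dots> = (\<integral>\<^sup>+(z::'a). (\<integral>\<^sup>+r. ennreal (pw \<gamma> r * gauss r z) * indicator (cball 0 R) z \<partial>lborel) \<partial>lborel)"
      by (rule nn_integral_cong_AE, use AE_lborel_singleton[of "0::'a"] in eventually_elim) (simp add: k(2) nn_integral_multc)
    also have "\<dots> = (\<integral>\<^sup>+r. (\<integral>\<^sup>+(z::'a). ennreal (pw \<gamma> r * gauss r z) * indicator (cball 0 R) z \<partial>lborel) \<partial>lborel)"
    proof (rule lborel_pair.Fubini')
      have [measurable]: "(indicator (cball (0::'a) R) :: 'a \<Rightarrow> ennreal) \<in> borel_measurable borel"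
        by (intro borel_measurable_indicator borel_closed closed_cball)
      show "(\<lambda>(r, z). ennreal (pw \<gamma> r * gauss r z) * indicator (cball 0 R) z) \<in> borel_measurable (lborel \<Otimes>\<^sub>M lborel)"
        unfolding case_prod_unfold
        by (intro borel_measurable_times_ennreal measurable_compose[OF measurable_snd borel_measurable_indicator]) measurable
    qed
    also have "\<dots> = (\<integral>\<^sup>+r. ennreal (pw \<gamma> r) * (\<integral>\<^sup>+(z::'a). ennreal (gauss r z) * indicator (cball 0 R) z \<partial>lborel) \<partial>lborel)"
    proof (intro nn_integral_cong)
      fix r :: real
      have "(\<integral>\<^sup>+(z::'a). ennreal (pw \<gamma> r * gauss r z) * indicator (cball 0 R) z \<partial>lborel) = (\<integral>\<^sup>+(z::'a). ennreal (pw \<gamma> r) * (ennreal (gauss r z) * indicator (cball 0 R) z) \<partial>lborel)"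
        by (simp only: ennreal_mult pw_nonneg gauss_nonneg mult.assoc)
      also have "\<dots> = ennreal (pw \<gamma> r) * (\<integral>\<^sup>+(z::'a). ennreal (gauss r z) * indicator (cball 0 R) z \<partial>lborel)"
      proof (rule nn_integral_cmult)
        have [measurable]: "(indicator (cball (0::'a) R) :: 'a \<Rightarrow> ennreal) \<in> borel_measurable lborel"
          by (intro borel_measurable_indicator) simp
        show "(\<lambda>z::'a. ennreal (gauss r z) * indicator (cball 0 R) z) \<in> borel_measurable lborel"
          by (intro borel_measurable_times_ennreal) measurable
      qed
      finally show "(\<integral>\<^sup>+(z::'a). ennreal (pw \<gamma> r * gauss r z) * indicator (cball 0 R) z \<partial>lborel) = ennreal (pw \<gamma> r) * (\<integral>\<^sup>+(z::'a). ennreal (gauss r z) * indicator (cball 0 R) z \<partial>lborel)" .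
    qed
    also have "\<dots> \<le> (\<integral>\<^sup>+r. ennreal (indicator {0<..<2} r * pw \<gamma> r) + ennreal c * ennreal (indicator {1<..} r * pw (- (h - \<gamma>)) r) \<partial>lborel)"
    proof (intro nn_integral_mono)
      fix r :: real
      consider "r \<le> 0" | "0 < r" "r \<le> 1" | "r > 1" by linarith
      thus "ennreal (pw \<gamma> r) * (\<integral>\<^sup>+(z::'a). ennreal (gauss r z) * indicator (cball 0 R) z \<partial>lborel) \<le> ennreal (indicator {0<..<2} r * pw \<gamma> r) + ennreal c * ennreal (indicator {1<..} r * pw (- (h - \<gamma>)) r)"
      proof cases
        case 2
        have "ennreal (pw \<gamma> r) * (\<integral>\<^sup>+(z::'a). ennreal (gauss r z) * indicator (cball 0 R) z \<partial>lborel) \<le> ennreal (pw \<gamma> r) * 1"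
          using inner1[OF 2(1)] by (intro mult_left_mono) auto
        thus ?thesis using 2 by simp
      next
        case 3
        have "ennreal (pw \<gamma> r) * (\<integral>\<^sup>+(z::'a). ennreal (gauss r z) * indicator (cball 0 R) z \<partial>lborel) \<le> ennreal (pw \<gamma> r) * ennreal (c * r powr (- h))"
          using inner[of r] 3 by (intro mult_left_mono) auto
        also have "\<dots> = ennreal c * ennreal (indicator {1<..} r * pw (- (h - \<gamma>)) r)"
        proof -
          have "r powr (\<gamma> - 1) * r powr (- h) = r powr ((\<gamma> - 1) + (- h))" by (rule powr_add[symmetric])
          also have "(\<gamma> - 1) + (- h) = - (h - \<gamma>) - 1" by simp
          finally have "pw \<gamma> r * (c * r powr (- h)) = c * pw (- (h - \<gamma>)) r" using 3 by (simp add: pw_def mult_ac)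
          thus ?thesis using 3 c by (simp add: ennreal_mult[symmetric] pw_nonneg del: minus_diff_eq)
        qed
        finally show ?thesis by (simp add: add_increasing)
      qed (simp add: pw_def)
    qed
    also have "\<dots> < \<infinity>"
      using nn_pw_0[of \<gamma> 2] nn_pw_inf[of "h - \<gamma>" 1] g by (subst nn_integral_add) (auto simp: nn_integral_cmult h_def ennreal_mult_less_top)
    finally show "(\<integral>\<^sup>+(z::'a). ennreal (norm (indicator (cball 0 R) z * norm z powr (2 * \<gamma> - real DIM('a)))) \<partial>lborel) < \<infinity>"
      using k(1) by (auto simp: ennreal_mult_less_top ennreal_eq_0_iff)
    show "(\<lambda>z::'a. indicator (cball 0 R) z * norm z powr (2 * \<gamma> - real DIM('a))) \<in> borel_measurable lborel"
      by (intro borel_measurable_times borel_measurable_indicator) (simp, measurable)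
  qed
qed

lemma locally_integrable_mult:
  fixes k f :: "'a::euclidean_space \<Rightarrow> real"
  assumes [measurable]: "k \<in> borel_measurable borel" "f \<in> borel_measurable borel"
    and k: "\<And>R. integrable lborel (\<lambda>z. indicator (cball 0 R) z * k z)"
    and f: "\<And>z. \<bar>f z\<bar> \<le> K" "\<And>z. norm z > R \<Longrightarrow> f z = 0"
  shows "integrable lborel (\<lambda>z. k z * f z)"
proof (rule Bochner_Integration.integrable_bound)
  show "integrable lborel (\<lambda>z. K * (indicator (cball 0 R) z * k z))" by (intro integrable_mult_right k)
  show "AE z in lborel. norm (k z * f z) \<le> norm (K * (indicator (cball 0 R) z * k z))"
  proof (rule AE_I2)
    fix z
    have "\<bar>f z\<bar> \<le> \<bar>K\<bar>" using f(1)[of z] by linarith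
    thus "norm (k z * f z) \<le> norm (K * (indicator (cball 0 R) z * k z))"
      using f(2)[of z] by (cases "norm z \<le> R") (auto simp: abs_mult mult.commute mult_right_mono)
  qed
qed measurable

text \<open>The derivative is taken under the integral, with the second-order Taylor remainder as error. For
  increments of norm at most \<open>1\<close>, the remainder is supported in a fixed ball, on which \<open>k\<close> is
  integrable.\<close>

lemma gderiv_conv:
  fixes k f :: "'a::euclidean_space \<Rightarrow> real"
  assumes [measurable]: "k \<in> borel_measurable borel"
    and k: "\<And>R. integrable lborel (\<lambda>z. indicator (cball 0 R) z * k z)" and f: "f \<in> Cc_inf S"
  shows "GDERIV (conv k f) x :> (\<Sum>j\<in>Basis. conv k (pd j f) x *\<^sub>R j)"
proof -
  have fm[measurable]: "f \<in> borel_measurable borel" using f by (rule test_borel)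
  have pm[measurable]: "pd j f \<in> borel_measurable borel" if "j \<in> Basis" for j using test_borel[OF test_pd[OF f that]] .
  obtain R where R: "R > 0" "\<And>x. norm x > R \<Longrightarrow> f x = 0" using test_support[OF f] by blast
  note pz = test_pd_support[of R f, OF R(2)]
  obtain K where K: "\<And>x. \<bar>f x\<bar> \<le> K" using test_bounded[OF f] by auto
  obtain L where L: "L > 0" "\<And>x h. \<bar>f (x + h) - f x - (\<Sum>j\<in>Basis. (h \<bullet> j) * pd j f x)\<bar> \<le> L * norm h ^ 2"
    using test_taylor[OF f] by blast
  have int_f: "integrable lborel (\<lambda>z. k z * f (y - z))" for y
  proof (rule locally_integrable_mult[OF _ _ k])
    show "\<bar>f (y - z)\<bar> \<le> K" for z by (rule K)
    show "f (y - z) = 0" if "norm z > R + norm y" for z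
      using R(2)[of "y - z"] that norm_triangle_ineq2[of z y] by (simp add: norm_minus_commute)
  qed measurable
  have int_p: "integrable lborel (\<lambda>z. k z * pd j f (y - z))" if j: "j \<in> Basis" for y j
  proof -
    obtain K' where K': "\<And>x. \<bar>pd j f x\<bar> \<le> K'" using test_bounded[OF test_pd[OF f j]] by auto
    note [measurable] = pm[OF j]
    show ?thesis
    proof (rule locally_integrable_mult[OF _ _ k])
      show "\<bar>pd j f (y - z)\<bar> \<le> K'" for z by (rule K')
      show "pd j f (y - z) = 0" if "norm z > R + norm y" for z
        using pz[of "y - z" j] that norm_triangle_ineq2[of z y] by (simp add: norm_minus_commute)
    qed measurable
  qed
  define B where "B = cball (0::'a) (R + norm x + 1)"
  define M where "M = (\<integral>z. \<bar>indicator B z * k z\<bar> \<partial>lborel)"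
  have M: "M \<ge> 0" unfolding M_def by (intro integral_nonneg_AE) auto
  have est: "\<bar>conv k f (x + h) - conv k f x - (\<Sum>j\<in>Basis. (h \<bullet> j) * conv k (pd j f) x)\<bar> \<le> L * M * norm h ^ 2" if h: "norm h \<le> 1" for h
  proof -
    have "conv k f (x + h) - conv k f x - (\<Sum>j\<in>Basis. (h \<bullet> j) * conv k (pd j f) x)
      = (\<integral>z. k z * f (x + h - z) \<partial>lborel) - (\<integral>z. k z * f (x - z) \<partial>lborel) - (\<Sum>j\<in>Basis. (\<integral>z. (h \<bullet> j) * (k z * pd j f (x - z)) \<partial>lborel))"
      by (simp add: conv_swap pm)
    also have "\<dots> = (\<integral>z. k z * f (x + h - z) - k z * f (x - z) - (\<Sum>j\<in>Basis. (h \<bullet> j) * (k z * pd j f (x - z))) \<partial>lborel)"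
      by (subst Bochner_Integration.integral_diff, (intro Bochner_Integration.integrable_diff Bochner_Integration.integrable_sum integrable_mult_right int_f int_p; assumption)+)
         (simp add: int_f int_p Bochner_Integration.integral_sum Bochner_Integration.integral_diff)
    also have "\<bar>\<dots>\<bar> \<le> (\<integral>z. (L * norm h ^ 2) * \<bar>indicator B z * k z\<bar> \<partial>lborel)"
    proof (rule abs_integral_le)
      show "integrable lborel (\<lambda>z. (L * norm h ^ 2) * \<bar>indicator B z * k z\<bar>)" unfolding B_def by (intro integrable_mult_right integrable_abs k)
      fix z
      have e: "k z * f (x + h - z) - k z * f (x - z) - (\<Sum>j\<in>Basis. (h \<bullet> j) * (k z * pd j f (x - z)))
         = k z * (f ((x - z) + h) - f (x - z) - (\<Sum>j\<in>Basis. (h \<bullet> j) * pd j f (x - z)))"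
        by (simp add: algebra_simps sum_distrib_left)
      show "\<bar>k z * f (x + h - z) - k z * f (x - z) - (\<Sum>j\<in>Basis. (h \<bullet> j) * (k z * pd j f (x - z)))\<bar> \<le> (L * norm h ^ 2) * \<bar>indicator B z * k z\<bar>"
      proof (cases "z \<in> B")
        case True
        have "\<bar>k z\<bar> * \<bar>f ((x - z) + h) - f (x - z) - (\<Sum>j\<in>Basis. (h \<bullet> j) * pd j f (x - z))\<bar> \<le> \<bar>k z\<bar> * (L * norm h ^ 2)"
          using L(2)[of "x - z" h] by (intro mult_left_mono) auto
        thus ?thesis unfolding e abs_mult using True by (simp add: mult.commute)
      next
        case False
        hence z: "norm z > R + norm x + 1" by (simp add: B_def)
        have "norm (x - z) > R" using z norm_triangle_ineq2[of z x] by (simp add: norm_minus_commute)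
        moreover have "norm (x + h - z) > R" using z h norm_triangle_ineq2[of z "x + h"] norm_triangle_ineq[of x h] by (simp add: norm_minus_commute)
        ultimately show ?thesis using R(2) pz L(1) by simp
      qed
    qed
    also have "\<dots> = L * M * norm h ^ 2" by (simp add: M_def)
    finally show ?thesis .
  qed
  have "(conv k f has_derivative (\<lambda>h. \<Sum>j\<in>Basis. (h \<bullet> j) * conv k (pd j f) x)) (at x)"
    unfolding has_derivative_within_alt[where s=UNIV, simplified]
  proof (intro conjI allI impI)
    show "bounded_linear (\<lambda>h. \<Sum>j\<in>Basis. (h \<bullet> j) * conv k (pd j f) x)"
      by (intro bounded_linear_sum bounded_linear_mult_const bounded_linear_inner_left)
    fix e :: real assume e: "e > 0"
    define d where "d = min 1 (e / (L * M + 1))"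
    have LM: "L * M \<ge> 0" using L M by simp
    show "\<exists>d>0. \<forall>y. norm (y - x) < d \<longrightarrow> norm (conv k f y - conv k f x - (\<Sum>j\<in>Basis. ((y - x) \<bullet> j) * conv k (pd j f) x)) \<le> e * norm (y - x)"
    proof (intro exI conjI allI impI)
      show "d > 0" using e LM by (auto simp: d_def)
      fix y assume y: "norm (y - x) < d"
      have "norm (conv k f y - conv k f x - (\<Sum>j\<in>Basis. ((y - x) \<bullet> j) * conv k (pd j f) x)) \<le> L * M * norm (y - x) ^ 2"
        using est[of "y - x"] y by (simp add: d_def)
      also have "\<dots> = (L * M * norm (y - x)) * norm (y - x)" by (simp add: power2_eq_square)
      also have "\<dots> \<le> e * norm (y - x)"
      proof (rule mult_right_mono)
        have "L * M * norm (y - x) \<le> (L * M + 1) * (e / (L * M + 1))"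
          using y LM e by (intro mult_mono) (auto simp: d_def)
        thus "L * M * norm (y - x) \<le> e" using LM by simp
      qed simp
      finally show "norm (conv k f y - conv k f x - (\<Sum>j\<in>Basis. ((y - x) \<bullet> j) * conv k (pd j f) x)) \<le> e * norm (y - x)" .
    qed
  qed
  thus ?thesis by (simp add: gderiv_def inner_sum_right mult.commute)
qed

text \<open>For small \<open>r\<close> the function \<open>\<partial>\<^sub>j f\<close> is merely bounded. For \<open>r \<ge> 1\<close> the derivative falls on the
  Gaussian, which yields \<open>r powr (-1/2 - d/2)\<close>, hence \<open>1/r\<close> in every dimension \<open>d \<ge> 1\<close>.\<close>

lemma heat_pd_decay:
  fixes f :: "'a::euclidean_space \<Rightarrow> real"
  assumes f: "f \<in> Cc_inf S" and j: "j \<in> Basis"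
  shows "\<exists>K>0. \<forall>r>0. \<forall>x. \<bar>conv (gauss r) (pd j f) x\<bar> \<le> K \<and> \<bar>conv (gauss r) (pd j f) x\<bar> \<le> K / r"
proof -
  obtain K1 where K1: "K1 > 0" "\<And>x. \<bar>pd j f x\<bar> \<le> K1" using test_bounded[OF test_pd[OF f j]] by auto
  define I where "I = (\<integral>x. \<bar>f x\<bar> \<partial>lborel)"
  have I: "I \<ge> 0" unfolding I_def by (intro integral_nonneg_AE) auto
  define K2 where "K2 = 2 * I / gauss_mass TYPE('a)"
  have K2: "K2 \<ge> 0" using I gauss_mass_pos[where 'a='a] by (simp add: K2_def)
  define K where "K = K1 + K2"
  have K: "K > 0" "K1 \<le> K" "K2 \<le> K" using K1 K2 by (auto simp: K_def)
  have a: "\<bar>conv (gauss r) (pd j f) x\<bar> \<le> K1" if r: "r > 0" for r x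
    by (rule heat_const_bound[OF r]) (use K1 in auto)
  have b: "\<bar>conv (gauss r) (pd j f) x\<bar> \<le> K2 / r" if r: "r \<ge> 1" for r x
  proof -
    have r0: "r > 0" using r by simp
    have "\<bar>egauss j r y\<bar> \<le> 1 / (r * gauss_mass TYPE('a))" for y :: 'a
    proof -
      have "\<bar>egauss j r y\<bar> \<le> 2 powr (real DIM('a) / 2) * r powr (-1/2) * gauss (2 * r) y" by (rule egauss_le[OF r0 j])
      also have "\<dots> \<le> 2 powr (real DIM('a) / 2) * r powr (-1/2) * (1 / ((2 * r) powr (real DIM('a) / 2) * gauss_mass TYPE('a)))"
        using r by (intro mult_left_mono gauss_le) auto
      also have "\<dots> = r powr (-1/2 - real DIM('a) / 2) / gauss_mass TYPE('a)"
        using r by (simp add: powr_mult powr_diff)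
      also have "\<dots> \<le> r powr (-1) / gauss_mass TYPE('a)"
      proof -
        have "1 \<le> real DIM('a)" by (simp add: Suc_leI)
        hence "-1/2 - real DIM('a) / 2 \<le> -1" by linarith
        thus ?thesis using r gauss_mass_pos[where 'a='a] by (intro divide_right_mono powr_mono) simp_all
      qed
      finally show ?thesis using r by (simp add: powr_minus divide_simps)
    qed
    hence "\<bar>conv (egauss j r) f x\<bar> \<le> 1 / (r * gauss_mass TYPE('a)) * I"
      unfolding I_def by (intro conv_abs_le_L1 test_integrable[OF f])
    hence "2 * \<bar>conv (egauss j r) f x\<bar> \<le> 2 * (1 / (r * gauss_mass TYPE('a)) * I)" by (intro mult_left_mono) auto
    thus ?thesis unfolding heat_pd[OF f r0 j] K2_def by (simp add: abs_mult mult.commute)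
  qed
  have "\<bar>conv (gauss r) (pd j f) x\<bar> \<le> K" "\<bar>conv (gauss r) (pd j f) x\<bar> \<le> K / r" if r: "r > 0" for r x
  proof -
    show "\<bar>conv (gauss r) (pd j f) x\<bar> \<le> K" using a[OF r, of x] K by linarith
    show "\<bar>conv (gauss r) (pd j f) x\<bar> \<le> K / r"
    proof (cases "r \<ge> 1")
      case True
      thus ?thesis using b[OF True, of x] K by (meson divide_right_mono order_trans r less_imp_le)
    next
      case False
      hence "K1 \<le> K / r" using K r by (simp add: pos_le_divide_eq) (smt (verit) K1(1) mult_left_le)
      thus ?thesis using a[OF r, of x] by linarith
    qed
  qed
  with K show ?thesis by blast
qed

lemma heat_time_measurable:
  assumes [measurable]: "f \<in> borel_measurable borel"
  shows "(\<lambda>r. conv (gauss r) f x) \<in> borel_measurable borel"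
  by (rule conv_measurable[where g="\<lambda>_. x" and k=gauss]) (simp_all add: case_prod_unfold)

lemma heat_pd_pw_integrable:
  fixes f :: "'a::euclidean_space \<Rightarrow> real"
  assumes f: "f \<in> Cc_inf S" and j: "j \<in> Basis" and b: "0 < b" "b < 1"
  shows "integrable lborel (\<lambda>r. pw b r * conv (gauss r) (pd j f) x)"
proof -
  obtain K where K: "\<And>r x. r > 0 \<Longrightarrow> \<bar>conv (gauss r) (pd j f) x\<bar> \<le> K" "\<And>r x. r > 0 \<Longrightarrow> \<bar>conv (gauss r) (pd j f) x\<bar> \<le> K / r"
    using heat_pd_decay[OF f j] by blast
  show ?thesis
    by (rule integrable_pw_decay[OF b heat_time_measurable K]) (use test_borel[OF test_pd[OF f j]] in auto)
qed

lemma riesz_mu_pos: "0 \<le> s \<Longrightarrow> s < 1 \<Longrightarrow> riesz_mu d s > 0"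
  unfolding riesz_mu_def by (intro divide_pos_pos mult_pos_pos Gamma_real_pos) auto

text \<open>The kernel of \<open>I\<^sub>1\<^sub>-\<^sub>t\<close> is a multiple of \<open>|z|^(1-t-d)\<close>, the case \<open>\<gamma> = (1-t)/2\<close> of the Gaussian
  representation, and the gradient of the potential falls on \<open>f\<close>.\<close>

lemma frac_gradient_heat_integral_pos:
  assumes t: "0 < t" "t < 1"
  shows "\<exists>c. c \<noteq> 0 \<and> (\<forall>f\<in>Cc_inf UNIV. \<forall>j\<in>Basis. \<forall>x::'a::euclidean_space.
     frac_gradient t f x \<bullet> j = c * (\<integral>r. pw ((1 - t) / 2) r * conv (gauss r) (pd j f) x \<partial>lborel))"
proof -
  define \<gamma> where "\<gamma> = (1 - t) / 2"
  have d1: "1 \<le> real DIM('a)" by (simp add: Suc_leI)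
  have g: "0 < \<gamma>" using t by (simp add: \<gamma>_def)
  have g2: "\<gamma> < real DIM('a) / 2"
  proof -
    have "\<gamma> < 1 / 2" using t by (simp add: \<gamma>_def)
    also have "\<dots> \<le> real DIM('a) / 2" by (rule divide_right_mono[OF d1]) simp
    finally show ?thesis .
  qed
  obtain \<kappa> where k: "\<kappa> > 0" "\<And>z::'a. z \<noteq> 0 \<Longrightarrow> (\<integral>\<^sup>+r. ennreal (pw \<gamma> r * gauss r z) \<partial>lborel) = ennreal (\<kappa> * norm z powr (2 * \<gamma> - real DIM('a)))"
    using riesz_kernel_gauss[OF g2] by blast
  define k0 where "k0 z = norm z powr (2 * \<gamma> - real DIM('a))" for z :: 'a
  have [measurable]: "k0 \<in> borel_measurable borel" unfolding k0_def by measurable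
  have kl: "integrable lborel (\<lambda>z. indicator (cball 0 R) z * k0 z)" for R
    unfolding k0_def by (rule riesz_kernel_locally_integrable[OF g g2])
  define m where "m = riesz_mu DIM('a) t / (real DIM('a) - (1 - t))"
  have "1 - t < 1" using t by simp
  also note d1
  finally have "real DIM('a) - (1 - t) \<noteq> 0" by simp
  hence m: "m \<noteq> 0" using riesz_mu_pos[of t "DIM('a)"] t by (auto simp: m_def)
  have "frac_gradient t f x \<bullet> j = (m / \<kappa>) * (\<integral>r. pw ((1 - t) / 2) r * conv (gauss r) (pd j f) x \<partial>lborel)"
    if f: "f \<in> Cc_inf UNIV" and j: "j \<in> Basis" for f and j x :: 'a
  proof -
    note [measurable] = test_borel[OF f] test_borel[OF test_pd[OF f j]]
    have rp: "riesz_potential (1 - t) f = (\<lambda>x. m * conv k0 f x)"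
    proof
      fix x
      have "(LINT y|lebesgue. f y / norm (x - y) powr (real DIM('a) - (1 - t))) = (\<integral>y. f y / norm (x - y) powr (real DIM('a) - (1 - t)) \<partial>lborel)"
        by (rule integral_completion) measurable
      also have "\<dots> = conv k0 f x"
      proof -
        have e: "2 * \<gamma> - real DIM('a) = - (real DIM('a) - (1 - t))" by (simp add: \<gamma>_def)
        show ?thesis unfolding conv_def k0_def e powr_minus by (simp add: divide_inverse mult.commute)
      qed
      finally show "riesz_potential (1 - t) f x = m * conv k0 f x" by (simp add: riesz_potential_def m_def)
    qed
    have "GDERIV (\<lambda>x. m * conv k0 f x) x :> m *\<^sub>R (\<Sum>j\<in>Basis. conv k0 (pd j f) x *\<^sub>R j)"
      using GDERIV_mult[OF GDERIV_const gderiv_conv[OF _ kl f], of m x] by simp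
    hence "frac_gradient t f x = m *\<^sub>R (\<Sum>j\<in>Basis. conv k0 (pd j f) x *\<^sub>R j)"
      using t rp by (simp add: frac_gradient_def gradient_eq)
    hence "frac_gradient t f x \<bullet> j = m * conv k0 (pd j f) x" using j by simp
    also have "conv k0 (pd j f) x = (\<integral>z. norm z powr (2 * \<gamma> - real DIM('a)) * pd j f (x - z) \<partial>lborel)"
      by (simp add: conv_swap k0_def[symmetric])
    also have "\<dots> = (1 / \<kappa>) * (\<integral>r. pw \<gamma> r * (\<integral>z. gauss r z * pd j f (x - z) \<partial>lborel) \<partial>lborel)"
    proof (rule riesz_kernel_fubini[OF k])
      obtain K' where K': "\<And>x. \<bar>pd j f x\<bar> \<le> K'" using test_bounded[OF test_pd[OF f j]] by auto
      obtain R where R: "R > 0" "\<And>x. norm x > R \<Longrightarrow> pd j f x = 0" using test_support[OF test_pd[OF f j]] by blast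
      have "integrable lborel (\<lambda>z. k0 z * pd j f (x - z))"
      proof (rule locally_integrable_mult[OF _ _ kl])
        show "\<bar>pd j f (x - z)\<bar> \<le> K'" for z by (rule K')
        show "pd j f (x - z) = 0" if "norm z > R + norm x" for z
          using R(2)[of "x - z"] that norm_triangle_ineq2[of z x] by (simp add: norm_minus_commute)
      qed measurable
      thus "integrable lborel (\<lambda>z. norm z powr (2 * \<gamma> - real DIM('a)) * pd j f (x - z))" by (simp add: k0_def)
    qed measurable
    also have "\<dots> = (1 / \<kappa>) * (\<integral>r. pw \<gamma> r * conv (gauss r) (pd j f) x \<partial>lborel)"
      by (simp add: conv_swap)
    finally show ?thesis by (simp add: \<gamma>_def)
  qed
  thus ?thesis using m k(1) by (intro exI[of _ "m / \<kappa>"]) auto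
qed

text \<open>The kernel of the Riesz transform is \<open>z\<^sub>j |z|^(-d-1)\<close>, the case \<open>\<gamma> = -1/2\<close> multiplied by \<open>z\<^sub>j\<close>.
  Since it is odd, the truncated integrals may be taken of \<open>f(x - z) - f(x + z)\<close>, which removes
  one power of the singularity: the principal value becomes an absolutely convergent integral.
  Inserting the Gaussian representation, \<open>z\<^sub>j gauss r z\<close> is \<open>r\<close> times \<open>egauss j r z\<close>, and the
  extra factor \<open>r\<close> raises the exponent \<open>-1/2\<close> to \<open>1/2\<close>.\<close>

lemma frac_gradient_heat_integral_zero:
  "\<exists>c. c \<noteq> 0 \<and> (\<forall>f\<in>Cc_inf UNIV. \<forall>j\<in>Basis. \<forall>x::'a::euclidean_space.
     frac_gradient 0 f x \<bullet> j = c * (\<integral>r. pw (1 / 2) r * conv (gauss r) (pd j f) x \<partial>lborel))"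
proof -
  define \<gamma> where "\<gamma> = (- 1 / 2 :: real)"
  have d1: "1 \<le> real DIM('a)" by (simp add: Suc_leI)
  have g: "\<gamma> < real DIM('a) / 2" using d1 by (auto simp: \<gamma>_def)
  obtain \<kappa> where k: "\<kappa> > 0" "\<And>z::'a. z \<noteq> 0 \<Longrightarrow> (\<integral>\<^sup>+r. ennreal (pw \<gamma> r * gauss r z) \<partial>lborel) = ennreal (\<kappa> * norm z powr (2 * \<gamma> - real DIM('a)))"
    using riesz_kernel_gauss[OF g] by blast
  define m where "m = Gamma ((real DIM('a) + 1) / 2) / pi powr ((real DIM('a) + 1) / 2)"
  have m: "m \<noteq> 0" using Gamma_real_pos[of "(real DIM('a) + 1) / 2"] by (simp add: m_def add_pos_pos less_imp_neq[symmetric])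
  define k0 where "k0 z = norm z powr (2 * \<gamma> - real DIM('a))" for z :: 'a
  have [measurable]: "k0 \<in> borel_measurable borel" unfolding k0_def by measurable
  have k0: "1 / norm z ^ (DIM('a) + 1) = k0 z" for z :: 'a
  proof (cases "z = 0")
    case False
    have "2 * \<gamma> - real DIM('a) = - real (DIM('a) + 1)" by (simp add: \<gamma>_def)
    thus ?thesis unfolding k0_def using False by (simp only: powr_minus) (simp add: powr_realpow[of "norm z" "Suc DIM('a)", simplified] divide_inverse)
  qed (simp add: k0_def)
  have "frac_gradient 0 f x \<bullet> j = (m / (2 * \<kappa>)) * (\<integral>r. pw (1 / 2) r * conv (gauss r) (pd j f) x \<partial>lborel)"
    if f: "f \<in> Cc_inf UNIV" and j: "j \<in> Basis" for f and j x :: 'a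
  proof -
    have fm[measurable]: "f \<in> borel_measurable borel" by (rule test_borel[OF f])
    note [measurable] = test_borel[OF test_pd[OF f j]]
    obtain K where K: "\<And>x. \<bar>f x\<bar> \<le> K" using test_bounded[OF f] by auto
    obtain R0 where R0: "R0 > 0" "\<And>x. norm x > R0 \<Longrightarrow> f x = 0" using test_support[OF f] by blast
    define R where "R = R0 + norm x"
    have R: "f (x - z) = 0" "f (x + z) = 0" if "norm z > R" for z
      using R0(2)[of "x - z"] R0(2)[of "x + z"] that norm_triangle_ineq2[of z x] norm_triangle_ineq2[of z "-x"] by (auto simp: R_def norm_minus_commute add.commute)
    obtain L where L: "L > 0" "\<And>x y. \<bar>f x - f y\<bar> \<le> L * norm (x - y)" using test_Lipschitz[OF f] by blast
    \<comment> \<open>The antisymmetrised integrand without its kernel; it vanishes to second order at zero.\<close>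
    define q where "q z = (z \<bullet> j) * (f (x - z) - f (x + z))" for z
    have [measurable]: "q \<in> borel_measurable borel" unfolding q_def by measurable
    have qb: "\<bar>q z\<bar> \<le> 2 * L * norm z ^ 2" for z
    proof -
      have "\<bar>z \<bullet> j\<bar> * \<bar>f (x - z) - f (x + z)\<bar> \<le> norm z * (L * norm ((x - z) - (x + z)))"
        using j by (intro mult_mono L Basis_le_norm) auto
      moreover have "(x - z) - (x + z) = - (2 *\<^sub>R z)" by (simp add: scaleR_2)
      ultimately show ?thesis by (simp add: q_def abs_mult power2_eq_square mult_ac)
    qed
    have int: "integrable lborel (\<lambda>z. k0 z * q z)"
    proof (rule Bochner_Integration.integrable_bound)
      \<comment> \<open>The majorant is the Riesz kernel with \<open>\<gamma> = 1/4\<close>, integrable in every dimension; the spare power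
        \<open>|z|^(1/2)\<close> is at most \<open>R powr (1/2)\<close>.\<close>
      have "1/4 < real DIM('a) / 2" using d1 by linarith
      thus "integrable lborel (\<lambda>z::'a. (2 * L * R powr (1/2)) * (indicator (cball 0 R) z * norm z powr (2 * (1/4) - real DIM('a))))"
        by (intro integrable_mult_right riesz_kernel_locally_integrable) auto
      show "AE z in lborel. norm (k0 z * q z) \<le> norm ((2 * L * R powr (1/2)) * (indicator (cball 0 R) z * norm z powr (2 * (1/4) - real DIM('a))))"
      proof (rule AE_I2)
        fix z :: 'a
        show "norm (k0 z * q z) \<le> norm ((2 * L * R powr (1/2)) * (indicator (cball 0 R) z * norm z powr (2 * (1/4) - real DIM('a))))"
        proof (cases "z = 0 \<or> norm z > R")
          case True thus ?thesis using R[of z] by (auto simp: q_def)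
        next
          case False
          hence z: "norm z > 0" "norm z \<le> R" by auto
          have "\<bar>k0 z * q z\<bar> \<le> k0 z * (2 * L * norm z ^ 2)" using qb[of z] by (simp add: abs_mult k0_def mult_left_mono)
          also have "\<dots> = 2 * L * (norm z powr (1/2) * norm z powr (2 * (1/4) - real DIM('a)))"
          proof -
            have "norm z ^ 2 = norm z powr 2" using z by simp
            hence "k0 z * norm z ^ 2 = norm z powr (1/2) * norm z powr (2 * (1/4) - real DIM('a))"
              unfolding k0_def by (simp only: powr_add[symmetric]) (simp add: \<gamma>_def)
            thus ?thesis by (simp add: mult_ac)
          qed
          also have "\<dots> \<le> 2 * L * (R powr (1/2) * norm z powr (2 * (1/4) - real DIM('a)))"
            using z L by (intro mult_left_mono mult_right_mono powr_mono2) auto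
          finally show ?thesis using z L by (simp add: abs_mult mult_ac)
        qed
      qed
    qed measurable
    define I where "I = (\<integral>z. k0 z * q z \<partial>lborel)"
    have trunc: "(LINT y:{y. \<epsilon> < norm (x - y)}|lebesgue. ((x - y) \<bullet> j) / norm (x - y) ^ (DIM('a) + 1) * f y) = (1/2) * (\<integral>z. indicator {z. \<epsilon> < norm z} z * (k0 z * q z) \<partial>lborel)"
      if e: "\<epsilon> > 0" for \<epsilon>
    proof -
      define g where "g z = indicator {z. \<epsilon> < norm z} z * ((z \<bullet> j) * k0 z)" for z
      have [measurable]: "g \<in> borel_measurable borel" unfolding g_def by measurable
      have gm: "g (- z) = - g z" for z by (simp add: g_def k0_def indicator_def)
      have gb: "\<bar>g z\<bar> \<le> (1 / \<epsilon>) ^ DIM('a)" for z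
      proof (cases "\<epsilon> < norm z")
        case True
        have "\<bar>z \<bullet> j\<bar> * k0 z \<le> norm z * k0 z" using j by (intro mult_right_mono Basis_le_norm) (auto simp: k0_def)
        also have "\<dots> = 1 / norm z ^ DIM('a)" using True e unfolding k0[symmetric] by simp
        also have "\<dots> \<le> 1 / \<epsilon> ^ DIM('a)" using True e by (intro divide_left_mono power_mono mult_pos_pos zero_less_power) auto
        finally show ?thesis using True by (simp add: g_def abs_mult k0_def power_one_over)
      qed (use e in \<open>simp add: g_def\<close>)
      have ig: "integrable lborel (\<lambda>z. g z * f (x - z))"
      proof (rule Bochner_Integration.integrable_bound)
        show "integrable lborel (\<lambda>z. (1 / \<epsilon>) ^ DIM('a) * f (x - z))" by (intro integrable_mult_right integrable_reflect test_integrable[OF f])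
        show "AE z in lborel. norm (g z * f (x - z)) \<le> norm ((1 / \<epsilon>) ^ DIM('a) * f (x - z))"
        proof (rule AE_I2)
          fix z
          have "\<bar>g z\<bar> * \<bar>f (x - z)\<bar> \<le> (1 / \<epsilon>) ^ DIM('a) * \<bar>f (x - z)\<bar>" by (intro mult_right_mono gb) auto
          thus "norm (g z * f (x - z)) \<le> norm ((1 / \<epsilon>) ^ DIM('a) * f (x - z))" using e by (simp add: abs_mult)
        qed
      qed measurable
      have ig': "integrable lborel (\<lambda>z. g z * f (x + z))"
        using integrable_reflect[OF ig, of 0] by (simp add: gm)
      have "(LINT y:{y. \<epsilon> < norm (x - y)}|lebesgue. ((x - y) \<bullet> j) / norm (x - y) ^ (DIM('a) + 1) * f y)
        = (\<integral>y. indicator {y. \<epsilon> < norm (x - y)} y * (((x - y) \<bullet> j) / norm (x - y) ^ (DIM('a) + 1) * f y) \<partial>lborel)"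
        unfolding set_lebesgue_integral_def by (subst integral_completion) (auto simp: measurable_completion)
      also have "\<dots> = (\<integral>y. g (x - y) * f y \<partial>lborel)"
        by (intro Bochner_Integration.integral_cong refl) (simp add: g_def k0[symmetric] indicator_def)
      also have "\<dots> = (\<integral>z. g z * f (x - z) \<partial>lborel)" using conv_swap[of g f x] by (simp add: conv_def)
      finally have A: "(LINT y:{y. \<epsilon> < norm (x - y)}|lebesgue. ((x - y) \<bullet> j) / norm (x - y) ^ (DIM('a) + 1) * f y) = (\<integral>z. g z * f (x - z) \<partial>lborel)" .
      have "(\<integral>z. g z * f (x - z) \<partial>lborel) = (\<integral>z. - (g z * f (x + z)) \<partial>lborel)"
        using integral_reflect[of "\<lambda>z. g z * f (x - z)" 0] by (simp add: gm)
      hence B: "(\<integral>z. g z * f (x - z) \<partial>lborel) = - (\<integral>z. g z * f (x + z) \<partial>lborel)" by simp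
      have "(\<integral>z. indicator {z. \<epsilon> < norm z} z * (k0 z * q z) \<partial>lborel) = (\<integral>z. g z * f (x - z) - g z * f (x + z) \<partial>lborel)"
        by (intro Bochner_Integration.integral_cong refl) (simp add: g_def q_def algebra_simps)
      also have "\<dots> = 2 * (\<integral>z. g z * f (x - z) \<partial>lborel)" using ig ig' B by simp
      finally show ?thesis using A by simp
    qed
    have lim: "((\<lambda>\<epsilon>. LINT y:{y. \<epsilon> < norm (x - y)}|lebesgue. ((x - y) \<bullet> j) / norm (x - y) ^ (DIM('a) + 1) * f y) \<longlongrightarrow> (1/2) * I) (at_right 0)"
    proof (rule tendsto_at_right_sequentially[where b=1])
      fix S :: "nat \<Rightarrow> real" assume S: "\<And>n. 0 < S n" "S \<longlonglongrightarrow> 0"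
      have "(\<lambda>n. \<integral>z. indicator {z. S n < norm z} z * (k0 z * q z) \<partial>lborel) \<longlonglongrightarrow> I"
        unfolding I_def
      proof (rule integral_dominated_convergence[where w="\<lambda>z. \<bar>k0 z * q z\<bar>"])
        show "integrable lborel (\<lambda>z. \<bar>k0 z * q z\<bar>)" using int by simp
        show "AE z in lborel. norm (indicator {z. S n < norm z} z * (k0 z * q z)) \<le> \<bar>k0 z * q z\<bar>" for n
          by (auto simp: indicator_def)
        show "AE z in lborel. (\<lambda>n. indicator {z. S n < norm z} z * (k0 z * q z)) \<longlonglongrightarrow> k0 z * q z"
        proof (rule AE_I2)
          fix z :: 'a
          show "(\<lambda>n. indicator {z. S n < norm z} z * (k0 z * q z)) \<longlonglongrightarrow> k0 z * q z"
          proof (cases "z = 0")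
            case True thus ?thesis by (simp add: q_def)
          next
            case False
            hence "\<forall>\<^sub>F n in sequentially. S n < norm z" using S(2) by (intro order_tendstoD) auto
            hence "\<forall>\<^sub>F n in sequentially. indicator {z. S n < norm z} z * (k0 z * q z) = k0 z * q z" by eventually_elim simp
            thus ?thesis by (rule tendsto_eventually)
          qed
        qed
      qed measurable
      hence "(\<lambda>n. (1/2) * (\<integral>z. indicator {z. S n < norm z} z * (k0 z * q z) \<partial>lborel)) \<longlonglongrightarrow> (1/2) * I"
        by (intro tendsto_intros)
      thus "(\<lambda>n. LINT y:{y. S n < norm (x - y)}|lebesgue. ((x - y) \<bullet> j) / norm (x - y) ^ (DIM('a) + 1) * f y) \<longlonglongrightarrow> (1/2) * I"
        by (simp only: trunc[OF S(1)])
    qed auto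
    have "frac_gradient 0 f x \<bullet> j = - riesz_transform_component j f x"
      using j by (simp add: frac_gradient_def riesz_transform_def)
    also have "riesz_transform_component j f x = m * ((1/2) * I)"
      unfolding riesz_transform_component_def m_def tendsto_Lim[OF trivial_limit_at_right_real lim] ..
    finally have A: "frac_gradient 0 f x \<bullet> j = - m * ((1/2) * I)" by simp
    have "I = (1 / \<kappa>) * (\<integral>r. pw \<gamma> r * (\<integral>z. gauss r z * q z \<partial>lborel) \<partial>lborel)"
      unfolding I_def k0_def by (rule riesz_kernel_fubini[OF k]) (use int in \<open>auto simp: k0_def\<close>)
    also have "(\<integral>r. pw \<gamma> r * (\<integral>z. gauss r z * q z \<partial>lborel) \<partial>lborel) = (\<integral>r. - (pw (1/2) r * conv (gauss r) (pd j f) x) \<partial>lborel)"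
    proof (intro Bochner_Integration.integral_cong refl)
      fix r
      show "pw \<gamma> r * (\<integral>z. gauss r z * q z \<partial>lborel) = - (pw (1/2) r * conv (gauss r) (pd j f) x)"
      proof (cases "r > 0")
        case True
        define e where "e z = gauss r z * (z \<bullet> j)" for z :: 'a
        have e: "e z = r * egauss j r z" for z using True by (simp add: e_def egauss_def)
        have em: "e (- z) = - e z" for z by (simp add: e_def)
        have [measurable]: "e \<in> borel_measurable borel" unfolding e_def by measurable
        have "integrable lborel (\<lambda>z. r * egauss j r z)" by (intro integrable_mult_right egauss_integrable True j)
        hence ie0: "integrable lborel e" by (simp add: e[abs_def])
        have "integrable lborel (\<lambda>y. e (x - y) * f y)" by (rule conv_integrable[OF ie0 fm K])
        from integrable_reflect[OF this, of x] have ie: "integrable lborel (\<lambda>z. e z * f (x - z))" by simp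
        have ie': "integrable lborel (\<lambda>z. e z * f (x + z))"
          using integrable_reflect[OF ie, of 0] by (simp add: em)
        have "(\<integral>z. e z * f (x - z) \<partial>lborel) = (\<integral>z. - (e z * f (x + z)) \<partial>lborel)"
          using integral_reflect[of "\<lambda>z. e z * f (x - z)" 0] by (simp add: em)
        hence B: "(\<integral>z. e z * f (x + z) \<partial>lborel) = - (\<integral>z. e z * f (x - z) \<partial>lborel)" by simp
        have "(\<integral>z. gauss r z * q z \<partial>lborel) = (\<integral>z. e z * f (x - z) - e z * f (x + z) \<partial>lborel)"
          by (intro Bochner_Integration.integral_cong refl) (simp add: e_def q_def algebra_simps)
        also have "\<dots> = 2 * (\<integral>z. e z * f (x - z) \<partial>lborel)" using ie ie' B by simp
        also have "(\<integral>z. e z * f (x - z) \<partial>lborel) = r * conv (egauss j r) f x"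
          unfolding e by (simp add: conv_swap mult.assoc)
        also have "2 * (r * conv (egauss j r) f x) = - (r * conv (gauss r) (pd j f) x)" by (simp add: heat_pd[OF f True j])
        finally have "(\<integral>z. gauss r z * q z \<partial>lborel) = - (r * conv (gauss r) (pd j f) x)" .
        moreover have "pw \<gamma> r * r = pw (1/2) r" using True powr_mult_base[of r "-3/2"] by (simp add: pw_def \<gamma>_def mult.commute)
        ultimately show ?thesis by (simp add: mult.assoc[symmetric])
      qed (simp add: pw_def)
    qed
    finally have "I = - (1 / \<kappa>) * (\<integral>r. pw (1/2) r * conv (gauss r) (pd j f) x \<partial>lborel)" by simp
    thus ?thesis unfolding A by simp
  qed
  thus ?thesis using m k(1) by (intro exI[of _ "m / (2 * \<kappa>)"]) auto
qed

lemma frac_gradient_heat_integral: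
  assumes t: "0 \<le> t" "t < 1"
  shows "\<exists>c. c \<noteq> 0 \<and> (\<forall>f\<in>Cc_inf UNIV. \<forall>j\<in>Basis. \<forall>x::'a::euclidean_space.
     frac_gradient t f x \<bullet> j = c * (\<integral>r. pw ((1 - t) / 2) r * conv (gauss r) (pd j f) x \<partial>lborel))"
  using frac_gradient_heat_integral_pos[of t] frac_gradient_heat_integral_zero t by (cases "t = 0") auto


section \<open>Test functions as time integrals of heat flows\<close>

text \<open>In terms of the semigroup, the integrand is a multiple of the time derivative of \<open>P\<^sub>r f\<close>. In the
  coordinates \<open>y = x - sqrt r z\<close>, the fundamental theorem of calculus is applied to
  \<open>f(x - sqrt r z)\<close> as a function of \<open>r\<close>, which runs from \<open>f x\<close> to \<open>0\<close> for each \<open>z \<noteq> 0\<close>, and the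
  result is averaged over \<open>z\<close> with the Gaussian weight.\<close>

lemma test_heat_integral:
  fixes f :: "'a::euclidean_space \<Rightarrow> real"
  assumes f: "f \<in> Cc_inf S"
  shows "integrable lborel (\<lambda>r. pw 1 r * (\<Sum>j\<in>Basis. conv (egauss j r) (pd j f) x))"
    and "f x = (1 / 2) * (\<integral>r. pw 1 r * (\<Sum>j\<in>Basis. conv (egauss j r) (pd j f) x) \<partial>lborel)"
proof -
  have fm[measurable]: "f \<in> borel_measurable borel" by (rule test_borel[OF f])
  have pm: "\<And>j. j \<in> Basis \<Longrightarrow> pd j f \<in> borel_measurable borel" using test_borel[OF test_pd[OF f]] .
  define D where "D y z = (\<Sum>j\<in>Basis. (z \<bullet> j) * pd j f y)" for y z
  define G where "G r z = indicator {0<..} r * (D (x - sqrt r *\<^sub>R z) z / sqrt r)" for r z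
  have Gm[measurable]: "(\<lambda>(z, r). G r z) \<in> borel_measurable (borel \<Otimes>\<^sub>M borel)"
    unfolding G_def D_def case_prod_unfold
    by (intro borel_measurable_times borel_measurable_divide borel_measurable_sum borel_measurable_indicator'
        measurable_compose[OF _ pm]) measurable
  obtain R0 where R0: "R0 > 0" "\<And>x. norm x > R0 \<Longrightarrow> f x = 0" using test_support[OF f] by blast
  note pz = test_pd_support[of R0 f, OF R0(2)]
  define R where "R = R0 + norm x"
  have R: "R > 0" using R0(1) by (simp add: R_def add_pos_nonneg)
  have far: "norm (x - w) > R0" if "norm w > R" for w
    using that norm_triangle_ineq2[of w x] by (simp add: R_def norm_minus_commute)
  obtain K where K: "K > 0" "\<And>y z. \<bar>D y z\<bar> \<le> K * norm z"
  proof -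
    have "\<forall>j\<in>Basis. \<exists>K>0. \<forall>x. norm (pd j f x) \<le> K" by (intro ballI test_bounded[OF test_pd[OF f]])
    then obtain K where K: "\<And>j. j \<in> Basis \<Longrightarrow> K j > 0" "\<And>j x. j \<in> Basis \<Longrightarrow> norm (pd j f x) \<le> K j" by metis
    have "\<bar>D y z\<bar> \<le> (\<Sum>j\<in>(Basis::'a set). K j) * norm z" for y z
    proof -
      have "norm (D y z) \<le> (\<Sum>j\<in>Basis. norm z * K j)" unfolding D_def
        using K by (intro sum_norm_le) (auto simp: abs_mult intro!: mult_mono Basis_le_norm)
      thus ?thesis by (simp add: sum_distrib_left mult.commute)
    qed
    moreover have "(\<Sum>j\<in>(Basis::'a set). K j) > 0" using K by (intro sum_pos) auto
    ultimately show ?thesis using that by blast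
  qed
  have G0: "G r z = 0" if "sqrt r * norm z > R" "r > 0" for r z
  proof -
    have "norm (sqrt r *\<^sub>R z) > R" using that by simp
    thus ?thesis using far pz by (simp add: G_def D_def)
  qed
  \<comment> \<open>Beyond \<open>r = (2 R/|z|)\<^sup>2\<close> the curve has left the support of \<open>f\<close>; the integral of \<open>r powr (-1/2)\<close>
    up to this time is a multiple of \<open>R/|z|\<close>, which cancels the factor \<open>|z|\<close> of \<open>D\<close>.\<close>
  have Gint: "integrable lborel (\<lambda>r. G r z)" and Gbd: "(\<integral>r. \<bar>G r z\<bar> \<partial>lborel) \<le> 4 * K * R" if z: "z \<noteq> 0" for z
  proof -
    define n where "n = norm z"
    have n: "n > 0" using z by (simp add: n_def)
    define T where "T = (R / n)\<^sup>2 * 4"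
    have T: "T > 0" "sqrt T = 2 * (R / n)" using R n by (auto simp: T_def real_sqrt_mult)
    have le: "\<bar>G r z\<bar> \<le> K * n * (indicator {0<..<T} r * pw (1/2) r)" for r
    proof (cases "0 < r \<and> r < T")
      case True
      have "\<bar>D (x - sqrt r *\<^sub>R z) z\<bar> / sqrt r \<le> K * n / sqrt r" using K(2)[of _ z] True by (intro divide_right_mono) (auto simp: n_def)
      also have "\<dots> = K * n * pw (1/2) r" using True powr_minus_divide[of r "1/2"] by (simp add: pw_def powr_half_sqrt)
      finally show ?thesis using True by (simp add: G_def)
    next
      case False
      have "G r z = 0"
      proof (cases "r > 0")
        case True
        hence "sqrt T \<le> sqrt r" using False by simp
        hence "sqrt T * n \<le> sqrt r * n" using n by (intro mult_right_mono) auto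
        hence "sqrt r * n > R" using T(2) R n by simp
        thus ?thesis using G0 True by (simp add: n_def)
      qed (simp add: G_def)
      thus ?thesis using False K n by (simp add: pw_nonneg)
    qed
    have ig: "integrable lborel (\<lambda>r. K * n * (indicator {0<..<T} r * pw (1/2) r))"
      using T by (intro integrable_mult_right integrable_pw_0) auto
    have [measurable]: "(\<lambda>r. G r z) \<in> borel_measurable borel" using measurable_Pair2[OF Gm, of z] by simp
    show "integrable lborel (\<lambda>r. G r z)"
      by (rule Bochner_Integration.integrable_bound[OF ig]) (use le in \<open>auto intro!: order_trans[OF _ abs_ge_self]\<close>)
    have "(\<integral>r. \<bar>G r z\<bar> \<partial>lborel) \<le> \<bar>\<integral>r. \<bar>G r z\<bar> \<partial>lborel\<bar>" by simp
    also have "\<dots> \<le> (\<integral>r. K * n * (indicator {0<..<T} r * pw (1/2) r) \<partial>lborel)"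
      by (intro abs_integral_le ig) (use le in auto)
    also have "\<dots> = K * n * (T powr (1/2) / (1/2))" using integral_pw_0[of "1/2" T] T by simp
    also have "\<dots> = 4 * K * R" using T n by (simp add: powr_half_sqrt)
    finally show "(\<integral>r. \<bar>G r z\<bar> \<partial>lborel) \<le> 4 * K * R" .
  qed
  have Gval: "(\<integral>r. G r z \<partial>lborel) = 2 * f x" if z: "z \<noteq> 0" for z
  proof -
    define n where "n = norm z"
    have n: "n > 0" using z by (simp add: n_def)
    have "(LBINT r=ereal 0..\<infinity>. G r z) = 0 - (- 2 * f x)"
    proof (rule interval_integral_FTC_integrable[where F="\<lambda>r. - 2 * f (x - sqrt r *\<^sub>R z)"])
      fix r :: real assume "ereal 0 < ereal r" "ereal r < \<infinity>"
      hence r: "r > 0" by simp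
      have "((\<lambda>r. f (x - sqrt r *\<^sub>R z)) has_derivative (\<lambda>h. \<Sum>j\<in>Basis. ((- ((h * (inverse (sqrt r) / 2)) *\<^sub>R z)) \<bullet> j) * pd j f (x - sqrt r *\<^sub>R z))) (at r)"
        by (rule has_derivative_compose[OF _ test_has_derivative[OF f]])
           (use r in \<open>auto intro!: derivative_eq_intros simp: has_field_derivative_def[symmetric]\<close>)
      moreover have "(\<Sum>j\<in>Basis. ((- ((h * (inverse (sqrt r) / 2)) *\<^sub>R z)) \<bullet> j) * pd j f (x - sqrt r *\<^sub>R z)) = (- (1/2) * G r z) * h" for h
        using r by (simp add: G_def D_def sum_distrib_left sum_distrib_right sum_negf[symmetric] sum_divide_distrib field_simps)
      ultimately have "((\<lambda>r. f (x - sqrt r *\<^sub>R z)) has_real_derivative - (1/2) * G r z) (at r)"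
        unfolding has_field_derivative_def by (simp only:)
      from DERIV_cmult[OF this, of "-2"] show "((\<lambda>r. - 2 * f (x - sqrt r *\<^sub>R z)) has_vector_derivative G r z) (at r)"
        by (simp add: has_real_derivative_iff_has_vector_derivative)
      have pc: "isCont (pd j f) y" if "j \<in> Basis" for j y
        using test_continuous[OF test_pd[OF f that]] by (simp add: continuous_on_eq_continuous_at)
      have "isCont (\<lambda>r. D (x - sqrt r *\<^sub>R z) z / sqrt r) r"
        unfolding D_def using r by (intro continuous_intros isCont_o2[OF _ pc]) auto
      thus "isCont (\<lambda>r. G r z) r"
        by (rule isCont_cong[THEN iffD1, rotated])
           (use r eventually_nhds_in_open[of "{0<..}" r] in \<open>auto simp: G_def elim!: eventually_mono\<close>)
    next
      show "set_integrable lborel (einterval (ereal 0) \<infinity>) (\<lambda>r. G r z)"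
        unfolding set_integrable_def using Gint[OF z]
        by (rule Bochner_Integration.integrable_cong[THEN iffD1, rotated 2]) (auto simp: G_def einterval_def indicator_def)
    next
      have "continuous_on UNIV (\<lambda>r. - 2 * f (x - sqrt r *\<^sub>R z))"
        by (intro continuous_intros continuous_on_compose2[OF test_continuous[OF f]]) auto
      hence "isCont (\<lambda>r. - 2 * f (x - sqrt r *\<^sub>R z)) 0" by (simp add: continuous_on_eq_continuous_at)
      hence "((\<lambda>r. - 2 * f (x - sqrt r *\<^sub>R z)) \<longlongrightarrow> - 2 * f x) (at 0)" by (simp add: isCont_def)
      hence "((\<lambda>r. - 2 * f (x - sqrt r *\<^sub>R z)) \<longlongrightarrow> - 2 * f x) (at_right 0)"
        by (rule tendsto_within_subset) simp
      thus "(((\<lambda>r. - 2 * f (x - sqrt r *\<^sub>R z)) \<circ> real_of_ereal) \<longlongrightarrow> - 2 * f x) (at_right (ereal 0))"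
        by (simp add: ereal_tendsto_simps)
    next
      have "\<forall>\<^sub>F r in at_top. - 2 * f (x - sqrt r *\<^sub>R z) = 0"
      proof (rule eventually_at_top_linorderI)
        fix r assume r: "r \<ge> (R / n)\<^sup>2 * 4"
        hence "sqrt r \<ge> sqrt ((R / n)\<^sup>2 * 4)" by simp
        hence "sqrt r \<ge> 2 * (R / n)" using R n by (simp add: real_sqrt_mult mult.commute)
        hence "sqrt r * n \<ge> 2 * R" using n by (simp add: field_simps)
        hence "norm (sqrt r *\<^sub>R z) > R" using R r by (simp add: n_def order_trans[OF _ r])
        thus "- 2 * f (x - sqrt r *\<^sub>R z) = 0" using far R0(2) by simp
      qed
      hence "((\<lambda>r. - 2 * f (x - sqrt r *\<^sub>R z)) \<longlongrightarrow> 0) at_top" by (rule tendsto_eventually)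
      thus "(((\<lambda>r. - 2 * f (x - sqrt r *\<^sub>R z)) \<circ> real_of_ereal) \<longlongrightarrow> 0) (at_left \<infinity>)"
        by (simp add: ereal_tendsto_simps)
    qed simp
    moreover have "(LBINT r=ereal 0..\<infinity>. G r z) = (\<integral>r. G r z \<partial>lborel)"
      unfolding interval_lebesgue_integral_def set_lebesgue_integral_def
      by (auto intro!: Bochner_Integration.integral_cong simp: G_def einterval_def indicator_def)
    ultimately show ?thesis by simp
  qed
  have meas: "(\<lambda>(z, r). gauss 1 z * G r z) \<in> borel_measurable (lborel \<Otimes>\<^sub>M lborel)"
    using Gm by (simp add: case_prod_unfold)
  have le: "AE z in lborel. (\<integral>r. \<bar>gauss 1 z * G r z\<bar> \<partial>lborel) \<le> 4 * K * R * gauss 1 z"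
    using AE_lborel_singleton[of "0::'a"]
  proof eventually_elim
    fix z :: 'a assume z: "z \<noteq> 0"
    have "gauss 1 z * (\<integral>r. \<bar>G r z\<bar> \<partial>lborel) \<le> gauss 1 z * (4 * K * R)" by (intro mult_left_mono Gbd z gauss_nonneg)
    thus "(\<integral>r. \<bar>gauss 1 z * G r z\<bar> \<partial>lborel) \<le> 4 * K * R * gauss 1 z"
      by (simp add: abs_mult gauss_nonneg mult_ac)
  qed
  have Gi: "AE z in lborel. integrable lborel (\<lambda>r. gauss 1 z * G r z)"
    using AE_lborel_singleton[of "0::'a"] by eventually_elim (auto intro!: integrable_mult_right Gint)
  have gi: "integrable lborel (\<lambda>z::'a. 4 * K * R * gauss 1 z)" by (intro integrable_mult_right gauss_integrable) simp
  note swap = fubini_dominated[OF meas Gi gi le]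
  have inner: "(\<integral>z. gauss 1 z * G r z \<partial>lborel) = pw 1 r * (\<Sum>j\<in>Basis. conv (egauss j r) (pd j f) x)" for r
  proof (cases "r > 0")
    case r: True
    have scale: "egauss j r (sqrt r *\<^sub>R z) = (z \<bullet> j) / sqrt r * gauss 1 z / r powr (real DIM('a) / 2)" for j z :: 'a
    proof -
      have "gauss r (sqrt r *\<^sub>R z) = gauss 1 z / r powr (real DIM('a) / 2)"
        using r by (simp add: gauss_def power_mult_distrib)
      moreover have "sqrt r * sqrt r = r" using r by simp
      hence "(sqrt r *\<^sub>R z) \<bullet> j / r = (z \<bullet> j) / sqrt r" using r by (simp add: divide_simps)
      ultimately show ?thesis by (simp only: egauss_def times_divide_eq_right)
    qed
    have cj: "conv (egauss j r) (pd j f) x = (\<integral>z. (z \<bullet> j) / sqrt r * gauss 1 z * pd j f (x - sqrt r *\<^sub>R z) \<partial>lborel)" if j: "j \<in> Basis" for j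
    proof -
      have "conv (egauss j r) (pd j f) x = (\<integral>y. egauss j r y * pd j f (x - y) \<partial>lborel)"
        by (rule conv_swap[OF _ pm[OF j]]) measurable
      also have "\<dots> = \<bar>sqrt r\<bar> ^ DIM('a) * (\<integral>z. egauss j r (0 + sqrt r *\<^sub>R z) * pd j f (x - (0 + sqrt r *\<^sub>R z)) \<partial>lborel)"
      proof (rule integral_lborel_affine)
        show "(\<lambda>y. egauss j r y * pd j f (x - y)) \<in> borel_measurable borel"
          by (intro borel_measurable_times measurable_compose[OF _ pm[OF j]]) measurable
      qed (use r in simp)
      also have "\<bar>sqrt r\<bar> ^ DIM('a) = r powr (real DIM('a) / 2)"
        using r by (simp add: powr_half_sqrt[symmetric] powr_powr powr_realpow[symmetric])
      also have "r powr (real DIM('a) / 2) * (\<integral>z. egauss j r (0 + sqrt r *\<^sub>R z) * pd j f (x - (0 + sqrt r *\<^sub>R z)) \<partial>lborel)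
        = (\<integral>z. r powr (real DIM('a) / 2) * (egauss j r (0 + sqrt r *\<^sub>R z) * pd j f (x - (0 + sqrt r *\<^sub>R z))) \<partial>lborel)" by simp
      also have "\<dots> = (\<integral>z. (z \<bullet> j) / sqrt r * gauss 1 z * pd j f (x - sqrt r *\<^sub>R z) \<partial>lborel)"
        using r by (intro Bochner_Integration.integral_cong refl) (simp add: scale)
      finally show ?thesis .
    qed
    have ij: "integrable lborel (\<lambda>z. (z \<bullet> j) / sqrt r * gauss 1 z * pd j f (x - sqrt r *\<^sub>R z))" if j: "j \<in> Basis" for j
    proof -
      obtain K' where K': "\<And>x. \<bar>pd j f x\<bar> \<le> K'" using test_bounded[OF test_pd[OF f j]] by auto
      note [measurable] = pm[OF j]
      have "integrable lborel (\<lambda>z. K' / sqrt r * egauss j 1 z)" by (intro integrable_mult_right egauss_integrable j) simp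
      thus ?thesis
      proof (rule Bochner_Integration.integrable_bound)
        show "AE z in lborel. norm ((z \<bullet> j) / sqrt r * gauss 1 z * pd j f (x - sqrt r *\<^sub>R z)) \<le> norm (K' / sqrt r * egauss j 1 z)"
        proof (rule AE_I2)
          fix z
          have "\<bar>(z \<bullet> j) / sqrt r * gauss 1 z\<bar> * \<bar>pd j f (x - sqrt r *\<^sub>R z)\<bar> \<le> \<bar>(z \<bullet> j) / sqrt r * gauss 1 z\<bar> * \<bar>K'\<bar>"
            by (intro mult_left_mono order_trans[OF K' abs_ge_self]) auto
          thus "norm ((z \<bullet> j) / sqrt r * gauss 1 z * pd j f (x - sqrt r *\<^sub>R z)) \<le> norm (K' / sqrt r * egauss j 1 z)"
            by (simp add: egauss_def abs_mult mult_ac)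
        qed
      qed measurable
    qed
    have "(\<integral>z. gauss 1 z * G r z \<partial>lborel) = (\<integral>z. (\<Sum>j\<in>Basis. (z \<bullet> j) / sqrt r * gauss 1 z * pd j f (x - sqrt r *\<^sub>R z)) \<partial>lborel)"
      using r by (intro Bochner_Integration.integral_cong refl) (simp add: G_def D_def sum_distrib_left sum_divide_distrib mult_ac)
    also have "\<dots> = (\<Sum>j\<in>Basis. conv (egauss j r) (pd j f) x)"
      by (subst Bochner_Integration.integral_sum, rule ij, assumption) (intro sum.cong refl cj[symmetric])
    finally show ?thesis using r by (simp add: pw_def)
  qed (simp add: G_def pw_def)
  have "integrable lborel (\<lambda>r. \<integral>z. gauss 1 z * G r z \<partial>lborel)"
    by (rule swap(2))
  thus "integrable lborel (\<lambda>r. pw 1 r * (\<Sum>j\<in>Basis. conv (egauss j r) (pd j f) x))" by (simp only: inner)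
  have "(\<integral>r. pw 1 r * (\<Sum>j\<in>Basis. conv (egauss j r) (pd j f) x) \<partial>lborel) = (\<integral>r. \<integral>z. gauss 1 z * G r z \<partial>lborel \<partial>lborel)"
    by (simp only: inner)
  also have "\<dots> = (\<integral>z. \<integral>r. gauss 1 z * G r z \<partial>lborel \<partial>lborel)"
    by (rule swap(1)[symmetric])
  also have "\<dots> = (\<integral>(z::'a). gauss 1 z * (2 * f x) \<partial>lborel)"
  proof (rule integral_cong_AE)
    show "AE z in lborel. (\<integral>r. gauss 1 z * G r z \<partial>lborel) = gauss 1 z * (2 * f x)"
      using AE_lborel_singleton[of "0::'a"] by eventually_elim (simp add: Gval)
    from lborel.borel_measurable_lebesgue_integral[OF meas]
    show "(\<lambda>z. \<integral>r. gauss 1 z * G r z \<partial>lborel) \<in> borel_measurable lborel" by simp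
  qed simp
  also have "\<dots> = 2 * f x" by (simp add: gauss_integral)
  finally show "f x = (1 / 2) * (\<integral>r. pw 1 r * (\<Sum>j\<in>Basis. conv (egauss j r) (pd j f) x) \<partial>lborel)" by simp
qed

section \<open>Smoothing of the heat semigroup between Lebesgue spaces\<close>

lemma heat_nn:
  fixes h :: "'a::euclidean_space \<Rightarrow> real"
  assumes r: "r > 0" and h: "bdd_borel h" "\<And>x. 0 \<le> h x"
  shows "ennreal (conv (gauss r) h x) = (\<integral>\<^sup>+y. ennreal (gauss r (x - y) * h y) \<partial>lborel)"
proof -
  obtain K where K: "h \<in> borel_measurable borel" "\<And>x. \<bar>h x\<bar> \<le> K" using h by (auto simp: bdd_borel_def)
  show ?thesis unfolding conv_def
    by (rule nn_integral_eq_integral[symmetric])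
       (use h(2) in \<open>auto intro!: conv_integrable[OF gauss_integrable[OF r] K] AE_I2 mult_nonneg_nonneg gauss_nonneg\<close>)
qed

lemma heat_mass:
  fixes h :: "'a::euclidean_space \<Rightarrow> real"
  assumes r: "r > 0" and h: "bdd_borel h" "\<And>x. 0 \<le> h x"
  shows "(\<integral>\<^sup>+x. ennreal (conv (gauss r) h x) \<partial>lborel) = (\<integral>\<^sup>+x. ennreal (h x) \<partial>lborel)"
proof -
  have [measurable]: "h \<in> borel_measurable borel" using h by (simp add: bdd_borel_def)
  have 1: "(\<integral>\<^sup>+x. ennreal (gauss r (x - y)) \<partial>lborel) = 1" for y :: 'a
  proof -
    have "(\<integral>\<^sup>+x. ennreal (gauss r (x - y)) \<partial>lborel) = (\<integral>\<^sup>+x. ennreal (gauss r (y + 1 *\<^sub>R x - y)) \<partial>lborel)"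
      by (subst nn_integral_lborel_affine[where c=1 and t=y]) auto
    also have "\<dots> = ennreal 1" using nn_integral_eq_integral[OF gauss_integrable[OF r, where 'a='a]] gauss_integral[OF r, where 'a='a] by (simp add: gauss_nonneg)
    finally show ?thesis by simp
  qed
  have "(\<integral>\<^sup>+x. ennreal (conv (gauss r) h x) \<partial>lborel) = (\<integral>\<^sup>+x. \<integral>\<^sup>+y. ennreal (gauss r (x - y) * h y) \<partial>lborel \<partial>lborel)"
    by (simp only: heat_nn[OF r h])
  also have "\<dots> = (\<integral>\<^sup>+y. \<integral>\<^sup>+x. ennreal (gauss r (x - y) * h y) \<partial>lborel \<partial>lborel)"
    by (rule lborel_pair.Fubini') measurable
  also have "\<dots> = (\<integral>\<^sup>+y. ennreal (h y) \<partial>lborel)"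
  proof (intro nn_integral_cong)
    fix y
    have "(\<integral>\<^sup>+x. ennreal (gauss r (x - y) * h y) \<partial>lborel) = (\<integral>\<^sup>+x. ennreal (gauss r (x - y)) * ennreal (h y) \<partial>lborel)"
      by (simp only: ennreal_mult gauss_nonneg h(2))
    also have "\<dots> = ennreal (h y)" by (subst nn_integral_multc) (auto simp: 1)
    finally show "(\<integral>\<^sup>+x. ennreal (gauss r (x - y) * h y) \<partial>lborel) = ennreal (h y)" .
  qed
  finally show ?thesis .
qed

lemma bdd_borel_powr:
  assumes h: "bdd_borel h" "\<And>x. 0 \<le> h x" and p: "p \<ge> 0" shows "bdd_borel (\<lambda>x. h x powr p)"
proof -
  obtain K where K: "h \<in> borel_measurable borel" "\<And>x. \<bar>h x\<bar> \<le> K" using h by (auto simp: bdd_borel_def)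
  have "\<bar>h x powr p\<bar> \<le> K powr p" for x using K(2)[of x] h(2)[of x] p by (auto intro!: powr_mono2)
  thus ?thesis using K(1) by (auto simp: bdd_borel_def)
qed

text \<open>Jensen's inequality gives \<open>(P\<^sub>r h)^p \<le> P\<^sub>r (h^p)\<close>. The right-hand side is bounded by \<open>M\<close> times
  the integral \<open>I\<close> of \<open>h^p\<close> and has integral \<open>I\<close>; interpolating the power \<open>q/p\<close> between these
  two bounds gives the claim.\<close>

lemma heat_smoothing:
  fixes h :: "'a::euclidean_space \<Rightarrow> real"
  assumes r: "r > 0" and h: "bdd_borel h" "\<And>x. 0 \<le> h x" and p: "1 \<le> p" "p \<le> q"
    and int: "integrable lborel (\<lambda>x. h x powr p)"
  shows "(\<integral>\<^sup>+x. ennreal (conv (gauss r) h x powr q) \<partial>lborel)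
    \<le> ennreal ((1 / (r powr (real DIM('a) / 2) * gauss_mass TYPE('a))) powr (q / p - 1) * (\<integral>x. h x powr p \<partial>lborel) powr (q / p))"
proof -
  have [measurable]: "h \<in> borel_measurable borel" using h by (simp add: bdd_borel_def)
  define I where "I = (\<integral>x. h x powr p \<partial>lborel)"
  define M where "M = 1 / (r powr (real DIM('a) / 2) * gauss_mass TYPE('a))"
  define e where "e = q / p - 1"
  have I: "I \<ge> 0" unfolding I_def by (intro integral_nonneg_AE) auto
  have M: "M > 0" unfolding M_def using r gauss_mass_pos[where 'a='a] by simp
  have e: "e \<ge> 0" using p by (simp add: e_def)
  note hp = bdd_borel_powr[OF h, of p]
  define c where "c x = conv (gauss r) (\<lambda>x. h x powr p) x" for x
  have c0: "c x \<ge> 0" for x unfolding c_def by (intro conv_nonneg gauss_nonneg) auto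
  have cle: "c x \<le> M * I" for x
  proof -
    have "\<bar>gauss r y\<bar> \<le> M" for y :: 'a unfolding M_def using gauss_le[OF r, of y] by (simp add: gauss_nonneg)
    hence "\<bar>c x\<bar> \<le> M * (\<integral>y. \<bar>h y powr p\<bar> \<partial>lborel)" unfolding c_def by (intro conv_abs_le_L1 int)
    thus ?thesis by (simp add: I_def)
  qed
  have jen: "conv (gauss r) h x powr p \<le> c x" for x
  proof -
    have "ennreal (conv (gauss r) h x powr p) \<le> ennreal ((\<integral>y. gauss r (x - y) \<partial>lborel) powr (p - 1)) * (\<integral>\<^sup>+y. ennreal (gauss r (x - y) * h y powr p) \<partial>lborel)"
    proof (rule jensen_powr)
      show "integrable lborel (\<lambda>y. gauss r (x - y))" by (intro integrable_reflect gauss_integrable r)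
      show "ennreal (conv (gauss r) h x) \<le> (\<integral>\<^sup>+y. ennreal (gauss r (x - y) * h y) \<partial>lborel)" by (simp add: heat_nn[OF r h])
      show "0 \<le> conv (gauss r) h x" by (intro conv_nonneg gauss_nonneg h)
    qed (use p h in \<open>auto simp: gauss_nonneg\<close>)
    also have "(\<integral>y. gauss r (x - y) \<partial>lborel) = 1" using integral_reflect[of "gauss r" x] gauss_integral[OF r, where 'a='a] by simp
    also have "(\<integral>\<^sup>+y. ennreal (gauss r (x - y) * h y powr p) \<partial>lborel) = ennreal (c x)"
      unfolding c_def using p by (subst heat_nn[OF r hp]) auto
    finally show ?thesis using c0[of x] by simp
  qed
  have "conv (gauss r) h x powr q \<le> (M * I) powr e * c x" for x
  proof -
    have "conv (gauss r) h x powr q = (conv (gauss r) h x powr p) powr (q / p)" using p by (simp add: powr_powr)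
    also have "\<dots> \<le> c x powr (q / p)" using jen[of x] p by (intro powr_mono2) auto
    also have "\<dots> = c x * c x powr e" using c0[of x] by (cases "c x = 0") (auto simp: e_def powr_diff)
    also have "\<dots> \<le> c x * (M * I) powr e" using cle[of x] c0[of x] e by (intro mult_left_mono powr_mono2) auto
    finally show ?thesis by (simp add: mult.commute)
  qed
  hence "(\<integral>\<^sup>+x. ennreal (conv (gauss r) h x powr q) \<partial>lborel) \<le> (\<integral>\<^sup>+x. ennreal ((M * I) powr e) * ennreal (c x) \<partial>lborel)"
    by (intro nn_integral_mono) (simp add: ennreal_mult[symmetric] c0 ennreal_leI)
  also have "\<dots> = ennreal ((M * I) powr e) * (\<integral>\<^sup>+x. ennreal (c x) \<partial>lborel)"
  proof (rule nn_integral_cmult)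
    have "c \<in> borel_measurable borel" unfolding c_def using conv_borel[of "gauss r" "\<lambda>x. h x powr p"] by simp
    thus "(\<lambda>x. ennreal (c x)) \<in> borel_measurable lborel" by measurable
  qed
  also have "(\<integral>\<^sup>+x. ennreal (c x) \<partial>lborel) = ennreal I"
    unfolding c_def using p nn_integral_eq_integral[OF int] by (subst heat_mass[OF r hp]) (auto simp: I_def)
  also have "ennreal ((M * I) powr e) * ennreal I = ennreal (M powr e * I powr (q / p))"
  proof -
    have "(M * I) powr e * I = M powr e * I powr (q / p)"
      using I M by (cases "I = 0") (auto simp: powr_mult e_def powr_diff)
    thus ?thesis using I by (simp add: ennreal_mult[symmetric])
  qed
  finally show ?thesis unfolding M_def I_def e_def .
qed

text \<open>It plays the role of Minkowski's integral inequality. A time average of \<open>r powr \<kappa> P\<^sub>\<tau>\<^sub>(\<^sub>r\<^sub>) h\<close>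
  against a weight \<open>w\<close> of finite mass is bounded by Jensen's inequality, whose right-hand side
  is this function. The factor \<open>r powr \<kappa>\<close> is, up to a constant, the reciprocal of the norm of \<open>P\<^sub>r\<close> from \<open>L^p\<close> to
  \<open>L^q\<close>, so that after integration in \<open>x\<close> no power of \<open>r\<close> is left.\<close>

definition heat_avg :: "real \<Rightarrow> (real \<Rightarrow> real) \<Rightarrow> real \<Rightarrow> (real \<Rightarrow> real) \<Rightarrow> ('a::euclidean_space \<Rightarrow> real) \<Rightarrow> 'a \<Rightarrow> ennreal" where
  "heat_avg q w \<kappa> \<tau> h x = (\<integral>\<^sup>+r. ennreal (w r * (r powr \<kappa> * conv (gauss (\<tau> r)) h x) powr q) \<partial>lborel)"

lemma heat_time_space_measurable:
  fixes h :: "'a::euclidean_space \<Rightarrow> real"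
  assumes [measurable]: "h \<in> borel_measurable borel" "\<tau> \<in> borel_measurable borel"
  shows "(\<lambda>p. conv (gauss (\<tau> (snd p))) h (fst p)) \<in> borel_measurable (lborel \<Otimes>\<^sub>M lborel)"
  by (rule conv_measurable[where g=fst and k="\<lambda>p. gauss (\<tau> (snd p))"]) (simp_all add: case_prod_unfold)

lemma heat_avg_integrand_measurable:
  fixes h :: "'a::euclidean_space \<Rightarrow> real"
  assumes [measurable]: "h \<in> borel_measurable borel" "\<tau> \<in> borel_measurable borel" "w \<in> borel_measurable borel"
  shows "(\<lambda>(x, r). ennreal (w r * (r powr \<kappa> * conv (gauss (\<tau> r)) h x) powr q)) \<in> borel_measurable (lborel \<Otimes>\<^sub>M lborel)"
proof -
  define c where "c p = conv (gauss (\<tau> (snd p))) h (fst p)" for p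
  have [measurable]: "c \<in> borel_measurable (lborel \<Otimes>\<^sub>M lborel)"
    unfolding c_def by (rule heat_time_space_measurable) fact+
  have "(\<lambda>p. ennreal (w (snd p) * (snd p powr \<kappa> * c p) powr q)) \<in> borel_measurable (lborel \<Otimes>\<^sub>M lborel)"
    by measurable
  thus ?thesis by (simp add: case_prod_unfold c_def)
qed

lemma heat_avg_jensen:
  fixes h :: "'a::euclidean_space \<Rightarrow> real"
  assumes h: "bdd_borel h" "\<And>x. 0 \<le> h x" and q: "1 \<le> q" and C: "0 \<le> C"
    and [measurable]: "\<tau> \<in> borel_measurable borel"
    and w: "integrable lborel w" "\<And>r. 0 \<le> w r" "\<And>r. r \<le> 0 \<Longrightarrow> w r = 0"
    and y: "0 \<le> y" "ennreal y \<le> ennreal C * (\<integral>\<^sup>+r. ennreal (w r * r powr \<kappa> * conv (gauss (\<tau> r)) h x) \<partial>lborel)"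
  shows "ennreal (y powr q) \<le> ennreal (C powr q * (\<integral>r. w r \<partial>lborel) powr (q - 1)) * heat_avg q w \<kappa> \<tau> h x"
proof (cases "C = 0")
  case True
  hence "y = 0" using y by simp
  thus ?thesis using q by simp
next
  case False
  hence C: "C > 0" using C by simp
  have [measurable]: "h \<in> borel_measurable borel" using h by (simp add: bdd_borel_def)
  have [measurable]: "(\<lambda>r. conv (gauss (\<tau> r)) h x) \<in> borel_measurable borel"
    by (rule conv_measurable[where g="\<lambda>_. x" and k="\<lambda>r. gauss (\<tau> r)"]) (simp_all add: case_prod_unfold)
  have "ennreal ((y / C) powr q) \<le> ennreal ((\<integral>r. w r \<partial>lborel) powr (q - 1)) * (\<integral>\<^sup>+r. ennreal (w r * (r powr \<kappa> * conv (gauss (\<tau> r)) h x) powr q) \<partial>lborel)"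
  proof (rule jensen_powr[OF w(1,2)])
    have "ennreal (y / C) = ennreal (1 / C) * ennreal y" using C y by (simp add: ennreal_mult[symmetric])
    also have "\<dots> \<le> ennreal (1 / C) * (ennreal C * (\<integral>\<^sup>+r. ennreal (w r * r powr \<kappa> * conv (gauss (\<tau> r)) h x) \<partial>lborel))"
      by (rule mult_left_mono[OF y(2)]) simp
    also have "\<dots> = (\<integral>\<^sup>+r. ennreal (w r * (r powr \<kappa> * conv (gauss (\<tau> r)) h x)) \<partial>lborel)"
      using C by (simp add: mult.assoc[symmetric] ennreal_mult[symmetric])
    finally show "ennreal (y / C) \<le> (\<integral>\<^sup>+r. ennreal (w r * (r powr \<kappa> * conv (gauss (\<tau> r)) h x)) \<partial>lborel)" .
  qed (use q C y h in \<open>auto intro!: mult_nonneg_nonneg conv_nonneg gauss_nonneg\<close>)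
  hence "ennreal (C powr q) * ennreal ((y / C) powr q) \<le> ennreal (C powr q) * (ennreal ((\<integral>r. w r \<partial>lborel) powr (q - 1)) * heat_avg q w \<kappa> \<tau> h x)"
    unfolding heat_avg_def by (rule mult_left_mono) simp
  moreover have "C powr q * (y / C) powr q = y powr q" using C y by (simp add: powr_mult[symmetric])
  ultimately show ?thesis by (simp add: ennreal_mult[symmetric] mult.assoc[symmetric])
qed

text \<open>Integrating in \<open>x\<close> first, \<open>heat_smoothing\<close> at the time \<open>\<tau> r \<ge> r\<close> costs at most \<open>r powr (-\<kappa> q)\<close>,
  which cancels the factor \<open>(r powr \<kappa>) powr q\<close>.\<close>

lemma heat_avg_smoothing:
  fixes h :: "'a::euclidean_space \<Rightarrow> real"
  assumes h: "bdd_borel h" "\<And>x. 0 \<le> h x" and p: "1 \<le> p" "p \<le> q" and int: "integrable lborel (\<lambda>x. h x powr p)"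
    and [measurable]: "\<tau> \<in> borel_measurable borel"
    and w: "integrable lborel w" "\<And>r. 0 \<le> w r" "\<And>r. r \<le> 0 \<Longrightarrow> w r = 0" and \<tau>: "\<And>r. w r \<noteq> 0 \<Longrightarrow> r \<le> \<tau> r"
    and \<kappa>: "\<kappa> = real DIM('a) / 2 * (1 / p - 1 / q)"
  shows "(\<integral>\<^sup>+x. heat_avg q w \<kappa> \<tau> h x \<partial>lborel) \<le> ennreal ((1 / gauss_mass TYPE('a)) powr (q / p - 1) * (\<integral>r. w r \<partial>lborel) * (\<integral>x. h x powr p \<partial>lborel) powr (q / p))"
proof -
  have [measurable]: "h \<in> borel_measurable borel" using h by (simp add: bdd_borel_def)
  note [measurable] = borel_measurable_integrable[OF w(1)]
  define I where "I = (\<integral>x. h x powr p \<partial>lborel)"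
  define c where "c = (1 / gauss_mass TYPE('a)) powr (q / p - 1)"
  have I: "I \<ge> 0" unfolding I_def by (intro integral_nonneg_AE) auto
  have c: "c \<ge> 0" by (simp add: c_def)
  have e: "q / p - 1 \<ge> 0" using p by simp
  have hx[measurable]: "(\<lambda>x. conv (gauss (\<tau> r)) h x) \<in> borel_measurable borel" for r by (rule conv_borel) auto
  have "(\<integral>\<^sup>+x. heat_avg q w \<kappa> \<tau> h x \<partial>lborel) = (\<integral>\<^sup>+r. \<integral>\<^sup>+x. ennreal (w r * (r powr \<kappa> * conv (gauss (\<tau> r)) h x) powr q) \<partial>lborel \<partial>lborel)"
    unfolding heat_avg_def
  proof (rule lborel_pair.Fubini'[symmetric])
    show "(\<lambda>(x, r). ennreal (w r * (r powr \<kappa> * conv (gauss (\<tau> r)) h x) powr q)) \<in> borel_measurable (lborel \<Otimes>\<^sub>M lborel)"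
      using borel_measurable_integrable[OF w(1)] by (intro heat_avg_integrand_measurable) auto
  qed
  also have "\<dots> \<le> (\<integral>\<^sup>+r. ennreal (c * I powr (q / p)) * ennreal (w r) \<partial>lborel)"
  proof (intro nn_integral_mono)
    fix r :: real
    show "(\<integral>\<^sup>+x. ennreal (w r * (r powr \<kappa> * conv (gauss (\<tau> r)) h x) powr q) \<partial>lborel) \<le> ennreal (c * I powr (q / p)) * ennreal (w r)"
    proof (cases "w r = 0")
      case False
      hence r: "r > 0" using w(3) not_le by blast
      hence \<tau>r: "\<tau> r \<ge> r" "\<tau> r > 0" using \<tau>[OF False] by auto
      have "(\<integral>\<^sup>+x. ennreal (w r * (r powr \<kappa> * conv (gauss (\<tau> r)) h x) powr q) \<partial>lborel)
         = (\<integral>\<^sup>+x. ennreal (w r * r powr (\<kappa> * q)) * ennreal (conv (gauss (\<tau> r)) h x powr q) \<partial>lborel)"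
      proof (intro nn_integral_cong)
        fix x
        have c0: "0 \<le> conv (gauss (\<tau> r)) h x" by (intro conv_nonneg gauss_nonneg h)
        have "(r powr \<kappa> * conv (gauss (\<tau> r)) h x) powr q = r powr (\<kappa> * q) * conv (gauss (\<tau> r)) h x powr q"
          using c0 by (simp add: powr_mult powr_powr)
        thus "ennreal (w r * (r powr \<kappa> * conv (gauss (\<tau> r)) h x) powr q) = ennreal (w r * r powr (\<kappa> * q)) * ennreal (conv (gauss (\<tau> r)) h x powr q)"
          using w(2)[of r] by (simp add: ennreal_mult[symmetric] mult.assoc)
      qed
      also have "\<dots> = ennreal (w r * r powr (\<kappa> * q)) * (\<integral>\<^sup>+x. ennreal (conv (gauss (\<tau> r)) h x powr q) \<partial>lborel)"
        by (rule nn_integral_cmult) (use hx[of r] in simp)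
      also have "\<dots> \<le> ennreal (w r * r powr (\<kappa> * q)) * ennreal ((1 / (\<tau> r powr (real DIM('a) / 2) * gauss_mass TYPE('a))) powr (q / p - 1) * I powr (q / p))"
        unfolding I_def by (intro mult_left_mono heat_smoothing \<tau>r h p int) auto
      also have "\<dots> \<le> ennreal (w r * r powr (\<kappa> * q)) * ennreal (r powr (- (\<kappa> * q)) * c * I powr (q / p))"
      proof (intro mult_left_mono ennreal_leI mult_right_mono)
        have "(1 / (\<tau> r powr (real DIM('a) / 2) * gauss_mass TYPE('a))) powr (q / p - 1) \<le> (1 / (r powr (real DIM('a) / 2) * gauss_mass TYPE('a))) powr (q / p - 1)"
        proof (rule powr_mono2[OF e])
          have "r powr (real DIM('a) / 2) \<le> \<tau> r powr (real DIM('a) / 2)" using \<tau>r r by (intro powr_mono2) auto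
          thus "1 / (\<tau> r powr (real DIM('a) / 2) * gauss_mass TYPE('a)) \<le> 1 / (r powr (real DIM('a) / 2) * gauss_mass TYPE('a))"
            using \<tau>r(2) r gauss_mass_pos[where 'a='a] by (intro divide_left_mono mult_right_mono mult_pos_pos) auto
        qed (use \<tau>r(2) gauss_mass_pos[where 'a='a] in auto)
        also have "\<dots> = (r powr (- (real DIM('a) / 2)) * (1 / gauss_mass TYPE('a))) powr (q / p - 1)"
        proof -
          have "1 / (r powr (real DIM('a) / 2) * gauss_mass TYPE('a)) = r powr (- (real DIM('a) / 2)) * (1 / gauss_mass TYPE('a))"
            by (subst powr_minus) (simp add: inverse_eq_divide)
          thus ?thesis by (simp only:)
        qed
        also have "\<dots> = r powr (- (real DIM('a) / 2) * (q / p - 1)) * c"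
          using gauss_mass_pos[where 'a='a] by (subst powr_mult) (auto simp add: c_def powr_powr)
        also have "- (real DIM('a) / 2) * (q / p - 1) = - (\<kappa> * q)" using p by (simp add: \<kappa> field_simps)
        finally show "(1 / (\<tau> r powr (real DIM('a) / 2) * gauss_mass TYPE('a))) powr (q / p - 1) \<le> r powr (- (\<kappa> * q)) * c" .
      qed auto
      also have "\<dots> = ennreal ((r powr (\<kappa> * q) * r powr (- (\<kappa> * q))) * (c * I powr (q / p) * w r))"
        using w(2)[of r] c by (simp add: ennreal_mult[symmetric] mult_ac)
      also have "r powr (\<kappa> * q) * r powr (- (\<kappa> * q)) = 1" using r by (simp add: powr_add[symmetric])
      finally show ?thesis using c w(2)[of r] by (simp add: ennreal_mult[symmetric])
    qed simp
  qed
  also have "\<dots> = ennreal (c * I powr (q / p)) * ennreal (\<integral>r. w r \<partial>lborel)"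
    using nn_integral_eq_integral[OF w(1)] w(2) by (subst nn_integral_cmult) auto
  also have "\<dots> = ennreal (c * (\<integral>r. w r \<partial>lborel) * I powr (q / p))"
    using c w(2) by (simp add: ennreal_mult[symmetric] mult_ac integral_nonneg_AE)
  finally show ?thesis unfolding c_def I_def .
qed

lemma heat_avg_measurable:
  fixes h :: "'a::euclidean_space \<Rightarrow> real"
  assumes [measurable]: "h \<in> borel_measurable borel" "\<tau> \<in> borel_measurable borel" "w \<in> borel_measurable borel"
  shows "heat_avg q w \<kappa> \<tau> h \<in> borel_measurable lborel"
proof -
  from lborel.borel_measurable_nn_integral[OF heat_avg_integrand_measurable[OF assms]] show ?thesis unfolding heat_avg_def[abs_def] by simp
qed

text \<open>The two time integrals that bound fractional gradients pointwise: \<open>h\<close> stands for the norm of the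
  gradient of order \<open>s\<close> and \<open>k\<close> for the modulus of \<open>P\<^sub>T\<^sub>/\<^sub>2 f\<close>. The doubled times come from
  \<open>egauss_le\<close> and \<open>gauss_double\<close>.\<close>

definition near_far :: "real \<Rightarrow> real \<Rightarrow> real \<Rightarrow> ('a::euclidean_space \<Rightarrow> real) \<Rightarrow> ('a \<Rightarrow> real) \<Rightarrow> 'a \<Rightarrow> ennreal" where
  "near_far s t T h k x =
     (\<integral>\<^sup>+r. ennreal (indicator {0<..<T} r * pw ((s - t) / 2) r * conv (gauss (2 * r)) h x) \<partial>lborel)
   + (\<integral>\<^sup>+r. ennreal (indicator {T<..} r * pw (- t / 2) r * conv (gauss (2 * r - T)) k x) \<partial>lborel)"

text \<open>The near integral uses \<open>P\<^sub>2\<^sub>r\<close> from \<open>L^p\<close> to \<open>L^q\<close> and the far one uses \<open>P\<^sub>2\<^sub>r\<^sub>-\<^sub>T\<close> from \<open>L^1\<close>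
  to \<open>L^q\<close>. After the loss of \<open>r powr \<kappa>\<close> and \<open>r powr \<kappa>'\<close>, the remaining weights have the
  exponents \<open>\<theta>0 > 0\<close> on \<open>(0,T)\<close>, which is the subcriticality hypothesis, and \<open>-a2 < 0\<close> on
  \<open>(T,\<infinity>)\<close>, which holds because \<open>t \<ge> 0\<close> and \<open>q > 1\<close>. The constants \<open>\<theta>\<close> and \<open>D\<close> do not depend on \<open>T\<close>: this
  makes the first summand small for small \<open>T\<close>.\<close>

lemma near_far_estimate:
  fixes s t p q C :: real
  assumes t: "0 \<le> t" and p: "1 \<le> p" "p \<le> q" "1 < q"
    and sub: "1 / p - s / real DIM('a) < 1 / q - t / real DIM('a::euclidean_space)" and C: "C \<ge> 0"
  shows "\<exists>\<theta>>0. \<exists>D\<ge>0. \<forall>T>0. \<exists>E\<ge>0. \<forall>h k y. bdd_borel h \<longrightarrow> (\<forall>x. 0 \<le> h x) \<longrightarrow> integrable lborel (\<lambda>x. h x powr p) \<longrightarrow>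
    bdd_borel k \<longrightarrow> (\<forall>x. 0 \<le> k x) \<longrightarrow> integrable lborel k \<longrightarrow> (\<forall>x::'a. 0 \<le> y x \<and> ennreal (y x) \<le> ennreal C * near_far s t T h k x) \<longrightarrow>
    (\<integral>\<^sup>+x. ennreal (y x powr q) \<partial>lborel) \<le> ennreal (D * T powr \<theta> * (\<integral>x. h x powr p \<partial>lborel) powr (q / p) + E * (\<integral>x. k x \<partial>lborel) powr q)"
proof -
  define d where "d = real DIM('a)"
  have d: "d > 0" by (simp add: d_def)
  define \<kappa> where "\<kappa> = d / 2 * (1 / p - 1 / q)"
  define \<kappa>' where "\<kappa>' = d / 2 * (1 / 1 - 1 / q)"
  define \<theta>0 where "\<theta>0 = (s - t) / 2 - \<kappa>"
  have \<theta>0: "\<theta>0 > 0"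
  proof -
    have "1 / p - 1 / q < s / d - t / d" using sub by (simp add: d_def)
    hence "d / 2 * (1 / p - 1 / q) < d / 2 * (s / d - t / d)" using d by (intro mult_strict_left_mono) auto
    also have "\<dots> = (s - t) / 2" using d by (simp add: field_simps)
    finally show ?thesis by (simp add: \<theta>0_def \<kappa>_def)
  qed
  have \<kappa>'0: "\<kappa>' > 0" using d p by (simp add: \<kappa>'_def)
  define a2 where "a2 = t / 2 + \<kappa>'"
  have a2: "a2 > 0" using t \<kappa>'0 by (simp add: a2_def)
  define g where "g = 1 / gauss_mass TYPE('a)"
  have g: "g > 0" using gauss_mass_pos[where 'a='a] by (simp add: g_def)
  define D where "D = (2 * C) powr q * g powr (q / p - 1) * (1 / \<theta>0) powr q"
  have tq: "0 < \<theta>0 * q" using \<theta>0 p by simp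
  have D0: "0 \<le> D" by (simp add: D_def)
  show ?thesis
  proof (rule exI[of _ "\<theta>0 * q"], rule conjI[OF tq], rule exI[of _ D], rule conjI[OF D0], intro allI impI)
    fix T :: real assume T: "T > 0"
    define A2 where "A2 = T powr (- a2) / a2"
    have A2: "A2 > 0" using T a2 by (simp add: A2_def)
    define E where "E = (2 * C) powr q * g powr (q / 1 - 1) * A2 powr q"
    show "\<exists>E\<ge>0. \<forall>h k y. bdd_borel h \<longrightarrow> (\<forall>x. 0 \<le> h x) \<longrightarrow> integrable lborel (\<lambda>x. h x powr p) \<longrightarrow>
      bdd_borel k \<longrightarrow> (\<forall>x. 0 \<le> k x) \<longrightarrow> integrable lborel k \<longrightarrow> (\<forall>x::'a. 0 \<le> y x \<and> ennreal (y x) \<le> ennreal C * near_far s t T h k x) \<longrightarrow>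
      (\<integral>\<^sup>+x. ennreal (y x powr q) \<partial>lborel) \<le> ennreal (D * T powr (\<theta>0 * q) * (\<integral>x. h x powr p \<partial>lborel) powr (q / p) + E * (\<integral>x. k x \<partial>lborel) powr q)"
    proof (intro exI[of _ E] conjI allI impI)
      show "0 \<le> E" by (simp add: E_def)
      fix h k y :: "'a \<Rightarrow> real"
      assume h: "bdd_borel h" "\<forall>x. 0 \<le> h x" "integrable lborel (\<lambda>x. h x powr p)"
        and k: "bdd_borel k" "\<forall>x. 0 \<le> k x" "integrable lborel k"
        and y: "\<forall>x. 0 \<le> y x \<and> ennreal (y x) \<le> ennreal C * near_far s t T h k x"
      \<comment> \<open>Weights of finite mass left over once the powers \<open>r powr \<kappa>\<close> and \<open>r powr \<kappa>'\<close> are split off.\<close>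
      define w1 where "w1 r = indicator {0<..<T} r * pw \<theta>0 r" for r
      define w2 where "w2 r = indicator {T<..} r * pw (- a2) r" for r
      have w1: "integrable lborel w1" "\<And>r. 0 \<le> w1 r" "\<And>r. r \<le> 0 \<Longrightarrow> w1 r = 0" "(\<integral>r. w1 r \<partial>lborel) = T powr \<theta>0 / \<theta>0"
        unfolding w1_def using integrable_pw_0[OF \<theta>0 T] integral_pw_0[OF \<theta>0 T] by (auto simp: pw_nonneg)
      have w2: "integrable lborel w2" "\<And>r. 0 \<le> w2 r" "\<And>r. r \<le> 0 \<Longrightarrow> w2 r = 0" "(\<integral>r. w2 r \<partial>lborel) = A2"
        unfolding w2_def A2_def using integrable_pw_inf[OF a2 T] integral_pw_inf[OF a2 T] T by (auto simp: pw_nonneg)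
      have e1: "indicator {0<..<T} r * pw ((s - t) / 2) r = w1 r * r powr \<kappa>" for r
        by (auto simp: w1_def pw_def \<theta>0_def powr_add[symmetric] indicator_def)
      have e2: "indicator {T<..} r * pw (- t / 2) r = w2 r * r powr \<kappa>'" for r
        by (auto simp: w2_def pw_def a2_def powr_add[symmetric] indicator_def)
      let ?Z1 = "heat_avg q w1 \<kappa> (\<lambda>r. 2 * r) h"
      let ?Z2 = "heat_avg q w2 \<kappa>' (\<lambda>r. 2 * r - T) k"
      have Zm: "?Z1 \<in> borel_measurable lborel" "?Z2 \<in> borel_measurable lborel"
        using bdd_borelD[OF h(1)] bdd_borelD[OF k(1)] borel_measurable_integrable[OF w1(1)] borel_measurable_integrable[OF w2(1)]
        by (intro heat_avg_measurable; simp)+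
      define c1 where "c1 = (2 * C) powr q * (T powr \<theta>0 / \<theta>0) powr (q - 1)"
      define c2 where "c2 = (2 * C) powr q * A2 powr (q - 1)"
      have pt: "ennreal (y x powr q) \<le> ennreal c1 * ?Z1 x + ennreal c2 * ?Z2 x" for x
      proof -
        define N where "N = (\<integral>\<^sup>+r. ennreal (indicator {0<..<T} r * pw ((s - t) / 2) r * conv (gauss (2 * r)) h x) \<partial>lborel)"
        define F where "F = (\<integral>\<^sup>+r. ennreal (indicator {T<..} r * pw (- t / 2) r * conv (gauss (2 * r - T)) k x) \<partial>lborel)"
        have yx: "0 \<le> y x" "ennreal (y x) \<le> ennreal C * (N + F)" using y by (auto simp: near_far_def N_def F_def)
        have two: "ennreal C * (a + a) = ennreal (2 * C) * a" for a :: ennreal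
        proof -
          have "ennreal (2 * C) = 2 * ennreal C" using C by (simp add: ennreal_mult)
          thus ?thesis by (simp add: mult.assoc mult_2[symmetric] mult.left_commute)
        qed
        \<comment> \<open>The sum is at most twice the larger summand, so each point needs only one of the two averages.\<close>
        show ?thesis
        proof (cases "F \<le> N")
          case True
          have "ennreal (y x) \<le> ennreal C * (N + N)" using yx(2) True by (meson add_left_mono mult_left_mono order_trans zero_le)
          hence "ennreal (y x) \<le> ennreal (2 * C) * (\<integral>\<^sup>+r. ennreal (w1 r * r powr \<kappa> * conv (gauss (2 * r)) h x) \<partial>lborel)"
            unfolding two N_def e1 .
          hence "ennreal (y x powr q) \<le> ennreal ((2 * C) powr q * (\<integral>r. w1 r \<partial>lborel) powr (q - 1)) * ?Z1 x"
            using h C p yx by (intro heat_avg_jensen w1) auto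
          thus ?thesis unfolding w1(4) c1_def[symmetric] by (simp add: add_increasing2)
        next
          case False
          hence "N \<le> F" by simp
          hence "ennreal (y x) \<le> ennreal C * (F + F)" using yx(2) by (meson add_right_mono mult_left_mono order_trans zero_le)
          hence "ennreal (y x) \<le> ennreal (2 * C) * (\<integral>\<^sup>+r. ennreal (w2 r * r powr \<kappa>' * conv (gauss (2 * r - T)) k x) \<partial>lborel)"
            unfolding two F_def e2 .
          hence "ennreal (y x powr q) \<le> ennreal ((2 * C) powr q * (\<integral>r. w2 r \<partial>lborel) powr (q - 1)) * ?Z2 x"
            using k C p yx by (intro heat_avg_jensen w2) auto
          thus ?thesis unfolding w2(4) c2_def[symmetric] by (simp add: add_increasing)
        qed
      qed
      define I where "I = (\<integral>x. h x powr p \<partial>lborel)"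
      define J where "J = (\<integral>x. k x \<partial>lborel)"
      have I: "I \<ge> 0" and J: "J \<ge> 0" unfolding I_def J_def using k by (auto intro!: integral_nonneg_AE)
      have Z1: "(\<integral>\<^sup>+x. ?Z1 x \<partial>lborel) \<le> ennreal (g powr (q / p - 1) * (T powr \<theta>0 / \<theta>0) * I powr (q / p))"
        unfolding g_def I_def w1(4)[symmetric]
        by (rule heat_avg_smoothing) (use h p w1 in \<open>auto simp: \<kappa>_def d_def w1_def indicator_def split: if_splits\<close>)
      have Z2: "(\<integral>\<^sup>+x. ?Z2 x \<partial>lborel) \<le> ennreal (g powr (q / 1 - 1) * A2 * J powr (q / 1))"
      proof -
        have kk: "(\<lambda>x. k x powr 1) = k" using k by (auto simp: powr_one_gt_zero_iff abs_of_nonneg)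
        have "(\<integral>\<^sup>+x. ?Z2 x \<partial>lborel) \<le> ennreal (g powr (q / 1 - 1) * A2 * (\<integral>x. k x powr 1 \<partial>lborel) powr (q / 1))"
          unfolding g_def w2(4)[symmetric]
          by (rule heat_avg_smoothing) (use k p w2 T in \<open>auto simp: \<kappa>'_def d_def w2_def indicator_def kk split: if_splits\<close>)
        thus ?thesis unfolding kk J_def .
      qed
      have "(\<integral>\<^sup>+x. ennreal (y x powr q) \<partial>lborel) \<le> (\<integral>\<^sup>+x. ennreal c1 * ?Z1 x + ennreal c2 * ?Z2 x \<partial>lborel)"
        by (intro nn_integral_mono pt)
      also have "\<dots> = ennreal c1 * (\<integral>\<^sup>+x. ?Z1 x \<partial>lborel) + ennreal c2 * (\<integral>\<^sup>+x. ?Z2 x \<partial>lborel)"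
        using Zm by (simp add: nn_integral_add nn_integral_cmult)
      also have "\<dots> \<le> ennreal c1 * ennreal (g powr (q / p - 1) * (T powr \<theta>0 / \<theta>0) * I powr (q / p)) + ennreal c2 * ennreal (g powr (q / 1 - 1) * A2 * J powr (q / 1))"
        by (intro add_mono mult_left_mono Z1 Z2) auto
      also have "\<dots> = ennreal (c1 * (g powr (q / p - 1) * (T powr \<theta>0 / \<theta>0) * I powr (q / p)) + c2 * (g powr (q / 1 - 1) * A2 * J powr (q / 1)))"
        using \<theta>0 A2 by (simp add: ennreal_mult[symmetric] ennreal_plus[symmetric] c1_def c2_def del: ennreal_plus)
      also have "c1 * (g powr (q / p - 1) * (T powr \<theta>0 / \<theta>0) * I powr (q / p)) = D * T powr (\<theta>0 * q) * I powr (q / p)"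
      proof -
        define a where "a = T powr \<theta>0 / \<theta>0"
        have a: "a > 0" using T \<theta>0 by (simp add: a_def)
        have "a powr (q - 1) * a = a powr q" using a by (simp add: powr_diff)
        moreover have "a powr q = (1 / \<theta>0) powr q * T powr (\<theta>0 * q)" using T \<theta>0 by (simp add: a_def powr_divide powr_powr)
        ultimately have aa: "a powr (q - 1) * a = (1 / \<theta>0) powr q * T powr (\<theta>0 * q)" by simp
        have "c1 * (g powr (q / p - 1) * a * I powr (q / p)) = (2 * C) powr q * g powr (q / p - 1) * (a powr (q - 1) * a) * I powr (q / p)"
          unfolding c1_def a_def[symmetric] by (simp only: mult_ac)
        thus ?thesis unfolding aa unfolding a_def D_def by (simp only: mult_ac)
      qed
      also have "c2 * (g powr (q / 1 - 1) * A2 * J powr (q / 1)) = E * J powr q"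
      proof -
        have aa: "A2 powr (q - 1) * A2 = A2 powr q" using A2 by (simp add: powr_diff)
        have "c2 * (g powr (q / 1 - 1) * A2 * J powr (q / 1)) = (2 * C) powr q * g powr (q / 1 - 1) * (A2 powr (q - 1) * A2) * J powr (q / 1)"
          unfolding c2_def by (simp only: mult_ac)
        thus ?thesis unfolding aa E_def by (simp only: mult_ac div_by_1)
      qed
      finally show "(\<integral>\<^sup>+x. ennreal (y x powr q) \<partial>lborel) \<le> ennreal (D * T powr (\<theta>0 * q) * (\<integral>x. h x powr p \<partial>lborel) powr (q / p) + E * (\<integral>x. k x \<partial>lborel) powr q)"
        unfolding I_def J_def .
    qed
  qed
qed

section \<open>Fractional gradients of test functions are bounded Borel functions\<close>

lemma frac_gradient_1_component:
  fixes f :: "'a::euclidean_space \<Rightarrow> real"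
  assumes f: "f \<in> Cc_inf S" and j: "j \<in> Basis" shows "frac_gradient 1 f x \<bullet> j = pd j f x"
  using j by (simp add: frac_gradient_def gradient_test[OF f])

lemma heat_pd_time_integral_bounded:
  fixes f :: "'a::euclidean_space \<Rightarrow> real"
  assumes f: "f \<in> Cc_inf S" and j: "j \<in> Basis" and b: "0 < b" "b < 1"
  shows "\<exists>M\<ge>0. \<forall>x. (\<integral>r. \<bar>pw b r * conv (gauss r) (pd j f) x\<bar> \<partial>lborel) \<le> M"
proof -
  obtain K where K: "K > 0" "\<And>r x. r > 0 \<Longrightarrow> \<bar>conv (gauss r) (pd j f) x\<bar> \<le> K" "\<And>r x. r > 0 \<Longrightarrow> \<bar>conv (gauss r) (pd j f) x\<bar> \<le> K / r"
    using heat_pd_decay[OF f j] by blast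
  have i: "integrable lborel (\<lambda>r. pw b r * min K (K / r))"
    by (rule integrable_pw_decay[OF b, of _ K]) (use K(1) in auto)
  have "(\<integral>r. \<bar>pw b r * conv (gauss r) (pd j f) x\<bar> \<partial>lborel) \<le> (\<integral>r. pw b r * min K (K / r) \<partial>lborel)" for x
  proof (rule order_trans[OF abs_ge_self abs_integral_le[OF i]])
    fix r show "\<bar>\<bar>pw b r * conv (gauss r) (pd j f) x\<bar>\<bar> \<le> pw b r * min K (K / r)"
    proof (cases "r > 0")
      case True thus ?thesis using K(2,3)[OF True, of x] by (simp add: abs_mult pw_nonneg mult_left_mono)
    qed (simp add: pw_def)
  qed
  moreover have "(\<integral>r. pw b r * min K (K / r) \<partial>lborel) \<ge> 0"
    using K(1) by (intro integral_nonneg_AE AE_I2) (auto simp: pw_def)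
  ultimately show ?thesis by blast
qed

lemma bdd_borel_frac_component:
  fixes f :: "'a::euclidean_space \<Rightarrow> real"
  assumes f: "f \<in> Cc_inf UNIV" and j: "j \<in> Basis" and s: "0 \<le> s" "s \<le> 1"
  shows "bdd_borel (\<lambda>x. frac_gradient s f x \<bullet> j)"
proof (cases "s = 1")
  case True
  have "(\<lambda>x. frac_gradient s f x \<bullet> j) = pd j f" using frac_gradient_1_component[OF f j] True by auto
  thus ?thesis using bdd_borel_test[OF test_pd[OF f j]] by simp
next
  case False
  then obtain c where c: "\<And>x. frac_gradient s f x \<bullet> j = c * (\<integral>r. pw ((1 - s) / 2) r * conv (gauss r) (pd j f) x \<partial>lborel)"
    using frac_gradient_heat_integral[of s, where 'a='a] f j s by auto
  obtain M where M: "\<And>x. (\<integral>r. \<bar>pw ((1 - s) / 2) r * conv (gauss r) (pd j f) x\<bar> \<partial>lborel) \<le> M"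
    using heat_pd_time_integral_bounded[OF f j, of "(1 - s) / 2"] s False by auto
  have bd: "\<bar>frac_gradient s f x \<bullet> j\<bar> \<le> \<bar>c\<bar> * M" for x
  proof -
    have "\<bar>\<integral>r. pw ((1 - s) / 2) r * conv (gauss r) (pd j f) x \<partial>lborel\<bar> \<le> M"
      by (rule order_trans[OF _ M[of x]])
         (use integral_norm_bound[of lborel "\<lambda>r. pw ((1 - s) / 2) r * conv (gauss r) (pd j f) x"] in \<open>simp only: real_norm_def\<close>)
    thus ?thesis unfolding c abs_mult by (intro mult_left_mono) auto
  qed
  have [measurable]: "(\<lambda>p. conv (gauss (snd p)) (pd j f) (fst p)) \<in> borel_measurable (lborel \<Otimes>\<^sub>M lborel)"
    using heat_time_space_measurable[OF test_borel[OF test_pd[OF f j]], of "\<lambda>r. r"] by simp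
  have "(\<lambda>p. pw ((1 - s) / 2) (snd p) * conv (gauss (snd p)) (pd j f) (fst p)) \<in> borel_measurable (lborel \<Otimes>\<^sub>M lborel)"
    by (intro borel_measurable_times measurable_compose[OF measurable_snd]) measurable
  hence "(\<lambda>(x, r). pw ((1 - s) / 2) r * conv (gauss r) (pd j f) x) \<in> borel_measurable (lborel \<Otimes>\<^sub>M lborel)"
    by (simp add: case_prod_unfold)
  from lborel.borel_measurable_lebesgue_integral[OF this]
  have "(\<lambda>x. frac_gradient s f x \<bullet> j) \<in> borel_measurable borel" unfolding c by simp
  thus ?thesis using bd by (auto simp: bdd_borel_def)
qed

lemma frac_gradient_borel:
  fixes f :: "'a::euclidean_space \<Rightarrow> real"
  assumes f: "f \<in> Cc_inf UNIV" and s: "0 \<le> s" "s \<le> 1"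
  shows "frac_gradient s f \<in> borel_measurable borel"
  by (subst borel_measurable_euclidean_space) (use bdd_borel_frac_component[OF f _ s] in \<open>auto simp: bdd_borel_def\<close>)

lemma bdd_borel_norm_frac_gradient:
  fixes f :: "'a::euclidean_space \<Rightarrow> real"
  assumes f: "f \<in> Cc_inf UNIV" and s: "0 \<le> s" "s \<le> 1"
  shows "bdd_borel (\<lambda>x. norm (frac_gradient s f x))"
proof -
  have "\<forall>j\<in>Basis. \<exists>K. \<forall>x. \<bar>frac_gradient s f x \<bullet> j\<bar> \<le> K" using bdd_borel_frac_component[OF f _ s] by (auto simp: bdd_borel_def)
  then obtain K where K: "\<And>j x. j \<in> Basis \<Longrightarrow> \<bar>frac_gradient s f x \<bullet> j\<bar> \<le> K j" by metis
  have "norm (frac_gradient s f x) \<le> (\<Sum>j\<in>Basis. K j)" for x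
    using norm_le_l1[of "frac_gradient s f x"] sum_mono[of Basis "\<lambda>j. \<bar>frac_gradient s f x \<bullet> j\<bar>" K] K by (auto intro: order_trans)
  thus ?thesis using frac_gradient_borel[OF f s] by (auto simp: bdd_borel_def)
qed

text \<open>Both integrals are absolutely convergent because the time integral is bounded uniformly in
  space.\<close>

lemma heat_time_space_swap:
  fixes \<phi> g :: "'a::euclidean_space \<Rightarrow> real"
  assumes \<phi>: "integrable lborel \<phi>" and g: "g \<in> Cc_inf S" and j: "j \<in> Basis" and b: "0 < b" "b < 1"
  shows "(\<integral>x. \<phi> x * (\<integral>r. pw b r * conv (gauss r) (pd j g) x \<partial>lborel) \<partial>lborel) = (\<integral>r. pw b r * (\<integral>x. \<phi> x * conv (gauss r) (pd j g) x \<partial>lborel) \<partial>lborel)"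
proof -
  define H where "H p = conv (gauss (snd p)) (pd j g) (fst p)" for p
  have [measurable]: "H \<in> borel_measurable (lborel \<Otimes>\<^sub>M lborel)"
    unfolding H_def using heat_time_space_measurable[OF test_borel[OF test_pd[OF g j]], of "\<lambda>r. r"] by simp
  have [measurable]: "\<phi> \<in> borel_measurable borel" using borel_measurable_integrable[OF \<phi>] by simp
  obtain M where M: "\<And>x. (\<integral>r. \<bar>pw b r * conv (gauss r) (pd j g) x\<bar> \<partial>lborel) \<le> M"
    using heat_pd_time_integral_bounded[OF g j b] by auto
  have "(\<integral>x. \<phi> x * (\<integral>r. pw b r * conv (gauss r) (pd j g) x \<partial>lborel) \<partial>lborel) = (\<integral>x. \<integral>r. \<phi> x * (pw b r * conv (gauss r) (pd j g) x) \<partial>lborel \<partial>lborel)"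
    by simp
  also have "\<dots> = (\<integral>r. \<integral>x. \<phi> x * (pw b r * conv (gauss r) (pd j g) x) \<partial>lborel \<partial>lborel)"
  proof (rule fubini_dominated(1))
    have "(\<lambda>p. \<phi> (fst p) * (pw b (snd p) * H p)) \<in> borel_measurable (lborel \<Otimes>\<^sub>M lborel)" by measurable
    thus "(\<lambda>(x, r). \<phi> x * (pw b r * conv (gauss r) (pd j g) x)) \<in> borel_measurable (lborel \<Otimes>\<^sub>M lborel)"
      by (simp add: case_prod_unfold H_def)
    show "AE x in lborel. integrable lborel (\<lambda>r. \<phi> x * (pw b r * conv (gauss r) (pd j g) x))"
      by (auto intro!: integrable_mult_right heat_pd_pw_integrable[OF g j b])
    show "integrable lborel (\<lambda>x. \<bar>\<phi> x\<bar> * M)" by (intro integrable_mult_left integrable_abs \<phi>)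
    have "\<bar>\<phi> x\<bar> * (\<integral>r. \<bar>pw b r * conv (gauss r) (pd j g) x\<bar> \<partial>lborel) \<le> \<bar>\<phi> x\<bar> * M" for x by (intro mult_left_mono M) simp
    thus "AE x in lborel. (\<integral>r. \<bar>\<phi> x * (pw b r * conv (gauss r) (pd j g) x)\<bar> \<partial>lborel) \<le> \<bar>\<phi> x\<bar> * M"
      by (simp add: abs_mult)
  qed
  also have "\<dots> = (\<integral>r. pw b r * (\<integral>x. \<phi> x * conv (gauss r) (pd j g) x \<partial>lborel) \<partial>lborel)"
    by (simp add: mult.left_commute[of "\<phi> _"])
  finally show ?thesis .
qed

lemma conv_frac_component:
  fixes f k :: "'a::euclidean_space \<Rightarrow> real"
  assumes f: "f \<in> Cc_inf UNIV" and j: "j \<in> Basis" and s: "0 \<le> s" "s < 1" and k: "integrable lborel k"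
    and c: "\<And>x. frac_gradient s f x \<bullet> j = c * (\<integral>r. pw ((1 - s) / 2) r * conv (gauss r) (pd j f) x \<partial>lborel)"
  shows "conv k (\<lambda>x. frac_gradient s f x \<bullet> j) x = c * (\<integral>r. pw ((1 - s) / 2) r * conv k (conv (gauss r) (pd j f)) x \<partial>lborel)"
proof -
  define a where "a = (1 - s) / 2"
  have a: "0 < a" "a < 1" using s by (auto simp: a_def)
  have "conv k (\<lambda>x. frac_gradient s f x \<bullet> j) x = c * (\<integral>y. k (x - y) * (\<integral>r. pw a r * conv (gauss r) (pd j f) y \<partial>lborel) \<partial>lborel)"
    unfolding conv_def[of k] c a_def[symmetric] by (simp add: mult.left_commute[of "k _" c])
  also have "\<dots> = c * (\<integral>r. pw a r * conv k (conv (gauss r) (pd j f)) x \<partial>lborel)"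
    unfolding heat_time_space_swap[OF integrable_reflect[OF k] f j a] by (simp only: conv_def[of k])
  finally show ?thesis by (simp add: a_def)
qed

section \<open>Pointwise bounds by heat flows\<close>

text \<open>The substitute for \<open>near_far_split\<close> when \<open>s = 1\<close>, where the order \<open>\<alpha> = (1 - s)/2\<close> degenerates to
  zero and \<open>A\<close> is \<open>B\<close>.\<close>

lemma near_far_trivial:
  fixes B :: "real \<Rightarrow> real"
  assumes [measurable]: "B \<in> borel_measurable borel" and T: "T > 0"
  shows "ennreal \<bar>\<integral>z. pw b z * B z \<partial>lborel\<bar> \<le>
     ennreal 1 * (\<integral>\<^sup>+r. ennreal (indicator {0<..<T} r * pw b r * \<bar>B r\<bar>) \<partial>lborel)
     + (\<integral>\<^sup>+z. ennreal (indicator {T<..} z * pw b z * \<bar>B z\<bar>) \<partial>lborel)"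
proof -
  have "ennreal \<bar>\<integral>z. pw b z * B z \<partial>lborel\<bar> \<le> (\<integral>\<^sup>+z. ennreal \<bar>pw b z * B z\<bar> \<partial>lborel)" by (rule abs_integral_le_nn)
  also have "\<dots> = (\<integral>\<^sup>+r. ennreal (indicator {0<..<T} r * pw b r * \<bar>B r\<bar>) + ennreal (indicator {T<..} r * pw b r * \<bar>B r\<bar>) \<partial>lborel)"
    by (rule nn_integral_cong_AE, use AE_lborel_singleton[of T] in eventually_elim)
       (auto simp: indicator_def pw_def abs_mult)
  also have "\<dots> = (\<integral>\<^sup>+r. ennreal (indicator {0<..<T} r * pw b r * \<bar>B r\<bar>) \<partial>lborel) + (\<integral>\<^sup>+z. ennreal (indicator {T<..} z * pw b z * \<bar>B z\<bar>) \<partial>lborel)"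
    by (intro nn_integral_add) auto
  finally show ?thesis by simp
qed

lemma near_far_combine:
  fixes H k :: "'a::euclidean_space \<Rightarrow> real" and A B :: "real \<Rightarrow> real"
  assumes F: "ennreal F \<le> ennreal c0 * (\<integral>\<^sup>+r. ennreal (indicator {0<..<T} r * pw a r * \<bar>A r\<bar>) \<partial>lborel)
     + (\<integral>\<^sup>+z. ennreal (indicator {T<..} z * pw b z * \<bar>B z\<bar>) \<partial>lborel)"
    and A: "\<And>r. r > 0 \<Longrightarrow> pw a r * \<bar>A r\<bar> \<le> c1 * (pw ((s - t) / 2) r * conv (gauss (2 * r)) H x)"
    and B: "\<And>z. z > T \<Longrightarrow> pw b z * \<bar>B z\<bar> \<le> c2 * (pw (- t / 2) z * conv (gauss (2 * z - T)) k x)"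
    and c: "c0 \<ge> 0" "c1 \<ge> 0" "c2 \<ge> 0" and [measurable]: "H \<in> borel_measurable borel" "k \<in> borel_measurable borel"
  shows "ennreal F \<le> ennreal (c0 * c1 + c2) * near_far s t T H k x"
proof -
  define N where "N = (\<integral>\<^sup>+r. ennreal (indicator {0<..<T} r * pw ((s - t) / 2) r * conv (gauss (2 * r)) H x) \<partial>lborel)"
  define Fa where "Fa = (\<integral>\<^sup>+r. ennreal (indicator {T<..} r * pw (- t / 2) r * conv (gauss (2 * r - T)) k x) \<partial>lborel)"
  have m1[measurable]: "(\<lambda>r. conv (gauss (2 * r)) H x) \<in> borel_measurable borel"
    by (rule conv_measurable[where g="\<lambda>_. x" and k="\<lambda>r. gauss (2 * r)"]) (simp_all add: case_prod_unfold)
  have m2[measurable]: "(\<lambda>r. conv (gauss (2 * r - T)) k x) \<in> borel_measurable borel"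
    by (rule conv_measurable[where g="\<lambda>_. x" and k="\<lambda>r. gauss (2 * r - T)"]) (simp_all add: case_prod_unfold)
  have "(\<integral>\<^sup>+r. ennreal (indicator {0<..<T} r * pw a r * \<bar>A r\<bar>) \<partial>lborel) \<le> (\<integral>\<^sup>+r. ennreal c1 * ennreal (indicator {0<..<T} r * pw ((s - t) / 2) r * conv (gauss (2 * r)) H x) \<partial>lborel)"
    using A c by (intro nn_integral_mono) (auto simp: ennreal_mult'[symmetric] indicator_def intro!: ennreal_leI)
  also have "\<dots> = ennreal c1 * N" unfolding N_def by (rule nn_integral_cmult) measurable
  finally have 1: "ennreal c0 * (\<integral>\<^sup>+r. ennreal (indicator {0<..<T} r * pw a r * \<bar>A r\<bar>) \<partial>lborel) \<le> ennreal c0 * (ennreal c1 * N)" by (rule mult_left_mono) simp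
  have "(\<integral>\<^sup>+z. ennreal (indicator {T<..} z * pw b z * \<bar>B z\<bar>) \<partial>lborel) \<le> (\<integral>\<^sup>+r. ennreal c2 * ennreal (indicator {T<..} r * pw (- t / 2) r * conv (gauss (2 * r - T)) k x) \<partial>lborel)"
    using B c by (intro nn_integral_mono) (auto simp: ennreal_mult'[symmetric] indicator_def intro!: ennreal_leI)
  also have "\<dots> = ennreal c2 * Fa" unfolding Fa_def by (rule nn_integral_cmult) measurable
  finally have 2: "(\<integral>\<^sup>+z. ennreal (indicator {T<..} z * pw b z * \<bar>B z\<bar>) \<partial>lborel) \<le> ennreal c2 * Fa" .
  have "ennreal F \<le> ennreal (c0 * c1) * N + ennreal c2 * Fa"
    using order_trans[OF F add_mono[OF 1 2]] c by (simp add: ennreal_mult mult.assoc)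
  also have "\<dots> \<le> ennreal (c0 * c1 + c2) * N + ennreal (c0 * c1 + c2) * Fa"
    using c by (intro add_mono mult_right_mono ennreal_leI) auto
  also have "\<dots> = ennreal (c0 * c1 + c2) * near_far s t T H k x" by (simp add: near_far_def N_def Fa_def distrib_left)
  finally show ?thesis .
qed

text \<open>The semigroup law with \<open>z = (z - T/2) + T/2\<close>: the last portion \<open>T/2\<close> of the time mollifies \<open>f\<close>,
  the rest carries the derivative.\<close>

lemma heat_pd_far:
  fixes f :: "'a::euclidean_space \<Rightarrow> real"
  assumes f: "f \<in> Cc_inf S" and j: "j \<in> Basis" and T: "0 < T" "T < z"
  shows "\<bar>conv (gauss z) (pd j f) x\<bar> \<le> 4 * 2 powr (real DIM('a) / 2) * z powr (- 1 / 2) * conv (gauss (2 * z - T)) (\<lambda>y. \<bar>conv (gauss (T / 2)) f y\<bar>) x"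
proof -
  define a where "a = z - T / 2"
  have a: "a > 0" "a + T / 2 = z" "2 * a = 2 * z - T" "z / 2 \<le> a" using T by (auto simp: a_def)
  have z: "z > 0" using T by simp
  note fb = bdd_borel_test[OF f]
  have fT: "bdd_borel (conv (gauss (T / 2)) f)" using T fb by (intro bdd_borel_conv gauss_integrable) auto
  define V where "V = conv (gauss (2 * z - T)) (\<lambda>y. \<bar>conv (gauss (T / 2)) f y\<bar>) x"
  have V: "V \<ge> 0" unfolding V_def by (intro conv_nonneg gauss_nonneg) auto
  have "conv (egauss j z) f x = conv (egauss j a) (conv (gauss (T / 2)) f) x"
    using egauss_heat[OF a(1) _ fb j, of "T / 2"] T a(2) by simp
  hence "\<bar>conv (gauss z) (pd j f) x\<bar> = 2 * \<bar>conv (egauss j a) (conv (gauss (T / 2)) f) x\<bar>"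
    by (simp add: heat_pd[OF f z j] abs_mult)
  also have "\<dots> \<le> 2 * (2 powr (real DIM('a) / 2) * a powr (-1/2) * V)"
    unfolding V_def a(3)[symmetric] by (intro mult_left_mono egauss_abs_le a fT j) simp
  also have "\<dots> \<le> 2 * (2 powr (real DIM('a) / 2) * (2 * z powr (-1/2)) * V)"
  proof (intro mult_left_mono mult_right_mono V)
    have "a powr (-1/2) \<le> (z / 2) powr (-1/2)" using a z by (intro powr_mono2') auto
    also have "\<dots> = z powr (-1/2) * 2 powr (1/2)" using z by (simp add: powr_divide powr_minus field_simps)
    also have "\<dots> \<le> z powr (-1/2) * 2 powr 1" by (intro mult_left_mono powr_mono) auto
    finally show "a powr (-1/2) \<le> 2 * z powr (-1/2)" by simp
  qed auto
  finally show ?thesis unfolding V_def by (simp add: mult_ac)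
qed

text \<open>Two derivatives must be absorbed, one by \<open>egauss j\<close> and one falling on \<open>f\<close>. The time \<open>z - T/2\<close>
  is therefore halved, and each half \<open>a\<close> gives a factor \<open>a powr (-1/2)\<close>.\<close>

lemma egauss_pd_far:
  fixes f :: "'a::euclidean_space \<Rightarrow> real"
  assumes f: "f \<in> Cc_inf S" and j: "j \<in> Basis" and T: "0 < T" "T < z"
  shows "\<bar>conv (egauss j z) (pd j f) x\<bar> \<le> 8 * 2 powr (real DIM('a)) / z * conv (gauss (2 * z - T)) (\<lambda>y. \<bar>conv (gauss (T / 2)) f y\<bar>) x"
proof -
  define c where "c = 2 powr (real DIM('a) / 2)"
  define a where "a = (z - T / 2) / 2"
  have a: "a > 0" "a + (a + T / 2) = z" "4 * a = 2 * z - T" "z / 4 \<le> a" "a + T / 2 > 0" using T by (auto simp: a_def field_simps)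
  have z: "z > 0" using T by simp
  note fb = bdd_borel_test[OF f] and pb = bdd_borel_test[OF test_pd[OF f j]]
  define F where "F = conv (gauss (T / 2)) f"
  have FT: "bdd_borel F" unfolding F_def using T fb by (intro bdd_borel_conv gauss_integrable) auto
  define W where "W = conv (gauss (2 * a)) (\<lambda>y. \<bar>F y\<bar>)"
  have Wb: "bdd_borel W" unfolding W_def using a FT by (intro bdd_borel_conv gauss_integrable bdd_borel_abs) auto
  have W0: "W y \<ge> 0" for y unfolding W_def by (intro conv_nonneg gauss_nonneg) auto
  have inner: "conv (gauss (a + T / 2)) (pd j f) = (\<lambda>y. - 2 * conv (egauss j a) F y)"
    using heat_pd[OF f a(5) j] egauss_heat[OF a(1) _ fb j, of "T / 2"] T by (auto simp: F_def fun_eq_iff)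
  have ib: "\<bar>- 2 * conv (egauss j a) F y\<bar> \<le> 2 * c * a powr (-1/2) * W y" for y
    using egauss_abs_le[OF a(1) FT j, of y] unfolding W_def c_def by (simp add: abs_mult)
  have ibb: "bdd_borel (\<lambda>y. - 2 * conv (egauss j a) F y)"
    unfolding inner[symmetric] using a pb by (intro bdd_borel_conv gauss_integrable) auto
  have W2: "conv (gauss (2 * a)) W x = conv (gauss (2 * z - T)) (\<lambda>y. \<bar>F y\<bar>) x"
  proof -
    have "2 * a + 2 * a = 2 * z - T" using a(3) by simp
    thus ?thesis unfolding W_def using heat_heat[of "2 * a" "2 * a" "\<lambda>y. \<bar>F y\<bar>"] a(1) bdd_borel_abs[OF FT] by simp
  qed
  have bb: "bdd_borel (\<lambda>y. 2 * c * a powr (-1/2) * W y)"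
  proof -
    obtain K where "W \<in> borel_measurable borel" "\<And>y. \<bar>W y\<bar> \<le> K" using Wb by (auto simp: bdd_borel_def)
    moreover from this have "\<bar>2 * c * a powr (-1/2) * W y\<bar> \<le> (2 * c * a powr (-1/2)) * K" for y
      using mult_left_mono[of "\<bar>W y\<bar>" K "2 * c * a powr (-1/2)"] by (simp add: abs_mult c_def)
    ultimately show ?thesis by (auto simp: bdd_borel_def)
  qed
  have "conv (egauss j z) (pd j f) x = conv (egauss j a) (conv (gauss (a + T / 2)) (pd j f)) x"
    using egauss_heat[OF a(1) a(5) pb j] a(2) by simp
  also have "\<bar>\<dots>\<bar> \<le> c * a powr (-1/2) * conv (gauss (2 * a)) (\<lambda>y. \<bar>- 2 * conv (egauss j a) F y\<bar>) x"
    unfolding inner c_def by (rule egauss_abs_le[OF a(1) ibb j])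
  also have "\<dots> \<le> c * a powr (-1/2) * conv (gauss (2 * a)) (\<lambda>y. 2 * c * a powr (-1/2) * W y) x"
    using a(1) by (intro mult_left_mono conv_mono gauss_integrable gauss_nonneg bdd_borel_abs ibb bb ib) (auto simp: c_def)
  also have "\<dots> = 2 * (c * c) * (a powr (-1/2) * a powr (-1/2)) * conv (gauss (2 * z - T)) (\<lambda>y. \<bar>F y\<bar>) x"
    unfolding conv_cmult_right W2 by (simp add: mult_ac)
  also have "c * c = 2 powr (real DIM('a))" unfolding c_def powr_add[symmetric] by simp
  also have "a powr (-1/2) * a powr (-1/2) = 1 / a" using a(1) by (simp add: powr_add[symmetric] powr_minus_divide)
  also have "2 * 2 powr (real DIM('a)) * (1 / a) * conv (gauss (2 * z - T)) (\<lambda>y. \<bar>F y\<bar>) x \<le> 2 * 2 powr (real DIM('a)) * (4 / z) * conv (gauss (2 * z - T)) (\<lambda>y. \<bar>F y\<bar>) x"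
    using a z by (intro mult_left_mono mult_right_mono conv_nonneg gauss_nonneg) (auto simp: field_simps)
  finally show ?thesis unfolding F_def by (simp add: mult_ac)
qed

text \<open>Convolution commutes with the time integral of \<open>frac_gradient_heat_integral\<close>. The case \<open>s = 1\<close>,
  where there is no time integral, is included to treat all orders at once.\<close>

lemma conv_frac_scale:
  assumes s: "0 < s" "s \<le> 1"
  shows "\<exists>c. c \<noteq> 0 \<and> (\<forall>f\<in>Cc_inf UNIV. \<forall>j\<in>Basis. \<forall>k. \<forall>x::'a::euclidean_space. integrable lborel k \<longrightarrow>
    conv k (\<lambda>y. frac_gradient s f y \<bullet> j) x = c * (if s = 1 then conv k (pd j f) x else (\<integral>r. pw ((1 - s) / 2) r * conv k (conv (gauss r) (pd j f)) x \<partial>lborel)))"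
proof (cases "s = 1")
  case True
  have "conv k (\<lambda>y. frac_gradient s f y \<bullet> j) x = conv k (pd j f) x" if "f \<in> Cc_inf UNIV" "j \<in> Basis" for f j k and x :: 'a
    using frac_gradient_1_component[OF that] True by (simp add: conv_def)
  thus ?thesis using True by (intro exI[of _ 1]) auto
next
  case False
  then obtain c where c: "c \<noteq> 0" "\<forall>f\<in>Cc_inf UNIV. \<forall>j\<in>Basis. \<forall>x::'a. frac_gradient s f x \<bullet> j = c * (\<integral>r. pw ((1 - s) / 2) r * conv (gauss r) (pd j f) x \<partial>lborel)"
    using frac_gradient_heat_integral[of s, where 'a='a] s by auto
  have "conv k (\<lambda>y. frac_gradient s f y \<bullet> j) x = c * (\<integral>r. pw ((1 - s) / 2) r * conv k (conv (gauss r) (pd j f)) x \<partial>lborel)"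
    if "f \<in> Cc_inf UNIV" "j \<in> Basis" "integrable lborel k" for f j k and x :: 'a
    by (rule conv_frac_component) (use that False s c in auto)
  thus ?thesis using False c(1) by (intro exI[of _ c]) auto
qed

text \<open>Up to constants, \<open>B z\<close> is \<open>P\<^sub>z \<partial>\<^sub>j f\<close> at \<open>x\<close>, whose integral of order \<open>(1 - t)/2\<close> is the
  fractional gradient of order \<open>t\<close>, and \<open>A r\<close> is \<open>P\<^sub>r\<close> of the gradient of order \<open>s\<close>, which by
  the semigroup law is the integral of order \<open>(1 - s)/2\<close> of \<open>B\<close>. The difference of the orders is
  \<open>(s - t)/2\<close>.\<close>

lemma frac_gradient_pointwise:
  assumes t: "0 \<le> t" "t < s" and s: "s \<le> 1"
  shows "\<exists>C\<ge>0. \<forall>f\<in>Cc_inf UNIV. \<forall>T>0. \<forall>x::'a::euclidean_space. \<forall>j\<in>Basis.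
     ennreal \<bar>frac_gradient t f x \<bullet> j\<bar> \<le> ennreal C * near_far s t T (\<lambda>y. norm (frac_gradient s f y)) (\<lambda>y. \<bar>conv (gauss (T / 2)) f y\<bar>) x"
proof -
  define \<alpha> where "\<alpha> = (1 - s) / 2"
  define b where "b = (1 - t) / 2"
  have ab: "0 \<le> \<alpha>" "\<alpha> < b" "b - \<alpha> = (s - t) / 2" "0 < b" "b < 1" using s t by (auto simp: \<alpha>_def b_def field_simps)
  obtain ct where ct: "ct \<noteq> 0" "\<forall>f\<in>Cc_inf UNIV. \<forall>j\<in>Basis. \<forall>x::'a. frac_gradient t f x \<bullet> j = ct * (\<integral>r. pw b r * conv (gauss r) (pd j f) x \<partial>lborel)"
    using frac_gradient_heat_integral[of t, where 'a='a] t s unfolding b_def by auto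
  obtain cs where cs: "cs \<noteq> 0" "\<forall>f\<in>Cc_inf UNIV. \<forall>j\<in>Basis. \<forall>k. \<forall>x::'a. integrable lborel k \<longrightarrow>
    conv k (\<lambda>y. frac_gradient s f y \<bullet> j) x = cs * (if s = 1 then conv k (pd j f) x else (\<integral>r. pw \<alpha> r * conv k (conv (gauss r) (pd j f)) x \<partial>lborel))"
    using conv_frac_scale[of s, where 'a='a] t s unfolding \<alpha>_def by auto
  define d2 where "d2 = 2 powr (real DIM('a) / 2)"
  define c0 where "c0 = (if s = 1 then 1 else 1 / Beta (b - \<alpha>) \<alpha>)"
  have c0: "c0 \<ge> 0"
  proof (cases "s = 1")
    case False
    hence "\<alpha> > 0" using s by (simp add: \<alpha>_def)
    hence "Beta (b - \<alpha>) \<alpha> > 0" using ab(2) by (intro Beta_pos) auto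
    thus ?thesis by (simp add: c0_def)
  qed (simp add: c0_def)
  define c1 where "c1 = d2 / \<bar>cs\<bar>"
  define c2 where "c2 = 4 * d2"
  have c12: "c1 \<ge> 0" "c2 \<ge> 0" by (auto simp: c1_def c2_def d2_def)
  have main: "ennreal \<bar>frac_gradient t f x \<bullet> j\<bar> \<le> ennreal (\<bar>ct\<bar> * (c0 * c1 + c2)) * near_far s t T (\<lambda>y. norm (frac_gradient s f y)) (\<lambda>y. \<bar>conv (gauss (T / 2)) f y\<bar>) x"
    if f: "f \<in> Cc_inf UNIV" and T: "T > 0" and j: "j \<in> Basis" for f T j and x :: 'a
  proof -
    have s0: "0 \<le> s" using t by simp
    define H where "H y = norm (frac_gradient s f y)" for y
    have Hb: "bdd_borel H" unfolding H_def by (rule bdd_borel_norm_frac_gradient[OF f s0 s])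
    define k where "k y = \<bar>conv (gauss (T / 2)) f y\<bar>" for y
    have kb: "bdd_borel k" unfolding k_def using T bdd_borel_test[OF f] by (intro bdd_borel_abs bdd_borel_conv gauss_integrable) auto
    define B where "B z = conv (gauss z) (pd j f) x" for z
    have Bm[measurable]: "B \<in> borel_measurable borel" unfolding B_def by (rule heat_time_measurable[OF test_borel[OF test_pd[OF f j]]])
    define G where "G y = frac_gradient s f y \<bullet> j" for y
    have Gb: "bdd_borel G" unfolding G_def by (rule bdd_borel_frac_component[OF f j s0 s])
    define A where "A r = (1 / cs) * conv (gauss r) G x" for r
    have int: "integrable lborel (\<lambda>z. pw b z * B z)" unfolding B_def by (rule heat_pd_pw_integrable[OF f j ab(4,5)])
    have AG: "A r = (if s = 1 then B r else (\<integral>\<sigma>. pw \<alpha> \<sigma> * B (r + \<sigma>) \<partial>lborel))" if r: "r > 0" for r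
    proof -
      have "conv (gauss r) G x = cs * (if s = 1 then conv (gauss r) (pd j f) x else (\<integral>\<sigma>. pw \<alpha> \<sigma> * conv (gauss r) (conv (gauss \<sigma>) (pd j f)) x \<partial>lborel))"
        unfolding G_def using cs(2) f j gauss_integrable[OF r] by blast
      moreover have "(\<integral>\<sigma>. pw \<alpha> \<sigma> * conv (gauss r) (conv (gauss \<sigma>) (pd j f)) x \<partial>lborel) = (\<integral>\<sigma>. pw \<alpha> \<sigma> * B (r + \<sigma>) \<partial>lborel)"
      proof (intro Bochner_Integration.integral_cong refl)
        fix \<sigma> show "pw \<alpha> \<sigma> * conv (gauss r) (conv (gauss \<sigma>) (pd j f)) x = pw \<alpha> \<sigma> * B (r + \<sigma>)"
          using heat_heat[OF r _ bdd_borel_test[OF test_pd[OF f j]], of \<sigma>] by (cases "\<sigma> > 0") (auto simp: pw_def B_def)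
      qed
      ultimately show ?thesis using cs(1) by (simp add: A_def B_def)
    qed
    have split: "ennreal \<bar>\<integral>z. pw b z * B z \<partial>lborel\<bar> \<le> ennreal c0 * (\<integral>\<^sup>+r. ennreal (indicator {0<..<T} r * pw (b - \<alpha>) r * \<bar>A r\<bar>) \<partial>lborel)
     + (\<integral>\<^sup>+z. ennreal (indicator {T<..} z * pw b z * \<bar>B z\<bar>) \<partial>lborel)"
    proof (cases "s = 1")
      case True
      have "(\<integral>\<^sup>+r. ennreal (indicator {0<..<T} r * pw (b - \<alpha>) r * \<bar>A r\<bar>) \<partial>lborel) = (\<integral>\<^sup>+r. ennreal (indicator {0<..<T} r * pw b r * \<bar>B r\<bar>) \<partial>lborel)"
        using True AG by (intro nn_integral_cong) (auto simp: \<alpha>_def indicator_def)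
      thus ?thesis using near_far_trivial[OF Bm T, of b] True by (simp add: c0_def)
    next
      case False
      hence "\<alpha> > 0" using s by (simp add: \<alpha>_def)
      thus ?thesis unfolding c0_def using False near_far_split[OF _ ab(2) Bm int _ T, of A] AG by simp
    qed
    have "ennreal \<bar>\<integral>z. pw b z * B z \<partial>lborel\<bar> \<le> ennreal (c0 * c1 + c2) * near_far s t T H k x"
    proof (rule near_far_combine[OF split])
      fix r :: real assume r: "r > 0"
      have GH: "\<bar>G y\<bar> \<le> H y" for y unfolding G_def H_def using j by (rule Basis_le_norm)
      have "\<bar>A r\<bar> = (1 / \<bar>cs\<bar>) * \<bar>conv (gauss r) G x\<bar>" by (simp add: A_def abs_mult)
      also have "\<dots> \<le> (1 / \<bar>cs\<bar>) * (d2 * conv (gauss (2 * r)) (\<lambda>y. \<bar>G y\<bar>) x)"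
        unfolding d2_def by (intro mult_left_mono heat_double_le r Gb) simp
      also have "\<dots> \<le> (1 / \<bar>cs\<bar>) * (d2 * conv (gauss (2 * r)) H x)"
        using r by (intro mult_left_mono conv_mono gauss_integrable gauss_nonneg bdd_borel_abs Gb Hb GH) (auto simp: d2_def)
      finally have "\<bar>A r\<bar> \<le> c1 * conv (gauss (2 * r)) H x" by (simp add: c1_def)
      hence "pw (b - \<alpha>) r * \<bar>A r\<bar> \<le> pw (b - \<alpha>) r * (c1 * conv (gauss (2 * r)) H x)" by (intro mult_left_mono pw_nonneg)
      thus "pw (b - \<alpha>) r * \<bar>A r\<bar> \<le> c1 * (pw ((s - t) / 2) r * conv (gauss (2 * r)) H x)" by (simp add: ab(3) mult_ac)
    next
      fix z assume z: "z > T"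
      hence z0: "z > 0" using T by simp
      have "\<bar>B z\<bar> \<le> 4 * d2 * z powr (- 1 / 2) * conv (gauss (2 * z - T)) k x"
        unfolding B_def d2_def k_def by (rule heat_pd_far[OF f j T z])
      hence "pw b z * \<bar>B z\<bar> \<le> pw b z * (4 * d2 * z powr (- 1 / 2) * conv (gauss (2 * z - T)) k x)" by (intro mult_left_mono pw_nonneg)
      also have "\<dots> = c2 * ((pw b z * z powr (-1/2)) * conv (gauss (2 * z - T)) k x)" by (simp add: c2_def mult_ac)
      also have "pw b z * z powr (-1/2) = pw (- t / 2) z"
      proof -
        have "(b - 1) + (-1/2) = - t / 2 - 1" by (simp add: b_def field_simps)
        thus ?thesis using z0 by (simp only: pw_pos powr_add[symmetric])
      qed
      finally show "pw b z * \<bar>B z\<bar> \<le> c2 * (pw (- t / 2) z * conv (gauss (2 * z - T)) k x)" .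
    qed (use c0 c12 bdd_borelD[OF Hb] bdd_borelD[OF kb] in auto)
    hence "ennreal \<bar>ct\<bar> * ennreal \<bar>\<integral>z. pw b z * B z \<partial>lborel\<bar> \<le> ennreal \<bar>ct\<bar> * (ennreal (c0 * c1 + c2) * near_far s t T H k x)" by (rule mult_left_mono) simp
    moreover have "frac_gradient t f x \<bullet> j = ct * (\<integral>z. pw b z * B z \<partial>lborel)" using ct(2) f j by (simp add: B_def)
    ultimately show ?thesis unfolding H_def k_def using c0 c12 by (simp add: abs_mult ennreal_mult mult.assoc)
  qed
  have "\<bar>ct\<bar> * (c0 * c1 + c2) \<ge> 0" using c0 c12 by simp
  with main show ?thesis by blast
qed

text \<open>The analogue of \<open>frac_gradient_pointwise\<close> for \<open>f\<close> itself, with \<open>test_heat_integral\<close> in place of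
  the formula for the gradient: now \<open>B\<close> contains \<open>egauss j z\<close>, its integral is of order \<open>1\<close>, and
  \<open>egauss\<close> contributes \<open>r powr (-1/2)\<close>, so the near integral has order
  \<open>1 - (1 - s)/2 - 1/2 = s/2\<close>. Formally this is the case \<open>t = 0\<close>.\<close>

lemma test_pointwise:
  assumes s: "0 < s" "s \<le> 1"
  shows "\<exists>C\<ge>0. \<forall>f\<in>Cc_inf UNIV. \<forall>T>0. \<forall>x::'a::euclidean_space.
     ennreal \<bar>f x\<bar> \<le> ennreal C * near_far s 0 T (\<lambda>y. norm (frac_gradient s f y)) (\<lambda>y. \<bar>conv (gauss (T / 2)) f y\<bar>) x"
proof -
  define \<alpha> where "\<alpha> = (1 - s) / 2"
  have ab: "0 \<le> \<alpha>" "\<alpha> < 1" using s by (auto simp: \<alpha>_def field_simps)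
  obtain cs where cs: "cs \<noteq> 0" "\<forall>f\<in>Cc_inf UNIV. \<forall>j\<in>Basis. \<forall>k. \<forall>x::'a. integrable lborel k \<longrightarrow>
    conv k (\<lambda>y. frac_gradient s f y \<bullet> j) x = cs * (if s = 1 then conv k (pd j f) x else (\<integral>r. pw \<alpha> r * conv k (conv (gauss r) (pd j f)) x \<partial>lborel))"
    using conv_frac_scale[of s, where 'a='a] s unfolding \<alpha>_def by auto
  define d where "d = real DIM('a)"
  define d2 where "d2 = 2 powr (d / 2)"
  define c0 where "c0 = (if s = 1 then 1 else 1 / Beta (1 - \<alpha>) \<alpha>)"
  have c0: "c0 \<ge> 0"
  proof (cases "s = 1")
    case False
    hence "\<alpha> > 0" using s by (simp add: \<alpha>_def)
    thus ?thesis using Beta_pos[of "1 - \<alpha>" \<alpha>] ab False by (simp add: c0_def)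
  qed (simp add: c0_def)
  define c1 where "c1 = d * d2 / \<bar>cs\<bar>"
  define c2 where "c2 = d * (8 * 2 powr d)"
  have c12: "c1 \<ge> 0" "c2 \<ge> 0" by (auto simp: c1_def c2_def d2_def d_def)
  have main: "ennreal \<bar>f x\<bar> \<le> ennreal (c0 * c1 + c2) * near_far s 0 T (\<lambda>y. norm (frac_gradient s f y)) (\<lambda>y. \<bar>conv (gauss (T / 2)) f y\<bar>) x"
    if f: "f \<in> Cc_inf UNIV" and T: "T > 0" for f T and x :: 'a
  proof -
    have s0: "0 \<le> s" using s by simp
    define H where "H y = norm (frac_gradient s f y)" for y
    have Hb: "bdd_borel H" unfolding H_def by (rule bdd_borel_norm_frac_gradient[OF f s0 s(2)])
    define k where "k y = \<bar>conv (gauss (T / 2)) f y\<bar>" for y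
    have kb: "bdd_borel k" unfolding k_def using T bdd_borel_test[OF f] by (intro bdd_borel_abs bdd_borel_conv gauss_integrable) auto
    define B where "B z = (\<Sum>j\<in>Basis. conv (egauss j z) (pd j f) x)" for z
    have Bj: "(\<lambda>z. conv (egauss j z) (pd j f) x) \<in> borel_measurable borel" if j: "j \<in> Basis" for j
      by (rule conv_measurable[where g="\<lambda>_. x" and k="egauss j"]) (use test_borel[OF test_pd[OF f j]] in \<open>simp_all add: case_prod_unfold\<close>)
    have Bm[measurable]: "B \<in> borel_measurable borel" unfolding B_def by (intro borel_measurable_sum Bj)
    define G where "G j y = frac_gradient s f y \<bullet> j" for j y
    have Gb: "bdd_borel (G j)" if "j \<in> Basis" for j unfolding G_def by (rule bdd_borel_frac_component[OF f that s0 s(2)])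
    define A where "A r = (1 / cs) * (\<Sum>j\<in>Basis. conv (egauss j r) (G j) x)" for r
    note rep = test_heat_integral[OF f, of x]
    have int: "integrable lborel (\<lambda>z. pw 1 z * B z)" unfolding B_def by (rule rep(1))
    have AG: "A r = (if s = 1 then B r else (\<integral>\<sigma>. pw \<alpha> \<sigma> * B (r + \<sigma>) \<partial>lborel))" if r: "r > 0" for r
    proof -
      have 1: "conv (egauss j r) (G j) x = cs * (if s = 1 then conv (egauss j r) (pd j f) x else (\<integral>\<sigma>. pw \<alpha> \<sigma> * conv (egauss j (r + \<sigma>)) (pd j f) x \<partial>lborel))"
        if j: "j \<in> Basis" for j
      proof -
        have "conv (egauss j r) (G j) x = cs * (if s = 1 then conv (egauss j r) (pd j f) x else (\<integral>\<sigma>. pw \<alpha> \<sigma> * conv (egauss j r) (conv (gauss \<sigma>) (pd j f)) x \<partial>lborel))"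
          unfolding G_def using cs(2) f j egauss_integrable[OF r j] by blast
        moreover have "(\<integral>\<sigma>. pw \<alpha> \<sigma> * conv (egauss j r) (conv (gauss \<sigma>) (pd j f)) x \<partial>lborel) = (\<integral>\<sigma>. pw \<alpha> \<sigma> * conv (egauss j (r + \<sigma>)) (pd j f) x \<partial>lborel)"
        proof (intro Bochner_Integration.integral_cong refl)
          fix \<sigma> show "pw \<alpha> \<sigma> * conv (egauss j r) (conv (gauss \<sigma>) (pd j f)) x = pw \<alpha> \<sigma> * conv (egauss j (r + \<sigma>)) (pd j f) x"
            using egauss_heat[OF r _ bdd_borel_test[OF test_pd[OF f j]] j, of \<sigma>] by (cases "\<sigma> > 0") (auto simp: pw_def)
        qed
        ultimately show ?thesis by simp
      qed
      show ?thesis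
      proof (cases "s = 1")
        case True
        thus ?thesis using 1 cs(1) by (simp add: A_def B_def sum_distrib_left[symmetric])
      next
        case False
        hence \<alpha>0: "\<alpha> > 0" using s by (simp add: \<alpha>_def)
        have ij: "integrable lborel (\<lambda>\<sigma>. pw \<alpha> \<sigma> * conv (egauss j (r + \<sigma>)) (pd j f) x)" if j: "j \<in> Basis" for j
        proof -
          have pb: "bdd_borel (pd j f)" by (rule bdd_borel_test[OF test_pd[OF f j]])
          obtain K where K: "K > 0" "\<forall>r>0. \<forall>x. \<bar>conv (gauss r) (pd j f) x\<bar> \<le> K \<and> \<bar>conv (gauss r) (pd j f) x\<bar> \<le> K / r"
            using heat_pd_decay[OF f j] by blast
          define M where "M = (\<integral>y. \<bar>egauss j r (y::'a)\<bar> \<partial>lborel)"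
          have e: "conv (egauss j (r + \<sigma>)) (pd j f) x = conv (egauss j r) (conv (gauss \<sigma>) (pd j f)) x" if "\<sigma> > 0" for \<sigma>
            using egauss_heat[OF r that pb j] by simp
          have b1: "\<bar>conv (egauss j (r + \<sigma>)) (pd j f) x\<bar> \<le> K * M" if "\<sigma> > 0" for \<sigma>
            unfolding e[OF that] M_def by (rule conv_abs_le[OF egauss_integrable[OF r j]]) (use K that in auto)
          have b2: "\<bar>conv (egauss j (r + \<sigma>)) (pd j f) x\<bar> \<le> (K * M) / \<sigma>" if "\<sigma> > 0" for \<sigma>
          proof -
            have "\<bar>conv (egauss j (r + \<sigma>)) (pd j f) x\<bar> \<le> (K / \<sigma>) * M"
              unfolding e[OF that] M_def by (rule conv_abs_le[OF egauss_integrable[OF r j]]) (use K that in auto)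
            thus ?thesis by simp
          qed
          have "(\<lambda>\<sigma>. conv (egauss j (r + \<sigma>)) (pd j f) x) \<in> borel_measurable borel"
            by (rule measurable_compose[OF _ Bj[OF j]]) simp
          thus ?thesis using \<alpha>0 ab by (intro integrable_pw_decay[OF _ _ _ b1 b2]) auto
        qed
        have "A r = (\<Sum>j\<in>Basis. (\<integral>\<sigma>. pw \<alpha> \<sigma> * conv (egauss j (r + \<sigma>)) (pd j f) x \<partial>lborel))"
          using 1 cs(1) False by (simp add: A_def sum_distrib_left[symmetric])
        also have "\<dots> = (\<integral>\<sigma>. (\<Sum>j\<in>Basis. pw \<alpha> \<sigma> * conv (egauss j (r + \<sigma>)) (pd j f) x) \<partial>lborel)"
          by (rule Bochner_Integration.integral_sum[symmetric]) (rule ij)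
        also have "\<dots> = (\<integral>\<sigma>. pw \<alpha> \<sigma> * B (r + \<sigma>) \<partial>lborel)" by (simp add: B_def sum_distrib_left)
        finally show ?thesis using False by simp
      qed
    qed
    have split: "ennreal \<bar>\<integral>z. pw 1 z * B z \<partial>lborel\<bar> \<le> ennreal c0 * (\<integral>\<^sup>+r. ennreal (indicator {0<..<T} r * pw (1 - \<alpha>) r * \<bar>A r\<bar>) \<partial>lborel)
     + (\<integral>\<^sup>+z. ennreal (indicator {T<..} z * pw 1 z * \<bar>B z\<bar>) \<partial>lborel)"
    proof (cases "s = 1")
      case True
      have "(\<integral>\<^sup>+r. ennreal (indicator {0<..<T} r * pw (1 - \<alpha>) r * \<bar>A r\<bar>) \<partial>lborel) = (\<integral>\<^sup>+r. ennreal (indicator {0<..<T} r * pw 1 r * \<bar>B r\<bar>) \<partial>lborel)"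
        using True AG by (intro nn_integral_cong) (auto simp: \<alpha>_def indicator_def)
      thus ?thesis using near_far_trivial[OF Bm T, of 1] True by (simp add: c0_def)
    next
      case False
      hence "\<alpha> > 0" using s by (simp add: \<alpha>_def)
      thus ?thesis unfolding c0_def using False near_far_split[OF _ ab(2) Bm int _ T, of A] AG by simp
    qed
    have nf: "ennreal \<bar>\<integral>z. pw 1 z * B z \<partial>lborel\<bar> \<le> ennreal (c0 * c1 + c2) * near_far s 0 T H k x"
    proof (rule near_far_combine[OF split])
      fix r :: real assume r: "r > 0"
      have GH: "\<bar>G j y\<bar> \<le> H y" if "j \<in> Basis" for j y unfolding G_def H_def using that by (rule Basis_le_norm)
      have gj: "\<bar>conv (egauss j r) (G j) x\<bar> \<le> d2 * r powr (-1/2) * conv (gauss (2 * r)) H x" if j: "j \<in> Basis" for j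
      proof -
        have "\<bar>conv (egauss j r) (G j) x\<bar> \<le> d2 * r powr (-1/2) * conv (gauss (2 * r)) (\<lambda>y. \<bar>G j y\<bar>) x"
          unfolding d2_def d_def by (rule egauss_abs_le[OF r Gb[OF j] j])
        also have "\<dots> \<le> d2 * r powr (-1/2) * conv (gauss (2 * r)) H x"
          using r by (intro mult_left_mono conv_mono gauss_integrable gauss_nonneg bdd_borel_abs Gb[OF j] Hb GH[OF j]) (auto simp: d2_def)
        finally show ?thesis .
      qed
      have "\<bar>A r\<bar> = (1 / \<bar>cs\<bar>) * \<bar>\<Sum>j\<in>Basis. conv (egauss j r) (G j) x\<bar>" by (simp add: A_def abs_mult)
      also have "\<dots> \<le> (1 / \<bar>cs\<bar>) * (\<Sum>j\<in>(Basis::'a set). d2 * r powr (-1/2) * conv (gauss (2 * r)) H x)"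
        by (intro mult_left_mono order_trans[OF sum_abs] sum_mono gj) auto
      finally have "\<bar>A r\<bar> \<le> c1 * (r powr (-1/2) * conv (gauss (2 * r)) H x)" by (simp add: c1_def d_def mult_ac)
      hence "pw (1 - \<alpha>) r * \<bar>A r\<bar> \<le> pw (1 - \<alpha>) r * (c1 * (r powr (-1/2) * conv (gauss (2 * r)) H x))" by (intro mult_left_mono pw_nonneg)
      also have "\<dots> = c1 * ((pw (1 - \<alpha>) r * r powr (-1/2)) * conv (gauss (2 * r)) H x)" by (simp add: mult_ac)
      also have "pw (1 - \<alpha>) r * r powr (-1/2) = pw ((s - 0) / 2) r"
      proof -
        have "(1 - \<alpha> - 1) + (-1/2) = (s - 0) / 2 - 1" by (simp add: \<alpha>_def field_simps)
        thus ?thesis using r by (simp only: pw_pos powr_add[symmetric])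
      qed
      finally show "pw (1 - \<alpha>) r * \<bar>A r\<bar> \<le> c1 * (pw ((s - 0) / 2) r * conv (gauss (2 * r)) H x)" .
    next
      fix z assume z: "z > T"
      hence z0: "z > 0" using T by simp
      have "\<bar>B z\<bar> \<le> (\<Sum>j\<in>(Basis::'a set). 8 * 2 powr d / z * conv (gauss (2 * z - T)) k x)"
        unfolding B_def d_def k_def by (intro order_trans[OF sum_abs] sum_mono egauss_pd_far[OF f _ T z])
      hence "\<bar>B z\<bar> \<le> c2 * (1 / z * conv (gauss (2 * z - T)) k x)" by (simp add: c2_def d_def mult_ac)
      hence "pw 1 z * \<bar>B z\<bar> \<le> pw 1 z * (c2 * (1 / z * conv (gauss (2 * z - T)) k x))" by (intro mult_left_mono pw_nonneg)
      also have "\<dots> = c2 * ((pw 1 z * (1 / z)) * conv (gauss (2 * z - T)) k x)" by (simp add: mult_ac)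
      also have "pw 1 z * (1 / z) = pw (- 0 / 2) z" using z0 powr_minus_divide[of z 1] by (simp add: pw_def)
      finally show "pw 1 z * \<bar>B z\<bar> \<le> c2 * (pw (- 0 / 2) z * conv (gauss (2 * z - T)) k x)" .
    qed (use c0 c12 bdd_borelD[OF Hb] bdd_borelD[OF kb] in auto)
    have "\<bar>f x\<bar> \<le> \<bar>\<integral>z. pw 1 z * B z \<partial>lborel\<bar>" using rep(2) by (simp add: B_def abs_mult)
    hence "ennreal \<bar>f x\<bar> \<le> ennreal \<bar>\<integral>z. pw 1 z * B z \<partial>lborel\<bar>" by (rule ennreal_leI)
    also note nf
    finally show ?thesis unfolding H_def k_def .
  qed
  have "c0 * c1 + c2 \<ge> 0" using c0 c12 by simp
  with main show ?thesis by blast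
qed

section \<open>The estimate with a small factor for test functions\<close>

lemma frac_gradient_1_integrable:
  fixes f :: "'a::euclidean_space \<Rightarrow> real"
  assumes f: "f \<in> Cc_inf UNIV" and p: "p > 0"
  shows "integrable lborel (\<lambda>x. norm (frac_gradient 1 f x) powr p)"
proof -
  obtain K where K: "\<And>x. norm (frac_gradient 1 f x) \<le> K"
    using bdd_borel_norm_frac_gradient[OF f, of 1] by (auto simp: bdd_borel_def)
  have [measurable]: "frac_gradient 1 f \<in> borel_measurable borel" by (rule frac_gradient_borel[OF f]) auto
  have "\<forall>j\<in>Basis. \<exists>R>0. \<forall>x. norm x > R \<longrightarrow> pd j f x = 0" by (intro ballI test_support[OF test_pd[OF f]])
  then obtain R where R: "\<And>j. j \<in> Basis \<Longrightarrow> R j > 0" "\<And>j x. j \<in> Basis \<Longrightarrow> norm x > R j \<Longrightarrow> pd j f x = 0" by metis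
  define R' where "R' = (\<Sum>j\<in>(Basis::'a set). R j)"
  have R': "R j \<le> R'" if "j \<in> Basis" for j
    unfolding R'_def using that R(1) by (intro member_le_sum) (auto intro: less_imp_le)
  have z: "frac_gradient 1 f x = 0" if "norm x > R'" for x
  proof -
    have "pd j f x = 0" if "j \<in> Basis" for j using R(2)[OF that] R'[OF that] \<open>norm x > R'\<close> by auto
    thus ?thesis using gradient_test[OF f, of x] by (simp add: frac_gradient_def)
  qed
  show ?thesis
    by (rule integrable_bounded_support[of _ "K powr p" R']) (measurable, use z K p in \<open>auto intro!: powr_mono2\<close>)
qed

text \<open>The bound for the \<open>q\<close>-th powers of norms: \<open>L\<close> stands for the \<open>p\<close>-th power of a norm of order
  \<open>s\<close>. The first summand is small for small \<open>T\<close>, the second involves only the mollified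
  function.\<close>

definition mollified_bound :: "real \<Rightarrow> real \<Rightarrow> real \<Rightarrow> real \<Rightarrow> real \<Rightarrow> real \<Rightarrow> real \<Rightarrow> ('a::euclidean_space \<Rightarrow> real) \<Rightarrow> ennreal" where
  "mollified_bound p q \<theta> D T E L f =
     ennreal (D * T powr \<theta> * L powr (q / p) + E * (\<integral>x. \<bar>conv (gauss (T / 2)) f x\<bar> \<partial>lborel) powr q)"

text \<open>\<open>near_far_estimate\<close> applied to the pointwise bounds for the gradient and for the function. In
  the estimate of \<open>f\<close> itself the role of \<open>t\<close> is played by \<open>0\<close>, which only weakens the
  subcriticality hypothesis. The restriction to \<open>T \<le> 1\<close> allows replacing the two exponents by
  their minimum.\<close>

lemma test_mollified_estimate:
  assumes t: "0 \<le> t" "t < s" and s: "s \<le> 1" and p: "1 < p" "p \<le> q"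
    and sub: "1 / p - s / real DIM('a) < 1 / q - t / real DIM('a::euclidean_space)"
  shows "\<exists>\<theta>>0. \<exists>D\<ge>0. \<forall>T. 0 < T \<longrightarrow> T \<le> 1 \<longrightarrow> (\<exists>E\<ge>0. \<forall>f::'a \<Rightarrow> real. f \<in> Cc_inf UNIV \<longrightarrow> integrable lborel (\<lambda>x. norm (frac_gradient s f x) powr p) \<longrightarrow>
    pmass lborel q (frac_gradient t f) \<le> mollified_bound p q \<theta> D T E (\<integral>x. norm (frac_gradient s f x) powr p \<partial>lborel) f
    \<and> pmass lborel q f \<le> mollified_bound p q \<theta> D T E (\<integral>x. norm (frac_gradient s f x) powr p \<partial>lborel) f)"
proof -
  have p1: "1 \<le> p" "1 < q" and s0: "0 \<le> s" "0 < s" using p t by auto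
  have sub0: "1 / p - s / real DIM('a) < 1 / q - 0 / real DIM('a)"
  proof -
    have "t / real DIM('a) \<ge> 0" using t by simp
    thus ?thesis using sub by linarith
  qed
  obtain C1 where C1: "C1 \<ge> 0" "\<forall>f\<in>Cc_inf UNIV. \<forall>T>0. \<forall>x::'a. \<forall>j\<in>Basis.
     ennreal \<bar>frac_gradient t f x \<bullet> j\<bar> \<le> ennreal C1 * near_far s t T (\<lambda>y. norm (frac_gradient s f y)) (\<lambda>y. \<bar>conv (gauss (T / 2)) f y\<bar>) x"
    using frac_gradient_pointwise[OF t s] by blast
  obtain C2 where C2: "C2 \<ge> 0" "\<forall>f\<in>Cc_inf UNIV. \<forall>T>0. \<forall>x::'a.
     ennreal \<bar>f x\<bar> \<le> ennreal C2 * near_far s 0 T (\<lambda>y. norm (frac_gradient s f y)) (\<lambda>y. \<bar>conv (gauss (T / 2)) f y\<bar>) x"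
    using test_pointwise[OF s0(2) s] by blast
  define C where "C = real DIM('a) * C1"
  have C: "C \<ge> 0" using C1(1) by (simp add: C_def)
  obtain \<theta>1 D1 where 1: "\<theta>1 > 0" "D1 \<ge> 0" "\<forall>T>0. \<exists>E\<ge>0. \<forall>h k y. bdd_borel h \<longrightarrow> (\<forall>x. 0 \<le> h x) \<longrightarrow> integrable lborel (\<lambda>x. h x powr p) \<longrightarrow>
    bdd_borel k \<longrightarrow> (\<forall>x. 0 \<le> k x) \<longrightarrow> integrable lborel k \<longrightarrow> (\<forall>x::'a. 0 \<le> y x \<and> ennreal (y x) \<le> ennreal C * near_far s t T h k x) \<longrightarrow>
    (\<integral>\<^sup>+x. ennreal (y x powr q) \<partial>lborel) \<le> ennreal (D1 * T powr \<theta>1 * (\<integral>x. h x powr p \<partial>lborel) powr (q / p) + E * (\<integral>x. k x \<partial>lborel) powr q)"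
    using near_far_estimate[OF t(1) p1(1) p(2) p1(2) sub C] by blast
  obtain \<theta>2 D2 where 2: "\<theta>2 > 0" "D2 \<ge> 0" "\<forall>T>0. \<exists>E\<ge>0. \<forall>h k y. bdd_borel h \<longrightarrow> (\<forall>x. 0 \<le> h x) \<longrightarrow> integrable lborel (\<lambda>x. h x powr p) \<longrightarrow>
    bdd_borel k \<longrightarrow> (\<forall>x. 0 \<le> k x) \<longrightarrow> integrable lborel k \<longrightarrow> (\<forall>x::'a. 0 \<le> y x \<and> ennreal (y x) \<le> ennreal C2 * near_far s 0 T h k x) \<longrightarrow>
    (\<integral>\<^sup>+x. ennreal (y x powr q) \<partial>lborel) \<le> ennreal (D2 * T powr \<theta>2 * (\<integral>x. h x powr p \<partial>lborel) powr (q / p) + E * (\<integral>x. k x \<partial>lborel) powr q)"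
    using near_far_estimate[OF order_refl p1(1) p(2) p1(2) sub0 C2(1)] by blast
  define \<theta> where "\<theta> = min \<theta>1 \<theta>2"
  define D where "D = max D1 D2"
  have \<theta>: "\<theta> > 0" and D: "D \<ge> 0" using 1 2 by (auto simp: \<theta>_def D_def)
  have "\<exists>E\<ge>0. \<forall>f::'a \<Rightarrow> real. f \<in> Cc_inf UNIV \<longrightarrow> integrable lborel (\<lambda>x. norm (frac_gradient s f x) powr p) \<longrightarrow>
    pmass lborel q (frac_gradient t f) \<le> mollified_bound p q \<theta> D T E (\<integral>x. norm (frac_gradient s f x) powr p \<partial>lborel) f
    \<and> pmass lborel q f \<le> mollified_bound p q \<theta> D T E (\<integral>x. norm (frac_gradient s f x) powr p \<partial>lborel) f"
    if T: "0 < T" "T \<le> 1" for T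
  proof -
    obtain E1 where E1: "E1 \<ge> 0" "\<forall>h k y. bdd_borel h \<longrightarrow> (\<forall>x. 0 \<le> h x) \<longrightarrow> integrable lborel (\<lambda>x. h x powr p) \<longrightarrow>
      bdd_borel k \<longrightarrow> (\<forall>x. 0 \<le> k x) \<longrightarrow> integrable lborel k \<longrightarrow> (\<forall>x::'a. 0 \<le> y x \<and> ennreal (y x) \<le> ennreal C * near_far s t T h k x) \<longrightarrow>
      (\<integral>\<^sup>+x. ennreal (y x powr q) \<partial>lborel) \<le> ennreal (D1 * T powr \<theta>1 * (\<integral>x. h x powr p \<partial>lborel) powr (q / p) + E1 * (\<integral>x. k x \<partial>lborel) powr q)"
      using 1(3) T(1) by blast
    obtain E2 where E2: "E2 \<ge> 0" "\<forall>h k y. bdd_borel h \<longrightarrow> (\<forall>x. 0 \<le> h x) \<longrightarrow> integrable lborel (\<lambda>x. h x powr p) \<longrightarrow>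
      bdd_borel k \<longrightarrow> (\<forall>x. 0 \<le> k x) \<longrightarrow> integrable lborel k \<longrightarrow> (\<forall>x::'a. 0 \<le> y x \<and> ennreal (y x) \<le> ennreal C2 * near_far s 0 T h k x) \<longrightarrow>
      (\<integral>\<^sup>+x. ennreal (y x powr q) \<partial>lborel) \<le> ennreal (D2 * T powr \<theta>2 * (\<integral>x. h x powr p \<partial>lborel) powr (q / p) + E2 * (\<integral>x. k x \<partial>lborel) powr q)"
      using 2(3) T(1) by blast
    define E where "E = max E1 E2"
    have E: "E \<ge> 0" using E1 by (simp add: E_def)
    have le: "Di * T powr \<theta>i * a + Ei * b \<le> D * T powr \<theta> * a + E * b"
      if "0 \<le> a" "0 \<le> b" "Di \<le> D" "0 \<le> Di" "\<theta> \<le> \<theta>i" "Ei \<le> E" for a b Di \<theta>i Ei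
      using that T by (intro add_mono mult_right_mono mult_mono powr_mono') auto
    show ?thesis unfolding mollified_bound_def pmass_def real_norm_def
    proof (intro exI[of _ E] conjI E allI impI)
      fix f :: "'a \<Rightarrow> real" assume f: "f \<in> Cc_inf UNIV" and int: "integrable lborel (\<lambda>x. norm (frac_gradient s f x) powr p)"
      let ?H = "\<lambda>y. norm (frac_gradient s f y)"
      let ?k = "\<lambda>y. \<bar>conv (gauss (T / 2)) f y\<bar>"
      have H: "bdd_borel ?H" by (rule bdd_borel_norm_frac_gradient[OF f s0(1) s])
      have T2: "T / 2 > 0" using T by simp
      have fb: "bdd_borel f" by (rule bdd_borel_test[OF f])
      have k: "bdd_borel ?k" using T2 fb by (intro bdd_borel_abs bdd_borel_conv gauss_integrable)
      have ki: "integrable lborel ?k"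
      proof (rule integrableI_bounded)
        show "?k \<in> borel_measurable lborel" using bdd_borelD[OF k] by simp
        have "(\<integral>\<^sup>+x. ennreal (norm (?k x)) \<partial>lborel) \<le> (\<integral>\<^sup>+x. ennreal (conv (gauss (T / 2)) (\<lambda>y. \<bar>f y\<bar>) x) \<partial>lborel)"
          using heat_abs_le[OF T2 fb] by (intro nn_integral_mono ennreal_leI) simp
        also have "\<dots> = (\<integral>\<^sup>+x. ennreal \<bar>f x\<bar> \<partial>lborel)" by (rule heat_mass[OF T2 bdd_borel_abs[OF fb]]) simp
        also have "\<dots> < \<infinity>" using test_integrable[OF f] by (simp add: integrable_iff_bounded)
        finally show "(\<integral>\<^sup>+x. ennreal (norm (?k x)) \<partial>lborel) < \<infinity>" .
      qed
      have "(\<integral>\<^sup>+x. ennreal (norm (frac_gradient t f x) powr q) \<partial>lborel) \<le> ennreal (D1 * T powr \<theta>1 * (\<integral>x. ?H x powr p \<partial>lborel) powr (q / p) + E1 * (\<integral>x. ?k x \<partial>lborel) powr q)"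
      proof -
        have "ennreal (norm (frac_gradient t f x)) \<le> ennreal C * near_far s t T ?H ?k x" for x
        proof -
          have "ennreal (norm (frac_gradient t f x)) \<le> ennreal (\<Sum>j\<in>Basis. \<bar>frac_gradient t f x \<bullet> j\<bar>)" by (intro ennreal_leI norm_le_l1)
          also have "\<dots> = (\<Sum>j\<in>Basis. ennreal \<bar>frac_gradient t f x \<bullet> j\<bar>)" by (rule sum_ennreal[symmetric]) simp
          also have "\<dots> \<le> (\<Sum>j\<in>(Basis::'a set). ennreal C1 * near_far s t T ?H ?k x)" using C1(2) f T(1) by (intro sum_mono) blast
          also have "\<dots> = ennreal C * near_far s t T ?H ?k x"
            using C1(1) by (simp add: C_def ennreal_mult ennreal_of_nat_eq_real_of_nat mult.assoc)
          finally show ?thesis .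
        qed
        thus ?thesis using E1(2) H int k ki by auto
      qed
      also have "\<dots> \<le> ennreal (D * T powr \<theta> * (\<integral>x. ?H x powr p \<partial>lborel) powr (q / p) + E * (\<integral>x. ?k x \<partial>lborel) powr q)"
        by (intro ennreal_leI le) (use 1 in \<open>auto simp: D_def E_def \<theta>_def\<close>)
      finally show "(\<integral>\<^sup>+x. ennreal (norm (frac_gradient t f x) powr q) \<partial>lborel) \<le> ennreal (D * T powr \<theta> * (\<integral>x. ?H x powr p \<partial>lborel) powr (q / p) + E * (\<integral>x. ?k x \<partial>lborel) powr q)" .
      have "(\<integral>\<^sup>+x. ennreal (\<bar>f x\<bar> powr q) \<partial>lborel) \<le> ennreal (D2 * T powr \<theta>2 * (\<integral>x. ?H x powr p \<partial>lborel) powr (q / p) + E2 * (\<integral>x. ?k x \<partial>lborel) powr q)"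
      proof -
        have "\<forall>x. 0 \<le> \<bar>f x\<bar> \<and> ennreal \<bar>f x\<bar> \<le> ennreal C2 * near_far s 0 T ?H ?k x" using C2(2) f T(1) by auto
        thus ?thesis using E2(2)[rule_format, of ?H ?k "\<lambda>x. \<bar>f x\<bar>"] H int k ki by auto
      qed
      also have "\<dots> \<le> ennreal (D * T powr \<theta> * (\<integral>x. ?H x powr p \<partial>lborel) powr (q / p) + E * (\<integral>x. ?k x \<partial>lborel) powr q)"
        by (intro ennreal_leI le) (use 2 in \<open>auto simp: D_def E_def \<theta>_def\<close>)
      finally show "(\<integral>\<^sup>+x. ennreal (\<bar>f x\<bar> powr q) \<partial>lborel) \<le> ennreal (D * T powr \<theta> * (\<integral>x. ?H x powr p \<partial>lborel) powr (q / p) + E * (\<integral>x. ?k x \<partial>lborel) powr q)" .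
    qed
  qed
  thus ?thesis using \<theta> D by blast
qed

text \<open>For \<open>t < 1\<close> the fractional gradient does not have compact support; its decay at infinity is taken from the estimate
  with \<open>s = 1\<close> and \<open>p = q\<close>, for which the right-hand side is finite.\<close>

lemma frac_gradient_powr_integrable:
  fixes f :: "'a::euclidean_space \<Rightarrow> real"
  assumes f: "f \<in> Cc_inf UNIV" and t: "0 \<le> t" "t \<le> 1" and q: "1 < q"
  shows "integrable lborel (\<lambda>x. norm (frac_gradient t f x) powr q)"
proof (cases "t = 1")
  case True thus ?thesis using frac_gradient_1_integrable[OF f] q by simp
next
  case False
  hence t1: "t < 1" using t by simp
  have "1 / q - 1 / real DIM('a) < 1 / q - t / real DIM('a)" using t1 by (simp add: divide_strict_right_mono)
  from test_mollified_estimate[OF t(1) t1 order_refl q order_refl this]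
  obtain \<theta> D where *: "\<forall>T. 0 < T \<longrightarrow> T \<le> 1 \<longrightarrow> (\<exists>E\<ge>0. \<forall>f::'a \<Rightarrow> real. f \<in> Cc_inf UNIV \<longrightarrow> integrable lborel (\<lambda>x. norm (frac_gradient 1 f x) powr q) \<longrightarrow>
    pmass lborel q (frac_gradient t f) \<le> mollified_bound q q \<theta> D T E (\<integral>x. norm (frac_gradient 1 f x) powr q \<partial>lborel) f
    \<and> pmass lborel q f \<le> mollified_bound q q \<theta> D T E (\<integral>x. norm (frac_gradient 1 f x) powr q \<partial>lborel) f)"
    by blast
  have "integrable lborel (\<lambda>x. norm (frac_gradient 1 f x) powr q)" using frac_gradient_1_integrable[OF f] q by simp
  then obtain c where "pmass lborel q (frac_gradient t f) \<le> ennreal c"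
    using *[rule_format, of 1] f by (auto simp: mollified_bound_def)
  hence "pmass lborel q (frac_gradient t f) < \<infinity>" by (rule le_less_trans) simp
  thus ?thesis using pmass_finite_iff[of "frac_gradient t f" lborel q] frac_gradient_borel[OF f t] by simp
qed

lemma heat_L1_contraction:
  fixes f :: "'a::euclidean_space \<Rightarrow> real"
  assumes r: "r > 0" and f: "f \<in> Cc_inf S"
  shows "integrable lborel (conv (gauss r) f)" "(\<integral>x. \<bar>conv (gauss r) f x\<bar> \<partial>lborel) \<le> (\<integral>x. \<bar>f x\<bar> \<partial>lborel)"
proof -
  have fb: "bdd_borel f" by (rule bdd_borel_test[OF f])
  have [measurable]: "conv (gauss r) f \<in> borel_measurable borel" using bdd_borel_conv[OF gauss_integrable[OF r] fb] by (simp add: bdd_borel_def)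
  have "(\<integral>\<^sup>+x. ennreal \<bar>conv (gauss r) f x\<bar> \<partial>lborel) \<le> (\<integral>\<^sup>+x. ennreal (conv (gauss r) (\<lambda>y. \<bar>f y\<bar>) x) \<partial>lborel)"
    using heat_abs_le[OF r fb] by (intro nn_integral_mono ennreal_leI) simp
  also have "\<dots> = (\<integral>\<^sup>+x. ennreal \<bar>f x\<bar> \<partial>lborel)" by (rule heat_mass[OF r bdd_borel_abs[OF fb]]) simp
  also have "\<dots> = ennreal (\<integral>x. \<bar>f x\<bar> \<partial>lborel)" using test_integrable[OF f] by (intro nn_integral_eq_integral) auto
  finally have le: "(\<integral>\<^sup>+x. ennreal \<bar>conv (gauss r) f x\<bar> \<partial>lborel) \<le> ennreal (\<integral>x. \<bar>f x\<bar> \<partial>lborel)" .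
  hence "(\<integral>\<^sup>+x. ennreal \<bar>conv (gauss r) f x\<bar> \<partial>lborel) < \<infinity>" by (rule le_less_trans) simp
  thus i: "integrable lborel (conv (gauss r) f)" by (intro integrableI_bounded) auto
  have "ennreal (\<integral>x. \<bar>conv (gauss r) f x\<bar> \<partial>lborel) \<le> ennreal (\<integral>x. \<bar>f x\<bar> \<partial>lborel)"
    using le nn_integral_eq_integral[OF integrable_abs[OF i]] by simp
  thus "(\<integral>x. \<bar>conv (gauss r) f x\<bar> \<partial>lborel) \<le> (\<integral>x. \<bar>f x\<bar> \<partial>lborel)" by (simp add: integral_nonneg_AE)
qed

text \<open>Jensen's inequality with the indicator function of \<open>S\<close> as weight.\<close>

lemma L1_le_Lp_bounded_support:
  fixes f :: "'a::euclidean_space \<Rightarrow> real"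
  assumes f: "f \<in> Cc_inf S" and S: "bounded S" "S \<in> sets borel" and p: "1 \<le> p"
    and int: "integrable lborel (\<lambda>x. \<bar>f x\<bar> powr p)"
  shows "(\<integral>x. \<bar>f x\<bar> \<partial>lborel) powr p \<le> measure lborel S powr (p - 1) * (\<integral>x. \<bar>f x\<bar> powr p \<partial>lborel)"
proof -
  have [measurable]: "S \<in> sets borel" by fact
  have [measurable]: "f \<in> borel_measurable borel" by (rule test_borel[OF f])
  have z: "f x = 0" if "x \<notin> S" for x using test_outside[OF f that] .
  have fin: "emeasure lborel S < \<infinity>" using S(1) by (rule emeasure_bounded_finite)
  have "ennreal ((\<integral>x. \<bar>f x\<bar> \<partial>lborel) powr p) \<le> ennreal ((\<integral>x. indicator S x \<partial>lborel) powr (p - 1)) * (\<integral>\<^sup>+x. ennreal (indicator S x * \<bar>f x\<bar> powr p) \<partial>lborel)"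
  proof (rule jensen_powr)
    show "integrable lborel (indicator S :: 'a \<Rightarrow> real)" using fin by simp
    have "ennreal (\<integral>x. \<bar>f x\<bar> \<partial>lborel) = (\<integral>\<^sup>+x. ennreal \<bar>f x\<bar> \<partial>lborel)"
      using test_integrable[OF f] by (intro nn_integral_eq_integral[symmetric]) auto
    also have "\<dots> = (\<integral>\<^sup>+x. ennreal (indicator S x * \<bar>f x\<bar>) \<partial>lborel)" using z by (intro nn_integral_cong) (auto simp: indicator_def)
    finally show "ennreal (\<integral>x. \<bar>f x\<bar> \<partial>lborel) \<le> (\<integral>\<^sup>+x. ennreal (indicator S x * \<bar>f x\<bar>) \<partial>lborel)" by simp
  qed (use p in auto)
  also have "(\<integral>\<^sup>+x. ennreal (indicator S x * \<bar>f x\<bar> powr p) \<partial>lborel) = (\<integral>\<^sup>+x. ennreal (\<bar>f x\<bar> powr p) \<partial>lborel)"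
    using z p by (intro nn_integral_cong) (auto simp: indicator_def)
  also have "\<dots> = ennreal (\<integral>x. \<bar>f x\<bar> powr p \<partial>lborel)" using int by (intro nn_integral_eq_integral) auto
  finally show ?thesis by (simp add: ennreal_mult[symmetric] integral_nonneg_AE)
qed

section \<open>Compactness of the heat flow on functions supported in a bounded set\<close>

lemma exp_neg_Lipschitz:
  fixes a b :: real assumes "a \<ge> 0" "b \<ge> 0" shows "\<bar>exp (- a) - exp (- b)\<bar> \<le> \<bar>a - b\<bar>"
proof -
  have *: "\<bar>exp (- a) - exp (- b)\<bar> \<le> \<bar>a - b\<bar>" if "0 \<le> a" "a \<le> b" for a b :: real
  proof -
    have "1 - exp (- (b - a)) \<le> b - a" using exp_ge_add_one_self[of "- (b - a)"] by linarith
    moreover have "1 - exp (- (b - a)) \<ge> 0" using that by simp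
    ultimately have "exp (- a) * (1 - exp (- (b - a))) \<le> 1 * (b - a)" using that by (intro mult_mono) auto
    moreover have "exp (- a) * (1 - exp (- (b - a))) = exp (- a) - exp (- b)" by (simp add: right_diff_distrib exp_add[symmetric])
    moreover have "exp (- b) \<le> exp (- a)" using that by simp
    ultimately show ?thesis using that by simp
  qed
  show ?thesis using *[of a b] *[of b a] assms by (cases "a \<le> b") (auto simp: abs_minus_commute)
qed

text \<open>For a fixed time, the mollified functions are bounded and Lipschitz near each point, uniformly
  in \<open>n\<close>; a diagonal sequence over all times \<open>1/(m+1)\<close> and the points of a countable dense set
  therefore converges at every point. Because the supports are uniformly bounded, a fixed
  Gaussian dominates, and dominated convergence gives convergence in \<open>L^1\<close>.\<close>

lemma heat_L1_compact:
  fixes f :: "nat \<Rightarrow> 'a::euclidean_space \<Rightarrow> real"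
  assumes f: "\<And>n. f n \<in> Cc_inf S" and S: "bounded S" and B: "\<And>n. (\<integral>x. \<bar>f n x\<bar> \<partial>lborel) \<le> B"
  shows "\<exists>r::nat\<Rightarrow>nat. strict_mono r \<and> (\<forall>m. \<forall>e>0. \<exists>N. \<forall>i\<ge>N. \<forall>j\<ge>N.
     (\<integral>x. \<bar>conv (gauss (1 / real (Suc m))) (\<lambda>y. f (r i) y - f (r j) y) x\<bar> \<partial>lborel) < e)"
proof -
  have "0 \<le> (\<integral>x. \<bar>f 0 x\<bar> \<partial>lborel)" by (intro integral_nonneg_AE) auto
  hence B0: "B \<ge> 0" using B[of 0] by linarith
  obtain R where R: "R > 0" "\<And>x. x \<in> S \<Longrightarrow> norm x \<le> R" using S by (auto simp: bounded_pos)
  define \<tau> where "\<tau> m = 1 / real (Suc m)" for m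
  have \<tau>: "\<tau> m > 0" for m by (simp add: \<tau>_def)
  define F where "F m n x = conv (gauss (\<tau> m)) (f n) x" for m n x
  define c where "c m = 1 / (\<tau> m powr (real DIM('a) / 2) * gauss_mass TYPE('a))" for m
  have c: "c m > 0" for m unfolding c_def using \<tau>[of m] gauss_mass_pos[where 'a='a] by simp
  have Fb: "\<bar>F m n x\<bar> \<le> c m * B" for m n x
  proof -
    have "\<bar>F m n x\<bar> \<le> c m * (\<integral>y. \<bar>f n y\<bar> \<partial>lborel)" unfolding F_def c_def
      using gauss_le[OF \<tau>[of m], where 'a='a] by (intro conv_abs_le_L1 test_integrable[OF f]) (simp add: gauss_nonneg)
    also have "\<dots> \<le> c m * B" using B c[of m] by (intro mult_left_mono) auto
    finally show ?thesis .
  qed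
  obtain D :: "'a set" where D: "countable D" "\<And>X. open X \<Longrightarrow> X \<noteq> {} \<Longrightarrow> \<exists>d\<in>D. d \<in> X" by (rule countable_dense_setE) blast
  have Dne: "D \<noteq> {}" using D(2)[of UNIV] by auto
  \<comment> \<open>An enumeration of the pairs of a time index and a point of \<open>D\<close>, the requirements of the diagonal
    sequence.\<close>
  define en where "en = from_nat_into ((UNIV::nat set) \<times> D)"
  have en: "\<exists>k. en k = (m, d)" if "d \<in> D" for m d
    unfolding en_def using from_nat_into_surj[of "(UNIV::nat set) \<times> D" "(m, d)"] D(1) that by auto
  define P where "P k s \<longleftrightarrow> convergent (\<lambda>i. F (fst (en k)) (s i) (snd (en k)))" for k and s :: "nat \<Rightarrow> nat"
  interpret subseqs P
  proof
    fix k and s :: "nat \<Rightarrow> nat" assume "strict_mono s"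
    have "bounded (range (\<lambda>i. F (fst (en k)) (s i) (snd (en k))))"
      using Fb by (auto simp: bounded_iff)
    from bounded_imp_convergent_subsequence[OF this]
    obtain l r where "strict_mono r" "((\<lambda>i. F (fst (en k)) (s i) (snd (en k))) \<circ> r) \<longlonglongrightarrow> l" by blast
    thus "\<exists>r'. strict_mono r' \<and> P k (s \<circ> r')" unfolding P_def convergent_def by (auto simp: o_def)
  qed
  define r where "r = diagseq"
  have r: "strict_mono r" unfolding r_def by (rule subseq_diagseq)
  have conv_D: "convergent (\<lambda>i. F m (r i) d)" if d: "d \<in> D" for m d
  proof -
    obtain k where k: "en k = (m, d)" using en[OF d] by blast
    have "P k (diagseq \<circ> ((+) (Suc k)))"
    proof (rule diagseq_holds)
      fix r s n assume "strict_mono (r::nat\<Rightarrow>nat)" "P n s"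
      then obtain l where "(\<lambda>i. F (fst (en n)) (s i) (snd (en n))) \<longlonglongrightarrow> l" by (auto simp: P_def convergent_def)
      from LIMSEQ_subseq_LIMSEQ[OF this \<open>strict_mono r\<close>] show "P n (s \<circ> r)" by (auto simp: P_def convergent_def o_def)
    qed
    hence "convergent (\<lambda>i. F m (r (i + Suc k)) d)" by (simp add: P_def k r_def o_def add.commute)
    thus ?thesis using convergent_ignore_initial_segment[of "\<lambda>i. F m (r i) d" "Suc k"] by simp
  qed
  have equi: "\<bar>F m n x - F m n x'\<bar> \<le> c m * ((2 * norm x + 2 * R + 1) / \<tau> m * B) * norm (x - x')" if x: "norm (x - x') \<le> 1" for m n x x'
  proof -
    define L where "L = c m * (2 * norm x + 2 * R + 1) / \<tau> m * norm (x - x')"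
    have L0: "L \<ge> 0" unfolding L_def using c[of m] \<tau>[of m] R by simp
    have g: "\<bar>gauss (\<tau> m) (x - y) - gauss (\<tau> m) (x' - y)\<bar> \<le> L" if y: "y \<in> S" for y
    proof -
      have "\<bar>gauss (\<tau> m) (x - y) - gauss (\<tau> m) (x' - y)\<bar> = c m * \<bar>exp (- ((norm (x - y))\<^sup>2 / \<tau> m)) - exp (- ((norm (x' - y))\<^sup>2 / \<tau> m))\<bar>"
      proof -
        have "gauss (\<tau> m) z = c m * exp (- ((norm z)\<^sup>2 / \<tau> m))" for z :: 'a by (simp add: gauss_def c_def)
        thus ?thesis using c[of m] by (simp add: right_diff_distrib[symmetric] abs_mult)
      qed
      also have "\<dots> \<le> c m * \<bar>(norm (x - y))\<^sup>2 / \<tau> m - (norm (x' - y))\<^sup>2 / \<tau> m\<bar>"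
        using c[of m] \<tau>[of m] by (intro mult_left_mono exp_neg_Lipschitz) auto
      also have "\<bar>(norm (x - y))\<^sup>2 / \<tau> m - (norm (x' - y))\<^sup>2 / \<tau> m\<bar> = \<bar>norm (x - y) - norm (x' - y)\<bar> * (norm (x - y) + norm (x' - y)) / \<tau> m"
      proof -
        have "(norm (x - y))\<^sup>2 / \<tau> m - (norm (x' - y))\<^sup>2 / \<tau> m = (norm (x - y) - norm (x' - y)) * (norm (x - y) + norm (x' - y)) / \<tau> m"
          by (simp add: diff_divide_distrib[symmetric] power2_eq_square algebra_simps)
        thus ?thesis using \<tau>[of m] by (simp add: abs_mult)
      qed
      also have "\<dots> \<le> norm (x - x') * (2 * norm x + 2 * R + 1) / \<tau> m"
      proof (intro divide_right_mono mult_mono)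
        show "\<bar>norm (x - y) - norm (x' - y)\<bar> \<le> norm (x - x')" using norm_triangle_ineq3[of "x - y" "x' - y"] by simp
        have "norm (x - y) \<le> norm x + R" using norm_triangle_ineq4[of x y] R(2)[OF y] by simp
        moreover have "norm (x' - y) \<le> norm x + R + 1"
          using norm_triangle_ineq4[of x' y] R(2)[OF y] x norm_triangle_ineq2[of x' x] by (simp add: norm_minus_commute)
        ultimately show "norm (x - y) + norm (x' - y) \<le> 2 * norm x + 2 * R + 1" by simp
      qed (use \<tau>[of m] in auto)
      finally show ?thesis using c[of m] by (simp add: L_def mult_ac)
    qed
    have fbd: "\<exists>K. \<forall>y. \<bar>f n y\<bar> \<le> K" using bdd_borel_test[OF f[of n]] by (auto simp: bdd_borel_def)
    then obtain K where K: "\<And>y. \<bar>f n y\<bar> \<le> K" by blast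
    have i: "integrable lborel (\<lambda>y. gauss (\<tau> m) (z - y) * f n y)" for z
      by (rule conv_integrable[OF gauss_integrable[OF \<tau>] test_borel[OF f] K])
    have "F m n x - F m n x' = (\<integral>y. gauss (\<tau> m) (x - y) * f n y - gauss (\<tau> m) (x' - y) * f n y \<partial>lborel)"
      unfolding F_def conv_def using i by simp
    also have "\<bar>\<dots>\<bar> \<le> (\<integral>y. L * \<bar>f n y\<bar> \<partial>lborel)"
    proof (rule abs_integral_le)
      show "integrable lborel (\<lambda>y. L * \<bar>f n y\<bar>)" using test_integrable[OF f] by simp
      fix y show "\<bar>gauss (\<tau> m) (x - y) * f n y - gauss (\<tau> m) (x' - y) * f n y\<bar> \<le> L * \<bar>f n y\<bar>"
      proof (cases "y \<in> S")
        case True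
        have "\<bar>gauss (\<tau> m) (x - y) - gauss (\<tau> m) (x' - y)\<bar> * \<bar>f n y\<bar> \<le> L * \<bar>f n y\<bar>" using g[OF True] by (intro mult_right_mono) auto
        thus ?thesis by (simp add: left_diff_distrib[symmetric] abs_mult)
      qed (simp add: test_outside[OF f])
    qed
    also have "\<dots> \<le> L * B" using B[of n] L0 by (simp add: mult_left_mono)
    finally show ?thesis by (simp add: L_def mult_ac)
  qed
  have conv_all: "convergent (\<lambda>i. F m (r i) x)" for m x
  proof -
    have "Cauchy (\<lambda>i. F m (r i) x)"
    proof (rule metric_CauchyI)
      fix e :: real assume e: "e > 0"
      define M where "M = c m * ((2 * norm x + 2 * R + 1) / \<tau> m * B)"
      have M: "M \<ge> 0" unfolding M_def using c[of m] \<tau>[of m] R B0 by simp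
      define \<delta> where "\<delta> = min 1 (e / (3 * (M + 1)))"
      have \<delta>: "\<delta> > 0" using e M by (simp add: \<delta>_def)
      obtain d where d: "d \<in> D" "d \<in> ball x \<delta>" using D(2)[of "ball x \<delta>"] \<delta> by auto
      have xd: "norm (x - d) < \<delta>" using d(2) by (simp add: dist_norm)
      have close: "\<bar>F m n x - F m n d\<bar> < e / 3" for n
      proof -
        have "\<bar>F m n x - F m n d\<bar> \<le> M * norm (x - d)" unfolding M_def using xd by (intro equi) (simp add: \<delta>_def)
        also have "\<dots> \<le> M * (e / (3 * (M + 1)))" using xd M by (intro mult_left_mono) (auto simp: \<delta>_def)
        also have "\<dots> < e / 3" using M e by (simp add: field_simps)
        finally show ?thesis .
      qed
      have "Cauchy (\<lambda>i. F m (r i) d)" using conv_D[OF d(1)] by (rule convergent_Cauchy)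
      then obtain N where N: "\<And>i j. i \<ge> N \<Longrightarrow> j \<ge> N \<Longrightarrow> dist (F m (r i) d) (F m (r j) d) < e / 3"
        using metric_CauchyD[of "\<lambda>i. F m (r i) d" "e/3"] e by auto
      show "\<exists>N. \<forall>i\<ge>N. \<forall>j\<ge>N. dist (F m (r i) x) (F m (r j) x) < e"
      proof (intro exI allI impI)
        fix i j assume "i \<ge> N" "j \<ge> N"
        thus "dist (F m (r i) x) (F m (r j) x) < e"
          using N[of i j] close[of "r i"] close[of "r j"] unfolding dist_real_def by linarith
      qed
    qed
    thus ?thesis by (simp add: Cauchy_convergent_iff)
  qed
  have "\<exists>N. \<forall>i\<ge>N. \<forall>j\<ge>N. (\<integral>x. \<bar>conv (gauss (1 / real (Suc m))) (\<lambda>y. f (r i) y - f (r j) y) x\<bar> \<partial>lborel) < e" if e: "e > 0" for m e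
  proof -
    define L where "L x = lim (\<lambda>i. F m (r i) x)" for x
    have L: "(\<lambda>i. F m (r i) x) \<longlonglongrightarrow> L x" for x using conv_all[of m x] by (simp add: L_def convergent_LIMSEQ_iff)
    have Fm[measurable]: "F m n \<in> borel_measurable borel" for n
      unfolding F_def using conv_borel[of "gauss (\<tau> m)" "f n"] test_borel[OF f] by simp
    have Lm[measurable]: "L \<in> borel_measurable borel" by (rule borel_measurable_LIMSEQ_real[OF L Fm])
    \<comment> \<open>From \<open>|x|\<^sup>2 \<le> 2 |x - y|\<^sup>2 + 2 R\<^sup>2\<close> for \<open>|y| \<le> R\<close>: the Gaussian at \<open>x - y\<close> is at most a multiple
      of the one at \<open>x\<close> with twice the time.\<close>
    define w where "w x = B * exp (R\<^sup>2 / \<tau> m) * 2 powr (real DIM('a) / 2) * gauss (2 * \<tau> m) x" for x :: 'a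
    have wi: "integrable lborel w" unfolding w_def using \<tau>[of m] by (intro integrable_mult_right gauss_integrable) simp
    have Fw: "\<bar>F m n x\<bar> \<le> w x" for n x
    proof -
      define K where "K = exp (R\<^sup>2 / \<tau> m) * 2 powr (real DIM('a) / 2) * gauss (2 * \<tau> m) x"
      have K: "K \<ge> 0" unfolding K_def by (simp add: gauss_nonneg)
      have gy: "gauss (\<tau> m) (x - y) \<le> K" if y: "y \<in> S" for y
      proof -
        have "(norm x)\<^sup>2 \<le> (norm (x - y) + norm y)\<^sup>2" using norm_triangle_sub[of x y] by (intro power_mono) (auto simp: add.commute)
        also have "\<dots> \<le> 2 * (norm (x - y))\<^sup>2 + 2 * (norm y)\<^sup>2"
        proof -
          have "0 \<le> (norm (x - y) - norm y)\<^sup>2" by simp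
          thus ?thesis by (simp add: power2_sum power2_diff)
        qed
        also have "(norm y)\<^sup>2 \<le> R\<^sup>2" using R(2)[OF y] by (intro power_mono) auto
        finally have "(norm x)\<^sup>2 / 2 - R\<^sup>2 \<le> (norm (x - y))\<^sup>2" by simp
        hence "((norm x)\<^sup>2 / 2 - R\<^sup>2) / \<tau> m \<le> (norm (x - y))\<^sup>2 / \<tau> m" using \<tau>[of m] by (intro divide_right_mono) auto
        hence "exp (- (norm (x - y))\<^sup>2 / \<tau> m) \<le> exp (R\<^sup>2 / \<tau> m + - (norm x)\<^sup>2 / (2 * \<tau> m))"
          by (simp add: diff_divide_distrib)
        hence "c m * exp (- (norm (x - y))\<^sup>2 / \<tau> m) \<le> c m * (exp (R\<^sup>2 / \<tau> m) * exp (- (norm x)\<^sup>2 / (2 * \<tau> m)))"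
          unfolding exp_add[symmetric] using c[of m] by (intro mult_left_mono) auto
        thus ?thesis unfolding K_def gauss_def c_def using \<tau>[of m] gauss_mass_pos[where 'a='a] by (simp add: powr_mult field_simps)
      qed
      have "\<bar>F m n x\<bar> \<le> (\<integral>y. K * \<bar>f n y\<bar> \<partial>lborel)" unfolding F_def conv_def
      proof (rule abs_integral_le)
        show "integrable lborel (\<lambda>y. K * \<bar>f n y\<bar>)" using test_integrable[OF f] by simp
        fix y show "\<bar>gauss (\<tau> m) (x - y) * f n y\<bar> \<le> K * \<bar>f n y\<bar>"
        proof (cases "y \<in> S")
          case True
          thus ?thesis using gy[OF True] by (simp add: abs_mult gauss_nonneg mult_right_mono)
        qed (simp add: test_outside[OF f])
      qed
      also have "\<dots> \<le> K * B" using B[of n] K by (simp add: mult_left_mono)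
      finally show ?thesis by (simp add: w_def K_def mult_ac)
    qed
    have Lw: "\<bar>L x\<bar> \<le> w x" for x
      by (rule LIMSEQ_le_const2[OF tendsto_rabs[OF L]]) (use Fw in auto)
    have "(\<lambda>i. \<integral>x. \<bar>F m (r i) x - L x\<bar> \<partial>lborel) \<longlonglongrightarrow> (\<integral>(x::'a). 0 \<partial>lborel)"
    proof (rule integral_dominated_convergence[where w="\<lambda>x. 2 * w x"])
      show "integrable lborel (\<lambda>x. 2 * w x)" using wi by simp
      show "AE x in lborel. (\<lambda>i. \<bar>F m (r i) x - L x\<bar>) \<longlonglongrightarrow> 0"
        using L by (intro AE_I2 tendsto_rabs_zero) (simp add: LIM_zero)
      show "AE x in lborel. norm \<bar>F m (r i) x - L x\<bar> \<le> 2 * w x" for i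
      proof (rule AE_I2)
        fix x show "norm \<bar>F m (r i) x - L x\<bar> \<le> 2 * w x" using Fw[of "r i" x] Lw[of x] by simp
      qed
    qed measurable
    hence "\<forall>\<^sub>F i in sequentially. (\<integral>x. \<bar>F m (r i) x - L x\<bar> \<partial>lborel) < e / 2"
      using e by (intro order_tendstoD) auto
    then obtain N where N: "\<And>i. i \<ge> N \<Longrightarrow> (\<integral>x. \<bar>F m (r i) x - L x\<bar> \<partial>lborel) < e / 2" unfolding eventually_sequentially by blast
    have iL: "integrable lborel L" by (rule Bochner_Integration.integrable_bound[OF wi]) (use Lw in \<open>auto intro: order_trans[OF _ abs_ge_self]\<close>)
    have iF: "integrable lborel (F m n)" for n by (rule Bochner_Integration.integrable_bound[OF wi]) (use Fw in \<open>auto intro: order_trans[OF _ abs_ge_self]\<close>)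
    show ?thesis
    proof (intro exI[of _ N] allI impI)
      fix i j assume ij: "i \<ge> N" "j \<ge> N"
      have e1: "conv (gauss (1 / real (Suc m))) (\<lambda>y. f (r i) y - f (r j) y) x = F m (r i) x - F m (r j) x" for x
      proof -
        have "integrable lborel (\<lambda>y. gauss (\<tau> m) (x - y) * f n y)" for n
        proof -
          obtain K where K: "\<And>y. \<bar>f n y\<bar> \<le> K" using bdd_borel_test[OF f[of n]] by (auto simp: bdd_borel_def)
          show ?thesis by (rule conv_integrable[OF gauss_integrable[OF \<tau>] test_borel[OF f] K])
        qed
        thus ?thesis unfolding F_def conv_def \<tau>_def[symmetric] by (simp add: right_diff_distrib)
      qed
      have "(\<integral>x. \<bar>F m (r i) x - F m (r j) x\<bar> \<partial>lborel) \<le> (\<integral>x. \<bar>F m (r i) x - L x\<bar> + \<bar>F m (r j) x - L x\<bar> \<partial>lborel)"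
        using iL iF by (intro integral_mono) auto
      also have "\<dots> = (\<integral>x. \<bar>F m (r i) x - L x\<bar> \<partial>lborel) + (\<integral>x. \<bar>F m (r j) x - L x\<bar> \<partial>lborel)"
        using iL iF by (intro Bochner_Integration.integral_add) auto
      also have "\<dots> < e" using N[OF ij(1)] N[OF ij(2)] by simp
      finally show "(\<integral>x. \<bar>conv (gauss (1 / real (Suc m))) (\<lambda>y. f (r i) y - f (r j) y) x\<bar> \<partial>lborel) < e" by (simp only: e1)
    qed
  qed
  with r show ?thesis by blast
qed

section \<open>Integration by parts for the fractional gradient\<close>

lemma test_mult_bdd_integrable:
  fixes f :: "'a::euclidean_space \<Rightarrow> real"
  assumes f: "f \<in> Cc_inf S" and g: "bdd_borel g"
  shows "integrable lborel (\<lambda>x. f x * g x)"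
proof -
  obtain K where K: "g \<in> borel_measurable borel" "\<And>x. \<bar>g x\<bar> \<le> K" using g by (auto simp: bdd_borel_def)
  have [measurable]: "f \<in> borel_measurable borel" "g \<in> borel_measurable borel" using test_borel[OF f] K by auto
  show ?thesis
  proof (rule Bochner_Integration.integrable_bound)
    show "integrable lborel (\<lambda>x. K * f x)" using test_integrable[OF f] by simp
    show "AE x in lborel. norm (f x * g x) \<le> norm (K * f x)"
      using K(2) by (auto simp: abs_mult mult.commute[of K] intro!: mult_left_mono order_trans[OF K(2) abs_ge_self])
  qed measurable
qed

lemma pd_ibp:
  fixes f g :: "'a::euclidean_space \<Rightarrow> real"
  assumes f: "f \<in> Cc_inf UNIV" and g: "g \<in> Cc_inf UNIV" and j: "j \<in> Basis"
  shows "(\<integral>x. f x * pd j g x \<partial>lborel) = - (\<integral>x. pd j f x * g x \<partial>lborel)"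
proof -
  note pf = test_pd[OF f j] and pg = test_pd[OF g j]
  have [measurable]: "f \<in> borel_measurable borel" "g \<in> borel_measurable borel" "pd j f \<in> borel_measurable borel" "pd j g \<in> borel_measurable borel"
    using test_borel f g pf pg by auto
  obtain K1 where K1: "\<And>x. \<bar>f x\<bar> \<le> K1" using test_bounded[OF f] by auto
  obtain K2 where K2: "\<And>x. \<bar>g x\<bar> \<le> K2" using test_bounded[OF g] by auto
  obtain K3 where K3: "\<And>x. \<bar>pd j f x\<bar> \<le> K3" using test_bounded[OF pf] by auto
  obtain K4 where K4: "\<And>x. \<bar>pd j g x\<bar> \<le> K4" using test_bounded[OF pg] by auto
  obtain R where R: "\<And>x. norm x > R \<Longrightarrow> f x = 0" using test_support[OF f] by blast
  have i: "integrable lborel (\<lambda>x. f x * pd j g x)" "integrable lborel (\<lambda>x. pd j f x * g x)" "integrable lborel (\<lambda>x. f x * g x)"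
    using test_mult_bdd_integrable[OF f bdd_borel_test[OF pg]] test_mult_bdd_integrable[OF pf bdd_borel_test[OF g]]
      test_mult_bdd_integrable[OF f bdd_borel_test[OF g]] by auto
  have "(\<integral>x. f x * pd j g x + pd j f x * g x \<partial>lborel) = 0"
  proof (rule integral_dir_deriv_zero[where f="\<lambda>x. f x * g x" and j=j])
    show "((\<lambda>r. f (x + r *\<^sub>R j) * g (x + r *\<^sub>R j)) has_real_derivative f x * pd j g x + pd j f x * g x) (at 0)" for x
      using DERIV_mult[OF test_dir_deriv[OF f j, of x] test_dir_deriv[OF g j, of x]] by (simp add: algebra_simps)
    show "\<bar>f x * pd j g x + pd j f x * g x\<bar> \<le> K1 * K4 + K3 * K2" for x
    proof -
      have "\<bar>f x * pd j g x\<bar> \<le> K1 * K4" "\<bar>pd j f x * g x\<bar> \<le> K3 * K2"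
        unfolding abs_mult using K1 K2 K3 K4 by (meson abs_ge_zero mult_mono order_trans)+
      thus ?thesis by linarith
    qed
    show "f x * g x = 0" if "R < norm x" for x using R[OF that] by simp
  qed (use i in auto)
  thus ?thesis using i by simp
qed

text \<open>Fubini's theorem: the adjoint of convolution with \<open>k\<close> is convolution with the reflected kernel.\<close>

lemma conv_adjoint:
  fixes f g k :: "'a::euclidean_space \<Rightarrow> real"
  assumes f: "f \<in> Cc_inf S" and g: "bdd_borel g" and k: "integrable lborel k"
  shows "(\<integral>x. f x * conv k g x \<partial>lborel) = (\<integral>y. g y * conv (\<lambda>z. k (- z)) f y \<partial>lborel)"
proof -
  obtain K where K: "g \<in> borel_measurable borel" "\<And>x. \<bar>g x\<bar> \<le> K" using g by (auto simp: bdd_borel_def)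
  have [measurable]: "f \<in> borel_measurable borel" "g \<in> borel_measurable borel" "k \<in> borel_measurable borel"
    using test_borel[OF f] K borel_measurable_integrable[OF k] by auto
  define M where "M = K * (\<integral>y. \<bar>k y\<bar> \<partial>lborel)"
  have swap: "(\<integral>x. \<integral>y. f x * (k (x - y) * g y) \<partial>lborel \<partial>lborel) = (\<integral>y. \<integral>x. f x * (k (x - y) * g y) \<partial>lborel \<partial>lborel)"
  proof (rule fubini_dominated(1))
    show "AE x in lborel. integrable lborel (\<lambda>y. f x * (k (x - y) * g y))" using conv_integrable[OF k K] by auto
    show "integrable lborel (\<lambda>x. \<bar>f x\<bar> * M)" using test_integrable[OF f] by simp
    show "AE x in lborel. (\<integral>y. \<bar>f x * (k (x - y) * g y)\<bar> \<partial>lborel) \<le> \<bar>f x\<bar> * M"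
    proof (rule AE_I2)
      fix x
      have "\<bar>conv (\<lambda>z. \<bar>k z\<bar>) (\<lambda>y. \<bar>g y\<bar>) x\<bar> \<le> K * (\<integral>y. \<bar>\<bar>k y\<bar>\<bar> \<partial>lborel)"
        by (rule conv_abs_le) (use k K in auto)
      hence "\<bar>f x\<bar> * conv (\<lambda>z. \<bar>k z\<bar>) (\<lambda>y. \<bar>g y\<bar>) x \<le> \<bar>f x\<bar> * M" by (intro mult_left_mono) (auto simp: M_def)
      thus "(\<integral>y. \<bar>f x * (k (x - y) * g y)\<bar> \<partial>lborel) \<le> \<bar>f x\<bar> * M" by (simp add: abs_mult conv_def)
    qed
  qed measurable
  have "(\<integral>x. f x * conv k g x \<partial>lborel) = (\<integral>x. \<integral>y. f x * (k (x - y) * g y) \<partial>lborel \<partial>lborel)" by (simp add: conv_def)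
  also have "\<dots> = (\<integral>y. \<integral>x. f x * (k (x - y) * g y) \<partial>lborel \<partial>lborel)"
    by (rule swap)
  also have "\<dots> = (\<integral>y. g y * conv (\<lambda>z. k (- z)) f y \<partial>lborel)"
  proof (intro Bochner_Integration.integral_cong refl)
    fix y
    have "(\<integral>x. f x * (k (x - y) * g y) \<partial>lborel) = (\<integral>x. g y * (k (- (y - x)) * f x) \<partial>lborel)"
      by (intro Bochner_Integration.integral_cong refl) simp
    also have "\<dots> = g y * conv (\<lambda>z. k (- z)) f y" unfolding conv_def by (rule integral_mult_right_zero)
    finally show "(\<integral>x. f x * (k (x - y) * g y) \<partial>lborel) = g y * conv (\<lambda>z. k (- z)) f y" .
  qed
  finally show ?thesis .
qed

lemma heat_pd_ibp:
  fixes f g :: "'a::euclidean_space \<Rightarrow> real"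
  assumes f: "f \<in> Cc_inf UNIV" and g: "g \<in> Cc_inf UNIV" and j: "j \<in> Basis" and r: "r > 0"
  shows "(\<integral>x. f x * conv (gauss r) (pd j g) x \<partial>lborel) = - (\<integral>x. conv (gauss r) (pd j f) x * g x \<partial>lborel)"
proof -
  have "(\<integral>x. f x * conv (gauss r) (pd j g) x \<partial>lborel) = -2 * (\<integral>x. f x * conv (egauss j r) g x \<partial>lborel)"
    unfolding heat_pd[OF g r j] by (simp add: mult.left_commute[of "f _"])
  also have "(\<integral>x. f x * conv (egauss j r) g x \<partial>lborel) = (\<integral>y. g y * conv (\<lambda>z. egauss j r (- z)) f y \<partial>lborel)"
    by (rule conv_adjoint[OF f bdd_borel_test[OF g] egauss_integrable[OF r j]])
  also have "\<dots> = - (\<integral>y. g y * conv (egauss j r) f y \<partial>lborel)"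
    using conv_cmult_left[of "-1" "egauss j r" f] by simp
  also have "-2 * - (\<integral>y. g y * conv (egauss j r) f y \<partial>lborel) = - (\<integral>x. conv (gauss r) (pd j f) x * g x \<partial>lborel)"
    unfolding heat_pd[OF f r j] by (simp add: mult.assoc mult.commute[of "g _"])
  finally show ?thesis .
qed

text \<open>\<open>P\<^sub>r \<partial>\<^sub>j\<close> is convolution with an odd kernel, hence antisymmetric, and so is its time integral.\<close>

lemma frac_ibp_component:
  fixes f g :: "'a::euclidean_space \<Rightarrow> real"
  assumes f: "f \<in> Cc_inf UNIV" and g: "g \<in> Cc_inf UNIV" and j: "j \<in> Basis" and s: "0 \<le> s" "s \<le> 1"
  shows "(\<integral>x. f x * (frac_gradient s g x \<bullet> j) \<partial>lborel) = - (\<integral>x. (frac_gradient s f x \<bullet> j) * g x \<partial>lborel)"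
proof (cases "s = 1")
  case True
  thus ?thesis using pd_ibp[OF f g j] frac_gradient_1_component[OF f j] frac_gradient_1_component[OF g j] by simp
next
  case False
  define b where "b = (1 - s) / 2"
  have b: "0 < b" "b < 1" using s False by (auto simp: b_def)
  obtain c where c: "\<forall>f\<in>Cc_inf UNIV. \<forall>j\<in>Basis. \<forall>x::'a. frac_gradient s f x \<bullet> j = c * (\<integral>r. pw b r * conv (gauss r) (pd j f) x \<partial>lborel)"
    using frac_gradient_heat_integral[of s, where 'a='a] s False unfolding b_def by auto
  have "(\<integral>x. f x * (frac_gradient s g x \<bullet> j) \<partial>lborel) = c * (\<integral>x. f x * (\<integral>r. pw b r * conv (gauss r) (pd j g) x \<partial>lborel) \<partial>lborel)"
    using c g j by (simp add: mult.left_commute[of "f _"])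
  also have "(\<integral>x. f x * (\<integral>r. pw b r * conv (gauss r) (pd j g) x \<partial>lborel) \<partial>lborel) = (\<integral>r. pw b r * (\<integral>x. f x * conv (gauss r) (pd j g) x \<partial>lborel) \<partial>lborel)"
    by (rule heat_time_space_swap[OF test_integrable[OF f] g j b])
  also have "\<dots> = (\<integral>r. - (pw b r * (\<integral>x. g x * conv (gauss r) (pd j f) x \<partial>lborel)) \<partial>lborel)"
  proof (intro Bochner_Integration.integral_cong refl)
    fix r show "pw b r * (\<integral>x. f x * conv (gauss r) (pd j g) x \<partial>lborel) = - (pw b r * (\<integral>x. g x * conv (gauss r) (pd j f) x \<partial>lborel))"
      using heat_pd_ibp[OF f g j, of r] by (cases "r > 0") (auto simp: pw_def mult.commute[of "g _"])
  qed
  also have "\<dots> = - (\<integral>x. g x * (\<integral>r. pw b r * conv (gauss r) (pd j f) x \<partial>lborel) \<partial>lborel)"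
    by (simp add: heat_time_space_swap[OF test_integrable[OF g] f j b])
  also have "c * - (\<integral>x. g x * (\<integral>r. pw b r * conv (gauss r) (pd j f) x \<partial>lborel) \<partial>lborel) = - (\<integral>x. (frac_gradient s f x \<bullet> j) * g x \<partial>lborel)"
    using c f j by (simp add: mult.assoc mult.commute[of "g _"])
  finally show ?thesis .
qed

lemma test_component:
  assumes "\<Phi> \<in> Cc_inf UNIV" shows "(\<lambda>y. \<Phi> y \<bullet> j) \<in> Cc_inf UNIV"
  by (rule test_linear[OF assms bounded_linear_inner_left])

lemma frac_ibp:
  fixes f :: "'a::euclidean_space \<Rightarrow> real"
  assumes f: "f \<in> Cc_inf UNIV" and \<Phi>: "\<Phi> \<in> Cc_inf UNIV" and s: "0 \<le> s" "s \<le> 1"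
  shows "(\<integral>x. f x * frac_divergence s \<Phi> x \<partial>lborel) = - (\<integral>x. frac_gradient s f x \<bullet> \<Phi> x \<partial>lborel)"
proof -
  have i1: "integrable lborel (\<lambda>x. f x * (frac_gradient s (\<lambda>y. \<Phi> y \<bullet> j) x \<bullet> j))" if "j \<in> Basis" for j
    by (rule test_mult_bdd_integrable[OF f bdd_borel_frac_component[OF test_component[OF \<Phi>] that s]])
  have i2: "integrable lborel (\<lambda>x. (frac_gradient s f x \<bullet> j) * (\<Phi> x \<bullet> j))" if "j \<in> Basis" for j
    using test_mult_bdd_integrable[OF test_component[OF \<Phi>] bdd_borel_frac_component[OF f that s]] by (simp add: mult.commute)
  have "(\<integral>x. f x * frac_divergence s \<Phi> x \<partial>lborel) = (\<Sum>j\<in>Basis. \<integral>x. f x * (frac_gradient s (\<lambda>y. \<Phi> y \<bullet> j) x \<bullet> j) \<partial>lborel)"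
    unfolding frac_divergence_def sum_distrib_left by (rule Bochner_Integration.integral_sum) (rule i1)
  also have "\<dots> = (\<Sum>j\<in>Basis. - (\<integral>x. (frac_gradient s f x \<bullet> j) * (\<Phi> x \<bullet> j) \<partial>lborel))"
    by (intro sum.cong refl frac_ibp_component f test_component \<Phi> s)
  also have "\<dots> = - (\<integral>x. (\<Sum>j\<in>Basis. (frac_gradient s f x \<bullet> j) * (\<Phi> x \<bullet> j)) \<partial>lborel)"
    by (subst Bochner_Integration.integral_sum) (auto simp: i2 sum_negf)
  also have "\<dots> = - (\<integral>x. frac_gradient s f x \<bullet> \<Phi> x \<partial>lborel)" by (simp add: euclidean_inner[symmetric])
  finally show ?thesis .
qed

section \<open>Weak fractional gradients\<close>

lemma frac_divergence_borel:
  fixes \<Phi> :: "'a::euclidean_space \<Rightarrow> 'a"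
  assumes \<Phi>: "\<Phi> \<in> Cc_inf UNIV" and s: "0 \<le> s" "s \<le> 1"
  shows "frac_divergence s \<Phi> \<in> borel_measurable borel"
  unfolding frac_divergence_def[abs_def]
  using bdd_borel_frac_component[OF test_component[OF \<Phi>] _ s] by (intro borel_measurable_sum) (auto simp: bdd_borel_def)

text \<open>This makes the pairing of an \<open>L^p\<close> function with a fractional divergence well defined; for
  \<open>s < 1\<close> the divergence is not compactly supported.\<close>

lemma frac_divergence_powr_integrable:
  fixes \<Phi> :: "'a::euclidean_space \<Rightarrow> 'a"
  assumes \<Phi>: "\<Phi> \<in> Cc_inf UNIV" and s: "0 \<le> s" "s \<le> 1" and q: "1 < q"
  shows "integrable lborel (\<lambda>x. \<bar>frac_divergence s \<Phi> x\<bar> powr q)"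
proof -
  let ?a = "\<lambda>j x. frac_gradient s (\<lambda>y. \<Phi> y \<bullet> j) x \<bullet> j"
  have am: "?a j \<in> borel_measurable lborel" if "j \<in> Basis" for j
    using bdd_borel_frac_component[OF test_component[OF \<Phi>] that s] by (auto simp: bdd_borel_def)
  have fin: "pmass lborel q (?a j) < \<infinity>" if j: "j \<in> Basis" for j
  proof -
    have "pmass lborel q (?a j) \<le> pmass lborel q (frac_gradient s (\<lambda>y. \<Phi> y \<bullet> j))"
      unfolding pmass_def using j q by (intro nn_integral_mono ennreal_leI powr_mono2) (auto intro: Basis_le_norm)
    also have "\<dots> < \<infinity>"
      using frac_gradient_powr_integrable[OF test_component[OF \<Phi>] s q] frac_gradient_borel[OF test_component[OF \<Phi>] s]
      by (subst pmass_finite_iff) auto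
    finally show ?thesis .
  qed
  have "pmass lborel q (\<lambda>x. \<Sum>j\<in>A. ?a j x) < \<infinity>" if "finite A" "A \<subseteq> Basis" for A
    using that
  proof (induction A rule: finite_induct)
    case empty thus ?case by (simp add: pmass_def)
  next
    case (insert j A)
    have "(\<lambda>x. \<Sum>j\<in>A. ?a j x) \<in> borel_measurable lborel" using insert.prems am by (intro borel_measurable_sum) auto
    hence "pmass lborel q (\<lambda>x. ?a j x + (\<Sum>j\<in>A. ?a j x)) \<le> ennreal (2 powr q) * (pmass lborel q (?a j) + pmass lborel q (\<lambda>x. \<Sum>j\<in>A. ?a j x))"
      using insert.prems am q by (intro pmass_add) auto
    also have "\<dots> < \<infinity>" using insert fin by (auto simp: ennreal_mult_less_top)
    finally show ?case using insert by simp
  qed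
  from this[OF finite_Basis order_refl]
  have "pmass lborel q (frac_divergence s \<Phi>) < \<infinity>" by (simp add: frac_divergence_def[abs_def])
  thus ?thesis using frac_divergence_borel[OF \<Phi> s] by (subst (asm) pmass_finite_iff) auto
qed

lemma borel_lebesgue: "f \<in> borel_measurable borel \<Longrightarrow> f \<in> borel_measurable lebesgue"
  by (rule measurable_completion) simp

lemma pmass_lebesgue: "pmass lebesgue p u = pmass lborel p u"
  by (simp add: pmass_def nn_integral_completion)

lemma L1_loc_pairing_integrable:
  fixes G \<Phi> :: "'a::euclidean_space \<Rightarrow> 'a"
  assumes G: "G \<in> L1_loc" and \<Phi>: "\<Phi> \<in> Cc_inf UNIV"
  shows "integrable lebesgue (\<lambda>x. norm (G x) * norm (\<Phi> x))" and "integrable lebesgue (\<lambda>x. G x \<bullet> \<Phi> x)"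
proof -
  obtain K where K: "K > 0" "\<And>x. norm (\<Phi> x) \<le> K" using test_bounded[OF \<Phi>] by blast
  obtain R where R: "\<And>x. norm x > R \<Longrightarrow> \<Phi> x = 0" using test_support[OF \<Phi>] by blast
  have [measurable]: "G \<in> borel_measurable lebesgue" using G by (simp add: L1_loc_def)
  have [measurable]: "\<Phi> \<in> borel_measurable lebesgue" by (rule borel_lebesgue[OF test_borel[OF \<Phi>]])
  have i: "integrable lebesgue (\<lambda>x. indicator (cball 0 R) x *\<^sub>R G x)" using G by (simp add: L1_loc_def set_integrable_def)
  show n: "integrable lebesgue (\<lambda>x. norm (G x) * norm (\<Phi> x))"
  proof (rule Bochner_Integration.integrable_bound)
    show "integrable lebesgue (\<lambda>x. K *\<^sub>R (indicator (cball 0 R) x *\<^sub>R G x))" by (rule integrable_scaleR_right) (rule i)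
    show "AE x in lebesgue. norm (norm (G x) * norm (\<Phi> x)) \<le> norm (K *\<^sub>R (indicator (cball 0 R) x *\<^sub>R G x))"
    proof (rule AE_I2)
      fix x
      have "norm (G x) * norm (\<Phi> x) \<le> norm (G x) * K" by (intro mult_left_mono K(2)) simp
      thus "norm (norm (G x) * norm (\<Phi> x)) \<le> norm (K *\<^sub>R (indicator (cball 0 R) x *\<^sub>R G x))"
        using R[of x] K(1) by (cases "norm x \<le> R") (auto simp: mult.commute)
    qed
  qed measurable
  show "integrable lebesgue (\<lambda>x. G x \<bullet> \<Phi> x)"
    by (rule Bochner_Integration.integrable_bound[OF n]) (auto simp: Cauchy_Schwarz_ineq2)
qed

lemma Lp_imp_L1_loc:
  fixes G :: "'a::euclidean_space \<Rightarrow> 'a"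
  assumes m[measurable]: "G \<in> borel_measurable lebesgue" and G: "pmass lebesgue p G < \<infinity>" and p: "1 \<le> p"
  shows "G \<in> L1_loc"
proof -
  have i: "integrable lebesgue (\<lambda>x. norm (G x) powr p)" using G pmass_finite_iff[OF m, of p] by simp
  have "set_integrable lebesgue K G" if K: "compact K" for K
  proof -
    have Ks: "K \<in> sets lebesgue" using K by (auto simp: compact_imp_closed)
    have "emeasure lborel K < \<infinity>" using K by (intro emeasure_bounded_finite compact_imp_bounded)
    hence iK: "integrable lebesgue (indicator K :: 'a \<Rightarrow> real)"
      using K by (auto simp: compact_imp_closed)
    show ?thesis unfolding set_integrable_def
    proof (rule Bochner_Integration.integrable_bound)
      show "integrable lebesgue (\<lambda>x. indicator K x + norm (G x) powr p)" using iK i by (rule Bochner_Integration.integrable_add)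
      show "AE x in lebesgue. norm (indicator K x *\<^sub>R G x) \<le> norm (indicator K x + norm (G x) powr p)"
      proof (rule AE_I2)
        fix x
        have "norm (G x) \<le> 1 + norm (G x) powr p"
        proof (cases "norm (G x) \<le> 1")
          case True thus ?thesis by (simp add: add_increasing2)
        next
          case False
          hence "norm (G x) powr 1 \<le> norm (G x) powr p" using p by (intro powr_mono) auto
          thus ?thesis using False by simp
        qed
        thus "norm (indicator K x *\<^sub>R G x) \<le> norm (indicator K x + norm (G x) powr p)" by (auto simp: indicator_def)
      qed
      show "(\<lambda>x. indicator K x *\<^sub>R G x) \<in> borel_measurable lebesgue" using Ks by (intro borel_measurable_scaleR borel_measurable_indicator) auto
    qed
  qed
  thus ?thesis using m by (simp add: L1_loc_def)
qed

lemma L1_loc_diff: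
  assumes "G \<in> L1_loc" "H \<in> L1_loc" shows "(\<lambda>x. G x - H x) \<in> L1_loc"
  using assms unfolding L1_loc_def by (auto intro!: set_integral_diff(1))

text \<open>The difference of two weak gradients is orthogonal to all test fields.\<close>

lemma weak_frac_gradient_unique:
  assumes "has_weak_frac_gradient s u G" "has_weak_frac_gradient s u H"
  shows "AE x in lebesgue. G x = H x"
proof -
  have GH: "G \<in> L1_loc" "H \<in> L1_loc" using assms by (auto simp: has_weak_frac_gradient_def)
  have "AE x in lebesgue. G x - H x = 0"
  proof (rule AE_zero_if_orthogonal_to_tests[OF L1_loc_diff[OF GH]])
    fix \<Phi> :: "'a \<Rightarrow> 'a" assume \<Phi>: "\<Phi> \<in> Cc_inf UNIV"
    have "(LINT x|lebesgue. G x \<bullet> \<Phi> x) = (LINT x|lebesgue. H x \<bullet> \<Phi> x)"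
    proof -
      have "- (LINT x|lebesgue. G x \<bullet> \<Phi> x) = - (LINT x|lebesgue. H x \<bullet> \<Phi> x)"
        using assms \<Phi> unfolding has_weak_frac_gradient_def by simp
      thus ?thesis by simp
    qed
    thus "(LINT x|lebesgue. (G x - H x) \<bullet> \<Phi> x) = 0"
      using L1_loc_pairing_integrable[OF GH(1) \<Phi>] L1_loc_pairing_integrable[OF GH(2) \<Phi>] by (simp add: inner_diff_left)
  qed
  thus ?thesis by eventually_elim simp
qed

lemma weak_pairing_integrable:
  fixes u :: "'a::euclidean_space \<Rightarrow> real"
  assumes u: "u \<in> borel_measurable lebesgue" "pmass lebesgue p u < \<infinity>" and p: "1 < p" and \<Phi>: "\<Phi> \<in> Cc_inf UNIV" and s: "0 \<le> s" "s \<le> 1"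
  shows "integrable lebesgue (\<lambda>x. u x * frac_divergence s \<Phi> x)"
proof (rule integrable_mult_conjugate[OF u(1) _ p])
  show "frac_divergence s \<Phi> \<in> borel_measurable lebesgue" by (rule borel_lebesgue[OF frac_divergence_borel[OF \<Phi> s]])
  show "integrable lebesgue (\<lambda>x. \<bar>u x\<bar> powr p)" using pmass_finite_iff[OF u(1), of p] u(2) by simp
  have "1 < p / (p - 1)" using p by (simp add: field_simps)
  from frac_divergence_powr_integrable[OF \<Phi> s this]
  show "integrable lebesgue (\<lambda>x. \<bar>frac_divergence s \<Phi> x\<bar> powr (p / (p - 1)))"
    using frac_divergence_borel[OF \<Phi> s] by (subst integrable_completion) auto
qed

lemma has_weak_frac_gradient_diff:
  fixes u v :: "'a::euclidean_space \<Rightarrow> real"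
  assumes u: "has_weak_frac_gradient s u G" "u \<in> borel_measurable lebesgue" "pmass lebesgue p u < \<infinity>"
    and v: "has_weak_frac_gradient s v H" "v \<in> borel_measurable lebesgue" "pmass lebesgue p v < \<infinity>"
    and p: "1 < p" and s: "0 \<le> s" "s \<le> 1"
  shows "has_weak_frac_gradient s (\<lambda>x. u x - v x) (\<lambda>x. G x - H x)"
proof -
  have GH: "G \<in> L1_loc" "H \<in> L1_loc" using u v by (auto simp: has_weak_frac_gradient_def)
  have "(LINT x|lebesgue. (u x - v x) * frac_divergence s \<Phi> x) = - (LINT x|lebesgue. (G x - H x) \<bullet> \<Phi> x)" if \<Phi>: "\<Phi> \<in> Cc_inf UNIV" for \<Phi> :: "'a \<Rightarrow> 'a"
    using u v \<Phi> weak_pairing_integrable[OF u(2,3) p \<Phi> s] weak_pairing_integrable[OF v(2,3) p \<Phi> s]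
      L1_loc_pairing_integrable[OF GH(1) \<Phi>] L1_loc_pairing_integrable[OF GH(2) \<Phi>]
    by (simp add: left_diff_distrib inner_diff_left has_weak_frac_gradient_def)
  thus ?thesis using L1_loc_diff[OF GH] by (simp add: has_weak_frac_gradient_def)
qed

lemma test_pmass_finite:
  fixes f :: "'a::euclidean_space \<Rightarrow> real"
  assumes f: "f \<in> Cc_inf UNIV" and p: "1 < p"
  shows "pmass lebesgue p f < \<infinity>"
proof -
  obtain K where K: "K > 0" "\<And>x. \<bar>f x\<bar> \<le> K" using test_bounded[OF f] by auto
  have "pmass lebesgue p f = (\<integral>\<^sup>+x. ennreal (\<bar>f x\<bar> powr p) \<partial>lborel)" by (simp add: pmass_lebesgue) (simp add: pmass_def)
  also have "\<dots> \<le> (\<integral>\<^sup>+x. ennreal (K powr (p - 1)) * ennreal \<bar>f x\<bar> \<partial>lborel)"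
  proof (intro nn_integral_mono)
    fix x
    have "\<bar>f x\<bar> powr p = \<bar>f x\<bar> powr (p - 1) * \<bar>f x\<bar>" by (cases "f x = 0") (auto simp: powr_diff)
    also have "\<dots> \<le> K powr (p - 1) * \<bar>f x\<bar>" using K p by (intro mult_right_mono powr_mono2) auto
    finally show "ennreal (\<bar>f x\<bar> powr p) \<le> ennreal (K powr (p - 1)) * ennreal \<bar>f x\<bar>" by (simp add: ennreal_mult[symmetric] ennreal_leI)
  qed
  also have "\<dots> = ennreal (K powr (p - 1)) * (\<integral>\<^sup>+x. ennreal \<bar>f x\<bar> \<partial>lborel)"
    using test_borel[OF f] by (intro nn_integral_cmult) simp
  also have "\<dots> < \<infinity>" using test_integrable[OF f] by (auto simp: ennreal_mult_less_top integrable_iff_bounded)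
  finally show ?thesis .
qed

lemma frac_gradient_pmass_finite:
  fixes f :: "'a::euclidean_space \<Rightarrow> real"
  assumes f: "f \<in> Cc_inf UNIV" and p: "1 < p" and s: "0 \<le> s" "s \<le> 1"
  shows "pmass lebesgue p (frac_gradient s f) < \<infinity>"
  unfolding pmass_lebesgue using frac_gradient_powr_integrable[OF f s p] frac_gradient_borel[OF f s] by (subst pmass_finite_iff) auto

text \<open>Integration by parts; local integrability follows from integrability of the square.\<close>

lemma test_has_weak_frac_gradient:
  fixes f :: "'a::euclidean_space \<Rightarrow> real"
  assumes f: "f \<in> Cc_inf UNIV" and s: "0 \<le> s" "s \<le> 1"
  shows "has_weak_frac_gradient s f (frac_gradient s f)"
proof -
  have m: "frac_gradient s f \<in> borel_measurable borel" by (rule frac_gradient_borel[OF f s])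
  have "frac_gradient s f \<in> L1_loc"
    by (rule Lp_imp_L1_loc[OF borel_lebesgue[OF m] frac_gradient_pmass_finite[OF f, of 2]]) (use s in auto)
  moreover have "(LINT x|lebesgue. f x * frac_divergence s \<Phi> x) = - (LINT x|lebesgue. frac_gradient s f x \<bullet> \<Phi> x)" if \<Phi>: "\<Phi> \<in> Cc_inf UNIV" for \<Phi> :: "'a \<Rightarrow> 'a"
  proof -
    have [measurable]: "f \<in> borel_measurable borel" "frac_divergence s \<Phi> \<in> borel_measurable borel" "frac_gradient s f \<in> borel_measurable borel" "\<Phi> \<in> borel_measurable borel"
      using test_borel[OF f] frac_divergence_borel[OF \<Phi> s] m test_borel[OF \<Phi>] by auto
    have "(LINT x|lebesgue. f x * frac_divergence s \<Phi> x) = (\<integral>x. f x * frac_divergence s \<Phi> x \<partial>lborel)" by (rule integral_completion) measurable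
    moreover have "(LINT x|lebesgue. frac_gradient s f x \<bullet> \<Phi> x) = (\<integral>x. frac_gradient s f x \<bullet> \<Phi> x \<partial>lborel)" by (rule integral_completion) measurable
    ultimately show ?thesis using frac_ibp[OF f \<Phi> s] by simp
  qed
  ultimately show ?thesis by (simp add: has_weak_frac_gradient_def)
qed

text \<open>Both sides of the defining identity pass to the limit: on the left, \<open>f n\<close> converges in \<open>L^q\<close> and
  the divergence lies in the dual space; on the right, the gradients converge in \<open>L^q\<close> and the
  test field is bounded with bounded support.\<close>

lemma has_weak_frac_gradient_limit:
  fixes u :: "'a::euclidean_space \<Rightarrow> real"
  assumes fn: "\<And>n. f n \<in> Cc_inf UNIV" and s: "0 \<le> s" "s \<le> 1" and q: "1 < q"
    and u: "u \<in> borel_measurable lebesgue" "pmass lebesgue q u < \<infinity>" "(\<lambda>n. pmass lebesgue q (\<lambda>x. f n x - u x)) \<longlonglongrightarrow> 0"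
    and G: "G \<in> borel_measurable lebesgue" "pmass lebesgue q G < \<infinity>" "(\<lambda>n. pmass lebesgue q (\<lambda>x. frac_gradient s (f n) x - G x)) \<longlonglongrightarrow> 0"
  shows "has_weak_frac_gradient s u G"
proof -
  have GL: "G \<in> L1_loc" by (rule Lp_imp_L1_loc[OF G(1,2)]) (use q in simp)
  have "(LINT x|lebesgue. u x * frac_divergence s \<Phi> x) = - (LINT x|lebesgue. G x \<bullet> \<Phi> x)" if \<Phi>: "\<Phi> \<in> Cc_inf UNIV" for \<Phi> :: "'a \<Rightarrow> 'a"
  proof -
    have q': "1 < q / (q - 1)" using q by (simp add: field_simps)
    have fm: "f n \<in> borel_measurable lebesgue" for n by (rule borel_lebesgue[OF test_borel[OF fn]])
    have gm: "frac_gradient s (f n) \<in> borel_measurable lebesgue" for n by (rule borel_lebesgue[OF frac_gradient_borel[OF fn s]])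
    have dm: "frac_divergence s \<Phi> \<in> borel_measurable lebesgue" by (rule borel_lebesgue[OF frac_divergence_borel[OF \<Phi> s]])
    have pm: "\<Phi> \<in> borel_measurable lebesgue" by (rule borel_lebesgue[OF test_borel[OF \<Phi>]])
    note [measurable] = fm gm dm pm u(1) G(1)
    have iu: "integrable lebesgue (\<lambda>x. u x * frac_divergence s \<Phi> x)" by (rule weak_pairing_integrable[OF u(1,2) q \<Phi> s])
    have ifn: "integrable lebesgue (\<lambda>x. f n x * frac_divergence s \<Phi> x)" for n by (rule weak_pairing_integrable[OF fm test_pmass_finite[OF fn q] q \<Phi> s])
    have "(\<lambda>n. LINT x|lebesgue. (f n x - u x) * frac_divergence s \<Phi> x) \<longlonglongrightarrow> 0"
    proof (rule pairing_tendsto_0[OF _ dm q u(3)])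
      show "integrable lebesgue (\<lambda>x. \<bar>frac_divergence s \<Phi> x\<bar> powr (q / (q - 1)))"
        using frac_divergence_powr_integrable[OF \<Phi> s q'] frac_divergence_borel[OF \<Phi> s] by (subst integrable_completion) auto
    qed measurable
    hence l1: "(\<lambda>n. (LINT x|lebesgue. f n x * frac_divergence s \<Phi> x) - (LINT x|lebesgue. u x * frac_divergence s \<Phi> x)) \<longlonglongrightarrow> 0"
      using iu ifn by (simp add: left_diff_distrib)
    have iG: "integrable lebesgue (\<lambda>x. G x \<bullet> \<Phi> x)" by (rule L1_loc_pairing_integrable(2)[OF GL \<Phi>])
    have ign: "integrable lebesgue (\<lambda>x. frac_gradient s (f n) x \<bullet> \<Phi> x)" for n
      using L1_loc_pairing_integrable(2)[OF _ \<Phi>] test_has_weak_frac_gradient[OF fn s] by (auto simp: has_weak_frac_gradient_def)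
    have abs_lim: "(\<lambda>n. LINT x|lebesgue. norm (frac_gradient s (f n) x - G x) * norm (\<Phi> x)) \<longlonglongrightarrow> 0"
    proof (rule pairing_tendsto_0[OF _ _ q])
      show "(\<lambda>n. pmass lebesgue q (\<lambda>x. norm (frac_gradient s (f n) x - G x))) \<longlonglongrightarrow> 0" using G(3) by (simp add: pmass_def)
      have "(\<lambda>x. \<bar>norm (\<Phi> x)\<bar> powr (q / (q - 1))) \<in> borel_measurable borel" using test_borel[OF \<Phi>] by measurable
      moreover have "integrable lborel (\<lambda>x. \<bar>norm (\<Phi> x)\<bar> powr (q / (q - 1)))"
      proof -
        obtain K where K: "K > 0" "\<And>x. norm (\<Phi> x) \<le> K" using test_bounded[OF \<Phi>] by blast
        obtain R where R: "\<And>x. norm x > R \<Longrightarrow> \<Phi> x = 0" using test_support[OF \<Phi>] by blast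
        show ?thesis
          by (rule integrable_bounded_support[of _ "K powr (q / (q - 1))" R])
             (use test_borel[OF \<Phi>] in measurable, use R K q' in \<open>auto intro!: powr_mono2\<close>)
      qed
      ultimately show "integrable lebesgue (\<lambda>x. \<bar>norm (\<Phi> x)\<bar> powr (q / (q - 1)))" by (subst integrable_completion) auto
    qed measurable
    have l2: "(\<lambda>n. (LINT x|lebesgue. frac_gradient s (f n) x \<bullet> \<Phi> x) - (LINT x|lebesgue. G x \<bullet> \<Phi> x)) \<longlonglongrightarrow> 0"
    proof (rule Lim_null_comparison[OF _ abs_lim], intro always_eventually allI)
      fix n
      have "(LINT x|lebesgue. frac_gradient s (f n) x \<bullet> \<Phi> x) - (LINT x|lebesgue. G x \<bullet> \<Phi> x) = (LINT x|lebesgue. (frac_gradient s (f n) x - G x) \<bullet> \<Phi> x)"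
        using iG ign by (simp add: inner_diff_left)
      also have "\<bar>\<dots>\<bar> \<le> (LINT x|lebesgue. norm (frac_gradient s (f n) x - G x) * norm (\<Phi> x))"
      proof (rule abs_integral_le)
        show "\<bar>(frac_gradient s (f n) x - G x) \<bullet> \<Phi> x\<bar> \<le> norm (frac_gradient s (f n) x - G x) * norm (\<Phi> x)" for x
          by (rule Cauchy_Schwarz_ineq2)
        have gL: "frac_gradient s (f n) \<in> L1_loc" using test_has_weak_frac_gradient[OF fn s] by (auto simp: has_weak_frac_gradient_def)
        show "integrable lebesgue (\<lambda>x. norm (frac_gradient s (f n) x - G x) * norm (\<Phi> x))"
          by (rule L1_loc_pairing_integrable(1)[OF L1_loc_diff[OF gL GL] \<Phi>])
      qed
      finally show "norm ((LINT x|lebesgue. frac_gradient s (f n) x \<bullet> \<Phi> x) - (LINT x|lebesgue. G x \<bullet> \<Phi> x)) \<le> (LINT x|lebesgue. norm (frac_gradient s (f n) x - G x) * norm (\<Phi> x))" by simp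
    qed
    have e: "(LINT x|lebesgue. f n x * frac_divergence s \<Phi> x) = - (LINT x|lebesgue. frac_gradient s (f n) x \<bullet> \<Phi> x)" for n
      using test_has_weak_frac_gradient[OF fn s] \<Phi> by (auto simp: has_weak_frac_gradient_def)
    have "(\<lambda>n. (LINT x|lebesgue. f n x * frac_divergence s \<Phi> x)) \<longlonglongrightarrow> (LINT x|lebesgue. u x * frac_divergence s \<Phi> x)"
      using l1 by (simp add: LIM_zero_iff)
    moreover have "(\<lambda>n. - (LINT x|lebesgue. frac_gradient s (f n) x \<bullet> \<Phi> x)) \<longlonglongrightarrow> - (LINT x|lebesgue. G x \<bullet> \<Phi> x)"
      using l2 by (intro tendsto_minus) (simp add: LIM_zero_iff)
    ultimately show ?thesis unfolding e by (rule LIMSEQ_unique)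
  qed
  thus ?thesis using GL by (simp add: has_weak_frac_gradient_def)
qed

section \<open>The spaces of functions with a weak fractional gradient\<close>

text \<open>The \<open>p\<close>-th power of the norm \<open>Lambda_norm s p\<close> in the extended reals, as explained for \<open>pmass\<close>.
  The two agree on \<open>Lambda_space s p\<close>.\<close>

definition Lmass :: "real \<Rightarrow> real \<Rightarrow> ('a::euclidean_space \<Rightarrow> real) \<Rightarrow> ennreal" where
  "Lmass s p u = pmass lebesgue p u + pmass lebesgue p (weak_frac_gradient s u)"

lemma Lp_space_iff: "u \<in> Lp_space p \<longleftrightarrow> u \<in> borel_measurable lebesgue \<and> pmass lebesgue p u < \<infinity>"
  unfolding Lp_space_def using pmass_finite_iff[of u lebesgue p] by auto

lemma pmass_cong_AE: "AE x in M. u x = v x \<Longrightarrow> pmass M p u = pmass M p v"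
  unfolding pmass_def by (intro nn_integral_cong_AE) (auto elim: eventually_mono)

lemma has_weak_weak_frac_gradient: "has_weak_frac_gradient s u G \<Longrightarrow> has_weak_frac_gradient s u (weak_frac_gradient s u)"
  unfolding weak_frac_gradient_def by (rule someI[of "\<lambda>G. has_weak_frac_gradient s u G" G])

lemma weak_frac_gradient_AE:
  "has_weak_frac_gradient s u G \<Longrightarrow> AE x in lebesgue. weak_frac_gradient s u x = G x"
  by (rule weak_frac_gradient_unique[OF has_weak_weak_frac_gradient])

lemma Lambda_spaceD:
  assumes "u \<in> Lambda_space s p"
  shows "u \<in> borel_measurable lebesgue" "pmass lebesgue p u < \<infinity>" "has_weak_frac_gradient s u (weak_frac_gradient s u)"
    "weak_frac_gradient s u \<in> borel_measurable lebesgue" "pmass lebesgue p (weak_frac_gradient s u) < \<infinity>"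
  using assms has_weak_weak_frac_gradient[of s u] by (auto simp: Lambda_space_def Lp_space_iff)

lemma Lambda_spaceI:
  assumes u: "u \<in> borel_measurable lebesgue" "pmass lebesgue p u < \<infinity>" and G: "has_weak_frac_gradient s u G" "pmass lebesgue p G < \<infinity>"
  shows "u \<in> Lambda_space s p"
proof -
  have "weak_frac_gradient s u \<in> borel_measurable lebesgue"
    using has_weak_weak_frac_gradient[OF G(1)] by (auto simp: has_weak_frac_gradient_def L1_loc_def)
  thus ?thesis using u G pmass_cong_AE[OF weak_frac_gradient_AE[OF G(1)], of p] by (auto simp: Lambda_space_def Lp_space_iff)
qed

lemma Lambda_norm_powr:
  assumes u: "u \<in> Lambda_space s p" and p: "0 < p"
  shows "ennreal (Lambda_norm s p u powr p) = Lmass s p u"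
proof -
  note D = Lambda_spaceD[OF u]
  have N: "ennreal (Lp_norm p v powr p) = pmass lebesgue p v" if "v \<in> borel_measurable lebesgue" "pmass lebesgue p v < \<infinity>" for v :: "'a \<Rightarrow> 'b::euclidean_space"
  proof -
    have "integrable lebesgue (\<lambda>x. norm (v x) powr p)" using that pmass_finite_iff by blast
    thus ?thesis using p by (simp add: pmass_eq_integral Lp_norm_def powr_powr integral_nonneg_AE)
  qed
  have "Lambda_norm s p u powr p = Lp_norm p u powr p + Lp_norm p (weak_frac_gradient s u) powr p"
    using p by (simp add: Lambda_norm_def powr_powr)
  thus ?thesis unfolding Lmass_def using N[OF D(1,2)] N[OF D(4,5)] by simp
qed

lemma Lambda_norm_nonneg: "Lambda_norm s p u \<ge> 0"
  by (simp add: Lambda_norm_def)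

lemma Lambda_norm_le:
  assumes u: "u \<in> Lambda_space s p" and p: "0 < p" and c: "0 \<le> c" "Lmass s p u \<le> ennreal c"
  shows "Lambda_norm s p u \<le> c powr (1 / p)"
proof -
  have "ennreal (Lambda_norm s p u powr p) \<le> ennreal c" using Lambda_norm_powr[OF u p] c(2) by (simp only:)
  hence "Lambda_norm s p u powr p \<le> c" using c(1) by simp
  hence "(Lambda_norm s p u powr p) powr (1 / p) \<le> c powr (1 / p)" using p by (intro powr_mono2) auto
  thus ?thesis using p Lambda_norm_nonneg[of s p u] by (simp add: powr_powr)
qed

lemma Lambda_norm_tendsto_0:
  assumes u: "\<And>n. u n \<in> Lambda_space s p" and p: "0 < p" and lim: "(\<lambda>n. Lmass s p (u n)) \<longlonglongrightarrow> 0"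
  shows "(\<lambda>n. Lambda_norm s p (u n)) \<longlonglongrightarrow> 0"
proof (rule tendsto_0_if_powr_tendsto_0[OF _ p])
  have "(\<lambda>n. ennreal (Lambda_norm s p (u n) powr p)) \<longlonglongrightarrow> ennreal 0" using lim Lambda_norm_powr[OF u p] by simp
  thus "(\<lambda>n. Lambda_norm s p (u n) powr p) \<longlonglongrightarrow> 0" by (subst (asm) tendsto_ennreal_iff) auto
qed (rule Lambda_norm_nonneg)

lemma Lmass_tendsto_0:
  assumes u: "\<And>n. u n \<in> Lambda_space s p" and p: "0 < p" and lim: "(\<lambda>n. Lambda_norm s p (u n)) \<longlonglongrightarrow> 0"
  shows "(\<lambda>n. Lmass s p (u n)) \<longlonglongrightarrow> 0"
proof -
  have "(\<lambda>n. Lambda_norm s p (u n) powr p) \<longlonglongrightarrow> 0 powr p" using p by (intro tendsto_powr2 lim tendsto_const) (auto simp: Lambda_norm_nonneg)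
  hence "(\<lambda>n. ennreal (Lambda_norm s p (u n) powr p)) \<longlonglongrightarrow> ennreal 0" using p by (intro tendsto_ennrealI) simp
  thus ?thesis using Lambda_norm_powr[OF u p] by simp
qed

text \<open>The weak gradient chosen for a difference need not be the difference of the chosen weak
  gradients; by uniqueness the two agree almost everywhere, which is all the mass functional
  sees.\<close>

lemma Lambda_diff:
  assumes u: "u \<in> Lambda_space s p" and v: "v \<in> Lambda_space s p" and p: "1 < p" and s: "0 \<le> s" "s \<le> 1"
  shows "(\<lambda>x. u x - v x) \<in> Lambda_space s p"
    and "AE x in lebesgue. weak_frac_gradient s (\<lambda>x. u x - v x) x = weak_frac_gradient s u x - weak_frac_gradient s v x"
    and "Lmass s p (\<lambda>x. u x - v x) \<le> ennreal (2 powr p) * (Lmass s p u + Lmass s p v)"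
proof -
  note U = Lambda_spaceD[OF u] and V = Lambda_spaceD[OF v]
  have h: "has_weak_frac_gradient s (\<lambda>x. u x - v x) (\<lambda>x. weak_frac_gradient s u x - weak_frac_gradient s v x)"
    by (rule has_weak_frac_gradient_diff[OF U(3,1,2) V(3,1,2) p s])
  have p0: "p \<ge> 0" using p by simp
  have 1: "pmass lebesgue p (\<lambda>x. u x - v x) \<le> ennreal (2 powr p) * (pmass lebesgue p u + pmass lebesgue p v)"
    by (rule pmass_diff[OF U(1) V(1) p0])
  have 2: "pmass lebesgue p (\<lambda>x. weak_frac_gradient s u x - weak_frac_gradient s v x) \<le> ennreal (2 powr p) * (pmass lebesgue p (weak_frac_gradient s u) + pmass lebesgue p (weak_frac_gradient s v))"
    by (rule pmass_diff[OF U(4) V(4) p0])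
  show "(\<lambda>x. u x - v x) \<in> Lambda_space s p"
  proof (rule Lambda_spaceI[OF _ _ h])
    show "(\<lambda>x. u x - v x) \<in> borel_measurable lebesgue" using U(1) V(1) by measurable
    show "pmass lebesgue p (\<lambda>x. u x - v x) < \<infinity>" using le_less_trans[OF 1] U(2) V(2) by (auto simp: ennreal_mult_less_top)
    show "pmass lebesgue p (\<lambda>x. weak_frac_gradient s u x - weak_frac_gradient s v x) < \<infinity>" using le_less_trans[OF 2] U(5) V(5) by (auto simp: ennreal_mult_less_top)
  qed
  show AE: "AE x in lebesgue. weak_frac_gradient s (\<lambda>x. u x - v x) x = weak_frac_gradient s u x - weak_frac_gradient s v x"
    by (rule weak_frac_gradient_AE[OF h])
  have "Lmass s p (\<lambda>x. u x - v x) = pmass lebesgue p (\<lambda>x. u x - v x) + pmass lebesgue p (\<lambda>x. weak_frac_gradient s u x - weak_frac_gradient s v x)"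
    unfolding Lmass_def by (simp add: pmass_cong_AE[OF AE])
  also have "\<dots> \<le> ennreal (2 powr p) * (pmass lebesgue p u + pmass lebesgue p v) + ennreal (2 powr p) * (pmass lebesgue p (weak_frac_gradient s u) + pmass lebesgue p (weak_frac_gradient s v))"
    by (intro add_mono 1 2)
  also have "\<dots> = ennreal (2 powr p) * (Lmass s p u + Lmass s p v)" by (simp add: Lmass_def distrib_left add_ac)
  finally show "Lmass s p (\<lambda>x. u x - v x) \<le> ennreal (2 powr p) * (Lmass s p u + Lmass s p v)" .
qed

lemma Lmass_commute:
  assumes u: "u \<in> Lambda_space s p" and v: "v \<in> Lambda_space s p" and p: "1 < p" and s: "0 \<le> s" "s \<le> 1"
  shows "Lmass s p (\<lambda>x. u x - v x) = Lmass s p (\<lambda>x. v x - u x)"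
  unfolding Lmass_def pmass_cong_AE[OF Lambda_diff(2)[OF u v p s]] pmass_cong_AE[OF Lambda_diff(2)[OF v u p s]]
  by (simp only: pmass_minus_commute[of lebesgue p u v] pmass_minus_commute[of lebesgue p "weak_frac_gradient s u" "weak_frac_gradient s v"])

lemma Lmass_triangle:
  assumes u: "u \<in> Lambda_space s p" and v: "v \<in> Lambda_space s p" and w: "w \<in> Lambda_space s p" and p: "1 < p" and s: "0 \<le> s" "s \<le> 1"
  shows "Lmass s p (\<lambda>x. u x - w x) \<le> ennreal (2 powr p) * (Lmass s p (\<lambda>x. u x - v x) + Lmass s p (\<lambda>x. v x - w x))"
  using Lambda_diff(3)[OF Lambda_diff(1)[OF u v p s] Lambda_diff(1)[OF w v p s] p s] Lmass_commute[OF w v p s] by simp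

lemma test_Lambda:
  fixes f :: "'a::euclidean_space \<Rightarrow> real"
  assumes f: "f \<in> Cc_inf S" and p: "1 < p" and s: "0 \<le> s" "s \<le> 1"
  shows "f \<in> Lambda_space s p" "AE x in lebesgue. weak_frac_gradient s f x = frac_gradient s f x"
    "Lmass s p f = pmass lebesgue p f + pmass lebesgue p (frac_gradient s f)"
proof -
  have fU: "f \<in> Cc_inf UNIV" by (rule test_UNIV[OF f])
  note h = test_has_weak_frac_gradient[OF fU s]
  show "f \<in> Lambda_space s p"
    by (rule Lambda_spaceI[OF borel_lebesgue[OF test_borel[OF f]] test_pmass_finite[OF fU p] h frac_gradient_pmass_finite[OF fU p s]])
  show AE: "AE x in lebesgue. weak_frac_gradient s f x = frac_gradient s f x" by (rule weak_frac_gradient_AE[OF h])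
  show "Lmass s p f = pmass lebesgue p f + pmass lebesgue p (frac_gradient s f)" by (simp add: Lmass_def pmass_cong_AE[OF AE])
qed

lemma Lambda0_minus_test:
  assumes u: "u \<in> Lambda0_space s p \<Omega>" and f: "f \<in> Cc_inf \<Omega>" and p: "1 < p" and s: "0 \<le> s" "s \<le> 1"
  shows "(\<lambda>x. u x - f x) \<in> Lambda0_space s p \<Omega>"
proof -
  have uL: "u \<in> Lambda_space s p" using u by (simp add: Lambda0_space_def)
  have "\<exists>\<phi>\<in>Cc_inf \<Omega>. Lambda_norm s p (\<lambda>x. u x - f x - \<phi> x) < \<epsilon>" if e: "\<epsilon> > 0" for \<epsilon>
  proof -
    obtain g where g: "g \<in> Cc_inf \<Omega>" "Lambda_norm s p (\<lambda>x. u x - g x) < \<epsilon>" using u e by (auto simp: Lambda0_space_def)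
    show ?thesis using g test_diff[OF g(1) f] by (intro bexI[of _ "\<lambda>x. g x - f x"]) auto
  qed
  thus ?thesis using Lambda_diff(1)[OF uL test_Lambda(1)[OF f p s] p s] by (simp add: Lambda0_space_def)
qed

lemma Lambda0_approx:
  fixes u :: "'a::euclidean_space \<Rightarrow> real"
  assumes u: "u \<in> Lambda0_space s p \<Omega>" and p: "1 < p" and s: "0 \<le> s" "s \<le> 1"
  shows "\<exists>f. (\<forall>n. f n \<in> Cc_inf \<Omega>) \<and> (\<lambda>n. Lmass s p (\<lambda>x. u x - f n x)) \<longlonglongrightarrow> 0"
proof -
  have uL: "u \<in> Lambda_space s p" using u by (simp add: Lambda0_space_def)
  have "\<forall>n. \<exists>f\<in>Cc_inf \<Omega>. Lambda_norm s p (\<lambda>x. u x - f x) < inverse (real (Suc n))"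
    using u by (auto simp: Lambda0_space_def)
  then obtain f where f: "\<And>n. f n \<in> Cc_inf \<Omega>" "\<And>n. Lambda_norm s p (\<lambda>x. u x - f n x) < inverse (real (Suc n))" by metis
  have "(\<lambda>n. Lambda_norm s p (\<lambda>x. u x - f n x)) \<longlonglongrightarrow> 0"
    by (rule tendsto_sandwich[OF always_eventually[OF allI[OF Lambda_norm_nonneg]] always_eventually[OF allI[OF less_imp_le[OF f(2)]]] tendsto_const LIMSEQ_inverse_real_of_nat])
  hence "(\<lambda>n. Lmass s p (\<lambda>x. u x - f n x)) \<longlonglongrightarrow> 0"
    using p by (intro Lmass_tendsto_0 Lambda_diff(1)[OF uL test_Lambda(1)[OF f(1) p s] p s]) auto
  with f show ?thesis by blast
qed

text \<open>By completeness the gradients have an \<open>L^q\<close> limit, which is the weak gradient of \<open>u\<close>; hence the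
  convergence takes place in the full norm and \<open>u\<close> lies in the closure of the test functions.\<close>

lemma Lambda0_limit:
  fixes f :: "nat \<Rightarrow> 'a::euclidean_space \<Rightarrow> real"
  assumes f: "\<And>n. f n \<in> Cc_inf \<Omega>" and q: "1 < q" and t: "0 \<le> t" "t \<le> 1"
    and C: "pCauchy lebesgue q (\<lambda>n. frac_gradient t (f n))"
    and u: "u \<in> borel_measurable lebesgue" "(\<lambda>n. pmass lebesgue q (\<lambda>x. f n x - u x)) \<longlonglongrightarrow> 0"
  shows "u \<in> Lambda0_space t q \<Omega>" "(\<lambda>n. Lmass t q (\<lambda>x. f n x - u x)) \<longlonglongrightarrow> 0"
proof -
  have fU: "f n \<in> Cc_inf UNIV" for n by (rule test_UNIV[OF f])
  have q0: "q > 0" using q by simp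
  have fm: "f n \<in> borel_measurable lebesgue" for n by (rule borel_lebesgue[OF test_borel[OF f]])
  have gm: "frac_gradient t (f n) \<in> borel_measurable lebesgue" for n by (rule borel_lebesgue[OF frac_gradient_borel[OF fU t]])
  obtain G where G: "G \<in> borel_measurable lebesgue" "(\<lambda>n. pmass lebesgue q (\<lambda>x. frac_gradient t (f n) x - G x)) \<longlonglongrightarrow> 0"
    using pCauchy_imp_limit[OF gm C q0] by blast
  have fin: "pmass lebesgue q v < \<infinity>"
    if v: "v \<in> borel_measurable lebesgue" and g: "\<And>n. g n \<in> borel_measurable lebesgue" "\<And>n. pmass lebesgue q (g n) < \<infinity>" and lim: "(\<lambda>n. pmass lebesgue q (\<lambda>x. g n x - v x)) \<longlonglongrightarrow> 0"
    for v :: "'a \<Rightarrow> 'b::euclidean_space" and g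
  proof -
    have "\<forall>\<^sub>F n in sequentially. pmass lebesgue q (\<lambda>x. g n x - v x) < 1" using lim by (intro order_tendstoD) auto
    then obtain n where n: "pmass lebesgue q (\<lambda>x. g n x - v x) < 1" by (auto simp: eventually_sequentially)
    have d: "(\<lambda>x. g n x - v x) \<in> borel_measurable lebesgue" using v g(1)[of n] by measurable
    have "pmass lebesgue q (\<lambda>x. g n x - (g n x - v x)) \<le> ennreal (2 powr q) * (pmass lebesgue q (g n) + pmass lebesgue q (\<lambda>x. g n x - v x))"
      using q by (intro pmass_diff g d) simp
    also have "\<dots> < \<infinity>" using g(2)[of n] order_less_trans[OF n] by (auto simp: ennreal_mult_less_top)
    finally show ?thesis by simp
  qed
  have ufin: "pmass lebesgue q u < \<infinity>" by (rule fin[OF u(1) fm test_pmass_finite[OF fU q] u(2)])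
  have Gfin: "pmass lebesgue q G < \<infinity>" by (rule fin[OF G(1) gm frac_gradient_pmass_finite[OF fU q t] G(2)])
  have h: "has_weak_frac_gradient t u G"
    by (rule has_weak_frac_gradient_limit[OF fU t q u(1) ufin u(2) G(1) Gfin G(2)])
  have uL: "u \<in> Lambda_space t q" by (rule Lambda_spaceI[OF u(1) ufin h Gfin])
  have AE: "AE x in lebesgue. weak_frac_gradient t (\<lambda>x. f n x - u x) x = frac_gradient t (f n) x - G x" for n
    using Lambda_diff(2)[OF test_Lambda(1)[OF f q t] uL q t, of n] test_Lambda(2)[OF f q t, of n] weak_frac_gradient_AE[OF h]
    by eventually_elim simp
  have "(\<lambda>n. pmass lebesgue q (\<lambda>x. f n x - u x) + pmass lebesgue q (\<lambda>x. frac_gradient t (f n) x - G x)) \<longlonglongrightarrow> 0 + 0"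
    by (intro tendsto_add u(2) G(2))
  thus lim: "(\<lambda>n. Lmass t q (\<lambda>x. f n x - u x)) \<longlonglongrightarrow> 0"
    unfolding Lmass_def by (simp add: pmass_cong_AE[OF AE])
  have "(\<lambda>n. Lmass t q (\<lambda>x. u x - f n x)) \<longlonglongrightarrow> 0"
    using lim Lmass_commute[OF uL test_Lambda(1)[OF f q t] q t] by simp
  hence N: "(\<lambda>n. Lambda_norm t q (\<lambda>x. u x - f n x)) \<longlonglongrightarrow> 0"
    by (intro Lambda_norm_tendsto_0 Lambda_diff(1)[OF uL test_Lambda(1)[OF f q t] q t] q0)
  have "\<exists>\<phi>\<in>Cc_inf \<Omega>. Lambda_norm t q (\<lambda>x. u x - \<phi> x) < \<epsilon>" if "\<epsilon> > 0" for \<epsilon>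
  proof -
    have "\<forall>\<^sub>F n in sequentially. Lambda_norm t q (\<lambda>x. u x - f n x) < \<epsilon>" using N that by (intro order_tendstoD) auto
    then obtain n where "Lambda_norm t q (\<lambda>x. u x - f n x) < \<epsilon>" by (auto simp: eventually_sequentially)
    thus ?thesis using f by blast
  qed
  thus "u \<in> Lambda0_space t q \<Omega>" using uL by (simp add: Lambda0_space_def)
qed

section \<open>The compact embedding\<close>

lemma Lmass_test_real:
  fixes f :: "'a::euclidean_space \<Rightarrow> real"
  assumes f: "f \<in> Cc_inf S" and p: "1 < p" and s: "0 \<le> s" "s \<le> 1"
  shows "Lmass s p f = ennreal ((\<integral>x. \<bar>f x\<bar> powr p \<partial>lborel) + (\<integral>x. norm (frac_gradient s f x) powr p \<partial>lborel))"
    and "integrable lborel (\<lambda>x. \<bar>f x\<bar> powr p)"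
proof -
  have fU: "f \<in> Cc_inf UNIV" by (rule test_UNIV[OF f])
  have fm: "f \<in> borel_measurable lborel" using test_borel[OF f] by simp
  show i: "integrable lborel (\<lambda>x. \<bar>f x\<bar> powr p)"
    using test_pmass_finite[OF fU p] pmass_finite_iff[OF fm, of p] by (simp add: pmass_lebesgue)
  note j = frac_gradient_powr_integrable[OF fU s p]
  have "pmass lborel p f = ennreal (\<integral>x. \<bar>f x\<bar> powr p \<partial>lborel)" using pmass_eq_integral[of lborel f p] i by simp
  moreover have "pmass lborel p (frac_gradient s f) = ennreal (\<integral>x. norm (frac_gradient s f x) powr p \<partial>lborel)" by (rule pmass_eq_integral[OF j])
  ultimately show "Lmass s p f = ennreal ((\<integral>x. \<bar>f x\<bar> powr p \<partial>lborel) + (\<integral>x. norm (frac_gradient s f x) powr p \<partial>lborel))"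
    unfolding test_Lambda(3)[OF f p s] pmass_lebesgue by (simp add: integral_nonneg_AE)
qed

text \<open>\<open>test_mollified_estimate\<close> in terms of the full norms. Stating the bound for every
  \<open>L\<close> above the mass keeps \<open>L\<close> a real number.\<close>

lemma Lmass_test_estimate:
  assumes t: "0 \<le> t" "t < s" and s: "s \<le> 1" and p: "1 < p" "p \<le> q"
    and sub: "1 / p - s / real DIM('a) < 1 / q - t / real DIM('a::euclidean_space)"
  shows "\<exists>\<theta>>0. \<exists>D\<ge>0. \<forall>T. 0 < T \<longrightarrow> T \<le> 1 \<longrightarrow> (\<exists>E\<ge>0. \<forall>f::'a \<Rightarrow> real. \<forall>L. f \<in> Cc_inf UNIV \<longrightarrow> 0 \<le> L \<longrightarrow> Lmass s p f \<le> ennreal L \<longrightarrow>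
    Lmass t q f \<le> mollified_bound p q \<theta> D T E L f)"
proof -
  have q: "1 < q" using p by simp
  have s0: "0 \<le> s" and t1: "t \<le> 1" using t s by auto
  obtain \<theta> D where *: "\<theta> > 0" "D \<ge> 0" "\<forall>T. 0 < T \<longrightarrow> T \<le> 1 \<longrightarrow> (\<exists>E\<ge>0. \<forall>f::'a \<Rightarrow> real. f \<in> Cc_inf UNIV \<longrightarrow> integrable lborel (\<lambda>x. norm (frac_gradient s f x) powr p) \<longrightarrow>
    pmass lborel q (frac_gradient t f) \<le> mollified_bound p q \<theta> D T E (\<integral>x. norm (frac_gradient s f x) powr p \<partial>lborel) f
    \<and> pmass lborel q f \<le> mollified_bound p q \<theta> D T E (\<integral>x. norm (frac_gradient s f x) powr p \<partial>lborel) f)"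
    using test_mollified_estimate[OF t s p sub] by blast
  have main: "\<exists>E\<ge>0. \<forall>f::'a \<Rightarrow> real. \<forall>L. f \<in> Cc_inf UNIV \<longrightarrow> 0 \<le> L \<longrightarrow> Lmass s p f \<le> ennreal L \<longrightarrow>
    Lmass t q f \<le> mollified_bound p q \<theta> (2 * D) T E L f"
    if T: "0 < T" "T \<le> 1" for T
  proof -
    obtain E where E: "E \<ge> 0" "\<forall>f::'a \<Rightarrow> real. f \<in> Cc_inf UNIV \<longrightarrow> integrable lborel (\<lambda>x. norm (frac_gradient s f x) powr p) \<longrightarrow>
    pmass lborel q (frac_gradient t f) \<le> mollified_bound p q \<theta> D T E (\<integral>x. norm (frac_gradient s f x) powr p \<partial>lborel) f
    \<and> pmass lborel q f \<le> mollified_bound p q \<theta> D T E (\<integral>x. norm (frac_gradient s f x) powr p \<partial>lborel) f"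
      using *(3) T by blast
    show ?thesis
    proof (intro exI[of _ "2 * E"] conjI allI impI)
      show "0 \<le> 2 * E" using E by simp
      fix f :: "'a \<Rightarrow> real" and L assume f: "f \<in> Cc_inf UNIV" and L: "0 \<le> L" "Lmass s p f \<le> ennreal L"
      define I where "I = (\<integral>x. norm (frac_gradient s f x) powr p \<partial>lborel)"
      define J where "J = (\<integral>x. \<bar>conv (gauss (T / 2)) f x\<bar> \<partial>lborel)"
      have I: "0 \<le> I" unfolding I_def by (intro integral_nonneg_AE) auto
      have "ennreal ((\<integral>x. \<bar>f x\<bar> powr p \<partial>lborel) + I) \<le> ennreal L"
        using L(2) Lmass_test_real(1)[OF f p(1) s0 s] by (simp only: I_def)
      hence "(\<integral>x. \<bar>f x\<bar> powr p \<partial>lborel) + I \<le> L" using ennreal_le_iff[OF L(1)] by blast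
      moreover have "0 \<le> (\<integral>x. \<bar>f x\<bar> powr p \<partial>lborel)" by (intro integral_nonneg_AE) auto
      ultimately have "I \<le> L" by linarith
      hence IL: "I powr (q / p) \<le> L powr (q / p)" using I p by (intro powr_mono2) auto
      define X where "X = D * T powr \<theta> * I powr (q / p) + E * J powr q"
      have X: "0 \<le> X" unfolding X_def using *(2) E(1) by simp
      have "Lmass t q f = pmass lborel q f + pmass lborel q (frac_gradient t f)"
        unfolding test_Lambda(3)[OF f q t(1) t1] pmass_lebesgue ..
      also have "\<dots> \<le> ennreal X + ennreal X"
        using E(2)[rule_format, OF f frac_gradient_powr_integrable[OF f s0 s p(1)]]
        unfolding mollified_bound_def X_def I_def J_def by (intro add_mono) auto
      also have "\<dots> = ennreal (2 * X)" using X by (simp add: ennreal_plus[symmetric] del: ennreal_plus)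
      also have "\<dots> \<le> ennreal (2 * D * T powr \<theta> * L powr (q / p) + 2 * E * J powr q)"
      proof (rule ennreal_leI)
        have "D * T powr \<theta> * I powr (q / p) \<le> D * T powr \<theta> * L powr (q / p)" using *(2) by (intro mult_left_mono IL) auto
        thus "2 * X \<le> 2 * D * T powr \<theta> * L powr (q / p) + 2 * E * J powr q" by (simp add: X_def)
      qed
      finally show "Lmass t q f \<le> mollified_bound p q \<theta> (2 * D) T (2 * E) L f"
        by (simp add: mollified_bound_def J_def)
    qed
  qed
  show ?thesis
    by (rule exI[of _ \<theta>], rule conjI[OF *(1)], rule exI[of _ "2 * D"]) (use main *(2) in auto)
qed

lemma L1_test_bound:
  fixes f :: "'a::euclidean_space \<Rightarrow> real"
  assumes f: "f \<in> Cc_inf \<Omega>" and \<Omega>: "open \<Omega>" "bounded \<Omega>" and p: "1 < p" and s: "0 \<le> s" "s \<le> 1" and L: "0 \<le> L" "Lmass s p f \<le> ennreal L"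
  shows "(\<integral>x. \<bar>f x\<bar> \<partial>lborel) powr p \<le> measure lborel \<Omega> powr (p - 1) * L"
proof -
  have "(\<integral>x. \<bar>f x\<bar> \<partial>lborel) powr p \<le> measure lborel \<Omega> powr (p - 1) * (\<integral>x. \<bar>f x\<bar> powr p \<partial>lborel)"
    using \<Omega> p by (intro L1_le_Lp_bounded_support[OF f] Lmass_test_real(2)[OF f p s]) auto
  also have "\<dots> \<le> measure lborel \<Omega> powr (p - 1) * L"
  proof (rule mult_left_mono)
    have "0 \<le> (\<integral>x. norm (frac_gradient s f x) powr p \<partial>lborel)" "0 \<le> (\<integral>x. \<bar>f x\<bar> powr p \<partial>lborel)" by (auto intro!: integral_nonneg_AE)
    moreover have "ennreal ((\<integral>x. \<bar>f x\<bar> powr p \<partial>lborel) + (\<integral>x. norm (frac_gradient s f x) powr p \<partial>lborel)) \<le> ennreal L"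
      using L(2) Lmass_test_real(1)[OF f p s] by (simp only:)
    hence "(\<integral>x. \<bar>f x\<bar> powr p \<partial>lborel) + (\<integral>x. norm (frac_gradient s f x) powr p \<partial>lborel) \<le> L" using ennreal_le_iff[OF L(1)] by blast
    ultimately show "(\<integral>x. \<bar>f x\<bar> powr p \<partial>lborel) \<le> L" by linarith
  qed simp
  finally show ?thesis .
qed

text \<open>The estimate at \<open>T = 1\<close>: the heat flow contracts \<open>L^1\<close>, and on \<open>\<Omega>\<close> the \<open>L^1\<close> norm is bounded by
  the \<open>L^p\<close> norm.\<close>

lemma Lmass_test_embedding:
  fixes \<Omega> :: "'a::euclidean_space set"
  assumes \<Omega>: "open \<Omega>" "bounded \<Omega>" and t: "0 \<le> t" "t < s" and s: "s \<le> 1" and p: "1 < p" "p \<le> q"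
    and sub: "1 / p - s / real DIM('a) < 1 / q - t / real DIM('a)"
  shows "\<exists>C\<ge>0. \<forall>f L. f \<in> Cc_inf \<Omega> \<longrightarrow> 0 \<le> L \<longrightarrow> Lmass s p f \<le> ennreal L \<longrightarrow> Lmass t q f \<le> ennreal (C * L powr (q / p))"
proof -
  have s0: "0 \<le> s" using t by simp
  obtain \<theta> D where *: "D \<ge> 0" "\<forall>T. 0 < T \<longrightarrow> T \<le> 1 \<longrightarrow> (\<exists>E\<ge>0. \<forall>f::'a \<Rightarrow> real. \<forall>L. f \<in> Cc_inf UNIV \<longrightarrow> 0 \<le> L \<longrightarrow> Lmass s p f \<le> ennreal L \<longrightarrow>
    Lmass t q f \<le> mollified_bound p q \<theta> D T E L f)"
    using Lmass_test_estimate[OF t s p sub] by blast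
  obtain E where E: "E \<ge> 0" "\<forall>f::'a \<Rightarrow> real. \<forall>L. f \<in> Cc_inf UNIV \<longrightarrow> 0 \<le> L \<longrightarrow> Lmass s p f \<le> ennreal L \<longrightarrow>
    Lmass t q f \<le> mollified_bound p q \<theta> D 1 E L f"
    using *(2)[rule_format, of 1] by auto
  define V where "V = measure lborel \<Omega> powr (p - 1)"
  define C where "C = D + E * V powr (q / p)"
  have C: "C \<ge> 0" using *(1) E(1) by (simp add: C_def)
  have "Lmass t q f \<le> ennreal (C * L powr (q / p))" if f: "f \<in> Cc_inf \<Omega>" and L: "0 \<le> L" "Lmass s p f \<le> ennreal L" for f L
  proof -
    define J where "J = (\<integral>x. \<bar>conv (gauss (1 / 2)) f x\<bar> \<partial>lborel)"
    define N where "N = (\<integral>x. \<bar>f x\<bar> \<partial>lborel)"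
    have J: "0 \<le> J" "J \<le> N" unfolding J_def N_def using heat_L1_contraction(2)[OF _ f, of "1/2"] by (auto intro: integral_nonneg_AE)
    have "J powr q \<le> N powr q" using J p by (intro powr_mono2) auto
    also have "\<dots> = (N powr p) powr (q / p)" using p by (simp add: powr_powr)
    also have "\<dots> \<le> (V * L) powr (q / p)"
      using L1_test_bound[OF f \<Omega> p(1) s0 s L] p unfolding N_def V_def by (intro powr_mono2) auto
    also have "\<dots> = V powr (q / p) * L powr (q / p)" using L by (simp add: powr_mult V_def)
    finally have JV: "J powr q \<le> V powr (q / p) * L powr (q / p)" .
    have "Lmass t q f \<le> ennreal (D * 1 powr \<theta> * L powr (q / p) + E * J powr q)"
      using E(2) test_UNIV[OF f] L unfolding J_def mollified_bound_def by blast
    also have "\<dots> \<le> ennreal (C * L powr (q / p))"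
    proof (rule ennreal_leI)
      have "E * J powr q \<le> E * (V powr (q / p) * L powr (q / p))" by (intro mult_left_mono JV E(1))
      thus "D * 1 powr \<theta> * L powr (q / p) + E * J powr q \<le> C * L powr (q / p)" by (simp add: C_def algebra_simps)
    qed
    finally show ?thesis .
  qed
  with C show ?thesis by blast
qed

lemma frac_gradient_diff_pmass:
  assumes f: "f \<in> Cc_inf S" and g: "g \<in> Cc_inf S" and p: "1 < p" and s: "0 \<le> s" "s \<le> 1"
  shows "Lmass s p (\<lambda>x. f x - g x) = pmass lebesgue p (\<lambda>x. f x - g x) + pmass lebesgue p (\<lambda>x. frac_gradient s f x - frac_gradient s g x)"
proof -
  have "AE x in lebesgue. weak_frac_gradient s (\<lambda>x. f x - g x) x = frac_gradient s f x - frac_gradient s g x"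
    using Lambda_diff(2)[OF test_Lambda(1)[OF f p s] test_Lambda(1)[OF g p s] p s] test_Lambda(2)[OF f p s] test_Lambda(2)[OF g p s]
    by eventually_elim simp
  thus ?thesis by (simp add: Lmass_def pmass_cong_AE)
qed

lemma pCauchy_of_Lmass:
  assumes f: "\<And>n. f n \<in> Cc_inf S" and p: "1 < p" and s: "0 \<le> s" "s \<le> 1"
    and C: "\<And>e. e > 0 \<Longrightarrow> \<exists>N. \<forall>m\<ge>N. \<forall>n\<ge>N. Lmass s p (\<lambda>x. f m x - f n x) \<le> ennreal e"
  shows "pCauchy lebesgue p f" "pCauchy lebesgue p (\<lambda>n. frac_gradient s (f n))"
  unfolding pCauchy_def using C unfolding frac_gradient_diff_pmass[OF f f p s]
  by (meson order_trans add_increasing add_increasing2 order_refl zero_le)+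

text \<open>Approximating test functions form a Cauchy sequence in the source, hence, by the estimate for
  their differences, in the target. The limit in the target is \<open>u\<close>, because a subsequence
  converges to \<open>u\<close> almost everywhere. The bound follows by letting the approximation error \<open>e\<close>
  tend to zero.\<close>

lemma Lambda0_embedding:
  fixes \<Omega> :: "'a::euclidean_space set"
  assumes \<Omega>: "open \<Omega>" "bounded \<Omega>" and t: "0 \<le> t" "t < s" and s: "s \<le> 1" and p: "1 < p" "p \<le> q"
    and sub: "1 / p - s / real DIM('a) < 1 / q - t / real DIM('a)"
  shows "\<exists>C\<ge>0. \<forall>u\<in>Lambda0_space s p \<Omega>. u \<in> Lambda0_space t q \<Omega> \<and> Lmass t q u \<le> ennreal (C * Lambda_norm s p u powr q)"
proof -
  have s0: "0 \<le> s" and t1: "t \<le> 1" and q: "1 < q" and p0: "0 < p" and q0: "0 < q" using t s p by auto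
  obtain C where C: "C \<ge> 0" "\<And>f L. f \<in> Cc_inf \<Omega> \<Longrightarrow> 0 \<le> L \<Longrightarrow> Lmass s p f \<le> ennreal L \<Longrightarrow> Lmass t q f \<le> ennreal (C * L powr (q / p))"
    using Lmass_test_embedding[OF \<Omega> t s p sub] by blast
  define C' where "C' = 2 powr q * C * (2 powr p) powr (q / p)"
  have "u \<in> Lambda0_space t q \<Omega> \<and> Lmass t q u \<le> ennreal (C' * Lambda_norm s p u powr q)" if u: "u \<in> Lambda0_space s p \<Omega>" for u
  proof -
    have uL: "u \<in> Lambda_space s p" using u by (simp add: Lambda0_space_def)
    obtain f where f: "\<And>n. f n \<in> Cc_inf \<Omega>" "(\<lambda>n. Lmass s p (\<lambda>x. u x - f n x)) \<longlonglongrightarrow> 0"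
      using Lambda0_approx[OF u p(1) s0 s] by blast
    note fL = test_Lambda(1)[OF f(1) p(1) s0 s] and fL' = test_Lambda(1)[OF f(1) q t(1) t1]
    have ev: "\<exists>N. \<forall>n\<ge>N. Lmass s p (\<lambda>x. u x - f n x) \<le> ennreal e" if "e > 0" for e
    proof -
      have "\<forall>\<^sub>F n in sequentially. Lmass s p (\<lambda>x. u x - f n x) < ennreal e" using f(2) that by (intro order_tendstoD) auto
      thus ?thesis by (auto simp: eventually_sequentially intro: less_imp_le)
    qed
    have cauchy: "\<exists>N. \<forall>m\<ge>N. \<forall>n\<ge>N. Lmass s p (\<lambda>x. f m x - f n x) \<le> ennreal e" if e: "e > 0" for e
    proof -
      define d where "d = e / (2 powr p * 2)"
      have d: "d > 0" using e by (simp add: d_def)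
      obtain N where N: "\<And>n. n \<ge> N \<Longrightarrow> Lmass s p (\<lambda>x. u x - f n x) \<le> ennreal d" using ev[OF d] by blast
      have "Lmass s p (\<lambda>x. f m x - f n x) \<le> ennreal e" if "m \<ge> N" "n \<ge> N" for m n
      proof -
        have "Lmass s p (\<lambda>x. f m x - f n x) \<le> ennreal (2 powr p) * (Lmass s p (\<lambda>x. f m x - u x) + Lmass s p (\<lambda>x. u x - f n x))"
          by (rule Lmass_triangle[OF fL uL fL p(1) s0 s])
        also have "\<dots> \<le> ennreal (2 powr p) * (ennreal d + ennreal d)"
          unfolding Lmass_commute[OF fL uL p(1) s0 s] by (intro mult_left_mono add_mono N that) auto
        also have "\<dots> = ennreal e" using d by (simp add: ennreal_plus[symmetric] ennreal_mult[symmetric] d_def del: ennreal_plus)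
        finally show ?thesis .
      qed
      thus ?thesis by blast
    qed
    have cauchy': "\<exists>N. \<forall>m\<ge>N. \<forall>n\<ge>N. Lmass t q (\<lambda>x. f m x - f n x) \<le> ennreal e" if e: "e > 0" for e
    proof -
      define d where "d = (e / (C + 1)) powr (p / q)"
      have d: "d > 0" using e C(1) by (simp add: d_def)
      have de: "C * d powr (q / p) \<le> e"
      proof -
        have "d powr (q / p) = e / (C + 1)" using e C(1) p0 q0 by (simp add: d_def powr_powr)
        moreover have "C * (e / (C + 1)) \<le> e" using e C(1) by (simp add: field_simps)
        ultimately show ?thesis by simp
      qed
      obtain N where N: "\<And>m n. m \<ge> N \<Longrightarrow> n \<ge> N \<Longrightarrow> Lmass s p (\<lambda>x. f m x - f n x) \<le> ennreal d" using cauchy[OF d] by blast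
      have "Lmass t q (\<lambda>x. f m x - f n x) \<le> ennreal e" if "m \<ge> N" "n \<ge> N" for m n
        using C(2)[OF test_diff[OF f(1) f(1)] less_imp_le[OF d] N[OF that]] de by (meson ennreal_leI order_trans)
      thus ?thesis by blast
    qed
    note pC = pCauchy_of_Lmass[OF f(1) q t(1) t1 cauchy']
    have fm: "f n \<in> borel_measurable lebesgue" for n by (rule borel_lebesgue[OF test_borel[OF f(1)]])
    note um = Lambda_spaceD(1)[OF uL]
    have "\<exists>r::nat\<Rightarrow>nat. strict_mono r \<and> (AE x in lebesgue. (\<lambda>k. f (r k) x - u x) \<longlonglongrightarrow> 0)"
    proof (rule pmass_tendsto_AE_subseq[where p=p])
      show "(\<lambda>x. f n x - u x) \<in> borel_measurable lebesgue" for n using fm um by measurable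
      show "(\<lambda>n. pmass lebesgue p (\<lambda>x. f n x - u x)) \<longlonglongrightarrow> 0"
        by (rule tendsto_sandwich[OF _ _ tendsto_const f(2)]) (auto simp: Lmass_def pmass_minus_commute[of _ _ "f _"])
      show "pmass lebesgue p (\<lambda>x. f n x - u x) < \<infinity>" for n
        using Lambda_spaceD(2)[OF Lambda_diff(1)[OF fL uL p(1) s0 s]] .
    qed (rule p0)
    then obtain r :: "nat \<Rightarrow> nat" where r: "strict_mono r" "AE x in lebesgue. (\<lambda>k. f (r k) x - u x) \<longlonglongrightarrow> 0" by blast
    have r': "AE x in lebesgue. (\<lambda>k. f (r k) x) \<longlonglongrightarrow> u x" using r(2) by eventually_elim (simp add: LIM_zero_iff)
    have lim: "(\<lambda>n. pmass lebesgue q (\<lambda>x. f n x - u x)) \<longlonglongrightarrow> 0"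
      by (rule pCauchy_AE_limit[OF fm um pC(1) r(1) r' q0])
    note lim0 = Lambda0_limit[OF f(1) q t(1) t1 pC(2) um lim]
    have uL': "u \<in> Lambda_space t q" using lim0(1) by (simp add: Lambda0_space_def)
    define X where "X = Lambda_norm s p u powr p"
    have X: "X \<ge> 0" "Lmass s p u = ennreal X" unfolding X_def using Lambda_norm_powr[OF uL p0] by auto
    have main: "Lmass t q u \<le> ennreal (2 powr q * (e + C * (2 powr p * (X + e)) powr (q / p)))" if e: "e > 0" for e
    proof -
      obtain N where N: "\<And>n. n \<ge> N \<Longrightarrow> Lmass s p (\<lambda>x. u x - f n x) \<le> ennreal e" using ev[OF e] by blast
      have "\<forall>\<^sub>F n in sequentially. Lmass t q (\<lambda>x. f n x - u x) < ennreal e" using lim0(2) e by (intro order_tendstoD) auto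
      then obtain N' where N': "\<And>n. n \<ge> N' \<Longrightarrow> Lmass t q (\<lambda>x. f n x - u x) < ennreal e" by (auto simp: eventually_sequentially)
      define n where "n = max N N'"
      have n: "Lmass s p (\<lambda>x. u x - f n x) \<le> ennreal e" "Lmass t q (\<lambda>x. f n x - u x) \<le> ennreal e"
        using N[of n] N'[of n] by (auto simp: n_def)
      have "Lmass s p (\<lambda>x. u x - (u x - f n x)) \<le> ennreal (2 powr p) * (Lmass s p u + Lmass s p (\<lambda>x. u x - f n x))"
        by (rule Lambda_diff(3)[OF uL Lambda_diff(1)[OF uL fL p(1) s0 s] p(1) s0 s])
      also have "\<dots> \<le> ennreal (2 powr p) * (ennreal X + ennreal e)" using n X by (intro mult_left_mono add_mono) auto
      also have "\<dots> = ennreal (2 powr p * (X + e))" using X e by (simp add: ennreal_plus[symmetric] ennreal_mult[symmetric] del: ennreal_plus)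
      finally have "Lmass s p (f n) \<le> ennreal (2 powr p * (X + e))" by simp
      hence fn: "Lmass t q (f n) \<le> ennreal (C * (2 powr p * (X + e)) powr (q / p))" using X e by (intro C(2) f(1)) auto
      have "Lmass t q (\<lambda>x. f n x - (f n x - u x)) \<le> ennreal (2 powr q) * (Lmass t q (f n) + Lmass t q (\<lambda>x. f n x - u x))"
        by (rule Lambda_diff(3)[OF fL' Lambda_diff(1)[OF fL' uL' q t(1) t1] q t(1) t1])
      also have "\<dots> \<le> ennreal (2 powr q) * (ennreal (C * (2 powr p * (X + e)) powr (q / p)) + ennreal e)"
        by (intro mult_left_mono add_mono fn n) auto
      also have "\<dots> = ennreal (2 powr q * (e + C * (2 powr p * (X + e)) powr (q / p)))"
        using e C(1) by (simp add: ennreal_plus[symmetric] ennreal_mult[symmetric] add.commute del: ennreal_plus)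
      finally show ?thesis by simp
    qed
    have "((\<lambda>e. ennreal (2 powr q * (e + C * (2 powr p * (X + e)) powr (q / p)))) \<longlongrightarrow> ennreal (2 powr q * (0 + C * (2 powr p * (X + 0)) powr (q / p)))) (at_right 0)"
    proof (intro tendsto_ennrealI tendsto_mult tendsto_add tendsto_const tendsto_powr2 tendsto_ident_at)
      show "\<forall>\<^sub>F e in at_right 0. 0 \<le> 2 powr p * (X + e)" using X by (auto simp: eventually_at_filter)
      show "0 < q / p" using p0 q0 by simp
    qed
    moreover have "\<forall>\<^sub>F e in at_right 0. Lmass t q u \<le> ennreal (2 powr q * (e + C * (2 powr p * (X + e)) powr (q / p)))"
      using main by (auto simp: eventually_at_filter)
    ultimately have "Lmass t q u \<le> ennreal (2 powr q * (0 + C * (2 powr p * (X + 0)) powr (q / p)))"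
      by (intro tendsto_lowerbound) auto
    also have "2 powr q * (0 + C * (2 powr p * (X + 0)) powr (q / p)) = C' * Lambda_norm s p u powr q"
    proof -
      have "X powr (q / p) = Lambda_norm s p u powr q" using p0 by (simp add: X_def powr_powr)
      moreover have "(2 powr p * X) powr (q / p) = (2 powr p) powr (q / p) * X powr (q / p)" using X by (simp add: powr_mult)
      ultimately show ?thesis by (simp add: C'_def)
    qed
    finally show ?thesis using lim0(1) by blast
  qed
  moreover have "C' \<ge> 0" using C(1) by (simp add: C'_def)
  ultimately show ?thesis by blast
qed

theorem theorem2p6:
  fixes \<Omega> :: "'a::euclidean_space set" and s t p q :: real
  assumes "open \<Omega>" and "bounded \<Omega>"
    and "0 \<le> t" and "t < s" and "s \<le> 1"
    and "1 < p" and "p \<le> q"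
    and "1 / p - s / real DIM('a) < 1 / q - t / real DIM('a)"
  shows "compact_embedding (Lambda0_space s p \<Omega>) (Lambda_norm s p)
           (Lambda0_space t q \<Omega>) (Lambda_norm t q)"
proof -
  note \<Omega> = assms(1,2) and t = assms(3,4) and s = assms(5) and p = assms(6,7) and sub = assms(8)
  have s0: "0 \<le> s" and t1: "t \<le> 1" and q: "1 < q" and p0: "0 < p" and q0: "0 < q" using t s p by auto
  obtain C where C: "C \<ge> 0" "\<And>u. u \<in> Lambda0_space s p \<Omega> \<Longrightarrow> u \<in> Lambda0_space t q \<Omega>"
      "\<And>u. u \<in> Lambda0_space s p \<Omega> \<Longrightarrow> Lmass t q u \<le> ennreal (C * Lambda_norm s p u powr q)"
    using Lambda0_embedding[OF \<Omega> t s p sub] by blast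
  have L0: "u \<in> Lambda_space s' p'" if "u \<in> Lambda0_space s' p' \<Omega>" for u s' p' using that by (simp add: Lambda0_space_def)
  have bound: "Lambda_norm t q u \<le> C powr (1 / q) * Lambda_norm s p u" if u: "u \<in> Lambda0_space s p \<Omega>" for u
  proof -
    have "Lambda_norm t q u \<le> (C * Lambda_norm s p u powr q) powr (1 / q)"
      by (rule Lambda_norm_le[OF L0[OF C(2)[OF u]] q0 _ C(3)[OF u]]) (use C(1) in simp)
    also have "\<dots> = C powr (1 / q) * Lambda_norm s p u"
      using C(1) q0 Lambda_norm_nonneg[of s p u] by (simp add: powr_mult powr_powr)
    finally show ?thesis .
  qed
  have cont: "continuous_embedding (Lambda0_space s p \<Omega>) (Lambda_norm s p) (Lambda0_space t q \<Omega>) (Lambda_norm t q)"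
    unfolding continuous_embedding_def using C(2) bound by blast
  have comp: "\<exists>v\<in>Lambda0_space t q \<Omega>. \<exists>r::nat\<Rightarrow>nat. strict_mono r \<and> (\<lambda>n. Lambda_norm t q (\<lambda>x. u (r n) x - v x)) \<longlonglongrightarrow> 0"
    if u: "\<And>n. u n \<in> Lambda0_space s p \<Omega>" and B: "\<And>n. Lambda_norm s p (u n) \<le> B" for u :: "nat \<Rightarrow> 'a \<Rightarrow> real" and B
  proof -
    have "\<forall>n. \<exists>f\<in>Cc_inf \<Omega>. Lambda_norm s p (\<lambda>x. u n x - f x) < inverse (real (Suc n))"
      using u by (auto simp: Lambda0_space_def)
    \<comment> \<open>Replacing \<open>u n\<close> by test functions \<open>f n\<close> at distance less than \<open>1/(n+1)\<close> changes neither
      boundedness nor, by continuity of the embedding, convergence in the target.\<close>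
    then obtain f where f: "\<And>n. f n \<in> Cc_inf \<Omega>" "\<And>n. Lambda_norm s p (\<lambda>x. u n x - f n x) < inverse (real (Suc n))" by metis
    note fL = test_Lambda(1)[OF f(1) p(1) s0 s] and fL' = test_Lambda(1)[OF f(1) q t(1) t1]
    note uL = L0[OF u] and uL' = L0[OF C(2)[OF u]]
    have dL: "(\<lambda>x. u n x - f n x) \<in> Lambda0_space s p \<Omega>" for n by (rule Lambda0_minus_test[OF u f(1) p(1) s0 s])
    define M where "M = 2 powr p * (B powr p + 1)"
    have B0: "B \<ge> 0" using B[of 0] Lambda_norm_nonneg[of s p "u 0"] by linarith
    have M0: "M > 0" unfolding M_def by (intro mult_pos_pos add_nonneg_pos) auto
    have fM: "Lmass s p (f n) \<le> ennreal M" for n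
    proof -
      have 1: "Lmass s p (u n) \<le> ennreal (B powr p)"
        unfolding Lambda_norm_powr[OF uL p0, symmetric] using B[of n] Lambda_norm_nonneg p0 by (intro ennreal_leI powr_mono2) auto
      have 2: "Lmass s p (\<lambda>x. u n x - f n x) \<le> ennreal 1"
      proof -
        have "inverse (real (Suc n)) \<le> 1" by (simp add: inverse_le_1_iff)
        hence "Lambda_norm s p (\<lambda>x. u n x - f n x) \<le> 1" using f(2)[of n] by linarith
        hence "Lambda_norm s p (\<lambda>x. u n x - f n x) powr p \<le> 1 powr p" using Lambda_norm_nonneg p0 by (intro powr_mono2) auto
        thus ?thesis unfolding Lambda_norm_powr[OF L0[OF dL] p0, symmetric] by (intro ennreal_leI) simp
      qed
      have "Lmass s p (\<lambda>x. u n x - (u n x - f n x)) \<le> ennreal (2 powr p) * (Lmass s p (u n) + Lmass s p (\<lambda>x. u n x - f n x))"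
        by (rule Lambda_diff(3)[OF uL L0[OF dL] p(1) s0 s])
      also have "\<dots> \<le> ennreal (2 powr p) * (ennreal (B powr p) + ennreal 1)" by (intro mult_left_mono add_mono 1 2) auto
      also have "\<dots> = ennreal M" unfolding M_def by (subst ennreal_plus[symmetric]) (auto simp: ennreal_mult[symmetric] simp del: ennreal_plus ennreal_1)
      finally show ?thesis by simp
    qed
    define K where "K = (measure lborel \<Omega> powr (p - 1) * M) powr (1 / p)"
    have fK: "(\<integral>x. \<bar>f n x\<bar> \<partial>lborel) \<le> K" for n
    proof -
      have n0: "0 \<le> (\<integral>x. \<bar>f n x\<bar> \<partial>lborel)" by (intro integral_nonneg_AE) auto
      have "((\<integral>x. \<bar>f n x\<bar> \<partial>lborel) powr p) powr (1 / p) \<le> K"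
        unfolding K_def using p0 by (intro powr_mono2 L1_test_bound[OF f(1) \<Omega> p(1) s0 s less_imp_le[OF M0] fM]) auto
      thus ?thesis using n0 p0 by (simp add: powr_powr)
    qed
    obtain r :: "nat \<Rightarrow> nat" where r: "strict_mono r" "\<And>m e. e > 0 \<Longrightarrow> \<exists>N. \<forall>i\<ge>N. \<forall>j\<ge>N.
       (\<integral>x. \<bar>conv (gauss (1 / real (Suc m))) (\<lambda>y. f (r i) y - f (r j) y) x\<bar> \<partial>lborel) < e"
      using heat_L1_compact[of f \<Omega> K, OF f(1) \<Omega>(2) fK] by blast
    define g where "g n = f (r n)" for n
    have g: "g n \<in> Cc_inf \<Omega>" for n unfolding g_def by (rule f(1))
    define M2 where "M2 = 2 powr p * (M + M)"
    have M2: "M2 \<ge> 0" using M0 by (simp add: M2_def)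
    have gM: "Lmass s p (\<lambda>x. g i x - g j x) \<le> ennreal M2" for i j
    proof -
      have "Lmass s p (\<lambda>x. g i x - g j x) \<le> ennreal (2 powr p) * (Lmass s p (g i) + Lmass s p (g j))"
        unfolding g_def by (rule Lambda_diff(3)[OF fL fL p(1) s0 s])
      also have "\<dots> \<le> ennreal (2 powr p) * (ennreal M + ennreal M)" unfolding g_def by (intro mult_left_mono add_mono fM) auto
      also have "\<dots> = ennreal M2" using M0 by (simp add: M2_def ennreal_plus[symmetric] ennreal_mult[symmetric] del: ennreal_plus)
      finally show ?thesis .
    qed
    obtain \<theta> D where est: "\<theta> > 0" "D \<ge> 0" "\<forall>T. 0 < T \<longrightarrow> T \<le> 1 \<longrightarrow> (\<exists>E\<ge>0. \<forall>f::'a \<Rightarrow> real. \<forall>L. f \<in> Cc_inf UNIV \<longrightarrow> 0 \<le> L \<longrightarrow> Lmass s p f \<le> ennreal L \<longrightarrow>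
      Lmass t q f \<le> mollified_bound p q \<theta> D T E L f)"
      using Lmass_test_estimate[OF t s p sub] by blast
    \<comment> \<open>The time \<open>T\<close> is chosen first, to make the first summand smaller than \<open>e/2\<close>; it has the form
      \<open>2/(m+1)\<close>, for which the mollified sequence is known to be Cauchy in \<open>L^1\<close>.\<close>
    have cauchy: "\<exists>N. \<forall>i\<ge>N. \<forall>j\<ge>N. Lmass t q (\<lambda>x. g i x - g j x) \<le> ennreal e" if e: "e > 0" for e
    proof -
      have T0: "(\<lambda>m. 2 / real (Suc m)) \<longlonglongrightarrow> 0" using tendsto_mult_right_zero[OF LIMSEQ_inverse_real_of_nat, of 2] by (simp add: divide_inverse)
      have "(\<lambda>m. D * (2 / real (Suc m)) powr \<theta> * M2 powr (q / p)) \<longlonglongrightarrow> D * 0 powr \<theta> * M2 powr (q / p)"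
        by (intro tendsto_mult tendsto_const tendsto_powr2[OF T0]) (use est(1) in auto)
      hence "\<forall>\<^sub>F m in sequentially. D * (2 / real (Suc m)) powr \<theta> * M2 powr (q / p) < e / 2"
        using e est(1) by (intro order_tendstoD) auto
      then obtain m0 where m0: "\<And>m. m \<ge> m0 \<Longrightarrow> D * (2 / real (Suc m)) powr \<theta> * M2 powr (q / p) < e / 2" by (auto simp: eventually_sequentially)
      define m where "m = max m0 1"
      define T where "T = 2 / real (Suc m)"
      have T: "0 < T" "T \<le> 1" "T / 2 = 1 / real (Suc m)" "D * T powr \<theta> * M2 powr (q / p) < e / 2"
      proof -
        have m: "1 \<le> m" "m0 \<le> m" by (auto simp: m_def)
        thus "0 < T" "T \<le> 1" "D * T powr \<theta> * M2 powr (q / p) < e / 2" using m0[of m] by (auto simp: T_def)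
        show "T / 2 = 1 / real (Suc m)" unfolding T_def by (simp add: field_simps)
      qed
      obtain E where E: "E \<ge> 0" "\<forall>f::'a \<Rightarrow> real. \<forall>L. f \<in> Cc_inf UNIV \<longrightarrow> 0 \<le> L \<longrightarrow> Lmass s p f \<le> ennreal L \<longrightarrow>
        Lmass t q f \<le> mollified_bound p q \<theta> D T E L f"
        using est(3) T(1,2) by blast
      define d where "d = (e / (2 * (E + 1))) powr (1 / q)"
      have d: "d > 0" using e E(1) by (simp add: d_def)
      have dE: "E * d powr q \<le> e / 2"
      proof -
        have "d powr q = e / (2 * (E + 1))" using e E(1) q0 by (simp add: d_def powr_powr)
        moreover have "E * (e / (2 * (E + 1))) \<le> e / 2" using e E(1) by (simp add: field_simps)
        ultimately show ?thesis by simp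
      qed
      obtain N where N: "\<And>i j. i \<ge> N \<Longrightarrow> j \<ge> N \<Longrightarrow> (\<integral>x. \<bar>conv (gauss (1 / real (Suc m))) (\<lambda>y. f (r i) y - f (r j) y) x\<bar> \<partial>lborel) < d"
        using r(2)[OF d, of m] by blast
      have "Lmass t q (\<lambda>x. g i x - g j x) \<le> ennreal e" if ij: "i \<ge> N" "j \<ge> N" for i j
      proof -
        define J where "J = (\<integral>x. \<bar>conv (gauss (T / 2)) (\<lambda>x. g i x - g j x) x\<bar> \<partial>lborel)"
        have J: "0 \<le> J" "J < d" unfolding J_def T(3) g_def using N[OF ij] by (auto intro!: integral_nonneg_AE)
        have "Lmass t q (\<lambda>x. g i x - g j x) \<le> ennreal (D * T powr \<theta> * M2 powr (q / p) + E * J powr q)"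
          using E(2) test_UNIV[OF test_diff[OF g g]] M2 gM unfolding J_def mollified_bound_def by blast
        also have "\<dots> \<le> ennreal e"
        proof (rule ennreal_leI)
          have "J powr q \<le> d powr q" using J q0 by (intro powr_mono2) auto
          hence "E * J powr q \<le> E * d powr q" using E(1) by (rule mult_left_mono)
          thus "D * T powr \<theta> * M2 powr (q / p) + E * J powr q \<le> e" using T(4) dE by linarith
        qed
        finally show ?thesis .
      qed
      thus ?thesis by blast
    qed
    note pC = pCauchy_of_Lmass[OF g q t(1) t1 cauchy]
    obtain v where v: "v \<in> borel_measurable lebesgue" "(\<lambda>n. pmass lebesgue q (\<lambda>x. g n x - v x)) \<longlonglongrightarrow> 0"
      using pCauchy_imp_limit[OF borel_lebesgue[OF test_borel[OF g]] pC(1) q0] by blast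
    note lim = Lambda0_limit[OF g q t(1) t1 pC(2) v]
    note vL = L0[OF lim(1)]
    have small: "(\<lambda>n. Lmass t q (\<lambda>x. u (r n) x - g n x)) \<longlonglongrightarrow> 0"
    proof -
      have "(\<lambda>n. Lambda_norm s p (\<lambda>x. u n x - f n x)) \<longlonglongrightarrow> 0"
        by (rule tendsto_sandwich[OF always_eventually[OF allI[OF Lambda_norm_nonneg]] always_eventually[OF allI[OF less_imp_le[OF f(2)]]] tendsto_const LIMSEQ_inverse_real_of_nat])
      hence "(\<lambda>n. C * Lambda_norm s p (\<lambda>x. u n x - f n x) powr q) \<longlonglongrightarrow> C * 0 powr q"
        using q0 by (intro tendsto_mult tendsto_const tendsto_powr2) (auto simp: Lambda_norm_nonneg)
      hence "(\<lambda>n. ennreal (C * Lambda_norm s p (\<lambda>x. u n x - f n x) powr q)) \<longlonglongrightarrow> ennreal 0"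
        using q0 by (intro tendsto_ennrealI) simp
      hence "(\<lambda>n. ennreal (C * Lambda_norm s p (\<lambda>x. u n x - f n x) powr q)) \<longlonglongrightarrow> 0" by simp
      from tendsto_sandwich[OF always_eventually[OF allI[OF zero_le]] always_eventually[OF allI[OF C(3)[OF dL]]] tendsto_const this]
      have "(\<lambda>n. Lmass t q (\<lambda>x. u n x - f n x)) \<longlonglongrightarrow> 0" .
      from LIMSEQ_subseq_LIMSEQ[OF this r(1)] show ?thesis by (simp add: o_def g_def)
    qed
    have gL': "g n \<in> Lambda_space t q" for n unfolding g_def by (rule fL')
    have "(\<lambda>n. ennreal (2 powr q) * (Lmass t q (\<lambda>x. u (r n) x - g n x) + Lmass t q (\<lambda>x. g n x - v x))) \<longlonglongrightarrow> ennreal (2 powr q) * (0 + 0)"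
      by (intro ennreal_tendsto_cmult tendsto_add small lim(2)) simp
    hence "(\<lambda>n. ennreal (2 powr q) * (Lmass t q (\<lambda>x. u (r n) x - g n x) + Lmass t q (\<lambda>x. g n x - v x))) \<longlonglongrightarrow> 0" by simp
    from tendsto_sandwich[OF always_eventually[OF allI[OF zero_le]] always_eventually[OF allI[OF Lmass_triangle[OF uL' gL' vL q t(1) t1]]] tendsto_const this]
    have "(\<lambda>n. Lmass t q (\<lambda>x. u (r n) x - v x)) \<longlonglongrightarrow> 0" .
    hence "(\<lambda>n. Lambda_norm t q (\<lambda>x. u (r n) x - v x)) \<longlonglongrightarrow> 0"
      by (intro Lambda_norm_tendsto_0 Lambda_diff(1)[OF uL' vL q t(1) t1] q0)
    thus ?thesis using lim(1) r(1) by blast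
  qed
  show ?thesis unfolding compact_embedding_def using cont comp by blast
qed

end
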